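(* Let $k\ge2$ be fixed and let $(h_1,\dots,h_k)$ be a fixed admissible $k$-tuple. Let $b\ (W)$ be such that $b+h_i$ is coprime to $W$ for each $i$. Let $1\le i_0\le k$ be fixed, and for each $i\ne i_0$ let $F_i,G_i:[0,+\infty)\to\mathbb{R}$ be fixed smooth compactly supported functions. Assume one of the following: (i) there is a fixed $0<\vartheta<1$ such that $\mathrm{EH}[\vartheta]$ holds and $\sum_{i\ne i_0}(S(F_i)+S(G_i))<\vartheta$; or (ii) there are fixed $0\le\varpi<1/4$ and $\delta>0$ such that $\mathrm{MPZ}[\varpi,\delta]$ holds, $\sum_{i\ne i_0}(S(F_i)+S(G_i))<\frac12+2\varpi$, and $\max_{i\ne i_0}\max\{S(F_i),S(G_i)\}<\delta$. Then $$\sum_{\substack{x\le n\le2x\\ n\equiv b\ (W)}}\theta(n+h_{i_0})\prod_{i\ne i_0}\lambda_{F_i}(n+h_i)\lambda_{G_i}(n+h_i)=(c+o(1))B^{1-k}\frac x{\phi(W)},$$ where $$c:=\prod_{1\le i\le k,\ i\ne i_0}\int_0^1F_i'(t)G_i'(t)\,dt.$$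
   Context: Asymptotic conventions: $x\to\infty$ is a large parameter, and "fixed" means independent of $x$; $b$ may depend on $x$. $o(1)\to0$ as $x\to\infty$. $X\ll Y$ means $|X|\le CY$ with $C$ fixed. $X\lessapprox Y$ means $|X|\le x^{o(1)}Y$. Notation: - $w=\log\log\log x$, $W=\prod_{p\le w}p$, and $B=\frac{\phi(W)}W\log x$. - $\theta(n)=\log n$ for $n$ prime, and $0$ otherwise. - $\log_x n=\log n/\log x$, and $\lambda_F(n):=\sum_{d\mid n}\mu(d)F(\log_x d)$. - For compactly supported $F$, $S(F):=\sup\{t\ge0:F(t)\ne0\}$ (with $S(0)=0$). - An admissible $k$-tuple is a tuple of integers $h_1<\dots<h_k$ avoiding, for each prime $p$, some residue class mod $p$. - $\Lambda$ is the von Mangoldt function. For primitive $a\ (q)$, $\Delta(\alpha;a\ (q)):=\sum_{n\equiv a\ (q)}\alpha(n)-\frac1{\phi(q)}\sum_{(n,q)=1}\alpha(n)$. $\mathrm{EH}[\vartheta]$: for all $Q\lessapprox x^\vartheta$ and fixed $A\ge1$, $$\sum_{q\le Q}\sup_{a\in(\mathbb{Z}/q\mathbb{Z})^\times}|\Delta(\Lambda\mathbf 1_{[x,2x]};a\ (q))|\ll x\log^{-A}x.$$ $\mathrm{MPZ}[\varpi,\delta]$: let $I\subset[1,x^\delta]$ and $Q\lessapprox x^{1/2+2\varpi}$. Let $P_I$ be the product of the primes in $I$, and $\mathcal S_I$ the set of squarefree naturals all of whose prime factors lie in $I$. Then for every primitive residue class $a\ (P_I)$ (which may depend on $x$) and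 fixed $A\ge1$, $$\sum_{q\le Q,\ q\in\mathcal S_I}|\Delta(\Lambda\mathbf 1_{[x,2x]};a\ (q))|\ll x\log^{-A}x,$$ with implied constant depending only on $A,\varpi,\delta$. *)

theory Defs
  imports
    "HOL-Analysis.Analysis"
    "HOL-Number_Theory.Number_Theory"
    "HOL-Library.Landau_Symbols"
    "HOL-Computational_Algebra.Squarefree"
begin

text \<open>
  Quantities that may depend on the large real parameter x are functions of x, and asymptotic
  assertions refer to the filter \<^const>\<open>at_top\<close> on the reals. Variables that are not functions
  of x are fixed.
\<close>

text \<open>X \<open>\<lessapprox>\<close> Y, that is |X| \<open>\<le>\<close> x^{o(1)} Y.\<close>

definition lessapprox :: "(real \<Rightarrow> real) \<Rightarrow> (real \<Rightarrow> real) \<Rightarrow> bool" where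
  "lessapprox X Y \<longleftrightarrow>
     (\<exists>\<epsilon>. (\<epsilon> \<longlongrightarrow> 0) at_top \<and> (\<forall>\<^sub>F x in at_top. \<bar>X x\<bar> \<le> x powr \<epsilon> x * Y x))"

definition W_mod :: "real \<Rightarrow> nat" where
  "W_mod x = \<Prod>{p::nat. prime p \<and> real p \<le> ln (ln (ln x))}"

definition B_size :: "real \<Rightarrow> real" where
  "B_size x = real (totient (W_mod x)) / real (W_mod x) * ln x"

definition theta :: "nat \<Rightarrow> real" where
  "theta n = (if prime n then ln (real n) else 0)"

definition moebius :: "nat \<Rightarrow> real" where
  "moebius d = (if squarefree d then (-1) ^ card (prime_factors d) else 0)"

text \<open>
  Shifts n + h with h negative are integers and are passed to \<open>theta\<close> and \<open>lambda_weight\<close> through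
  \<open>nat\<close>; the truncation only matters for bounded x. For n = 0 the set of divisors is infinite, so
  \<open>lambda_weight\<close> is the default value 0.
\<close>

definition lambda_weight :: "real \<Rightarrow> (real \<Rightarrow> real) \<Rightarrow> nat \<Rightarrow> real" where
  "lambda_weight x F n = (\<Sum>d | d dvd n. moebius d * F (log x (real d)))"

text \<open>
  Functions on the half-line [0,\<open>\<infinity>\<close>) are represented by functions on the reals whose values at
  negative arguments are ignored; derivatives at 0 are one-sided. Below, D n is the n-th derivative.
\<close>

definition smooth_halfline :: "(real \<Rightarrow> real) \<Rightarrow> bool" where
  "smooth_halfline F \<longleftrightarrow>
     (\<exists>D :: nat \<Rightarrow> real \<Rightarrow> real.
        (\<forall>t\<ge>0. D 0 t = F t) \<and>
        (\<forall>n. \<forall>t\<ge>0. (D n has_real_derivative D (Suc n) t) (at t within {0..})))"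

definition compact_support_halfline :: "(real \<Rightarrow> real) \<Rightarrow> bool" where
  "compact_support_halfline F \<longleftrightarrow> (\<exists>R. \<forall>t\<ge>0. t > R \<longrightarrow> F t = 0)"

definition deriv_halfline :: "(real \<Rightarrow> real) \<Rightarrow> real \<Rightarrow> real" where
  "deriv_halfline F t = vector_derivative F (at t within {0..})"

text \<open>S(F), with S(0) = 0.\<close>

definition supp_sup :: "(real \<Rightarrow> real) \<Rightarrow> real" where
  "supp_sup F = (if \<forall>t\<ge>0. F t = 0 then 0 else Sup {t. t \<ge> 0 \<and> F t \<noteq> 0})"

definition admissible_tuple :: "nat \<Rightarrow> (nat \<Rightarrow> int) \<Rightarrow> bool" where
  "admissible_tuple k h \<longleftrightarrow>
     strict_mono_on {1..k} h \<and>
     (\<forall>p::nat. prime p \<longrightarrow> (\<exists>r::int. \<forall>i\<in>{1..k}. \<not> [h i = r] (mod int p)))"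

definition discrepancy :: "(nat \<Rightarrow> real) \<Rightarrow> nat \<Rightarrow> nat \<Rightarrow> real" where
  "discrepancy \<alpha> a q =
     (\<Sum>\<^sub>\<infinity>n\<in>{n. [n = a] (mod q)}. \<alpha> n)
       - 1 / real (totient q) * (\<Sum>\<^sub>\<infinity>n\<in>{n. coprime n q}. \<alpha> n)"

definition mangoldt_dyadic :: "real \<Rightarrow> nat \<Rightarrow> real" where
  "mangoldt_dyadic x n = mangoldt n * indicator {x..2 * x} (real n)"

definition EH :: "real \<Rightarrow> bool" where
  "EH \<theta> \<longleftrightarrow>
     (\<forall>Q A. lessapprox Q (\<lambda>x. x powr \<theta>) \<longrightarrow> A \<ge> 1 \<longrightarrow>
        (\<lambda>x. \<Sum>q | q \<ge> 1 \<and> real q \<le> Q x.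
               SUP a\<in>totatives q. \<bar>discrepancy (mangoldt_dyadic x) a q\<bar>)
          \<in> O[at_top](\<lambda>x. x * ln x powr (-A)))"

definition prime_prod_in :: "real set \<Rightarrow> nat" where
  "prime_prod_in I = \<Prod>{p::nat. prime p \<and> real p \<in> I}"

definition squarefree_in :: "real set \<Rightarrow> nat set" where
  "squarefree_in I = {q. squarefree q \<and> (\<forall>p\<in>prime_factors q. real p \<in> I)}"

text \<open>
  The implied constant C is chosen after A (and \<open>\<omega>\<close>, \<open>\<delta>\<close>) only; Q, I and the residue class a
  may all vary with x.
\<close>

definition MPZ :: "real \<Rightarrow> real \<Rightarrow> bool" where
  "MPZ \<omega> \<delta> \<longleftrightarrow>
     (\<forall>A\<ge>1. \<exists>C. \<forall>(Q :: real \<Rightarrow> real) (I :: real \<Rightarrow> real set) (a :: real \<Rightarrow> nat).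
        lessapprox Q (\<lambda>x. x powr (1/2 + 2 * \<omega>)) \<longrightarrow>
        (\<forall>\<^sub>F x in at_top. I x \<subseteq> {1..x powr \<delta>} \<and> coprime (a x) (prime_prod_in (I x))) \<longrightarrow>
        (\<forall>\<^sub>F x in at_top.
           (\<Sum>q | real q \<le> Q x \<and> q \<in> squarefree_in (I x).
              \<bar>discrepancy (mangoldt_dyadic x) (a x) q\<bar>) \<le> C * (x * ln x powr (-A))))"

end

theory Submission
  imports Defs "HOL-Complex_Analysis.Complex_Analysis" "HOL-Real_Asymp.Real_Asymp"
begin

text \<open>
  Every \<open>\<lambda>\<^sub>F(n + h\<^sub>i)\<close> is expanded over the sets of primes dividing \<open>n + h\<^sub>i\<close>. The von Mangoldt function
  is equidistributed in the resulting residue classes, so up to \<open>O(x (log x)^{-A})\<close> the sum is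
  \<open>(\<psi>(2x) - \<psi>(x)) / \<phi>(W)\<close> times the expectation of the product of the weights in a random model,
  in which a prime \<open>p > w\<close> divides each \<open>n + h\<^sub>i\<close> with probability \<open>1 / (p - 1)\<close> and never two of them.
  This expectation is a multilinear form in the \<open>F\<^sub>i\<close>, \<open>G\<^sub>i\<close>. For \<open>F\<^sub>i\<close>, \<open>G\<^sub>i\<close> of the form \<open>exp (-a t)\<close>
  it is an Euler product, evaluated by comparison with \<open>\<zeta>(1 + a / log x)\<close>. In general it is bounded
  by the third derivatives of the weights, uniformly in \<open>x\<close>, and smooth compactly supported functions
  are approximated in this norm by polynomials in \<open>exp (-t)\<close>. Finally \<open>\<psi>(2x) - \<psi>(x) \<sim> x\<close> is the prime
  number theorem, obtained by Newman's contour argument.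
\<close>

section \<open>The prime number theorem\<close>

text \<open>Exponentials make the random model factorise, but they have no compact support, so for
  them the arithmetic sum has no usable level of distribution. The order of the two steps is
  therefore forced: equidistribution is applied while the given compactly supported weights are in
  place, and the approximation happens afterwards, inside the model, where no bound on the moduli is
  needed. For this reason the model contains all primes between \<open>wlim x\<close> and exp((ln
  x)^2), far more than can occur in a modulus. The approximation needs an upper bound of the exact
  order B^(1-k) for the model expectation, with a constant independent of x. Taking absolute values
  loses powers of log x; the cancellation of the Moebius signs is recovered by splitting off the
  least prime up to three times, each time at the cost of one derivative. This is the source of the
  number three. Hypotheses (i) and (ii) both enter only through \<open>level\<close>, in which one
  residue class serves all moduli at once. The expansion of the weights produces several classes for
  one modulus; a random assignment of primes to shifts singles out one of them.\<close>

lemma sum_powr_tail_le: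
  fixes y :: real
  assumes "y > 0" "N \<ge> 1"
  shows "summable (\<lambda>n. real (n + Suc N) powr (-1 - y))"
    and "(\<Sum>n. real (n + Suc N) powr (-1 - y)) \<le> real N powr (-y) / y"
proof -
  \<comment> \<open>The integral of t^(-1-y) from n + N to infinity. The mean value theorem compares
    each summand with the integral over the unit interval ending at it.\<close>
  define g where "g n = real (n + N) powr (-y) / y" for n
  have *: "real (n + Suc N) powr (-1 - y) \<le> g n - g (Suc n)" for n
  proof -
    have "\<exists>z. z > real (n + N) \<and> z < real (n + Suc N) \<and>
        real (n + Suc N) powr (-y) - real (n + N) powr (-y)
          = (real (n + Suc N) - real (n + N)) * (-y * z powr (-y - 1))"
      using assms by (intro MVT2) (auto intro!: derivative_eq_intros)
    then obtain z where z: "z > real (n + N)" "z < real (n + Suc N)"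
      "real (n + Suc N) powr (-y) - real (n + N) powr (-y) = -y * z powr (-y - 1)" by auto
    have "real (n + Suc N) powr (-1 - y) \<le> z powr (-y - 1)"
      using z assms by (simp add: powr_mono2' minus_diff_commute)
    hence "y * real (n + Suc N) powr (-1 - y) \<le> y * z powr (-y - 1)"
      using assms(1) by simp
    also have "\<dots> = real (n + N) powr (-y) - real (n + Suc N) powr (-y)"
      using z(3) by simp
    finally show ?thesis
      using assms(1) unfolding g_def diff_divide_distrib[symmetric] by (simp add: pos_le_divide_eq mult.commute)
  qed
  have lim: "filterlim (\<lambda>n. real (n + N)) at_top sequentially"
    by (rule filterlim_compose[OF filterlim_real_sequentially filterlim_add_const_nat_at_top])
  have "g \<longlonglongrightarrow> 0 / y"
    unfolding g_def
    by (intro tendsto_divide tendsto_const tendsto_neg_powr)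
       (use assms lim in auto)
  hence s: "(\<lambda>n. g n - g (Suc n)) sums (g 0 - 0)"
    by (intro telescope_sums') simp
  show S: "summable (\<lambda>n. real (n + Suc N) powr (-1 - y))"
    by (rule summable_comparison_test'[OF sums_summable[OF s], of 0]) (use * in auto)
  have "(\<Sum>n. real (n + Suc N) powr (-1 - y)) \<le> (\<Sum>n. g n - g (Suc n))"
    by (intro suminf_le * S sums_summable[OF s])
  also have "\<dots> = g 0" using sums_unique[OF s] by simp
  finally show "(\<Sum>n. real (n + Suc N) powr (-1 - y)) \<le> real N powr (-y) / y"
    by (simp add: g_def)
qed

text \<open>The summand decreases in n for y \<le> 1 and increases for y > 1, so the unit interval
  used for the integral comparison lies to the left or to the right of n. In the second case the
  last summand has no interval left and is counted separately; it is the term 1 / N.\<close>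

lemma sum_powr_le:
  fixes y :: real
  assumes y: "y > 0" and N: "N \<ge> 1"
  shows "(\<Sum>n=1..N. real n powr (-1 + y)) \<le> real N powr y * (1 / y + 1 / real N)"
proof -
  have mvt: "\<exists>z. z > real n \<and> z < real (Suc n) \<and>
      real (Suc n) powr y - real n powr y = (real (Suc n) - real n) * (y * z powr (y - 1))" if "n \<ge> 1" for n
    using that by (intro MVT2) (auto intro!: derivative_eq_intros)
  show ?thesis
  proof (cases "y \<le> 1")
    case True
    have *: "real (Suc n) powr (-1 + y) \<le> (real (Suc n) powr y - real n powr y) / y" for n
    proof (cases "n = 0")
      case True
      then show ?thesis using y \<open>y \<le> 1\<close> by simp
    next
      case False
      then obtain z where z: "z > real n" "z < real (Suc n)"
        "real (Suc n) powr y - real n powr y = y * z powr (y - 1)" using mvt[of n] by auto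
      have "real (Suc n) powr (y - 1) \<le> z powr (y - 1)"
        using z True by (intro powr_mono2') auto
      with z(3) y show ?thesis by (simp add: field_simps)
    qed
    have "(\<Sum>n=1..N. real n powr (-1 + y)) = (\<Sum>n<N. real (Suc n) powr (-1 + y))"
      by (rule sum.reindex_bij_witness[of _ Suc "\<lambda>n. n - 1"]) auto
    also have "\<dots> \<le> (\<Sum>n<N. (real (Suc n) powr y - real n powr y) / y)"
      by (intro sum_mono *)
    also have "\<dots> = real N powr y / y"
      unfolding sum_divide_distrib[symmetric] sum_lessThan_telescope[of "\<lambda>n. real n powr y"] by simp
    also have "\<dots> \<le> real N powr y * (1 / y + 1 / real N)"
      by (simp add: algebra_simps)
    finally show ?thesis .
  next
    case False
    have *: "real (Suc n) powr (-1 + y) \<le> (real (Suc (Suc n)) powr y - real (Suc n) powr y) / y" for n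
    proof -
      obtain z where z: "z > real (Suc n)" "z < real (Suc (Suc n))"
        "real (Suc (Suc n)) powr y - real (Suc n) powr y = y * z powr (y - 1)" using mvt[of "Suc n"] by auto
      have "real (Suc n) powr (y - 1) \<le> z powr (y - 1)"
        using z False by (intro powr_mono2) auto
      with z(3) y show ?thesis by (simp add: field_simps)
    qed
    obtain M where M: "N = Suc M" using N by (cases N) auto
    have "(\<Sum>n=1..N. real n powr (-1 + y)) = (\<Sum>n<N. real (Suc n) powr (-1 + y))"
      by (rule sum.reindex_bij_witness[of _ Suc "\<lambda>n. n - 1"]) auto
    also have "\<dots> = (\<Sum>n<M. real (Suc n) powr (-1 + y)) + real N powr (-1 + y)"
      by (simp add: M)
    also have "(\<Sum>n<M. real (Suc n) powr (-1 + y)) \<le> (\<Sum>n<M. (real (Suc (Suc n)) powr y - real (Suc n) powr y) / y)"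
      by (intro sum_mono *)
    also have "\<dots> = (real N powr y - 1) / y"
      unfolding sum_divide_distrib[symmetric] sum_lessThan_telescope[of "\<lambda>n. real (Suc n) powr y"] M by simp
    also have "\<dots> \<le> real N powr y / y"
      using y by (simp add: field_simps)
    also have "real N powr (-1 + y) = real N powr y / real N"
      using N powr_diff[of "real N" y 1] by simp
    finally show ?thesis by (simp add: algebra_simps)
  qed
qed

text \<open>Newman's argument in the variable z with s = 1 - \<i> z, so that Re s \<ge> 1 becomes Im
  z \<ge> 0. The limit function is given as z H z: it vanishes at 0, and division by z leaves H,
  which is holomorphic across the real axis. The contour can therefore be closed along the real
  segment itself, where the oscillation of N^(-\<i> z) yields a factor 1 / ln N.\<close>

lemma newman_tauberian:
  fixes a :: "nat \<Rightarrow> complex" and H :: "complex \<Rightarrow> complex"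
  assumes a: "\<And>n. norm (a n) \<le> C"
    and U: "open U" "{z. Im z \<ge> 0} \<subseteq> U" "H holomorphic_on U"
    and sums: "\<And>z. Im z > 0 \<Longrightarrow> (\<lambda>n. a (Suc n) * of_nat (Suc n) powr (-1 + \<i> * z)) sums (z * H z)"
  shows "(\<lambda>N. \<Sum>n=1..N. a n / of_nat n) \<longlonglongrightarrow> 0"
proof (rule tendstoI)
  fix e :: real assume e: "e > 0"
  have C: "C \<ge> 0" using a[of 0] norm_ge_zero order_trans by blast
  \<comment> \<open>The two arcs together contribute 2 C / R in the limit, which this choice makes
    smaller than e.\<close>
  define R where "R = 4 * (C + 1) / e"
  have R: "R > 0" using e C by (simp add: R_def)
  \<comment> \<open>The factor 1 - z^2 / R^2 serves twice: on the circle it supplies a factor Im z,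
    and it vanishes at R and -R, so that integration by parts along the segment leaves no boundary
    terms.\<close>
  define h where "h z = H z * (1 - z\<^sup>2 / of_real R ^ 2)" for z
  have h: "h holomorphic_on U" unfolding h_def using U R by (auto intro!: holomorphic_intros)
  have dh: "deriv h holomorphic_on U" by (rule holomorphic_deriv[OF h U(1)])
  define seg where "seg = linepath (of_real (-R)) (of_real R :: complex)"
  have segU: "closed_segment (of_real (-R)) (of_real R :: complex) \<subseteq> {z. Im z = 0}"
    by (auto simp: closed_segment_def)
  have segU': "closed_segment (of_real (-R)) (of_real R :: complex) \<subseteq> U"
    using segU U by force
  obtain D where D: "\<And>z. z \<in> closed_segment (of_real (-R)) (of_real R :: complex) \<Longrightarrow> norm (deriv h z) \<le> D"
  proof -
    have "compact (deriv h ` closed_segment (of_real (-R)) (of_real R :: complex))"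
      using holomorphic_on_imp_continuous_on[OF dh] segU' continuous_on_subset
      by (intro compact_continuous_image) (auto intro: continuous_on_subset)
    then show ?thesis using that compact_imp_bounded bounded_iff by (metis image_eqI)
  qed
  have D0: "D \<ge> 0" using D[of "of_real R"] norm_ge_zero order_trans ends_in_segment by blast
  define E where "E N z = (of_nat N powr (-\<i> * z) :: complex)" for N :: nat and z
  define S where "S N z = (\<Sum>n=1..N. a n * of_nat n powr (-1 + \<i> * z))" for N z
  have main: "norm (\<Sum>n=1..N. a n / of_nat n) \<le> (2 * C / R + C / real N) + (D * (2 * R) / ln (real N))" if N: "N \<ge> 2" for N
  proof -
    define T where "T = ln (real N)"
    have T: "T > 0" using N by (simp add: T_def)
    have E_exp: "E N z = exp (-\<i> * z * of_real T)" for z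
      using N by (simp add: E_def T_def powr_def Ln_of_nat)
    have normE: "norm (E N z) = real N powr Im z" for z
      using N by (simp add: E_exp T_def powr_def)
    have norm_pow: "norm (of_nat n powr (-1 + \<i> * z) :: complex) = real n powr (-1 - Im z)" for n z
      by (cases "n = 0") (simp_all add: norm_powr_real_powr minus_diff_commute)
    define kern where "kern z = E N z * (1 - z\<^sup>2 / of_real R ^ 2)" for z
    \<comment> \<open>On the circle R^2 = z \<open>cnj z\<close>, whence (1 - z^2 / R^2) / z =
      (\<open>cnj z\<close> - z) / R^2. The resulting |Im z| cancels the 1 / |Im z| in the bounds
      for the tail (upper arc) and for the partial sum (lower arc).\<close>
    have kern_norm: "norm (kern z / z) = real N powr Im z * (2 * \<bar>Im z\<bar> / R\<^sup>2)" if "norm z = R" for z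
    proof -
      have z0: "z \<noteq> 0" using that R by auto
      have "of_real R ^ 2 = z * cnj z" using complex_norm_square[of z] that by simp
      hence "(1 - z\<^sup>2 / of_real R ^ 2) / z = (cnj z - z) / of_real R ^ 2"
        using z0 R by (simp add: field_simps power2_eq_square)
      also have "norm \<dots> = 2 * \<bar>Im z\<bar> / R\<^sup>2"
      proof -
        have "cnj z - z = - (2 * \<i> * of_real (Im z))" by (simp add: complex_eq_iff)
        thus ?thesis using R by (simp add: norm_divide norm_mult norm_power)
      qed
      finally have "norm ((1 - z\<^sup>2 / of_real R ^ 2) / z) = 2 * \<bar>Im z\<bar> / R\<^sup>2" .
      thus ?thesis unfolding kern_def using normE[of z] by (metis norm_mult times_divide_eq_right)
    qed
    have Shol: "S N holomorphic_on UNIV"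
      unfolding S_def by (auto intro!: holomorphic_intros)
    have kernhol: "kern holomorphic_on UNIV"
      unfolding kern_def E_exp using R by (auto intro!: holomorphic_intros)
    have circ: "((\<lambda>z. S N z * kern z / z) has_contour_integral (2 * pi * \<i> * S N 0)) (circlepath 0 R)"
    proof -
      have "((\<lambda>u. (\<lambda>z. S N z * kern z) u / (u - 0)) has_contour_integral (2 * of_real pi * \<i> * (S N 0 * kern 0))) (circlepath 0 R)"
        using R by (intro Cauchy_integral_circlepath_simple holomorphic_on_subset[OF holomorphic_on_mult[OF Shol kernhol]]) auto
      moreover have "kern 0 = 1" by (simp add: kern_def E_exp)
      ultimately show ?thesis by simp
    qed
    have cS: "continuous_on A (\<lambda>z. S N z * kern z / z)" if "0 \<notin> A" for A
      using that by (intro continuous_intros holomorphic_on_imp_continuous_on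
          holomorphic_on_subset[OF Shol] holomorphic_on_subset[OF kernhol]) auto
    have norm_pi: "norm z = R" if "z \<in> path_image (part_circlepath 0 R s t)" for z s t
      using that R path_image_part_circlepath_subset'[of R 0 s t] by (auto simp: dist_norm sphere_def)
    have iS: "(\<lambda>z. S N z * kern z / z) contour_integrable_on (part_circlepath 0 R s t)" for s t
      using norm_pi R by (intro contour_integrable_continuous_part_circlepath cS) force
    have im_up: "path_image (part_circlepath 0 R 0 pi) \<subseteq> {z. Im z \<ge> 0}"
      using R by (auto simp: path_image_part_circlepath' cis.ctr closed_segment_eq_real_ivl intro!: mult_nonneg_nonneg sin_ge_zero)
    have im_lo: "path_image (part_circlepath 0 R pi (2 * pi)) \<subseteq> {z. Im z \<le> 0}"
    proof -
      have "sin x \<le> 0" if "pi \<le> x" "x \<le> 2 * pi" for x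
      proof -
        have "sin (x - pi) \<ge> 0" using that by (intro sin_ge_zero) auto
        thus ?thesis by (simp add: sin_diff)
      qed
      thus ?thesis
        using R by (auto simp: path_image_part_circlepath' cis.ctr closed_segment_eq_real_ivl intro!: mult_nonneg_nonpos)
    qed
    define up where "up = contour_integral (part_circlepath 0 R 0 pi) (\<lambda>z. S N z * kern z / z)"
    define lo where "lo = contour_integral (part_circlepath 0 R pi (2*pi)) (\<lambda>z. S N z * kern z / z)"
    have up: "((\<lambda>z. S N z * kern z / z) has_contour_integral up) (part_circlepath 0 R 0 pi)"
      unfolding up_def using iS has_contour_integral_integral by blast
    have lo: "((\<lambda>z. S N z * kern z / z) has_contour_integral lo) (part_circlepath 0 R pi (2*pi))"
      unfolding lo_def using iS has_contour_integral_integral by blast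
    have split: "up + lo = 2 * pi * \<i> * S N 0"
    proof -
      let ?f = "\<lambda>t. (\<lambda>z. S N z * kern z / z) (0 + of_real R * cis t) * of_real R * \<i> * cis t"
      have "(?f has_integral up) {0..pi}" "(?f has_integral lo) {pi..2*pi}"
        "(?f has_integral (2 * pi * \<i> * S N 0)) {0..2*pi}"
        using up lo circ has_contour_integral_part_circlepath_iff pi_gt_zero unfolding circlepath_def by auto
      moreover from this(1,2) have "(?f has_integral (up + lo)) {0..2*pi}"
        by (intro has_integral_combine[of 0 pi "2*pi"]) auto
      ultimately show ?thesis using has_integral_unique by blast
    qed
    define sg where "sg = contour_integral seg (\<lambda>z. h z * E N z)"
    have Ehol: "E N holomorphic_on A" for A unfolding E_exp by (auto intro!: holomorphic_intros)
    have chE: "continuous_on U (\<lambda>z. h z * E N z)"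
      by (intro continuous_intros holomorphic_on_imp_continuous_on h Ehol)
    have "(\<lambda>z. h z * E N z) contour_integrable_on seg"
      unfolding seg_def using segU' by (intro contour_integrable_continuous_linepath continuous_on_subset[OF chE])
    hence sg: "((\<lambda>z. h z * E N z) has_contour_integral sg) seg"
      unfolding sg_def by (rule has_contour_integral_integral)
    \<comment> \<open>Cauchy's theorem for the boundary of the upper half disc trades the arc for
      the real segment.\<close>
    have up': "((\<lambda>z. h z * E N z) has_contour_integral -sg) (part_circlepath 0 R 0 pi)"
    proof -
      note im = im_up
      have "(\<lambda>z. h z * E N z) contour_integrable_on (part_circlepath 0 R 0 pi)"
        using im U(2) by (intro contour_integrable_continuous_part_circlepath continuous_on_subset[OF chE]) auto
      then obtain I where I: "((\<lambda>z. h z * E N z) has_contour_integral I) (part_circlepath 0 R 0 pi)"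
        by (auto simp: contour_integrable_on_def)
      have ends: "pathfinish (part_circlepath 0 R 0 pi) = pathstart seg" "pathstart (part_circlepath 0 R 0 pi) = pathfinish seg"
        by (simp_all add: seg_def exp_Euler)
      have "((\<lambda>z. h z * E N z) has_contour_integral (I + sg)) (part_circlepath 0 R 0 pi +++ seg)"
        by (rule has_contour_integral_join[OF I sg]) (auto simp: seg_def)
      moreover have "((\<lambda>z. h z * E N z) has_contour_integral 0) (part_circlepath 0 R 0 pi +++ seg)"
      proof (rule Cauchy_theorem_convex[where S = "{z. Im z \<ge> 0}" and K = "{}"])
        show "convex {z. Im z \<ge> 0}" by (rule convex_halfspace_Im_ge)
        show "continuous_on {z. 0 \<le> Im z} (\<lambda>z. h z * E N z)" by (rule continuous_on_subset[OF chE U(2)])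
        show "(\<lambda>z. h z * E N z) field_differentiable at x" if "x \<in> interior {z. 0 \<le> Im z} - {}" for x
        proof -
          have "x \<in> U" using that interior_subset U(2) by blast
          thus ?thesis using holomorphic_on_mult[OF h Ehol] U(1) holomorphic_on_imp_differentiable_at by blast
        qed
        show "path_image (part_circlepath 0 R 0 pi +++ seg) \<subseteq> {z. 0 \<le> Im z}"
          using im segU ends by (subst path_image_join) (auto simp: seg_def)
      qed (use ends in \<open>auto simp: seg_def intro!: valid_path_join\<close>)
      ultimately have "I + sg = 0" using has_contour_integral_unique by blast
      hence "I = -sg" by (simp add: eq_neg_iff_add_eq_0)
      thus ?thesis using I by simp
    qed
    have sgb: "norm sg \<le> D * (2 * R) / T"
    proof -
      \<comment> \<open>Integration by parts: E N z = exp (-\<i> z T) with T = ln N, so h E is the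
        derivative of P minus (\<i> / T) h' E, and the latter is at most D / T on the
        segment.\<close>
      define P where "P z = h z * E N z * (\<i> / of_real T)" for z
      have dP: "(P has_field_derivative (deriv h z * E N z * (\<i> / of_real T) + h z * E N z)) (at z within closed_segment (of_real (-R)) (of_real R))"
        if "z \<in> closed_segment (of_real (-R)) (of_real R)" for z
      proof -
        have "(h has_field_derivative deriv h z) (at z)"
          using h U(1) that segU' holomorphic_derivI by blast
        moreover have "((\<lambda>z. exp (-\<i> * z * of_real T)) has_field_derivative (-\<i> * of_real T * exp (-\<i> * z * of_real T))) (at z)"
          by (auto intro!: derivative_eq_intros)
        ultimately have "(P has_field_derivative ((deriv h z * exp (-\<i> * z * of_real T) + (-\<i> * of_real T * exp (-\<i> * z * of_real T)) * h z) * (\<i> / of_real T))) (at z)"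
          unfolding P_def E_exp by (intro DERIV_cmult_right DERIV_mult)
        moreover have "(-\<i> * of_real T * exp (-\<i> * z * of_real T)) * h z * (\<i> / of_real T) = h z * exp (-\<i> * z * of_real T)"
        proof -
          have *: "(-\<i> * t * u) * v * (\<i> / t) = v * u" if "t \<noteq> 0" for t u v :: complex
            using that by (simp add: mult_ac)
          show ?thesis by (rule *) (use T in simp)
        qed
        ultimately have "(P has_field_derivative (deriv h z * exp (-\<i> * z * of_real T) * (\<i> / of_real T) + h z * exp (-\<i> * z * of_real T))) (at z)"
          by (simp only: distrib_right)
        thus ?thesis unfolding E_exp by (rule has_field_derivative_at_within)
      qed
      have "((\<lambda>z. deriv h z * E N z * (\<i> / of_real T) + h z * E N z) has_contour_integral (P (of_real R) - P (of_real (-R)))) seg"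
        using contour_integral_primitive[of "closed_segment (of_real (-R)) (of_real R)" P _ seg] dP
        by (auto simp: seg_def)
      moreover have "P (of_real R) = 0" "P (of_real (-R)) = 0"
        using R by (auto simp: P_def h_def)
      ultimately have "((\<lambda>z. deriv h z * E N z * (\<i> / of_real T) + h z * E N z) has_contour_integral 0) seg" by simp
      from has_contour_integral_diff[OF this sg]
      have "((\<lambda>z. deriv h z * E N z * (\<i> / of_real T)) has_contour_integral -sg) seg" by simp
      from this[unfolded seg_def] have "norm (-sg) \<le> (D / T) * norm (of_real R - of_real (-R) :: complex)"
      proof (rule has_contour_integral_bound_linepath)
        fix z assume z: "z \<in> closed_segment (of_real (-R)) (of_real R :: complex)"
        have "Im z = 0" using segU z by auto
        hence "norm (E N z) = 1" using N by (simp add: normE)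
        thus "norm (deriv h z * E N z * (\<i> / of_real T)) \<le> D / T"
          using D[OF z] T by (simp add: norm_mult norm_divide divide_right_mono)
      qed (use T D0 in auto)
      also have "norm (of_real R - of_real (-R) :: complex) = 2 * R"
      proof -
        have "of_real R - of_real (-R) = (of_real (2 * R) :: complex)" by simp
        thus ?thesis using R by (metis norm_of_real abs_of_pos mult_pos_pos zero_less_numeral)
      qed
      finally show ?thesis by simp
    qed
    have upb: "norm (-sg - up) \<le> 2 * C / R\<^sup>2 * R * (pi - 0)"
    proof (rule has_contour_integral_bound_part_circlepath_strong)
      show "((\<lambda>z. h z * E N z - S N z * kern z / z) has_contour_integral (-sg - up)) (part_circlepath 0 R 0 pi)"
        by (rule has_contour_integral_diff[OF up' up])
      \<comment> \<open>The bound 1 / Im z breaks down at the two real points of the circle, which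
        may be left out of the estimate.\<close>
      show "finite {z. norm z = R \<and> Im z = 0}"
      proof (rule finite_subset)
        show "{z. norm z = R \<and> Im z = 0} \<subseteq> {of_real R, of_real (-R)}"
          by (auto simp: cmod_def complex_eq_iff)
      qed auto
      fix z assume z: "z \<in> path_image (part_circlepath 0 R 0 pi) - {z. norm z = R \<and> Im z = 0}"
      have nz: "norm z = R" using norm_pi z by blast
      have imz: "Im z > 0" using z nz im_up by force
      have z0: "z \<noteq> 0" using nz R by auto
      have s: "(\<lambda>n. a (Suc (n + N)) * of_nat (Suc (n + N)) powr (-1 + \<i> * z)) sums (z * H z - S N z)"
      proof -
        have "S N z = (\<Sum>n<N. a (Suc n) * of_nat (Suc n) powr (-1 + \<i> * z))"
          unfolding S_def by (rule sum.reindex_bij_witness[of _ Suc "\<lambda>n. n - 1"]) auto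
        thus ?thesis using sums_split_initial_segment[OF sums[OF imz], of N] by simp
      qed
      have nrm: "norm (a (Suc (n + N)) * of_nat (Suc (n + N)) powr (-1 + \<i> * z)) \<le> C * real (n + Suc N) powr (-1 - Im z)" for n
        unfolding norm_mult norm_pow using a[of "Suc (n+N)"] by (simp add: mult_right_mono)
      have "norm (z * H z - S N z) \<le> (\<Sum>n. C * real (n + Suc N) powr (-1 - Im z))"
        unfolding sums_unique[OF s]
        using N imz by (intro norm_suminf_le nrm summable_mult sum_powr_tail_le(1)) auto
      also have "\<dots> = C * (\<Sum>n. real (n + Suc N) powr (-1 - Im z))"
        using N imz by (intro suminf_mult sum_powr_tail_le(1)) auto
      also have "\<dots> \<le> C * (real N powr (-Im z) / Im z)"
        using N imz C by (intro mult_left_mono sum_powr_tail_le(2)) auto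
      finally have b: "norm (z * H z - S N z) \<le> C * (real N powr (-Im z) / Im z)" .
      have "h z * E N z - S N z * kern z / z = (z * H z - S N z) * (kern z / z)"
        using z0 by (simp add: h_def kern_def left_diff_distrib diff_divide_distrib)
      hence "norm (h z * E N z - S N z * kern z / z) = norm (z * H z - S N z) * (real N powr Im z * (2 * \<bar>Im z\<bar> / R\<^sup>2))"
        unfolding kern_norm[OF nz, symmetric] by (simp only: norm_mult)
      also have "\<dots> \<le> C * (real N powr (-Im z) / Im z) * (real N powr Im z * (2 * \<bar>Im z\<bar> / R\<^sup>2))"
        using R by (intro mult_right_mono b) auto
      also have "\<dots> = 2 * C / R\<^sup>2 * (real N powr (-Im z) * real N powr Im z)"
        using imz by (simp add: field_simps)
      also have "real N powr (-Im z) * real N powr Im z = 1" using N by (simp add: powr_minus)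
      finally show "norm (h z * E N z - S N z * kern z / z) \<le> 2 * C / R\<^sup>2" by simp
    qed (use C R in auto)
    have lob: "norm lo \<le> (2 * C / R\<^sup>2 + 2 * C / (R * N)) * R * (2 * pi - pi)"
    proof (rule has_contour_integral_bound_part_circlepath_strong[OF lo])
      show "finite {z. norm z = R \<and> Im z = 0}"
      proof (rule finite_subset)
        show "{z. norm z = R \<and> Im z = 0} \<subseteq> {of_real R, of_real (-R)}"
          by (auto simp: cmod_def complex_eq_iff)
      qed auto
      fix z assume z: "z \<in> path_image (part_circlepath 0 R pi (2*pi)) - {z. norm z = R \<and> Im z = 0}"
      have nz: "norm z = R" using norm_pi z by blast
      have imz: "Im z < 0" using z nz im_lo by force
      define y where "y = - Im z"
      have y: "y > 0" "y \<le> R" using imz nz abs_Im_le_cmod[of z] by (auto simp: y_def)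
      have "norm (S N z) \<le> (\<Sum>n=1..N. C * real n powr (-1 + y))"
        unfolding S_def
      proof (rule sum_norm_le)
        fix n assume "n \<in> {1..N}"
        show "norm (a n * of_nat n powr (-1 + \<i> * z)) \<le> C * real n powr (-1 + y)"
          unfolding norm_mult norm_pow y_def using a[of n] by (simp add: mult_right_mono)
      qed
      also have "\<dots> = C * (\<Sum>n=1..N. real n powr (-1 + y))" by (simp add: sum_distrib_left)
      also have "\<dots> \<le> C * (real N powr y * (1 / y + 1 / real N))"
        using N y C by (intro mult_left_mono sum_powr_le) auto
      finally have b: "norm (S N z) \<le> C * (real N powr y * (1 / y + 1 / real N))" .
      have "norm (S N z * kern z / z) = norm (S N z) * (real N powr (-y) * (2 * y / R\<^sup>2))"
        using kern_norm[OF nz] imz by (simp add: y_def norm_mult flip: times_divide_eq_right)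
      also have "\<dots> \<le> C * (real N powr y * (1 / y + 1 / real N)) * (real N powr (-y) * (2 * y / R\<^sup>2))"
        using y R by (intro mult_right_mono b) auto
      also have "\<dots> = C * (1 / y + 1 / real N) * (2 * y / R\<^sup>2) * (real N powr y * real N powr (-y))"
        by (simp add: mult_ac)
      also have "real N powr y * real N powr (-y) = 1" using N by (simp add: powr_minus)
      also have "C * (1 / y + 1 / real N) * (2 * y / R\<^sup>2) * 1 = 2 * C / R\<^sup>2 + 2 * C / (R\<^sup>2 * N) * y"
        using y by (simp add: field_simps)
      also have "\<dots> \<le> 2 * C / R\<^sup>2 + 2 * C / (R\<^sup>2 * N) * R"
        using y C by (intro add_left_mono mult_left_mono) auto
      also have "\<dots> = 2 * C / R\<^sup>2 + 2 * C / (R * N)"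
        using R N by (simp add: field_simps power2_eq_square)
      finally show "norm (S N z * kern z / z) \<le> 2 * C / R\<^sup>2 + 2 * C / (R * N)" .
    qed (use C R in auto)
    have "2 * pi * \<i> * S N 0 = lo - sg - (-sg - up)" using split by (simp add: algebra_simps)
    hence "norm (2 * pi * \<i> * S N 0) \<le> norm lo + norm sg + norm (-sg - up)"
      using norm_triangle_ineq4[of "lo - sg" "-sg-up"] norm_triangle_ineq4[of lo sg] by simp
    also have "\<dots> \<le> (2 * C / R\<^sup>2 + 2 * C / (R * N)) * R * (2 * pi - pi) + D * (2 * R) / T + 2 * C / R\<^sup>2 * R * (pi - 0)"
      using upb lob sgb by linarith
    also have "\<dots> = 2 * pi * (2 * C / R + C / real N) + D * (2 * R) / T"
      using R N by (simp add: field_simps power2_eq_square)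
    also have "\<dots> \<le> 2 * pi * (2 * C / R + C / real N) + 2 * pi * (D * (2 * R) / T)"
    proof -
      have "1 \<le> 2 * pi" using pi_gt3 by simp
      hence "1 * (D * (2 * R) / T) \<le> 2 * pi * (D * (2 * R) / T)"
        using D0 R T by (intro mult_right_mono) auto
      thus ?thesis by simp
    qed
    finally have "2 * pi * norm (S N 0) \<le> 2 * pi * ((2 * C / R + C / real N) + D * (2 * R) / T)"
      by (simp add: norm_mult algebra_simps)
    hence "norm (S N 0) \<le> (2 * C / R + C / real N) + D * (2 * R) / T" by simp
    moreover have "S N 0 = (\<Sum>n=1..N. a n / of_nat n)"
      unfolding S_def by (intro sum.cong) (auto simp: powr_minus field_simps)
    ultimately show ?thesis by (simp add: T_def)
  qed
  have lim: "(\<lambda>N. (2 * C / R + C / real N) + (D * (2 * R) / ln (real N))) \<longlonglongrightarrow> (2 * C / R + 0) + 0"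
    by (intro tendsto_add tendsto_const tendsto_divide_0[OF tendsto_const]
        filterlim_at_top_imp_at_infinity filterlim_real_sequentially
        filterlim_compose[OF ln_at_top filterlim_real_sequentially])
  have "2 * C / R < e"
    using e C by (simp add: R_def field_simps add_pos_nonneg)
  hence "\<forall>\<^sub>F N in sequentially. (2 * C / R + C / real N) + (D * (2 * R) / ln (real N)) < e"
    using order_tendstoD(2)[OF lim, of e] by simp
  thus "\<forall>\<^sub>F N in sequentially. dist (\<Sum>n=1..N. a n / of_nat n) 0 < e"
    using eventually_ge_at_top[of 2]
    by eventually_elim (use main in force)
qed

text \<open>The error at n + 1 of the linear approximation of t^(-s) around n. It has size n^(-Re s
  - 2), so exchanging s n^(-s-1) for the difference n^(-s) - (n+1)^(-s), which can be summed by
  parts, costs a series that converges one unit further to the left.\<close>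

definition pstep :: "nat \<Rightarrow> complex \<Rightarrow> complex" where
  "pstep n s = s * of_nat n powr (-s - 1) - of_nat n powr (-s) + of_nat (Suc n) powr (-s)"

lemma norm_pstep_le:
  assumes "n \<ge> 1" "Re s \<ge> -2"
  shows "norm (pstep n s) \<le> norm s * norm (s + 1) * real n powr (-Re s - 2)"
proof -
  let ?S = "closed_segment (of_nat n) (of_nat (Suc n)) :: complex set"
  have S: "z \<notin> \<real>\<^sub>\<le>\<^sub>0 \<and> norm z \<ge> real n \<and> z \<in> \<real> \<and> Re z \<ge> real n" if z: "z \<in> ?S" for z
  proof -
    obtain u where u: "z = (1 - u) *\<^sub>R of_nat n + u *\<^sub>R of_nat (Suc n)" "u \<ge> 0" "u \<le> 1"
      using z by (auto simp: in_segment)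
    hence "z = of_real (real n + u)" by (simp add: scaleR_conv_of_real algebra_simps)
    moreover have "of_real (real n + u) \<notin> (\<real>\<^sub>\<le>\<^sub>0 :: complex set)"
      using u(2) assms(1) by (auto simp: complex_nonpos_Reals_iff)
    ultimately show ?thesis using u(2) assms(1) norm_of_real[of "real n + u", where 'a = complex] by auto
  qed
  define f :: "nat \<Rightarrow> complex \<Rightarrow> complex" where
    "f i = (\<lambda>z. if i = 0 then z powr (-s) else if i = 1 then -s * z powr (-s - 1) else s * (s + 1) * z powr (-s - 2))" for i
  have "norm (f 0 (of_nat (Suc n)) - (\<Sum>i\<le>1. f i (of_nat n) * (of_nat (Suc n) - of_nat n) ^ i / fact i))
    \<le> norm s * norm (s + 1) * real n powr (-Re s - 2) * norm (of_nat (Suc n) - of_nat n :: complex) ^ Suc 1 / fact 1"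
  proof (rule complex_Taylor[where S = "?S"])
    show "(f i has_field_derivative f (Suc i) x) (at x within ?S)" if "x \<in> ?S" "i \<le> 1" for i x
    proof (cases "i = 0")
      case True
      thus ?thesis using S[OF that(1)] by (auto simp: f_def intro!: derivative_eq_intros)
    next
      case False
      hence "i = 1" using that by simp
      thus ?thesis using S[OF that(1)] by (auto simp: f_def algebra_simps intro!: derivative_eq_intros)
    qed
    show "norm (f (Suc 1) x) \<le> norm s * norm (s + 1) * real n powr (-Re s - 2)" if "x \<in> ?S" for x
    proof -
      have "norm (x powr (-s - 2)) = Re x powr (-Re s - 2)"
        using S[OF that] by (subst norm_powr_real_powr) auto
      also have "\<dots> \<le> real n powr (-Re s - 2)"
        using S[OF that] assms by (intro powr_mono2') auto
      finally show ?thesis by (simp add: f_def norm_mult mult_left_mono)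
    qed
  qed auto
  moreover have "f 0 (of_nat (Suc n)) - (\<Sum>i\<le>1. f i (of_nat n) * (of_nat (Suc n) - of_nat n) ^ i / fact i) = pstep n s"
    by (simp add: f_def pstep_def algebra_simps)
  ultimately show ?thesis by simp
qed

text \<open>By \<open>norm_pstep_le\<close> the terms have size n^(\<kappa> - Re s - 2). The lemma
  is used with c = 1, \<kappa> = 0 for the continuation of zeta, and with Chebyshev's function and
  \<kappa> = 1 for the series of \<psi>(n).\<close>

lemma pstep_series:
  fixes c :: "nat \<Rightarrow> complex"
  assumes c: "\<And>n. n \<ge> 1 \<Longrightarrow> norm (c n) \<le> C * real n powr \<kappa>" and \<kappa>: "\<kappa> \<ge> 0"
  shows "(\<lambda>s. \<Sum>n. c (Suc n) * pstep (Suc n) s) holomorphic_on {s. Re s > \<kappa> - 1}"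
    and "Re s > \<kappa> - 1 \<Longrightarrow> summable (\<lambda>n. c (Suc n) * pstep (Suc n) s)"
proof -
  have C: "C \<ge> 0" using order_trans[OF norm_ge_zero c[of 1]] by simp
  have bnd: "norm (c (Suc n) * pstep (Suc n) z) \<le> C * (M * (M + 1)) * real (Suc n) powr (-1 - \<delta>)"
    if "norm z \<le> M" "Re z \<ge> \<kappa> - 1 + \<delta>" "\<delta> > 0" for n z M \<delta>
  proof -
    have "norm (pstep (Suc n) z) \<le> norm z * norm (z + 1) * real (Suc n) powr (-Re z - 2)"
      using that \<kappa> by (intro norm_pstep_le) auto
    also have "\<dots> \<le> (M * (M + 1)) * real (Suc n) powr (-\<kappa> - 1 - \<delta>)"
      using that norm_triangle_ineq[of z 1] order_trans[OF norm_ge_zero that(1)]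
      by (intro mult_mono powr_mono) auto
    finally have "norm (c (Suc n)) * norm (pstep (Suc n) z) \<le> (C * real (Suc n) powr \<kappa>) * ((M * (M + 1)) * real (Suc n) powr (-\<kappa> - 1 - \<delta>))"
      using c[of "Suc n"] C by (intro mult_mono) auto
    also have "\<dots> = C * (M * (M + 1)) * (real (Suc n) powr \<kappa> * real (Suc n) powr (-\<kappa> - 1 - \<delta>))"
      by (simp add: mult_ac)
    also have "real (Suc n) powr \<kappa> * real (Suc n) powr (-\<kappa> - 1 - \<delta>) = real (Suc n) powr (-1 - \<delta>)"
      by (subst powr_add[symmetric]) simp
    finally show ?thesis by (simp add: norm_mult)
  qed
  have sm: "summable (\<lambda>n. C * (M * (M + 1)) * real (Suc n) powr (-1 - \<delta>))" if "\<delta> > 0" for M \<delta> :: real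
    using that by (intro summable_mult) (subst summable_Suc_iff, simp add: summable_real_powr_iff)
  show "summable (\<lambda>n. c (Suc n) * pstep (Suc n) s)" if "Re s > \<kappa> - 1" for s
    by (rule summable_comparison_test'[OF sm[of "Re s - (\<kappa> - 1)" "norm s"], of 0])
       (use that bnd[of s "norm s" "Re s - (\<kappa> - 1)"] in \<open>auto simp del: of_nat_Suc\<close>)
  show "(\<lambda>s. \<Sum>n. c (Suc n) * pstep (Suc n) s) holomorphic_on {s. Re s > \<kappa> - 1}"
  proof (rule holomorphic_uniform_sequence)
    show "open {s. Re s > \<kappa> - 1}" by (rule open_halfspace_Re_gt)
    show "(\<lambda>s. \<Sum>n<N. c (Suc n) * pstep (Suc n) s) holomorphic_on {s. Re s > \<kappa> - 1}" for N
      unfolding pstep_def by (auto intro!: holomorphic_intros)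
    fix x assume x: "x \<in> {s. Re s > \<kappa> - 1}"
    define d where "d = (Re x - (\<kappa> - 1)) / 2"
    have d: "d > 0" using x by (simp add: d_def)
    have in_ball: "norm z \<le> norm x + d \<and> Re z \<ge> \<kappa> - 1 + d" if "z \<in> cball x d" for z
    proof -
      have "norm (x - z) \<le> d" using that by (simp add: dist_norm)
      moreover have "\<bar>Re (x - z)\<bar> \<le> norm (x - z)" by (rule abs_Re_le_cmod)
      ultimately have "Re x - Re z \<le> d" by auto
      moreover have "norm z \<le> norm x + norm (x - z)" by (metis norm_minus_commute norm_triangle_sub)
      ultimately show ?thesis using \<open>norm (x - z) \<le> d\<close> by (auto simp: d_def field_simps)
    qed
    show "\<exists>d>0. cball x d \<subseteq> {s. Re s > \<kappa> - 1} \<and>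
        uniform_limit (cball x d) (\<lambda>N s. \<Sum>n<N. c (Suc n) * pstep (Suc n) s) (\<lambda>s. \<Sum>n. c (Suc n) * pstep (Suc n) s) sequentially"
    proof (intro exI[of _ d] conjI d)
      show "cball x d \<subseteq> {s. Re s > \<kappa> - 1}" using in_ball d by force
      show "uniform_limit (cball x d) (\<lambda>N s. \<Sum>n<N. c (Suc n) * pstep (Suc n) s) (\<lambda>s. \<Sum>n. c (Suc n) * pstep (Suc n) s) sequentially"
        by (rule Weierstrass_m_test[OF bnd[of _ "norm x + d" d] sm[of d "norm x + d"]])
           (use in_ball d in auto)
    qed
  qed
qed

text \<open>The function \<open>(s - 1) \<zeta>(s)\<close>, continued to \<open>Re s > 0\<close> by partial summation.\<close>

definition szeta :: "complex \<Rightarrow> complex" where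
  "szeta s = 1 + (\<Sum>n. pstep (Suc n) (s - 1))"

lemma szeta_holomorphic: "szeta holomorphic_on {s. Re s > 0}"
proof -
  have "(\<lambda>s. \<Sum>n. (\<lambda>_. 1) (Suc n) * pstep (Suc n) s) holomorphic_on {s. Re s > 0 - 1}"
    by (rule pstep_series(1)[of _ 1]) auto
  hence "((\<lambda>s. \<Sum>n. pstep (Suc n) s) \<circ> (\<lambda>s. s - 1)) holomorphic_on {s. Re s > 0}"
    by (intro holomorphic_on_compose_gen[where t = "{s. Re s > -1}"]) (auto intro!: holomorphic_intros)
  thus ?thesis unfolding szeta_def[abs_def] o_def by (intro holomorphic_intros)
qed

lemma szeta_1 [simp]: "szeta 1 = 1"
  by (simp add: szeta_def pstep_def del: of_nat_Suc)

lemma of_nat_powr_tendsto_0: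
  assumes "Re s < 0"
  shows "(\<lambda>n. of_nat (Suc n) powr s :: complex) \<longlonglongrightarrow> 0"
proof (rule tendsto_norm_zero_cancel)
  have "(\<lambda>n. real (Suc n) powr Re s) \<longlonglongrightarrow> 0"
    using assms by (intro tendsto_neg_powr filterlim_compose[OF filterlim_real_sequentially filterlim_Suc]) auto
  thus "(\<lambda>n. norm (of_nat (Suc n) powr s :: complex)) \<longlonglongrightarrow> 0"
    by (subst norm_powr_real_powr) auto
qed

lemma szeta_sums:
  assumes "Re s > 1"
  shows "(\<lambda>n. of_nat (Suc n) powr (-s)) sums (szeta s / (s - 1))"
proof -
  have s1: "s \<noteq> 1" using assms by auto
  have "summable (\<lambda>n. (\<lambda>_. 1) (Suc n) * pstep (Suc n) (s - 1))"
    using assms by (intro pstep_series(2)[of _ 1 0]) auto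
  hence "(\<lambda>N. \<Sum>n<N. pstep (Suc n) (s - 1)) \<longlonglongrightarrow> szeta s - 1"
    by (simp add: szeta_def summable_sums_iff[symmetric] sums_def[symmetric])
  moreover have "(\<Sum>n<N. pstep (Suc n) (s - 1)) = (s - 1) * (\<Sum>n<N. of_nat (Suc n) powr (-s)) - 1 + of_nat (Suc N) powr (1 - s)" for N
    by (induction N) (simp_all add: pstep_def algebra_simps)
  ultimately have "(\<lambda>N. (s - 1) * (\<Sum>n<N. of_nat (Suc n) powr (-s)) - 1 + of_nat (Suc N) powr (1 - s)) \<longlonglongrightarrow> szeta s - 1"
    by simp
  from tendsto_diff[OF this of_nat_powr_tendsto_0[of "1 - s"]] assms
  have "(\<lambda>N. (s - 1) * (\<Sum>n<N. of_nat (Suc n) powr (-s)) - 1) \<longlonglongrightarrow> szeta s - 1 - 0" by simp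
  from tendsto_divide[OF tendsto_add[OF this tendsto_const[of 1]] tendsto_const[of "s - 1"]] s1
  show ?thesis by (simp add: sums_def)
qed

lemma szeta_deriv_sums:
  assumes "Re s > 1"
  shows "(\<lambda>n. of_real (ln (real (Suc n))) * of_nat (Suc n) powr (-s))
           sums (szeta s / (s - 1) ^ 2 - deriv szeta s / (s - 1))"
proof -
  let ?S = "{s. Re s > 1} :: complex set"
  let ?f = "\<lambda>N s. \<Sum>n<N. of_nat (Suc n) powr (-s) :: complex"
  let ?f' = "\<lambda>N s. \<Sum>n<N. -of_real (ln (real (Suc n))) * of_nat (Suc n) powr (-s) :: complex"
  have "\<exists>g'. \<forall>x\<in>?S. ((\<lambda>s. szeta s / (s - 1)) has_field_derivative g' x) (at x) \<and> ((\<lambda>N. ?f' N x) \<longlongrightarrow> g' x) sequentially"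
  proof (rule has_complex_derivative_uniform_sequence)
    show "open ?S" by (rule open_halfspace_Re_gt)
    show "(?f N has_field_derivative ?f' N x) (at x)" for N x
    proof (rule DERIV_sum)
      fix n
      show "((\<lambda>s. of_nat (Suc n) powr (-s)) has_field_derivative -of_real (ln (real (Suc n))) * of_nat (Suc n) powr (-x)) (at x)"
        using DERIV_chain2[OF has_field_derivative_powr_right[of "of_nat (Suc n) :: complex" "-x"] DERIV_minus[OF DERIV_ident]]
        by (simp add: Ln_of_nat del: of_nat_Suc)
    qed
    fix x assume x: "x \<in> ?S"
    define d where "d = (Re x - 1) / 2"
    have d: "d > 0" using x by (simp add: d_def)
    have in_ball: "Re z \<ge> 1 + d" if "z \<in> cball x d" for z
    proof -
      have "\<bar>Re (x - z)\<bar> \<le> d" using abs_Re_le_cmod[of "x - z"] that by (simp add: dist_norm)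
      hence "Re x - Re z \<le> d" by simp
      thus ?thesis unfolding d_def by argo
    qed
    show "\<exists>d>0. cball x d \<subseteq> ?S \<and> uniform_limit (cball x d) ?f (\<lambda>s. szeta s / (s - 1)) sequentially"
    proof (intro exI[of _ d] conjI d)
      show "cball x d \<subseteq> ?S" using in_ball d by force
      have "uniform_limit (cball x d) ?f (\<lambda>s. \<Sum>n. of_nat (Suc n) powr (-s)) sequentially"
      proof (rule Weierstrass_m_test)
        show "norm (of_nat (Suc n) powr (-z) :: complex) \<le> real (Suc n) powr (-1 - d)" if "z \<in> cball x d" for n z
          using in_ball[OF that] by (subst norm_powr_real_powr) (auto intro!: powr_mono)
        show "summable (\<lambda>n. real (Suc n) powr (-1 - d))"
          using d by (subst summable_Suc_iff) (simp add: summable_real_powr_iff)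
      qed
      moreover have "(\<Sum>n. of_nat (Suc n) powr (-z)) = szeta z / (z - 1)" if "z \<in> cball x d" for z
        using in_ball[OF that] d szeta_sums[of z] by (simp add: sums_iff)
      ultimately show "uniform_limit (cball x d) ?f (\<lambda>s. szeta s / (s - 1)) sequentially"
        by (subst (asm) uniform_limit_cong'[where g = ?f and i = "\<lambda>s. szeta s / (s - 1)"]) auto
    qed
  qed
  then obtain g' where g': "((\<lambda>s. szeta s / (s - 1)) has_field_derivative g') (at s)"
    "((\<lambda>N. ?f' N s) \<longlongrightarrow> g') sequentially" using assms by blast
  have s1: "s \<noteq> 1" using assms by auto
  have "(szeta has_field_derivative deriv szeta s) (at s)"
    using assms szeta_holomorphic by (intro holomorphic_derivI[OF _ open_halfspace_Re_gt[of 0]]) auto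
  from DERIV_divide[OF this DERIV_diff[OF DERIV_ident DERIV_const[of 1]]] s1
  have "((\<lambda>s. szeta s / (s - 1)) has_field_derivative (deriv szeta s * (s - 1) - szeta s) / (s - 1)^2) (at s)"
    by (simp add: power2_eq_square)
  from DERIV_unique[OF g'(1) this] have "g' = (deriv szeta s * (s - 1) - szeta s) / (s - 1)^2" .
  moreover have *: "(D * u - Z) / u\<^sup>2 = - (Z / u\<^sup>2 - D / u)" if "u \<noteq> 0" for D u Z :: complex
    using that by (simp add: field_simps power2_eq_square)
  ultimately have "g' = (deriv szeta s * (s - 1) - szeta s) / (s - 1)^2" by simp
  also have "\<dots> = - (szeta s / (s - 1) ^ 2 - deriv szeta s / (s - 1))"
    using *[of "s - 1"] s1 by simp
  finally have "- g' = szeta s / (s - 1) ^ 2 - deriv szeta s / (s - 1)" by simp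
  with tendsto_minus[OF g'(2)] show ?thesis by (simp add: sums_def sum_negf)
qed

text \<open>This is -\<zeta>'/\<zeta>, taken as an unordered sum so that its product with the series
  of \<zeta> can be regrouped freely.\<close>

definition mseries :: "complex \<Rightarrow> complex" where
  "mseries s = (\<Sum>\<^sub>\<infinity>n\<in>{1..}. mangoldt n * of_nat n powr (-s))"

lemma norm_of_nat_powr: "norm (of_nat n powr s :: complex) = real n powr Re s"
  by (cases "n = 0") (simp_all add: norm_powr_real_powr)

lemma sums_imp_has_sum_pos:
  assumes "(\<lambda>n. f (Suc n)) sums (S :: complex)" "summable (\<lambda>n. norm (f (Suc n)))"
  shows "(f has_sum S) {1..}"
proof -
  have "((\<lambda>n. f (Suc n)) has_sum S) UNIV"
    using norm_summable_imp_has_sum[OF assms(2,1)] by simp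
  moreover have "bij_betw Suc UNIV {1..}"
    by (rule bij_betwI[of _ _ _ "\<lambda>n. n - 1"]) auto
  ultimately show ?thesis using has_sum_reindex_bij_betw[of Suc UNIV "{1..}" f S] by simp
qed

lemma ln_powr_has_sum:
  assumes "Re s > 1"
  shows "((\<lambda>n. of_real (ln (real n)) * of_nat n powr (-s)) has_sum (szeta s / (s - 1) ^ 2 - deriv szeta s / (s - 1))) {1..}"
    and "summable (\<lambda>n. ln (real (Suc n)) * real (Suc n) powr (-Re s))"
proof -
  have "(\<lambda>n. Re (of_real (ln (real (Suc n))) * of_nat (Suc n) powr (-of_real (Re s)))) sums
     Re (szeta (Re s) / (of_real (Re s) - 1) ^ 2 - deriv szeta (Re s) / (of_real (Re s) - 1))"
    by (intro sums_Re szeta_deriv_sums) (use assms in auto)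
  moreover have "Re (of_real (ln (real (Suc n))) * of_nat (Suc n) powr (-of_real (Re s))) = ln (real (Suc n)) * real (Suc n) powr (-Re s)" for n
  proof -
    have "(of_nat (Suc n) powr (-of_real (Re s)) :: complex) = of_real (real (Suc n) powr (-Re s))"
      using powr_of_real[of "real (Suc n)" "- Re s"] by simp
    thus ?thesis by (simp del: of_nat_Suc)
  qed
  ultimately show sm: "summable (\<lambda>n. ln (real (Suc n)) * real (Suc n) powr (-Re s))"
    by (simp only: sums_iff)
  show "((\<lambda>n. of_real (ln (real n)) * of_nat n powr (-s)) has_sum (szeta s / (s - 1) ^ 2 - deriv szeta s / (s - 1))) {1..}"
    by (rule sums_imp_has_sum_pos[OF szeta_deriv_sums[OF assms]])
       (use sm in \<open>simp add: norm_mult norm_of_nat_powr del: of_nat_Suc\<close>)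
qed

text \<open>The last identity is \<Lambda> * 1 = log: the pairs (m, n) of the product with \<zeta>
  are regrouped by N = m n. It is stated without dividing by \<open>szeta\<close>, because the
  non-vanishing of \<open>szeta\<close> is itself derived from it.\<close>

lemma mseries_props:
  assumes s: "Re s > 1"
  shows "((\<lambda>n. mangoldt n * of_nat n powr (-s)) has_sum mseries s) {1..}"
    and "(\<lambda>n. mangoldt n * real n powr (-Re s)) summable_on {1..}"
    and "mseries s * szeta s = szeta s / (s - 1) - deriv szeta s"
proof -
  have s1: "s \<noteq> 1" using s by auto
  have "summable (\<lambda>n. mangoldt (Suc n) * real (Suc n) powr (-Re s))"
    by (rule summable_comparison_test'[OF ln_powr_has_sum(2)[OF s], of 0])
       (auto simp: abs_mult intro!: mult_right_mono mangoldt_le simp del: of_nat_Suc)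
  hence sm: "summable (\<lambda>n. norm (mangoldt (Suc n) * of_nat (Suc n) powr (-s) :: complex))"
    by (simp add: norm_mult norm_of_nat_powr del: of_nat_Suc)
  have hs: "((\<lambda>n. mangoldt n * of_nat n powr (-s) :: complex) has_sum (\<Sum>n. mangoldt (Suc n) * of_nat (Suc n) powr (-s))) {1..}"
    by (rule sums_imp_has_sum_pos[OF summable_sums[OF summable_norm_cancel[OF sm]] sm])
  show hm: "((\<lambda>n. mangoldt n * of_nat n powr (-s)) has_sum mseries s) {1..}"
    unfolding mseries_def using hs has_sum_infsum has_sum_imp_summable by blast
  have "(\<lambda>n. norm (mangoldt n * of_nat n powr (-s) :: complex)) summable_on {1..}"
    using has_sum_imp_summable[OF hm] by (simp only: summable_on_iff_abs_summable_on_complex)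
  thus "(\<lambda>n. mangoldt n * real n powr (-Re s)) summable_on {1..}"
    by (simp add: norm_mult norm_of_nat_powr)
  have "summable (\<lambda>n. norm (of_nat (Suc n) powr (-s) :: complex))"
    using s by (subst norm_of_nat_powr, subst summable_Suc_iff) (simp add: summable_real_powr_iff)
  hence hz: "((\<lambda>n. of_nat n powr (-s)) has_sum (szeta s / (s - 1))) {1..}"
    by (intro sums_imp_has_sum_pos szeta_sums s)
  define F where "F = (\<lambda>(m,n). (mangoldt m * of_nat m powr (-s)) * (of_nat n powr (-s)) :: complex)"
  have F: "(F has_sum (mseries s * (szeta s / (s - 1)))) ({1..} \<times> {1..})"
  proof -
    have "F summable_on ({1..} \<times> {1..})"
      using has_sum_imp_summable[OF hm] has_sum_imp_summable[OF hz]
      unfolding summable_on_iff_abs_summable_on_complex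
      by (intro Infinite_Sum.abs_summable_on_Sigma_iff[THEN iffD2] conjI ballI)
         (auto simp: F_def norm_mult abs_mult infsum_cmult_right' intro!: summable_on_cmult_right summable_on_cmult_left)
    then obtain T where T: "(F has_sum T) ({1..} \<times> {1..})" by (auto simp: summable_on_def)
    have "((\<lambda>m. mangoldt m * of_nat m powr (-s) * (szeta s / (s - 1))) has_sum T) {1..}"
      using T by (rule has_sum_SigmaD) (unfold F_def prod.case, rule has_sum_cmult_right[OF hz])
    from has_sum_unique[OF this has_sum_cmult_left[OF hm]] show ?thesis using T by simp
  qed
  have bij: "bij_betw (\<lambda>(N::nat,m). (m, N div m)) (SIGMA N:{1..}. {m. m dvd N}) ({1..} \<times> {1..})"
  proof -
    have "m \<ge> 1 \<and> N div m \<ge> 1 \<and> m * (N div m) = N" if "N \<ge> 1" "m dvd N" for N m :: nat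
      using that by (cases "m = 0") (auto elim!: dvdE)
    thus ?thesis by (intro bij_betwI[of _ _ _ "\<lambda>(m,n). (m * n, m)"]) auto
  qed
  have "((\<lambda>p. F ((\<lambda>(N,m). (m, N div m)) p)) has_sum (mseries s * (szeta s / (s - 1)))) (SIGMA N:{1..}. {m. m dvd N})"
    using has_sum_reindex_bij_betw[OF bij, of F] F by blast
  hence "((\<lambda>(N,m). (mangoldt m * of_nat m powr (-s)) * (of_nat (N div m) powr (-s))) has_sum (mseries s * (szeta s / (s - 1)))) (SIGMA N:{1..}. {m. m dvd N})"
    by (simp add: F_def case_prod_unfold)
  hence "((\<lambda>N. of_real (ln (real N)) * of_nat N powr (-s)) has_sum (mseries s * (szeta s / (s - 1)))) {1..}"
  proof (rule has_sum_SigmaD)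
    fix N :: nat assume N: "N \<in> {1..}"
    have "((\<lambda>m. mangoldt m * of_nat m powr (-s) * of_nat (N div m) powr (-s)) has_sum
       (\<Sum>m | m dvd N. mangoldt m * of_nat m powr (-s) * of_nat (N div m) powr (-s))) {m. m dvd N}"
      using N by (intro has_sum_finite) auto
    also have "(\<Sum>m | m dvd N. mangoldt m * of_nat m powr (-s) * of_nat (N div m) powr (-s)) = (\<Sum>m | m dvd N. mangoldt m * of_nat N powr (-s))"
    proof (rule sum.cong)
      fix m assume "m \<in> {m. m dvd N}"
      then obtain k where k: "N = m * k" by auto
      show "mangoldt m * of_nat m powr (-s) * of_nat (N div m) powr (-s) = mangoldt m * of_nat N powr (-s)"
        using k N powr_times_real[of "of_nat m" "of_nat k" "-s"] by simp
    qed auto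
    also have "\<dots> = of_real (ln (real N)) * of_nat N powr (-s)"
      using N by (simp add: sum_distrib_right[symmetric] mangoldt_sum)
    finally show "((\<lambda>m. (case (N, m) of (N, m) \<Rightarrow> mangoldt m * of_nat m powr (-s) * of_nat (N div m) powr (-s))) has_sum
       (of_real (ln (real N)) * of_nat N powr (-s))) {m. m dvd N}" by simp
  qed
  from has_sum_unique[OF this ln_powr_has_sum(1)[OF s]]
  have eq: "mseries s * (szeta s / (s - 1)) = szeta s / (s - 1)\<^sup>2 - deriv szeta s / (s - 1)" .
  have "m * z = z / u - d" if "m * (z / u) = z / u\<^sup>2 - d / u" "u \<noteq> 0" for m z u d :: complex
  proof -
    have "m * z = (m * (z / u)) * u" using that(2) by simp
    also have "\<dots> = (z / u\<^sup>2 - d / u) * u" by (simp only: that(1))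
    also have "\<dots> = z / u - d" using that(2) by (simp add: field_simps power2_eq_square)
    finally show ?thesis .
  qed
  from this[OF eq] show "mseries s * szeta s = szeta s / (s - 1) - deriv szeta s"
    using s1 by simp
qed

text \<open>With f = (w - a)^m g near a and g(a) nonzero, the logarithmic derivative is m / (w - a)
  plus a bounded term. The order m is read off along the horizontal ray to the right of a because
  for a on the line Re s = 1 this ray stays in the region of absolute convergence.\<close>

lemma horizontal_log_deriv:
  fixes f :: "complex \<Rightarrow> complex"
  assumes f: "f holomorphic_on U" "open U" "connected U" "a \<in> U" and nz: "b \<in> U" "f b \<noteq> 0"
  obtains m :: nat where "((\<lambda>e. of_real e * deriv f (a + of_real e) / f (a + of_real e)) \<longlongrightarrow> of_nat m) (at_right 0)"
    "f a = 0 \<longleftrightarrow> m > 0" "\<forall>\<^sub>F e in at_right 0. f (a + of_real e) \<noteq> 0"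
proof -
  have lim: "((\<lambda>e. a + of_real e) \<longlongrightarrow> a + of_real 0) (at_right 0)" by (intro tendsto_intros)
  have df: "deriv f holomorphic_on U" using f by (intro holomorphic_deriv)
  have cont: "isCont g a" if "g holomorphic_on V" "open V" "a \<in> V" for g V
    using that holomorphic_on_imp_continuous_on continuous_on_eq_continuous_at by blast
  have tend: "((\<lambda>e. g (a + of_real e)) \<longlongrightarrow> g a) (at_right 0)" if "g holomorphic_on V" "open V" "a \<in> V" for g V
    using isCont_tendsto_compose[OF cont[OF that] lim[simplified]] .
  show ?thesis
  proof (cases "f a = 0")
    case False
    have "((\<lambda>e. of_real e * deriv f (a + of_real e) / f (a + of_real e)) \<longlongrightarrow> of_real 0 * deriv f a / f a) (at_right 0)"
      using False f df by (intro tendsto_intros tend) auto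
    moreover have "\<forall>\<^sub>F e in at_right 0. f (a + of_real e) \<noteq> 0"
      using tendsto_imp_eventually_ne[OF tend[OF f(1,2,4)] False] .
    ultimately show ?thesis using False that[of 0] by simp
  next
    case True
    have "\<not> f constant_on U" using True nz f(4) by (metis constant_on_def)
    then obtain g r n where g: "0 < n" "0 < r" "ball a r \<subseteq> U" "g holomorphic_on ball a r"
      "\<And>w. w \<in> ball a r \<Longrightarrow> f w = (w - a) ^ n * g w" "\<And>w. w \<in> ball a r \<Longrightarrow> g w \<noteq> 0"
      using holomorphic_factor_zero_nonconstant[OF f(1-4) True] by metis
    have dg: "deriv g holomorphic_on ball a r" using g by (intro holomorphic_deriv) auto
    have ev: "\<forall>\<^sub>F e in at_right 0. 0 < e \<and> e < r"
      using g(2) by (auto simp: eventually_at_right_field intro: exI[of _ r])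
    have eq: "of_real e * deriv f (a + of_real e) / f (a + of_real e) = of_nat n + of_real e * deriv g (a + of_real e) / g (a + of_real e)"
      and fne: "f (a + of_real e) \<noteq> 0" if e: "0 < e" "e < r" for e :: real
    proof -
      let ?w = "a + of_real e"
      have w: "?w \<in> ball a r" using e by (simp add: dist_norm)
      have gd: "(g has_field_derivative deriv g ?w) (at ?w)" using g(4) w by (intro holomorphic_derivI) auto
      have "((\<lambda>w. (w - a) ^ n * g w) has_field_derivative (of_nat n * (?w - a) ^ (n - 1) * g ?w + deriv g ?w * (?w - a) ^ n)) (at ?w)"
        by (rule derivative_eq_intros gd refl | simp)+
      hence "(f has_field_derivative (of_nat n * (?w - a) ^ (n - 1) * g ?w + deriv g ?w * (?w - a) ^ n)) (at ?w)"
        by (rule has_field_derivative_transform_within_open[where S = "ball a r"]) (use w g in auto)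
      hence d: "deriv f ?w = of_nat n * of_real e ^ (n - 1) * g ?w + deriv g ?w * of_real e ^ n"
        by (simp add: DERIV_imp_deriv)
      have "of_real e * deriv f ?w = of_real e ^ n * (of_nat n * g ?w + of_real e * deriv g ?w)"
        unfolding d using g(1) by (cases n) (simp_all add: algebra_simps)
      moreover have fw: "f ?w = of_real e ^ n * g ?w" using g(5)[OF w] by simp
      ultimately show "of_real e * deriv f ?w / f ?w = of_nat n + of_real e * deriv g ?w / g ?w"
        using e g(6)[OF w] by (simp add: field_simps)
      show "f ?w \<noteq> 0" using fw e g(6)[OF w] by simp
    qed
    have "((\<lambda>e. of_nat n + of_real e * deriv g (a + of_real e) / g (a + of_real e)) \<longlongrightarrow> of_nat n + of_real 0 * deriv g a / g a) (at_right 0)"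
      using g dg by (intro tendsto_intros tend[where V = "ball a r"]) auto
    hence "((\<lambda>e. of_nat n + of_real e * deriv g (a + of_real e) / g (a + of_real e)) \<longlongrightarrow> of_nat n) (at_right 0)" by simp
    hence "((\<lambda>e. of_real e * deriv f (a + of_real e) / f (a + of_real e)) \<longlongrightarrow> of_nat n) (at_right 0)"
      by (rule Lim_transform_eventually) (use ev in \<open>eventually_elim, auto simp: eq\<close>)
    moreover have "\<forall>\<^sub>F e in at_right 0. f (a + of_real e) \<noteq> 0" using ev by eventually_elim (auto simp: fne)
    ultimately show ?thesis using True g(1) that[of n] by simp
  qed
qed

section \<open>Non-vanishing of zeta for Re s \<ge> 1\<close>

lemma norm_mseries_le:
  assumes "Re s > 1" "Re z \<ge> Re s"
  shows "norm (mseries z) \<le> (\<Sum>\<^sub>\<infinity>n\<in>{1..}. mangoldt n * real n powr (-Re s))"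
proof -
  have z: "Re z > 1" using assms by simp
  have "norm (mseries z) \<le> (\<Sum>\<^sub>\<infinity>n\<in>{1..}. mangoldt n * real n powr (-Re z))"
    using mseries_props(2)[OF z] unfolding mseries_def
    by (intro order_trans[OF norm_infsum_bound]) (simp_all add: norm_mult norm_of_nat_powr)
  also have "\<dots> \<le> (\<Sum>\<^sub>\<infinity>n\<in>{1..}. mangoldt n * real n powr (-Re s))"
    using assms by (intro infsum_mono mseries_props(2) z) (auto intro!: mult_left_mono powr_mono mangoldt_nonneg)
  finally show ?thesis .
qed

text \<open>For Re s > 1 the series \<open>mseries\<close> is bounded to the right of s, so the
  order of vanishing is 0. On Re s = 1 the inequality 3 + 4 cos \<theta> + cos 2\<theta> \<ge> 0 is
  applied at 1, 1 + it and 1 + 2it: in the limit it says 3 - 4 m1 - m2 \<ge> 0 for the orders m1, m2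
  of the zeros, which forces m1 = 0.\<close>

lemma szeta_nonzero:
  assumes s: "Re s \<ge> 1"
  shows "szeta s \<noteq> 0"
proof -
  let ?U = "{s. Re s > 0} :: complex set"
  have U: "open ?U" "connected ?U" by (simp_all add: open_halfspace_Re_gt convex_halfspace_Re_gt convex_connected)
  define P where "P a m \<longleftrightarrow> ((\<lambda>e. of_real e * deriv szeta (a + of_real e) / szeta (a + of_real e)) \<longlongrightarrow> of_nat m) (at_right 0) \<and>
     (szeta a = 0 \<longleftrightarrow> m > 0) \<and> (\<forall>\<^sub>F e in at_right 0. szeta (a + of_real e) \<noteq> 0)" for a and m :: nat
  have ex: "\<exists>m. P a m" if "Re a > 0" for a
  proof -
    have "a \<in> ?U" "1 \<in> ?U" "szeta 1 \<noteq> 0" using that by auto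
    from horizontal_log_deriv[OF szeta_holomorphic U this] show ?thesis unfolding P_def by blast
  qed
  have pos: "\<forall>\<^sub>F e :: real in at_right 0. e > 0" by (rule eventually_at_right_less)
  \<comment> \<open>The limit is minus the order of \<zeta> at a; the simple pole at 1, which is
    missing from \<open>szeta\<close>, accounts for the summand 1.\<close>
  have lim: "((\<lambda>e. of_real e * mseries (a + of_real e)) \<longlongrightarrow> (if a = 1 then 1 else 0) - of_nat m) (at_right 0)"
    if P: "P a m" and a: "Re a \<ge> 1" for a m
  proof -
    have "((\<lambda>e. of_real e / (a + of_real e - 1)) \<longlongrightarrow> (if a = 1 then 1 else 0)) (at_right 0)"
    proof (cases "a = 1")
      case True
      have "((\<lambda>e. 1 :: complex) \<longlongrightarrow> 1) (at_right 0)" by simp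
      hence "((\<lambda>e. of_real e / (a + of_real e - 1)) \<longlongrightarrow> 1) (at_right 0)"
        by (rule Lim_transform_eventually) (use pos in eventually_elim, auto simp: True)
      thus ?thesis using True by simp
    next
      case False
      have "((\<lambda>e. of_real e / (a + of_real e - 1)) \<longlongrightarrow> of_real 0 / (a + of_real 0 - 1)) (at_right 0)"
        using False by (intro tendsto_intros) auto
      thus ?thesis using False by simp
    qed
    moreover have "((\<lambda>e. of_real e * deriv szeta (a + of_real e) / szeta (a + of_real e)) \<longlongrightarrow> of_nat m) (at_right 0)"
      using P by (simp add: P_def)
    ultimately have "((\<lambda>e. of_real e / (a + of_real e - 1) - of_real e * deriv szeta (a + of_real e) / szeta (a + of_real e)) \<longlongrightarrow> (if a = 1 then 1 else 0) - of_nat m) (at_right 0)"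
      by (rule tendsto_diff)
    moreover have "\<forall>\<^sub>F e in at_right 0. of_real e / (a + of_real e - 1) - of_real e * deriv szeta (a + of_real e) / szeta (a + of_real e) = of_real e * mseries (a + of_real e)"
    proof -
      have "\<forall>\<^sub>F e in at_right 0. szeta (a + of_real e) \<noteq> 0" using P by (simp add: P_def)
      thus ?thesis using pos
      proof eventually_elim
        case (elim e)
        have "mseries (a + of_real e) * szeta (a + of_real e) = szeta (a + of_real e) / (a + of_real e - 1) - deriv szeta (a + of_real e)"
          using elim a by (intro mseries_props(3)) auto
        moreover have "M = 1 / u - D / Z" if "M * Z = Z / u - D" "Z \<noteq> 0" for M Z u D :: complex
        proof -
          have "M = M * Z / Z" using that(2) by simp
          also have "\<dots> = 1 / u - D / Z" unfolding that(1) using that(2) by (simp add: diff_divide_distrib)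
          finally show ?thesis .
        qed
        ultimately have "mseries (a + of_real e) = 1 / (a + of_real e - 1) - deriv szeta (a + of_real e) / szeta (a + of_real e)"
          using elim(1) by blast
        thus ?case by (simp add: right_diff_distrib)
      qed
    qed
    ultimately show ?thesis by (rule Lim_transform_eventually)
  qed
  show ?thesis
  proof (cases "Re s = 1")
    case False
    hence s1: "Re s > 1" using s by simp
    obtain m where m: "P s m" using ex[of s] s by auto
    have "((\<lambda>e. of_real e * mseries (s + of_real e)) \<longlongrightarrow> 0) (at_right 0)"
    proof (rule Lim_null_comparison)
      let ?M = "(\<Sum>\<^sub>\<infinity>n\<in>{1..}. mangoldt n * real n powr (-Re s))"
      show "\<forall>\<^sub>F e in at_right 0. norm (of_real e * mseries (s + of_real e)) \<le> e * ?M"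
        using pos
      proof eventually_elim
        case (elim e)
        have "norm (mseries (s + of_real e)) \<le> ?M" using elim by (intro norm_mseries_le s1) auto
        hence "e * norm (mseries (s + of_real e)) \<le> e * ?M" using elim by (intro mult_left_mono) auto
        thus ?case using elim by (simp add: norm_mult)
      qed
      show "((\<lambda>e. e * ?M) \<longlongrightarrow> 0) (at_right 0)" by (auto intro!: tendsto_eq_intros)
    qed
    from tendsto_unique[OF _ this lim[OF m s]] s1 have "m = 0"
      by (auto split: if_splits)
    thus ?thesis using m by (simp add: P_def)
  next
    case True
    show ?thesis
    proof (cases "s = 1")
      case False
      define t where "t = Im s"
      have t: "t \<noteq> 0" using False True by (auto simp: t_def complex_eq_iff)
      define a where "a j = Complex 1 (j * t)" for j :: real
      have sa: "s = a 1" using True by (simp add: a_def t_def complex_eq_iff)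
      have a0: "a 0 = 1" by (simp add: a_def complex_eq_iff)
      have ne: "a 1 \<noteq> 1" "a 2 \<noteq> 1" using t by (auto simp: a_def complex_eq_iff)
      have Rea: "Re (a j) = 1" for j by (simp add: a_def)
      obtain m1 where m1: "P (a 1) m1" using ex[of "a 1"] Rea by auto
      obtain m2 where m2: "P (a 2) m2" using ex[of "a 2"] Rea by auto
      obtain m0 where m0: "P 1 m0" using ex[of 1] by auto
      hence "m0 = 0" by (auto simp: P_def)
      let ?L = "\<lambda>e. 3 * (of_real e * mseries (a 0 + of_real e)) + 4 * (of_real e * mseries (a 1 + of_real e)) + of_real e * mseries (a 2 + of_real e)"
      have "((\<lambda>e. ?L e) \<longlongrightarrow> 3 * ((if a 0 = 1 then 1 else 0) - of_nat m0) + 4 * ((if a 1 = 1 then 1 else 0) - of_nat m1) + ((if a 2 = 1 then 1 else 0) - of_nat m2)) (at_right 0)"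
        using m0 m1 m2 by (intro tendsto_intros lim) (auto simp: Rea a0)
      hence "((\<lambda>e. ?L e) \<longlongrightarrow> 3 - 4 * of_nat m1 - of_nat m2) (at_right 0)"
        using ne a0 \<open>m0 = 0\<close> by simp
      hence "((\<lambda>e. Re (?L e)) \<longlongrightarrow> Re (3 - 4 * of_nat m1 - of_nat m2)) (at_right 0)"
        by (rule tendsto_Re)
      moreover have "\<forall>\<^sub>F e in at_right 0. 0 \<le> Re (?L e)"
        using pos
      proof eventually_elim
        case (elim e)
        have hs: "((\<lambda>n. mangoldt n * of_nat n powr (-(a j + of_real e))) has_sum mseries (a j + of_real e)) {1..}" for j
          using elim by (intro mseries_props(1)) (auto simp: Rea)
        have hr: "((\<lambda>n. mangoldt n * real n powr (-1 - e) * cos (j * t * ln (real n))) has_sum Re (mseries (a j + of_real e))) {1..}" for j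
        proof -
          have *: "Re (mangoldt n * of_nat n powr (-(a j + of_real e))) = mangoldt n * real n powr (-1 - e) * cos (j * t * ln (real n))" if "n \<ge> 1" for n
          proof -
            have "(of_nat n powr (-(a j + of_real e)) :: complex) = exp (-(a j + of_real e) * of_real (ln (real n)))"
              using that by (simp add: powr_def Ln_of_nat)
            also have "Re \<dots> = exp ((-1 - e) * ln (real n)) * cos (j * t * ln (real n))"
              by (simp add: Re_exp a_def minus_diff_commute)
            also have "exp ((-1 - e) * ln (real n)) = real n powr (-1 - e)"
              using that by (simp add: powr_def)
            finally have "Re (of_nat n powr (-(a j + of_real e))) = real n powr (-1 - e) * cos (j * t * ln (real n))" .
            moreover have "(mangoldt n :: complex) = of_real (mangoldt n)" by simp
            ultimately show ?thesis by (simp add: mangoldt_def)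
          qed
          from has_sum_Re[OF hs[of j]] show ?thesis
            by (rule has_sum_cong[THEN iffD1, rotated]) (intro *, simp)
        qed
        have "((\<lambda>n. 3 * (mangoldt n * real n powr (-1 - e) * cos (0 * t * ln (real n))) + 4 * (mangoldt n * real n powr (-1 - e) * cos (1 * t * ln (real n)))
            + mangoldt n * real n powr (-1 - e) * cos (2 * t * ln (real n))) has_sum
            (3 * Re (mseries (a 0 + of_real e)) + 4 * Re (mseries (a 1 + of_real e)) + Re (mseries (a 2 + of_real e)))) {1..}"
          by (intro has_sum_add has_sum_cmult_right hr)
        hence "0 \<le> 3 * Re (mseries (a 0 + of_real e)) + 4 * Re (mseries (a 1 + of_real e)) + Re (mseries (a 2 + of_real e))"
        proof (rule has_sum_nonneg)
          fix n :: nat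
          define \<theta> where "\<theta> = t * ln (real n)"
          have "3 * (mangoldt n * real n powr (-1 - e) * cos (0 * t * ln (real n))) + 4 * (mangoldt n * real n powr (-1 - e) * cos (1 * t * ln (real n)))
            + mangoldt n * real n powr (-1 - e) * cos (2 * t * ln (real n)) = mangoldt n * real n powr (-1 - e) * (3 + 4 * cos \<theta> + cos (2 * \<theta>))"
            by (simp add: \<theta>_def algebra_simps)
          also have "3 + 4 * cos \<theta> + cos (2 * \<theta>) = 2 * (1 + cos \<theta>)\<^sup>2"
            using cos_double_cos[of \<theta>] by (simp add: power2_eq_square algebra_simps)
          finally show "0 \<le> 3 * (mangoldt n * real n powr (-1 - e) * cos (0 * t * ln (real n))) + 4 * (mangoldt n * real n powr (-1 - e) * cos (1 * t * ln (real n)))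
            + mangoldt n * real n powr (-1 - e) * cos (2 * t * ln (real n))"
            by (simp add: mangoldt_nonneg)
        qed
        hence "0 \<le> e * (3 * Re (mseries (a 0 + of_real e)) + 4 * Re (mseries (a 1 + of_real e)) + Re (mseries (a 2 + of_real e)))"
          using elim by (intro mult_nonneg_nonneg) auto
        thus ?case by (simp add: algebra_simps)
      qed
      ultimately have "0 \<le> Re (3 - 4 * of_nat m1 - of_nat m2)"
        by (intro tendsto_lowerbound) auto
      hence "m1 = 0" by simp
      thus ?thesis using m1 sa by (simp add: P_def)
    qed simp
  qed
qed

section \<open>Chebyshev's function and its linear upper bound\<close>

definition cheb_psi :: "nat \<Rightarrow> real" where "cheb_psi n = (\<Sum>d=1..n. mangoldt d)"

text \<open>Passing from n to n + 1 raises n div d by one exactly for the divisors d of n + 1, and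
  the values of \<Lambda> at these add up to ln (n + 1).\<close>

lemma ln_fact_eq_sum_mangoldt: "ln (fact n) = (\<Sum>d=1..n. mangoldt d * real (n div d))"
proof (induction n)
  case (Suc n)
  have "(\<Sum>d=1..Suc n. mangoldt d * real (Suc n div d)) = (\<Sum>d=1..n. mangoldt d * real (Suc n div d)) + mangoldt (Suc n)"
    by simp
  also have "(\<Sum>d=1..n. mangoldt d * real (Suc n div d)) = (\<Sum>d=1..n. mangoldt d * real (n div d) + (if d dvd Suc n then mangoldt d else 0))"
    by (intro sum.cong) (auto simp: div_Suc algebra_simps dvd_eq_mod_eq_0)
  also have "\<dots> = ln (fact n) + (\<Sum>d=1..n. if d dvd Suc n then mangoldt d else 0)"
    by (simp add: sum.distrib Suc)
  also have "\<dots> + mangoldt (Suc n) = ln (fact n) + (\<Sum>d=1..Suc n. if d dvd Suc n then mangoldt d else 0)" by simp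
  also have "(\<Sum>d=1..Suc n. if d dvd Suc n then mangoldt d else (0::real)) = (\<Sum>d | d dvd Suc n. mangoldt d)"
    by (rule sum.mono_neutral_cong_right) (auto simp: Suc_le_eq dvd_imp_le intro!: Nat.gr0I dest: dvd_imp_le)
  also have "\<dots> = ln (real (Suc n))" by (subst mangoldt_sum) auto
  also have "ln (fact n) + ln (real (Suc n)) = ln (fact (Suc n))"
    by (simp add: ln_mult mult.commute)
  finally show ?case by simp
qed simp

text \<open>In the logarithm of the central binomial coefficient, \<Lambda>(d) has the coefficient
  2n div d - 2 (n div d), which is never negative and equals 1 for n < d \<le> 2n. The coefficient
  itself is at most 4^n.\<close>

lemma cheb_psi_double: "cheb_psi (2 * n) - cheb_psi n \<le> 2 * real n * ln 2"
proof -
  have "cheb_psi (2 * n) - cheb_psi n = (\<Sum>d\<in>{n<..2*n}. mangoldt d)"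
  proof -
    have "{1..2*n} = {1..n} \<union> {n<..2*n}" by auto
    thus ?thesis unfolding cheb_psi_def by (subst \<open>{1..2*n} = _\<close>, subst sum.union_disjoint) auto
  qed
  also have "\<dots> \<le> (\<Sum>d=1..2*n. mangoldt d * (real (2*n div d) - 2 * real (n div d)))"
  proof -
    have "(\<Sum>d\<in>{n<..2*n}. mangoldt d) = (\<Sum>d\<in>{n<..2*n}. mangoldt d * (real (2*n div d) - 2 * real (n div d)))"
    proof (rule sum.cong)
      fix d assume d: "d \<in> {n<..2*n}"
      hence "2 * n div d = 1" by (intro div_nat_eqI) auto
      thus "mangoldt d = mangoldt d * (real (2*n div d) - 2 * real (n div d))" using d by simp
    qed auto
    also have "\<dots> \<le> (\<Sum>d=1..2*n. mangoldt d * (real (2*n div d) - 2 * real (n div d)))"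
    proof (rule sum_mono2)
      fix d :: nat
      have "2 * (n div d) \<le> 2 * n div d"
        using div_times_less_eq_dividend[of n d] by (cases "d = 0") (auto simp: less_eq_div_iff_mult_less_eq)
      hence "2 * real (n div d) \<le> real (2 * n div d)" by linarith
      thus "0 \<le> mangoldt d * (real (2*n div d) - 2 * real (n div d))"
        by (intro mult_nonneg_nonneg mangoldt_nonneg) auto
    qed auto
    finally show ?thesis .
  qed
  also have "\<dots> = ln (fact (2*n)) - 2 * (\<Sum>d=1..2*n. mangoldt d * real (n div d))"
    unfolding ln_fact_eq_sum_mangoldt by (simp add: algebra_simps sum_subtractf sum_distrib_left)
  also have "(\<Sum>d=1..2*n. mangoldt d * real (n div d)) = ln (fact n)"
    unfolding ln_fact_eq_sum_mangoldt by (rule sum.mono_neutral_right) auto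
  also have "ln (fact (2*n)) - 2 * ln (fact n) = ln (real ((2*n) choose n))"
  proof -
    have "real ((2*n) choose n) = fact (2*n) / (fact n * fact n)"
      by (subst binomial_fact) (auto simp: mult_2)
    thus ?thesis by (simp add: ln_div ln_mult)
  qed
  also have "\<dots> \<le> ln (2 ^ (2*n))"
  proof -
    have "(2*n) choose n \<le> 2 ^ (2*n)" by (rule binomial_le_pow2)
    hence "real ((2*n) choose n) \<le> 2 ^ (2*n)" by (metis of_nat_le_iff of_nat_numeral of_nat_power)
    thus ?thesis by (subst ln_le_cancel_iff) (auto simp: zero_less_binomial_iff)
  qed
  also have "\<dots> = 2 * real n * ln 2" by (subst ln_realpow) auto
  finally show ?thesis .
qed

lemma cheb_psi_mono: "m \<le> n \<Longrightarrow> cheb_psi m \<le> cheb_psi n"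
  unfolding cheb_psi_def by (intro sum_mono2) (auto simp: mangoldt_nonneg)

lemma cheb_psi_nonneg: "cheb_psi n \<ge> 0"
  unfolding cheb_psi_def by (intro sum_nonneg mangoldt_nonneg)

lemma cheb_psi_le: "cheb_psi n \<le> 4 * real n"
proof (cases "n = 0")
  case False
  have pow: "cheb_psi (2 ^ k) \<le> 2 ^ Suc k * ln 2" for k
  proof (induction k)
    case (Suc k)
    have "cheb_psi (2 ^ Suc k) \<le> cheb_psi (2 ^ k) + 2 * 2 ^ k * ln 2"
      using cheb_psi_double[of "2^k"] by simp
    thus ?case using Suc by simp
  qed (simp add: cheb_psi_def)
  obtain k where k: "2 ^ k \<le> n" "n < 2 ^ Suc k" using ex_power_ivl1[of 2 n] False by auto
  have "cheb_psi n \<le> cheb_psi (2 ^ Suc k)" using k by (intro cheb_psi_mono) auto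
  also have "\<dots> \<le> 2 ^ Suc (Suc k) * ln 2" by (rule pow)
  also have "\<dots> \<le> 2 ^ Suc (Suc k) * 1" using ln2_le_25_over_36 by (intro mult_left_mono) auto
  also have "\<dots> = 4 * real (2 ^ k)" by simp
  also have "\<dots> \<le> 4 * real n" using k by linarith
  finally show ?thesis .
qed (simp add: cheb_psi_def)

text \<open>Partial summation: s \<psi>(n) n^(-s-1) equals \<psi>(n) \<open>pstep n s\<close> plus
  \<psi>(n) (n^(-s) - (n+1)^(-s)), and the second part sums to \<open>mseries s\<close>.\<close>

lemma cheb_psi_sums:
  assumes s: "Re s > 1"
  shows "(\<lambda>n. of_real (cheb_psi (Suc n)) * of_nat (Suc n) powr (-s - 1))
    sums (((\<Sum>n. of_real (cheb_psi (Suc n)) * pstep (Suc n) s) + mseries s) / s)"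
proof -
  have s0: "s \<noteq> 0" using s by auto
  have bnd: "norm (of_real (cheb_psi n) :: complex) \<le> 4 * real n powr 1" if "n \<ge> 1" for n
    using cheb_psi_le[of n] cheb_psi_nonneg[of n] that by simp
  have R: "(\<lambda>n. of_real (cheb_psi (Suc n)) * pstep (Suc n) s) sums (\<Sum>n. of_real (cheb_psi (Suc n)) * pstep (Suc n) s)"
    by (rule summable_sums[OF pstep_series(2)[OF bnd]]) (use s in auto)
  have "((\<lambda>n. mangoldt (Suc n) * of_nat (Suc n) powr (-s)) has_sum mseries s) UNIV"
  proof -
    have "bij_betw Suc UNIV {1..}" by (rule bij_betwI[of _ _ _ "\<lambda>n. n - 1"]) auto
    from has_sum_reindex_bij_betw[OF this, of "\<lambda>n. mangoldt n * of_nat n powr (-s)"] mseries_props(1)[OF s]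
    show ?thesis by blast
  qed
  hence m: "(\<lambda>n. mangoldt (Suc n) * of_nat (Suc n) powr (-s)) sums mseries s"
    by (rule has_sum_imp_sums)
  have abel: "(\<Sum>n<N. of_real (cheb_psi (Suc n)) * (of_nat (Suc n) powr (-s) - of_nat (Suc (Suc n)) powr (-s)))
     = (\<Sum>n<N. mangoldt (Suc n) * of_nat (Suc n) powr (-s)) - of_real (cheb_psi N) * of_nat (Suc N) powr (-s)" for N
  proof (induction N)
    case (Suc N)
    have "cheb_psi (Suc N) = cheb_psi N + mangoldt (Suc N)" by (simp add: cheb_psi_def)
    hence "(of_real (cheb_psi (Suc N)) :: complex) = of_real (cheb_psi N) + mangoldt (Suc N)"
      by (simp add: mangoldt_def)
    thus ?case unfolding sum.lessThan_Suc Suc.IH by (simp add: algebra_simps del: of_nat_Suc)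
  qed (simp add: cheb_psi_def)
  have lim0: "(\<lambda>N. of_real (cheb_psi N) * of_nat (Suc N) powr (-s) :: complex) \<longlonglongrightarrow> 0"
  proof (rule Lim_null_comparison)
    show "\<forall>\<^sub>F N in sequentially. norm (of_real (cheb_psi N) * of_nat (Suc N) powr (-s) :: complex) \<le> 4 * real (Suc N) powr (1 - Re s)"
    proof (rule always_eventually, rule allI)
      fix N
      have "norm (of_real (cheb_psi N) * of_nat (Suc N) powr (-s) :: complex) = cheb_psi N * real (Suc N) powr (-Re s)"
        by (simp add: norm_mult norm_of_nat_powr cheb_psi_nonneg del: of_nat_Suc)
      also have "\<dots> \<le> (4 * real (Suc N)) * real (Suc N) powr (-Re s)"
        using cheb_psi_le[of N] by (intro mult_right_mono) auto
      also have "\<dots> = 4 * real (Suc N) powr (1 - Re s)"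
        by (simp add: powr_diff powr_minus field_simps del: of_nat_Suc)
      finally show "norm (of_real (cheb_psi N) * of_nat (Suc N) powr (-s) :: complex) \<le> 4 * real (Suc N) powr (1 - Re s)" .
    qed
    have "(\<lambda>N. real (Suc N) powr (1 - Re s)) \<longlonglongrightarrow> 0"
      using s by (intro tendsto_neg_powr filterlim_compose[OF filterlim_real_sequentially filterlim_Suc]) auto
    from tendsto_mult[OF tendsto_const[of 4] this]
    show "(\<lambda>N. 4 * real (Suc N) powr (1 - Re s)) \<longlonglongrightarrow> 0" by simp
  qed
  have "(\<lambda>n. of_real (cheb_psi (Suc n)) * (of_nat (Suc n) powr (-s) - of_nat (Suc (Suc n)) powr (-s))) sums (mseries s - 0)"
    unfolding sums_def abel by (intro tendsto_diff m[unfolded sums_def] lim0)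
  from sums_add[OF R this]
  have "(\<lambda>n. s * (of_real (cheb_psi (Suc n)) * of_nat (Suc n) powr (-s - 1))) sums ((\<Sum>n. of_real (cheb_psi (Suc n)) * pstep (Suc n) s) + mseries s)"
    by (simp add: pstep_def algebra_simps del: of_nat_Suc)
  from sums_divide[OF this, of s] s0 show ?thesis by simp
qed

text \<open>Newman's theorem is applied to the bounded coefficients (\<psi>(n) - n) / n. Their
  Dirichlet series G continues to a neighbourhood of Re s \<ge> 1 because \<zeta> has no zeros there
  and the poles at 1 of -\<zeta>'/\<zeta> and of \<zeta> cancel.\<close>

lemma sum_cheb_psi_convergent:
  "convergent (\<lambda>N. \<Sum>n=1..N. (cheb_psi n - real n) / real n ^ 2)"
proof -
  define U where "U = {s. Re s > 0} \<inter> szeta -` (- {0})"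
  have oU0: "open {s. Re s > 0}" by (rule open_halfspace_Re_gt)
  have oU: "open U" unfolding U_def
    by (rule continuous_open_preimage[OF holomorphic_on_imp_continuous_on[OF szeta_holomorphic] oU0]) auto
  have U1: "s \<in> U" if "Re s \<ge> 1" for s using that szeta_nonzero[OF that] by (auto simp: U_def)
  define R where "R s = (\<Sum>n. of_real (cheb_psi (Suc n)) * pstep (Suc n) s)" for s
  have bnd: "norm (of_real (cheb_psi n) :: complex) \<le> 4 * real n powr 1" if "n \<ge> 1" for n
    using cheb_psi_le[of n] cheb_psi_nonneg[of n] that by simp
  have R: "R holomorphic_on {s. Re s > 0}"
    using pstep_series(1)[OF bnd] by (simp add: R_def[abs_def])
  \<comment> \<open>The two polar parts combine to (1 - s \<open>szeta s\<close>) / (s - 1). As Y 1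
    = 0, the singularity at 1 is removable, and q is its continuation.\<close>
  define Y where "Y s = 1 - s * szeta s" for s
  have Y: "Y holomorphic_on {s. Re s > 0}" unfolding Y_def by (intro holomorphic_intros szeta_holomorphic)
  define q where "q s = (if s = 1 then deriv Y 1 else (Y s - Y 1) / (s - 1))" for s
  have q: "q holomorphic_on {s. Re s > 0}" unfolding q_def by (rule pole_lemma_open[OF Y oU0])
  define G where "G s = (R s - deriv szeta s / szeta s + q s) / s" for s
  have G: "G holomorphic_on U"
    unfolding G_def
    by (intro holomorphic_intros holomorphic_on_subset[OF R] holomorphic_on_subset[OF q]
        holomorphic_on_subset[OF holomorphic_deriv[OF szeta_holomorphic oU0]] holomorphic_on_subset[OF szeta_holomorphic])
       (auto simp: U_def)
  define bb where "bb n = (cheb_psi n - real n) / real n" for n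
  have sumsG: "(\<lambda>n. of_real (bb (Suc n)) * of_nat (Suc n) powr (-s)) sums G s" if s: "Re s > 1" for s
  proof -
    have s01: "s \<noteq> 0" "s \<noteq> 1" "szeta s \<noteq> 0" using s szeta_nonzero[of s] by auto
    have "(\<lambda>n. of_real (cheb_psi (Suc n)) * of_nat (Suc n) powr (-s - 1) - of_nat (Suc n) powr (-s)) sums ((R s + mseries s) / s - szeta s / (s - 1))"
      unfolding R_def by (intro sums_diff cheb_psi_sums szeta_sums s)
    moreover have "of_real (cheb_psi (Suc n)) * of_nat (Suc n) powr (-s - 1) - of_nat (Suc n) powr (-s) = of_real (bb (Suc n)) * of_nat (Suc n) powr (-s)" for n
      by (simp add: bb_def powr_diff field_simps del: of_nat_Suc)
    moreover have "(R s + mseries s) / s - szeta s / (s - 1) = G s"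
    proof -
      have *: "(r + M) / s - Z / u = (r - D / Z + (1 - s * Z) / u) / s"
        if "M * Z = Z / u - D" "Z \<noteq> 0" "u \<noteq> 0" "s \<noteq> 0" for r M s Z u D :: complex
      proof -
        have "M = M * Z / Z" using that(2) by simp
        also have "\<dots> = 1 / u - D / Z" unfolding that(1) using that(2) by (simp add: diff_divide_distrib)
        finally have M: "M = 1 / u - D / Z" .
        show ?thesis unfolding M using that(2-4) by (simp add: field_simps)
      qed
      show ?thesis
        using *[OF mseries_props(3)[OF s] s01(3) _ s01(1), of "R s"] s01 by (simp add: G_def q_def Y_def)
    qed
    ultimately show ?thesis by simp
  qed
  \<comment> \<open>Subtracting G 1 from the first coefficient makes the series vanish at z = 0, as
    \<open>newman_tauberian\<close> requires; the constant is added back at the end.\<close>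
  define a :: "nat \<Rightarrow> complex" where "a n = of_real (bb n) - (if n = 1 then G 1 else 0)" for n
  define V where "V = (\<lambda>z. 1 - \<i> * z) -` U"
  define g where "g z = G (1 - \<i> * z)" for z
  have oV: "open V" unfolding V_def by (intro continuous_open_vimage oU) (auto intro!: continuous_intros)
  have g: "g holomorphic_on V"
  proof -
    have "(\<lambda>z. 1 - \<i> * z) holomorphic_on V" by (intro holomorphic_intros)
    from holomorphic_on_compose_gen[OF this G] show ?thesis
      by (auto simp: g_def[abs_def] V_def o_def)
  qed
  define H where "H z = (if z = 0 then deriv g 0 else (g z - g 0) / (z - 0))" for z
  have H: "H holomorphic_on V" unfolding H_def by (rule pole_lemma_open[OF g oV])
  have "(\<lambda>N. \<Sum>n=1..N. a n / of_nat n) \<longlonglongrightarrow> 0"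
  proof (rule newman_tauberian[OF _ oV _ H])
    show "norm (a n) \<le> 5 + norm (G 1)" for n
    proof -
      have "\<bar>bb n\<bar> \<le> 5"
      proof (cases "n = 0")
        case False
        have "\<bar>cheb_psi n - real n\<bar> \<le> 5 * real n"
          using cheb_psi_le[of n] cheb_psi_nonneg[of n] by linarith
        thus ?thesis using False by (simp add: bb_def field_simps)
      qed (simp add: bb_def)
      hence "norm (of_real (bb n) :: complex) \<le> 5" by simp
      moreover have "norm (if n = 1 then G 1 else 0) \<le> norm (G 1)" by simp
      moreover have "norm (a n) \<le> norm (of_real (bb n) :: complex) + norm (if n = 1 then G 1 else 0)"
        unfolding a_def by (rule norm_triangle_ineq4)
      ultimately show ?thesis by linarith
    qed
    show "{z. 0 \<le> Im z} \<subseteq> V" using U1 by (auto simp: V_def)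
    fix z assume z: "Im z > 0"
    have e: "-(1 - \<i> * z) = -1 + \<i> * z" by simp
    have "(\<lambda>n. of_real (bb (Suc n)) * of_nat (Suc n) powr (-1 + \<i> * z)) sums G (1 - \<i> * z)"
      using sumsG[of "1 - \<i> * z"] z unfolding e by simp
    moreover have "(\<lambda>n. (if Suc n = 1 then G 1 else 0) * of_nat (Suc n) powr (-1 + \<i> * z)) sums G 1"
    proof -
      have "(\<lambda>n. (if Suc n = 1 then G 1 else 0) * of_nat (Suc n) powr (-1 + \<i> * z)) =
          (\<lambda>n. if n = 0 then G 1 * of_nat (Suc n) powr (-1 + \<i> * z) else 0)" by auto
      thus ?thesis using sums_single[of 0 "\<lambda>n. G 1 * of_nat (Suc n) powr (-1 + \<i> * z)"] by simp
    qed
    ultimately have "(\<lambda>n. of_real (bb (Suc n)) * of_nat (Suc n) powr (-1 + \<i> * z) - (if Suc n = 1 then G 1 else 0) * of_nat (Suc n) powr (-1 + \<i> * z)) sums (G (1 - \<i> * z) - G 1)"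
      by (rule sums_diff)
    moreover have "G (1 - \<i> * z) - G 1 = z * H z"
      using z by (auto simp: H_def g_def)
    ultimately show "(\<lambda>n. a (Suc n) * of_nat (Suc n) powr (-1 + \<i> * z)) sums (z * H z)"
      by (simp add: a_def left_diff_distrib del: of_nat_Suc)
  qed
  hence "(\<lambda>N. Re (\<Sum>n=1..N. a n / of_nat n) + Re (G 1)) \<longlonglongrightarrow> Re 0 + Re (G 1)"
    by (intro tendsto_add tendsto_Re tendsto_const)
  moreover have "\<forall>\<^sub>F N in sequentially. Re (\<Sum>n=1..N. a n / of_nat n) + Re (G 1) = (\<Sum>n=1..N. (cheb_psi n - real n) / real n ^ 2)"
    using eventually_ge_at_top[of 1]
  proof eventually_elim
    case (elim N)
    have "(\<Sum>n=1..N. a n / of_nat n) = (\<Sum>n=1..N. of_real ((cheb_psi n - real n) / real n ^ 2) - (if n = 1 then G 1 else 0))"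
      by (intro sum.cong) (auto simp: a_def bb_def diff_divide_distrib power2_eq_square)
    also have "\<dots> = of_real (\<Sum>n=1..N. (cheb_psi n - real n) / real n ^ 2) - G 1"
      using elim by (simp add: sum_subtractf)
    finally show ?case by simp
  qed
  ultimately have "(\<lambda>N. \<Sum>n=1..N. (cheb_psi n - real n) / real n ^ 2) \<longlonglongrightarrow> Re 0 + Re (G 1)"
    by (rule Lim_transform_eventually)
  thus ?thesis by (auto simp: convergent_def)
qed

text \<open>\<psi> is monotone. If \<psi>(N) \<ge> (1 + e) N, then \<psi>(n) - n stays at least e N
  / 2 up to n = (1 + e/2) N, so a stretch of the convergent series has a sum bounded below, against
  Cauchy's criterion. A value \<psi>(N) \<le> (1 - e) N is excluded in the same way on the interval
  below N.\<close>

theorem cheb_psi_asymp: "(\<lambda>n. cheb_psi n / real n) \<longlonglongrightarrow> 1"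
proof (rule tendstoI)
  fix e0 :: real assume "e0 > 0"
  define e where "e = min (e0 / 2) (1/2)"
  have e: "0 < e" "e < 1" "e < e0" using \<open>e0 > 0\<close> by (auto simp: e_def)
  define S where "S N = (\<Sum>n=1..N. (cheb_psi n - real n) / real n ^ 2)" for N
  have "Cauchy S" using sum_cheb_psi_convergent unfolding S_def by (rule convergent_Cauchy)
  \<comment> \<open>The stretch has at least e N / 4 terms, each at least e / (8 N); the condition N
    \<ge> 4 / e pays for rounding its end point.\<close>
  then obtain N0 where N0: "\<And>m n. m \<ge> N0 \<Longrightarrow> n \<ge> N0 \<Longrightarrow> dist (S m) (S n) < e\<^sup>2 / 32"
    using e by (metis metric_CauchyD zero_less_divide_iff zero_less_numeral zero_less_power)
  have Sdiff: "S M - S N = (\<Sum>n\<in>{N<..M}. (cheb_psi n - real n) / real n ^ 2)" if "N \<le> M" for M N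
  proof -
    have "{1..M} = {1..N} \<union> {N<..M}" using that by auto
    thus ?thesis unfolding S_def by (subst \<open>{1..M} = _\<close>, subst sum.union_disjoint) auto
  qed
  have main: "\<bar>cheb_psi N - real N\<bar> < e * real N" if N: "N \<ge> 2 * N0 + 2" "real N \<ge> 4 / e" for N
  proof (rule ccontr)
    assume "\<not> \<bar>cheb_psi N - real N\<bar> < e * real N"
    then consider "cheb_psi N \<ge> (1 + e) * real N" | "cheb_psi N \<le> (1 - e) * real N"
      by (auto simp: algebra_simps abs_if split: if_splits)
    thus False
    proof cases
      case 1
      define M where "M = nat \<lfloor>(1 + e / 2) * real N\<rfloor>"
      have M: "real M \<le> (1 + e / 2) * real N" "real M > (1 + e / 2) * real N - 1"
        using e by (auto simp: M_def)
      have eN: "e * real N \<ge> 4" using N(2) e by (simp add: field_simps)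
      have "N \<le> M" using M eN by (simp add: algebra_simps)
      have "e\<^sup>2 / 32 \<le> (e * real N / 4) * (e / (8 * real N))" using N(1) by (simp add: field_simps power2_eq_square)
      also have "\<dots> \<le> real (card {N<..M}) * (e / (8 * real N))"
        using M eN e \<open>N \<le> M\<close> by (intro mult_right_mono) (auto simp: algebra_simps)
      also have "\<dots> \<le> S M - S N"
        unfolding Sdiff[OF \<open>N \<le> M\<close>]
      proof (rule sum_bounded_below)
        fix n assume n: "n \<in> {N<..M}"
        have n2: "real n \<le> (1 + e / 2) * real N" using n M by auto
        have "(1 + e) * real N \<le> cheb_psi n" using 1 cheb_psi_mono[of N n] n by auto
        hence "e / 2 * real N \<le> cheb_psi n - real n" using n2 by (simp add: algebra_simps)
        hence "e / 2 * real N / (2 * real N)^2 \<le> (cheb_psi n - real n) / real n ^ 2"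
        proof (rule frac_le[rotated 1])
          have "(1 + e / 2) * real N \<le> 2 * real N" using e by (intro mult_right_mono) auto
          thus "real n ^ 2 \<le> (2 * real N) ^ 2" using n2 by (intro power_mono) auto
          show "0 < real n ^ 2" using n by auto
          have "0 \<le> e / 2 * real N" using e by auto
          thus "0 \<le> cheb_psi n - real n" using \<open>e / 2 * real N \<le> cheb_psi n - real n\<close> by linarith
        qed
        thus "e / (8 * real N) \<le> (cheb_psi n - real n) / real n ^ 2"
          using N(1) by (simp add: power2_eq_square field_simps)
      qed
      also have "\<dots> \<le> dist (S M) (S N)" by (simp add: dist_real_def)
      also have "\<dots> < e\<^sup>2 / 32" using N \<open>N \<le> M\<close> by (intro N0) auto
      finally show False by simp
    next
      case 2
      define M where "M = nat \<lceil>(1 - e / 2) * real N\<rceil>"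
      have M: "real M \<ge> (1 - e / 2) * real N" "real M < (1 - e / 2) * real N + 1"
      proof -
        have "0 \<le> (1 - e / 2) * real N" using e by auto
        hence "real M = of_int \<lceil>(1 - e / 2) * real N\<rceil>" by (simp add: M_def)
        thus "real M \<ge> (1 - e / 2) * real N" "real M < (1 - e / 2) * real N + 1"
          using ceiling_correct[of "(1 - e / 2) * real N"] by linarith+
      qed
      have eN: "e * real N \<ge> 4" using N(2) e by (simp add: field_simps)
      have "M \<le> N" using M eN by (simp add: algebra_simps)
      have "(1/2) * real N \<le> (1 - e / 2) * real N" using e by (intro mult_right_mono) auto
      hence "M \<ge> N0" using M N by linarith
      have "e\<^sup>2 / 32 \<le> (e * real N / 4) * (e / (2 * real N))" using N(1) e by (simp add: field_simps power2_eq_square)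
      also have "\<dots> \<le> real (card {M<..N}) * (e / (2 * real N))"
        using M eN e \<open>M \<le> N\<close> by (intro mult_right_mono) (auto simp: algebra_simps of_nat_diff)
      also have "\<dots> \<le> (\<Sum>n\<in>{M<..N}. - ((cheb_psi n - real n) / real n ^ 2))"
      proof (rule sum_bounded_below)
        fix n assume n: "n \<in> {M<..N}"
        have n2: "real n \<ge> (1 - e / 2) * real N" using n M by auto
        have "cheb_psi n \<le> (1 - e) * real N" using 2 cheb_psi_mono[of n N] n by auto
        hence *: "e / 2 * real N \<le> real n - cheb_psi n" using n2 by (simp add: algebra_simps)
        have "e / 2 * real N / (real N)^2 \<le> (real n - cheb_psi n) / real n ^ 2"
        proof (rule frac_le)
          show "real n ^ 2 \<le> real N ^ 2" using n by (intro power_mono) auto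
          show "0 < real n ^ 2" using n by auto
          have "0 \<le> e / 2 * real N" using e by auto
          thus "0 \<le> real n - cheb_psi n" using * by linarith
        qed (rule *)
        moreover have "e / 2 * real N / (real N)^2 = e / (2 * real N)"
          using N(1) by (simp add: power2_eq_square field_simps)
        moreover have "- ((cheb_psi n - real n) / real n ^ 2) = (real n - cheb_psi n) / real n ^ 2"
          by (simp add: minus_divide_left)
        ultimately show "e / (2 * real N) \<le> - ((cheb_psi n - real n) / real n ^ 2)" by simp
      qed
      also have "\<dots> = S M - S N" using Sdiff[OF \<open>M \<le> N\<close>] by (simp add: sum_negf)
      also have "\<dots> \<le> dist (S M) (S N)" by (simp add: dist_real_def)
      also have "\<dots> < e\<^sup>2 / 32" using N \<open>M \<ge> N0\<close> by (intro N0) auto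
      finally show False by simp
    qed
  qed
  show "\<forall>\<^sub>F n in sequentially. dist (cheb_psi n / real n) 1 < e0"
    using eventually_ge_at_top[of "2 * N0 + 2"] eventually_ge_at_top[of "nat \<lceil>4 / e\<rceil>"]
  proof eventually_elim
    case (elim N)
    hence "\<bar>cheb_psi N - real N\<bar> < e * real N" by (intro main) linarith+
    moreover have "cheb_psi N / real N - 1 = (cheb_psi N - real N) / real N" using elim by (simp add: field_simps)
    ultimately have "dist (cheb_psi N / real N) 1 < e" using elim by (simp add: dist_real_def field_simps)
    thus ?case using e by simp
  qed
qed

section \<open>Mertens bounds\<close>

lemma finite_primes_le [simp]: "finite {p::nat. prime p \<and> real p \<le> x}"
  by (rule finite_subset[of _ "{..nat \<lfloor>x\<rfloor>}"]) (auto simp: le_nat_floor)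

text \<open>From n / d \<le> n div d + 1, the sum of n \<Lambda>(d) / d is at most ln n! +
  \<psi>(n); the 4 is the constant of \<open>cheb_psi_le\<close>.\<close>

lemma sum_ln_prime_le:
  assumes "x \<ge> 1"
  shows "(\<Sum>p | prime p \<and> real p \<le> x. ln (real p) / real p) \<le> ln x + 4"
proof -
  define n where "n = nat \<lfloor>x\<rfloor>"
  have n: "n \<ge> 1" "real n \<le> x" using assms by (auto simp: n_def le_nat_iff)
  have le_n: "p \<le> n \<longleftrightarrow> real p \<le> x" for p using assms unfolding n_def by (metis le_nat_floor of_nat_le_iff order_trans n(2) n_def)
  have "real n * (\<Sum>d=1..n. mangoldt d / real d) \<le> (\<Sum>d=1..n. mangoldt d * (real (n div d) + 1))"
    unfolding sum_distrib_left
  proof (rule sum_mono)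
    fix d assume d: "d \<in> {1..n}"
    have "n < d * (n div d + 1)" using d by (metis Suc_eq_plus1 dividend_less_times_div atLeastAtMost_iff less_le_trans mult_Suc_right less_one zero_less_one add.commute)
    hence "real n \<le> real d * (real (n div d) + 1)" by (metis less_imp_le of_nat_1 of_nat_add of_nat_le_iff of_nat_mult)
    hence "real n / real d \<le> real (n div d) + 1" using d by (simp add: field_simps)
    from mult_left_mono[OF this mangoldt_nonneg[of d]]
    show "real n * (mangoldt d / real d) \<le> mangoldt d * (real (n div d) + 1)" by (simp add: field_simps)
  qed
  also have "\<dots> = ln (fact n) + cheb_psi n"
    unfolding ln_fact_eq_sum_mangoldt cheb_psi_def by (simp add: algebra_simps sum.distrib)
  also have "\<dots> \<le> real n * ln (real n) + 4 * real n"
  proof -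
    have "fact n \<le> (real n ^ n)" using fact_le_power[of n] by simp
    hence "ln (fact n) \<le> ln (real n ^ n)" using n by (subst ln_le_cancel_iff) auto
    also have "\<dots> = real n * ln (real n)" using n by (simp add: ln_realpow)
    finally show ?thesis using cheb_psi_le[of n] by simp
  qed
  finally have "real n * (\<Sum>d=1..n. mangoldt d / real d) \<le> real n * (ln (real n) + 4)" by (simp add: algebra_simps)
  hence *: "(\<Sum>d=1..n. mangoldt d / real d) \<le> ln (real n) + 4" using n by simp
  have "(\<Sum>p | prime p \<and> real p \<le> x. ln (real p) / real p) = (\<Sum>p | prime p \<and> real p \<le> x. mangoldt p / real p)"
    by (intro sum.cong) auto
  also have "\<dots> \<le> (\<Sum>d=1..n. mangoldt d / real d)"
    by (intro sum_mono2) (auto simp: le_n mangoldt_nonneg Suc_le_eq prime_gt_0_nat)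
  also have "\<dots> \<le> ln x + 4" using * n by (smt (verit) ln_le_cancel_iff of_nat_1 of_nat_le_iff)
  finally show ?thesis .
qed

section \<open>Euler products over finite sets of primes\<close>

definition not_dvd_by :: "nat set \<Rightarrow> nat set" where
  "not_dvd_by P = {n. n \<ge> 1 \<and> (\<forall>p\<in>P. \<not> p dvd n)}"

lemma not_dvd_by_insert:
  assumes "prime p" "\<And>q. q \<in> P \<Longrightarrow> prime q" "p \<notin> P"
  shows "not_dvd_by P - not_dvd_by (insert p P) = (*) p ` not_dvd_by P" "not_dvd_by (insert p P) \<subseteq> not_dvd_by P"
proof -
  have "q dvd p * m \<longleftrightarrow> q dvd m" if "q \<in> P" for q m
    using assms that by (metis prime_dvd_mult_eq_nat primes_dvd_imp_eq)
  moreover have "p * m \<ge> 1 \<longleftrightarrow> m \<ge> 1" for m using prime_gt_0_nat[OF assms(1)] by (cases m) auto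
  ultimately have iff: "p * m \<in> not_dvd_by P \<longleftrightarrow> m \<in> not_dvd_by P" for m
    unfolding not_dvd_by_def by simp
  have "n \<in> not_dvd_by P - not_dvd_by (insert p P) \<longleftrightarrow> n \<in> not_dvd_by P \<and> p dvd n" for n
    by (auto simp: not_dvd_by_def)
  moreover have "n \<in> not_dvd_by P \<and> p dvd n \<longleftrightarrow> n \<in> (*) p ` not_dvd_by P" for n
    using iff by (auto elim!: dvdE)
  ultimately show "not_dvd_by P - not_dvd_by (insert p P) = (*) p ` not_dvd_by P" by blast
qed (auto simp: not_dvd_by_def)

text \<open>The sieve of Eratosthenes on a truncated series: multiplying by 1 - p^(-s) removes the
  multiples of p. Truncation only leads to an inequality in the required direction, since p m \<le>
  N implies m \<le> N.\<close>

lemma prod_primes_sum_le: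
  fixes s :: real
  assumes "finite P" "\<And>p. p \<in> P \<Longrightarrow> prime p" "s \<ge> 0"
  shows "(\<Prod>p\<in>P. 1 - real p powr (-s)) * (\<Sum>n=1..N. real n powr (-s)) \<le> (\<Sum>n\<in>not_dvd_by P \<inter> {..N}. real n powr (-s))"
  using assms(1,2)
proof (induction P)
  case empty
  have "not_dvd_by {} \<inter> {..N} = {1..N}" by (auto simp: not_dvd_by_def)
  thus ?case by simp
next
  case (insert p P)
  have p: "prime p" using insert by simp
  have p2: "p \<ge> 1" using prime_ge_1_nat[OF p] .
  let ?A = "\<lambda>P N. \<Sum>n\<in>not_dvd_by P \<inter> {..N}. real n powr (-s)"
  have pos: "?A P N \<ge> 0" by (intro sum_nonneg) auto
  note nd = not_dvd_by_insert[OF p _ insert(2)]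
  have "(not_dvd_by P \<inter> {..N}) - (not_dvd_by (insert p P) \<inter> {..N}) = ((*) p ` not_dvd_by P) \<inter> {..N}"
    using nd(1) insert.prems by blast
  also have "\<dots> \<subseteq> (*) p ` (not_dvd_by P \<inter> {..N})"
  proof safe
    fix m assume "m \<in> not_dvd_by P" "p * m \<le> N"
    moreover have "m \<le> p * m" using p2 by simp
    ultimately have "m \<in> not_dvd_by P" "m \<le> N" by linarith+
    thus "p * m \<in> (*) p ` (not_dvd_by P \<inter> {..N})" by (intro imageI) auto
  qed
  finally have sub: "(not_dvd_by P \<inter> {..N}) - (not_dvd_by (insert p P) \<inter> {..N}) \<subseteq> (*) p ` (not_dvd_by P \<inter> {..N})" .
  have "?A P N - ?A (insert p P) N = (\<Sum>n\<in>(not_dvd_by P \<inter> {..N}) - (not_dvd_by (insert p P) \<inter> {..N}). real n powr (-s))"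
    using nd(2) insert.prems by (subst sum_diff) auto
  also have "\<dots> \<le> (\<Sum>n\<in>(*) p ` (not_dvd_by P \<inter> {..N}). real n powr (-s))"
    by (intro sum_mono2 sub) auto
  also have "\<dots> = (\<Sum>n\<in>not_dvd_by P \<inter> {..N}. real (p * n) powr (-s))"
    using p2 by (subst sum.reindex) (auto simp: inj_on_def)
  also have "\<dots> = real p powr (-s) * ?A P N"
    by (simp add: powr_mult sum_distrib_left)
  finally have "(1 - real p powr (-s)) * ?A P N \<le> ?A (insert p P) N" by (simp add: algebra_simps)
  moreover have "1 - real p powr (-s) \<ge> 0" using p2 assms(3) powr_mono[of "-s" 0 "real p"] by simp
  hence "(1 - real p powr (-s)) * ((\<Prod>p\<in>P. 1 - real p powr (-s)) * (\<Sum>n=1..N. real n powr (-s))) \<le> (1 - real p powr (-s)) * ?A P N"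
    using insert.IH insert.prems by (intro mult_left_mono) auto
  ultimately show ?case using insert.hyps by (simp add: mult.assoc)
qed

definition rzeta :: "real \<Rightarrow> real" where "rzeta s = (\<Sum>n. real (Suc n) powr (-s))"

lemma rzeta_summable: "y > 0 \<Longrightarrow> summable (\<lambda>n. real (Suc n) powr (-(1 + y)))"
  by (subst summable_Suc_iff) (simp add: summable_real_powr_iff)

lemma rzeta_bounds:
  assumes y: "y > 0"
  shows "1 \<le> y * rzeta (1 + y)" "y * rzeta (1 + y) \<le> 1 + y"
proof -
  note sm = rzeta_summable[OF y]
  have "rzeta (1 + y) = 1 + (\<Sum>n. real (n + Suc 1) powr (-1 - y))"
    using suminf_split_head[OF sm] unfolding rzeta_def by (simp add: minus_diff_commute add.commute)
  also have "\<dots> \<le> 1 + 1 / y" using sum_powr_tail_le(2)[OF y, of 1] by simp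
  finally show "y * rzeta (1 + y) \<le> 1 + y" using y by (simp add: field_simps)
  define g where "g n = real (Suc n) powr (-y) / y" for n
  have *: "g n - g (Suc n) \<le> real (Suc n) powr (-(1 + y))" for n
  proof -
    have "\<exists>z. z > real (Suc n) \<and> z < real (Suc (Suc n)) \<and>
        real (Suc (Suc n)) powr (-y) - real (Suc n) powr (-y) = (real (Suc (Suc n)) - real (Suc n)) * (-y * z powr (-y - 1))"
      by (intro MVT2) (auto intro!: derivative_eq_intros)
    then obtain z where z: "z > real (Suc n)" "real (Suc n) powr (-y) - real (Suc (Suc n)) powr (-y) = y * z powr (-y - 1)"
      by auto
    have "g n - g (Suc n) = z powr (-y - 1)"
      using z(2) y unfolding g_def diff_divide_distrib[symmetric] by simp
    also have "\<dots> \<le> real (Suc n) powr (-y - 1)" using z y by (intro powr_mono2') auto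
    finally show ?thesis by (simp add: minus_diff_commute)
  qed
  have "g \<longlonglongrightarrow> 0 / y"
    unfolding g_def using y
    by (intro tendsto_divide tendsto_const tendsto_neg_powr filterlim_compose[OF filterlim_real_sequentially filterlim_Suc]) auto
  hence s: "(\<lambda>n. g n - g (Suc n)) sums (g 0 - 0)"
    by (intro telescope_sums') simp
  have "g 0 \<le> rzeta (1 + y)"
    unfolding rzeta_def using suminf_le[OF * sums_summable[OF s] sm] sums_unique[OF s] by simp
  thus "1 \<le> y * rzeta (1 + y)" using y by (simp add: g_def field_simps)
qed

lemma rzeta_pos: "y > 0 \<Longrightarrow> rzeta (1 + y) > 0"
  using rzeta_bounds(1)[of y] by (smt (verit) mult_nonneg_nonpos)

lemma euler_has_sum:
  assumes y: "y > 0" and P: "finite P" "\<And>p. p \<in> P \<Longrightarrow> prime p"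
  shows "((\<lambda>n. real n powr (-(1 + y))) has_sum (rzeta (1 + y) * (\<Prod>p\<in>P. 1 - real p powr (-(1 + y))))) (not_dvd_by P)"
  using P
proof (induction P)
  case empty
  have "((\<lambda>n. real (Suc n) powr (-(1 + y))) has_sum rzeta (1 + y)) UNIV"
    unfolding rzeta_def using rzeta_summable[OF y] by (intro norm_summable_imp_has_sum) (auto simp: summable_sums)
  moreover have "bij_betw Suc UNIV (not_dvd_by {})"
    by (rule bij_betwI[of _ _ _ "\<lambda>n. n - 1"]) (auto simp: not_dvd_by_def)
  ultimately show ?case using has_sum_reindex_bij_betw[of Suc UNIV "not_dvd_by {}" "\<lambda>n. real n powr (-(1 + y))"] by simp
next
  case (insert p P)
  let ?f = "\<lambda>n. real n powr (-(1 + y))"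
  let ?S = "rzeta (1 + y) * (\<Prod>p\<in>P. 1 - real p powr (-(1 + y)))"
  have p: "prime p" using insert by simp
  have IH: "(?f has_sum ?S) (not_dvd_by P)" using insert by simp
  have "inj_on ((*) p) (not_dvd_by P)" using prime_gt_0_nat[OF p] by (auto simp: inj_on_def)
  from has_sum_reindex[OF this, of ?f "real p powr (-(1+y)) * ?S"]
  have "(?f has_sum (real p powr (-(1+y)) * ?S)) ((*) p ` not_dvd_by P)"
    using has_sum_cmult_right[OF IH, of "real p powr (-(1+y))"] by (simp add: o_def powr_mult)
  from has_sum_Diff[OF IH this]
  have "(?f has_sum (?S - real p powr (-(1+y)) * ?S)) (not_dvd_by P - (*) p ` not_dvd_by P)"
    using not_dvd_by_insert[OF p _ insert(2)] insert.prems by blast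
  moreover have "not_dvd_by P - (*) p ` not_dvd_by P = not_dvd_by (insert p P)"
    using not_dvd_by_insert[OF p _ insert(2)] insert.prems by blast
  ultimately show ?case using insert by (simp add: algebra_simps)
qed

text \<open>By \<open>euler_has_sum\<close> the product is the sum over all n free of primes of P.
  The term n = 1 gives the lower bound; if P contains all primes up to N, every other such n exceeds
  N, and the tail of the series gives the upper bound.\<close>

lemma euler_bounds:
  assumes y: "y > 0" and P: "finite P" "\<And>p. p \<in> P \<Longrightarrow> prime p"
  shows "1 \<le> rzeta (1 + y) * (\<Prod>p\<in>P. 1 - real p powr (-(1 + y)))"
    and "N \<ge> 1 \<Longrightarrow> {p. prime p \<and> p \<le> N} \<subseteq> P \<Longrightarrow> rzeta (1 + y) * (\<Prod>p\<in>P. 1 - real p powr (-(1 + y))) \<le> 1 + real N powr (-y) / y"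
proof -
  let ?f = "\<lambda>n. real n powr (-(1 + y))"
  have 1: "((\<lambda>n. real n powr (-(1 + y))) has_sum 1) {1::nat}"
    using has_sum_finite[of "{1::nat}" ?f] by simp
  have "1 \<notin> P" using P(2) not_prime_1 by blast
  hence sub: "{1} \<subseteq> not_dvd_by P" by (auto simp: not_dvd_by_def)
  show "1 \<le> rzeta (1 + y) * (\<Prod>p\<in>P. 1 - real p powr (-(1 + y)))"
    using sub by (intro has_sum_mono_neutral[OF 1 euler_has_sum[OF y P]]) auto
  show "rzeta (1 + y) * (\<Prod>p\<in>P. 1 - real p powr (-(1 + y))) \<le> 1 + real N powr (-y) / y"
    if N: "N \<ge> 1" "{p. prime p \<and> p \<le> N} \<subseteq> P"
  proof -
    have "not_dvd_by P \<subseteq> insert 1 {Suc N..}"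
    proof
      fix n assume n: "n \<in> not_dvd_by P"
      show "n \<in> insert 1 {Suc N..}"
      proof (cases "n = 1")
        case False
        then obtain p where "prime p" "p dvd n" using prime_factor_nat by blast
        moreover from this have "p \<le> n" using n by (auto simp: not_dvd_by_def dvd_imp_le)
        ultimately show ?thesis using n N by (auto simp: not_dvd_by_def not_less_eq_eq[symmetric])
      qed auto
    qed
    moreover have "(?f has_sum (1 + (\<Sum>n. real (n + Suc N) powr (-1 - y)))) (insert 1 {Suc N..})"
    proof -
      have "((\<lambda>n. real (n + Suc N) powr (-1 - y)) has_sum (\<Sum>n. real (n + Suc N) powr (-1 - y))) UNIV"
        using sum_powr_tail_le(1)[OF y N(1)] by (intro norm_summable_imp_has_sum) (auto simp: summable_sums simp del: of_nat_Suc of_nat_add)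
      moreover have "bij_betw (\<lambda>n. n + Suc N) UNIV {Suc N..}"
        by (rule bij_betwI[of _ _ _ "\<lambda>n. n - Suc N"]) auto
      ultimately have "(?f has_sum (\<Sum>n. real (n + Suc N) powr (-1 - y))) {Suc N..}"
        using has_sum_reindex_bij_betw[of "\<lambda>n. n + Suc N" UNIV "{Suc N..}" ?f] by (simp add: minus_diff_commute del: of_nat_Suc of_nat_add)
      from has_sum_insert[of 1 "{Suc N..}", OF _ this] N(1) show ?thesis by simp
    qed
    ultimately have "rzeta (1 + y) * (\<Prod>p\<in>P. 1 - real p powr (-(1 + y))) \<le> 1 + (\<Sum>n. real (n + Suc N) powr (-1 - y))"
      by (intro has_sum_mono_neutral[OF euler_has_sum[OF y P]]) auto
    thus ?thesis using sum_powr_tail_le(2)[OF y N(1)] by simp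
  qed
qed

section \<open>Bounds of Mertens type for products over primes\<close>

lemma one_minus_prime_powr:
  assumes "prime p" "s \<ge> 1"
  shows "1 - real p powr (-s) \<ge> 1/2" "1 - real p powr (-s) < 1"
proof -
  have "real p \<ge> 2" using prime_ge_2_nat[OF assms(1)] by simp
  have "real p powr (-s) \<le> real p powr (-1)" using assms \<open>real p \<ge> 2\<close> by (intro powr_mono) auto
  also have "\<dots> \<le> 1/2" using \<open>real p \<ge> 2\<close> by (simp add: powr_minus field_simps)
  finally show "1 - real p powr (-s) \<ge> 1/2" by simp
  show "1 - real p powr (-s) < 1" using \<open>real p \<ge> 2\<close> by simp
qed

lemma sum_inverse_ge_ln: "(\<Sum>n=1..N. real n powr (-1)) \<ge> ln (real N + 1)"
proof -
  have "(\<Sum>n=1..N. real n powr (-1)) = harm N"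
    unfolding harm_def by (intro sum.cong) (auto simp: powr_minus inverse_eq_divide)
  thus ?thesis using ln_le_harm[of N] by simp
qed

lemma mertens_upper:
  assumes "x \<ge> 1"
  shows "(\<Prod>p | prime p \<and> real p \<le> x. 1 - 1 / real p) * ln x \<le> 1"
proof -
  define N where "N = nat \<lfloor>x\<rfloor>"
  have N: "x < real N + 1" "\<And>p. p \<le> N \<longleftrightarrow> real p \<le> x"
    using assms by (auto simp: N_def le_nat_iff le_floor_iff)
  let ?P = "{p. prime p \<and> real p \<le> x}"
  have pr: "(\<Prod>p\<in>?P. 1 - 1 / real p) = (\<Prod>p\<in>?P. 1 - real p powr (-1))"
    by (intro prod.cong) (auto simp: powr_minus field_simps)
  have "1 - real p powr (-1) \<ge> 0" if "p \<in> ?P" for p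
    using one_minus_prime_powr(1)[of p 1] that by simp
  hence pos: "(\<Prod>p\<in>?P. 1 - real p powr (-1)) \<ge> 0" by (intro prod_nonneg) auto
  have "ln x \<le> (\<Sum>n=1..N. real n powr (-1))"
    using sum_inverse_ge_ln[of N] N(1) assms by (smt (verit) ln_le_cancel_iff)
  hence "(\<Prod>p\<in>?P. 1 - 1 / real p) * ln x \<le> (\<Prod>p\<in>?P. 1 - real p powr (-1)) * (\<Sum>n=1..N. real n powr (-1))"
    unfolding pr using pos by (intro mult_left_mono)
  also have "\<dots> \<le> (\<Sum>n\<in>not_dvd_by ?P \<inter> {..N}. real n powr (-1))"
    by (rule prod_primes_sum_le) auto
  also have "not_dvd_by ?P \<inter> {..N} \<subseteq> {1}"
  proof
    fix n assume n: "n \<in> not_dvd_by ?P \<inter> {..N}"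
    show "n \<in> {1}"
    proof (rule ccontr)
      assume "n \<notin> {1}"
      then obtain p where p: "prime p" "p dvd n" using prime_factor_nat[of n] by auto
      moreover from this have "p \<le> n" using n by (auto simp: not_dvd_by_def dvd_imp_le)
      ultimately show False using n N(2) by (auto simp: not_dvd_by_def)
    qed
  qed
  hence "(\<Sum>n\<in>not_dvd_by ?P \<inter> {..N}. real n powr (-1)) \<le> (\<Sum>n\<in>{1::nat}. real n powr (-1))"
    by (intro sum_mono2) auto
  finally show ?thesis by simp
qed

text \<open>The price for moving the exponent from 1 + y to 1: the factor changes by at most y ln p
  / p in absolute terms, and the 2 appears because 1 - 1/p \<ge> 1/2 converts this into a relative
  change.\<close>

lemma one_minus_prime_powr_shift:
  assumes p: "prime p" and y: "y > 0"
  shows "(1 - real p powr (-(1+y))) * exp (-2 * y * (ln (real p) / real p)) \<le> 1 - 1 / real p"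
proof -
  have p: "real p \<ge> 2" using prime_ge_2_nat[OF p] by simp
  have "1 - real p powr (-y) \<le> y * ln (real p)"
    using exp_ge_add_one_self[of "-y * ln (real p)"] p by (simp add: powr_def)
  moreover have "real p powr (-(1+y)) = real p powr (-y) / real p"
    using powr_diff[of "real p" "-y" 1] p by (simp add: minus_diff_commute)
  ultimately have "1 - real p powr (-(1+y)) \<le> (1 - 1 / real p) + y * ln (real p) / real p"
    using p divide_right_mono[of "1 - real p powr (-y)" "y * ln (real p)" "real p"] by (simp add: diff_divide_distrib)
  also have "\<dots> \<le> (1 - 1 / real p) + (1 - 1 / real p) * (2 * y * (ln (real p) / real p))"
  proof -
    have "1/2 \<le> 1 - 1 / real p" using p by (simp add: field_simps)
    hence "1/2 * (2 * y * (ln (real p) / real p)) \<le> (1 - 1 / real p) * (2 * y * (ln (real p) / real p))"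
      using y p by (intro mult_right_mono) auto
    thus ?thesis by simp
  qed
  also have "\<dots> = (1 - 1 / real p) * (1 + 2 * y * (ln (real p) / real p))" by (simp add: algebra_simps)
  also have "\<dots> \<le> (1 - 1 / real p) * exp (2 * y * (ln (real p) / real p))"
    using p by (intro mult_left_mono exp_ge_add_one_self) auto
  finally show ?thesis by (simp add: exp_minus field_simps)
qed

text \<open>The exponent is shifted to 1 + y with y = 1 / ln x. There the product is at least 1 /
  \<zeta>(1 + y) \<ge> 1 / (2 ln x), and the shift costs exp(-2 y (ln x + 4)) by
  \<open>sum_ln_prime_le\<close>, which is at least exp(-10) because ln x \<ge> 1.\<close>

lemma mertens_lower:
  assumes "x \<ge> 3"
  shows "(\<Prod>p | prime p \<and> real p \<le> x. 1 - 1 / real p) \<ge> exp (-10) / (2 * ln x)"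
proof -
  let ?P = "{p. prime p \<and> real p \<le> x}"
  have lx: "ln x \<ge> 1" using assms exp_le by (simp add: ln_ge_iff)
  define y where "y = 1 / ln x"
  have y: "y > 0" using lx by (simp add: y_def)
  have *: "(1 - real p powr (-(1+y))) * exp (-2 * y * (ln (real p) / real p)) \<le> 1 - 1 / real p" if "p \<in> ?P" for p
    using one_minus_prime_powr_shift[of p y] that y by simp
  have fpos: "1 - real p powr (-(1+y)) > 0" if "p \<in> ?P" for p
    using one_minus_prime_powr[of p "1+y"] y that by simp
  have pos: "(\<Prod>p\<in>?P. 1 - real p powr (-(1+y))) \<ge> 0"
    using fpos by (intro prod_nonneg) (auto intro: less_imp_le)
  have a: "exp (-10) / (2 * ln x) \<le> (1 / (1 + ln x)) * exp (-2 * y * (ln x + 4))"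
  proof -
    have "2 * y * (ln x + 4) \<le> 10" using lx by (simp add: y_def field_simps)
    hence "exp (-10) \<le> exp (-2 * y * (ln x + 4))" by simp
    moreover have "1 / (2 * ln x) \<le> 1 / (1 + ln x)" using lx by (intro divide_left_mono) auto
    ultimately show ?thesis using mult_mono[of "1 / (2 * ln x)" "1 / (1 + ln x)" "exp (-10)" "exp (-2 * y * (ln x + 4))"] lx by simp
  qed
  have b: "1 / (1 + ln x) \<le> (\<Prod>p\<in>?P. 1 - real p powr (-(1+y)))"
  proof -
    have "rzeta (1 + y) \<le> 1 + ln x" using rzeta_bounds(2)[OF y] lx by (simp add: y_def field_simps)
    hence "rzeta (1 + y) * (\<Prod>p\<in>?P. 1 - real p powr (-(1+y))) \<le> (1 + ln x) * (\<Prod>p\<in>?P. 1 - real p powr (-(1+y)))"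
      using pos by (intro mult_right_mono)
    moreover have "1 \<le> rzeta (1 + y) * (\<Prod>p\<in>?P. 1 - real p powr (-(1+y)))"
      by (rule euler_bounds(1)[OF y]) auto
    ultimately have "1 \<le> (1 + ln x) * (\<Prod>p\<in>?P. 1 - real p powr (-(1+y)))" by linarith
    thus ?thesis using lx by (simp add: field_simps)
  qed
  have "exp (-2 * y * (ln x + 4)) \<le> exp (-2 * y * (\<Sum>p\<in>?P. ln (real p) / real p))"
    using sum_ln_prime_le[of x] assms y by simp
  also have "\<dots> = (\<Prod>p\<in>?P. exp (-2 * y * (ln (real p) / real p)))"
    by (simp add: exp_sum[symmetric] sum_distrib_left)
  finally have "(1 / (1 + ln x)) * exp (-2 * y * (ln x + 4)) \<le> (\<Prod>p\<in>?P. 1 - real p powr (-(1+y))) * (\<Prod>p\<in>?P. exp (-2 * y * (ln (real p) / real p)))"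
    using b pos by (intro mult_mono) auto
  also have "(\<Prod>p\<in>?P. 1 - real p powr (-(1+y))) * (\<Prod>p\<in>?P. exp (-2 * y * (ln (real p) / real p))) = (\<Prod>p\<in>?P. (1 - real p powr (-(1+y))) * exp (-2 * y * (ln (real p) / real p)))"
    by (simp add: prod.distrib)
  also have "\<dots> \<le> (\<Prod>p\<in>?P. 1 - 1 / real p)"
    using * fpos by (intro prod_mono conjI mult_nonneg_nonneg) (auto intro: less_imp_le)
  finally show ?thesis using a by linarith
qed

text \<open>Adding the primes below z turns the product into at most \<zeta>(1 + 1/L) \<le> 2 L
  times the product of 1 - p^(-1-1/L) over those primes. The latter is at most exp 1 / ln z, since
  n^(-1/L) \<ge> exp(-1) for n \<le> z \<le> exp L reduces the comparison sum to the harmonic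
  one.\<close>

lemma prod_large_primes_le:
  assumes L: "L \<ge> 1" and z: "1 < z" "ln z \<le> L"
    and P: "finite P" "\<And>p. p \<in> P \<Longrightarrow> prime p \<and> real p \<ge> z"
  shows "(\<Prod>p\<in>P. 1 / (1 - real p powr (-(1 + 1 / L)))) \<le> 2 * exp 1 * L / ln z"
proof -
  define y where "y = 1 / L"
  have y: "y > 0" using L by (simp add: y_def)
  \<comment> \<open>The largest integer strictly below z, so that the primes up to N are disjoint
    from P even if z is itself a prime.\<close>
  define N where "N = nat (\<lceil>z\<rceil> - 1)"
  have Nz: "real N < z" "z \<le> real N + 1" using z(1) by (auto simp: N_def of_nat_nat ceiling_less_iff) linarith+
  define Q where "Q = {p. prime p \<and> p \<le> N}"
  have Q: "finite Q" "\<And>p. p \<in> Q \<Longrightarrow> prime p" by (auto simp: Q_def)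
  have disj: "P \<inter> Q = {}" using P(2) Nz(1) by (fastforce simp: Q_def)
  let ?f = "\<lambda>p. 1 - real p powr (-(1 + y))"
  have fpos: "?f p > 0" if "prime p" for p using one_minus_prime_powr[OF that, of "1 + y"] y by simp
  have PP: "(\<Prod>p\<in>P. ?f p) > 0" and QQ: "(\<Prod>p\<in>Q. ?f p) > 0" using P Q fpos by (auto intro!: prod_pos)
  have "1 \<le> rzeta (1 + y) * (\<Prod>p\<in>P\<union>Q. ?f p)"
    using P Q by (intro euler_bounds(1)[OF y]) auto
  also have "(\<Prod>p\<in>P\<union>Q. ?f p) = (\<Prod>p\<in>P. ?f p) * (\<Prod>p\<in>Q. ?f p)"
    using P Q disj by (intro prod.union_disjoint) auto
  finally have 1: "(\<Prod>p\<in>P. 1 / ?f p) \<le> rzeta (1 + y) * (\<Prod>p\<in>Q. ?f p)"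
    using PP by (simp add: prod_dividef field_simps)
  have "(\<Prod>p\<in>Q. ?f p) * (\<Sum>n=1..N. real n powr (-(1+y))) \<le> (\<Sum>n\<in>not_dvd_by Q \<inter> {..N}. real n powr (-(1+y)))"
    using y by (intro prod_primes_sum_le Q) auto
  also have "not_dvd_by Q \<inter> {..N} \<subseteq> {1}"
  proof
    fix n assume n: "n \<in> not_dvd_by Q \<inter> {..N}"
    show "n \<in> {1}"
    proof (rule ccontr)
      assume "n \<notin> {1}"
      then obtain p where p: "prime p" "p dvd n" using prime_factor_nat[of n] by auto
      moreover from this have "p \<le> n" using n by (auto simp: not_dvd_by_def dvd_imp_le)
      ultimately show False using n by (auto simp: not_dvd_by_def Q_def)
    qed
  qed
  hence "(\<Sum>n\<in>not_dvd_by Q \<inter> {..N}. real n powr (-(1+y))) \<le> (\<Sum>n\<in>{1::nat}. real n powr (-(1+y)))"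
    by (intro sum_mono2) auto
  finally have 2: "(\<Prod>p\<in>Q. ?f p) * (\<Sum>n=1..N. real n powr (-(1+y))) \<le> 1" by simp
  have "exp (-1) * ln z \<le> exp (-1) * (\<Sum>n=1..N. real n powr (-1))"
    using sum_inverse_ge_ln[of N] Nz z(1) by (intro mult_left_mono) (smt (verit) ln_le_cancel_iff, simp)
  also have "\<dots> \<le> (\<Sum>n=1..N. real n powr (-(1+y)))"
    unfolding sum_distrib_left
  proof (rule sum_mono)
    fix n assume n: "n \<in> {1..N}"
    have "real n \<le> z" using n Nz(1) by auto
    hence "ln (real n) \<le> L" using n z by (smt (verit) atLeastAtMost_iff ln_le_cancel_iff of_nat_1 of_nat_le_iff)
    hence "- 1 \<le> - y * ln (real n)" using L by (simp add: y_def field_simps)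
    hence "exp (-1) \<le> real n powr (-y)" using n by (simp add: powr_def)
    hence "exp (-1) * real n powr (-1) \<le> real n powr (-y) * real n powr (-1)" by (intro mult_right_mono) auto
    also have "\<dots> = real n powr (-(1+y))" by (subst powr_add[symmetric]) (simp add: minus_diff_commute)
    finally show "exp (-1) * real n powr (-1) \<le> real n powr (-(1+y))" .
  qed
  finally have 3: "exp (-1) * ln z \<le> (\<Sum>n=1..N. real n powr (-(1+y)))" .
  have lz: "ln z > 0" using z by simp
  have "(\<Prod>p\<in>Q. ?f p) * (exp (-1) * ln z) \<le> 1"
    using mult_left_mono[OF 3 less_imp_le[OF QQ]] 2 by linarith
  hence 4: "(\<Prod>p\<in>Q. ?f p) \<le> exp 1 / ln z" using lz by (simp add: exp_minus field_simps)
  have "rzeta (1 + y) \<le> 2 * L"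
  proof -
    have "rzeta (1 + y) \<le> 1 + L" using rzeta_bounds(2)[OF y] L by (simp add: y_def field_simps)
    thus ?thesis using L by simp
  qed
  hence "rzeta (1 + y) * (\<Prod>p\<in>Q. ?f p) \<le> 2 * L * (exp 1 / ln z)"
    using 4 QQ L by (intro mult_mono) auto
  with 1 show ?thesis by (simp add: y_def field_simps)
qed

lemma sum_inverse_square_le:
  assumes "w \<ge> 1" "finite P" "\<And>p. p \<in> P \<Longrightarrow> real p > w"
  shows "(\<Sum>p\<in>P. 1 / real p ^ 2) \<le> 2 / w"
proof -
  define N where "N = nat \<lfloor>w\<rfloor>"
  have N: "N \<ge> 1" "real N \<le> w" "w < real N + 1" using assms(1) by (auto simp: N_def le_nat_iff)
  define M where "M = Max (insert 0 P)"
  have sub: "P \<subseteq> {Suc N..M}"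
  proof
    fix p assume p: "p \<in> P"
    have "real N < real p" using assms(3)[OF p] N by linarith
    moreover have "p \<le> M" unfolding M_def using p assms(2) by (intro Max_ge) auto
    ultimately show "p \<in> {Suc N..M}" by simp
  qed
  have "(\<Sum>p\<in>P. 1 / real p ^ 2) \<le> (\<Sum>p\<in>{Suc N..M}. 1 / real p ^ 2)"
    by (intro sum_mono2 sub) auto
  also have "\<dots> = (\<Sum>n<Suc M - Suc N. 1 / real (n + Suc N) ^ 2)"
    by (rule sum.reindex_bij_witness[of _ "\<lambda>n. n + Suc N" "\<lambda>n. n - Suc N"]) auto
  also have "\<dots> = (\<Sum>n<Suc M - Suc N. real (n + Suc N) powr (-1 - 1))"
    by (intro sum.cong refl) (simp add: powr_minus powr_numeral field_simps del: of_nat_add of_nat_Suc)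
  also have "\<dots> \<le> (\<Sum>n. real (n + Suc N) powr (-1 - 1))"
    using sum_powr_tail_le(1)[of 1 N] N by (intro sum_le_suminf) auto
  also have "\<dots> \<le> real N powr (-1) / 1" using N by (intro sum_powr_tail_le(2)) auto
  also have "\<dots> \<le> 2 / w"
  proof -
    have "real N \<ge> 1" using N(1) by simp
    hence "w \<le> 2 * real N" using N by linarith
    from divide_left_mono[OF this, of 2] have "2 / (2 * real N) \<le> 2 / w" using \<open>real N \<ge> 1\<close> assms(1) by simp
    thus ?thesis by (simp add: powr_minus inverse_eq_divide)
  qed
  finally show ?thesis .
qed

section \<open>Moebius sums over random sets of primes\<close>

text \<open>For A the set of prime factors of n and L = ln x this is \<lambda>_H(n) at t = 0. The
  shift t is carried along because splitting off a prime p from A moves the argument by ln p /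
  L.\<close>

definition lam_set :: "real \<Rightarrow> (real \<Rightarrow> real) \<Rightarrow> nat set \<Rightarrow> real \<Rightarrow> real" where
  "lam_set L H A t = (\<Sum>S\<in>Pow A. (-1) ^ card S * H (t + (\<Sum>p\<in>S. ln (real p) / L)))"

lemma sum_Pow_insert:
  fixes f :: "'a set \<Rightarrow> 'b::comm_monoid_add"
  assumes "finite A" "p \<notin> A"
  shows "sum f (Pow (insert p A)) = sum f (Pow A) + (\<Sum>S\<in>Pow A. f (insert p S))"
proof -
  have "inj_on (insert p) (Pow A)" using assms(2) by (auto simp: inj_on_def)
  moreover have "Pow A \<inter> insert p ` Pow A = {}" using assms(2) by auto
  ultimately show ?thesis
    unfolding Pow_insert using assms(1) by (subst sum.union_disjoint) (auto simp: sum.reindex)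
qed

lemma lam_set_empty [simp]: "lam_set L H {} t = H t"
  by (simp add: lam_set_def)

lemma lam_set_insert:
  assumes "finite A" "p \<notin> A"
  shows "lam_set L H (insert p A) t = lam_set L H A t - lam_set L H A (t + ln (real p) / L)"
proof -
  have "(\<Sum>S\<in>Pow A. (-1) ^ card (insert p S) * H (t + (\<Sum>p\<in>insert p S. ln (real p) / L)))
     = (\<Sum>S\<in>Pow A. - ((-1) ^ card S * H (t + ln (real p) / L + (\<Sum>p\<in>S. ln (real p) / L))))"
    using assms by (intro sum.cong refl) (auto simp: finite_subset subset_iff add.assoc card_insert_if)
  thus ?thesis unfolding lam_set_def sum_Pow_insert[OF assms] by (simp add: sum_negf)
qed

lemma lam_set_diff_shift:
  "lam_set L (\<lambda>s. H s - H (s + u)) A t = lam_set L H A t - lam_set L H A (t + u)"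
  by (simp add: lam_set_def sum_subtractf algebra_simps)

text \<open>The norm sup exp(t) |H^(i)(t)| over i \<le> j, with the derivatives given as a witness
  D, which fits one-sided derivatives at 0. The weight exp(t) makes products over primes far beyond
  x converge, and it is finite for the exponentials exp(-a t) with a \<ge> 1.\<close>

definition dchain :: "nat \<Rightarrow> real \<Rightarrow> (real \<Rightarrow> real) \<Rightarrow> (nat \<Rightarrow> real \<Rightarrow> real) \<Rightarrow> bool" where
  "dchain j \<nu> H D \<longleftrightarrow> (\<forall>t\<ge>0. D 0 t = H t) \<and>
     (\<forall>i<j. \<forall>t\<ge>0. (D i has_real_derivative D (Suc i) t) (at t within {0..})) \<and>
     (\<forall>i\<le>j. \<forall>t\<ge>0. \<bar>D i t\<bar> \<le> \<nu> * exp (-t))"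

definition dbound :: "nat \<Rightarrow> real \<Rightarrow> (real \<Rightarrow> real) \<Rightarrow> bool" where
  "dbound j \<nu> H \<longleftrightarrow> (\<exists>D. dchain j \<nu> H D)"

lemma dchain_mono: "dchain j \<nu> H D \<Longrightarrow> i \<le> j \<Longrightarrow> dchain i \<nu> H D"
  by (simp add: dchain_def)

lemma dbound_mono: "dbound j \<nu> H \<Longrightarrow> i \<le> j \<Longrightarrow> dbound i \<nu> H"
  unfolding dbound_def using dchain_mono by blast

lemma dbound_abs_le:
  assumes "dbound j \<nu> H" "t \<ge> 0"
  shows "\<bar>H t\<bar> \<le> \<nu> * exp (-t)"
proof -
  obtain D where D: "dchain j \<nu> H D" using assms(1) by (auto simp: dbound_def)
  hence "D 0 t = H t" "\<bar>D 0 t\<bar> \<le> \<nu> * exp (-t)" using assms(2) le0[of j] unfolding dchain_def by blast+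
  thus ?thesis by simp
qed

lemma dbound_shift:
  assumes "dbound (Suc j) \<nu> H" "u \<ge> 0"
  shows "dbound j (u * \<nu>) (\<lambda>s. H s - H (s + u))"
proof -
  obtain D where D': "dchain (Suc j) \<nu> H D" using assms(1) by (auto simp: dbound_def)
  have D1: "D 0 t = H t" if "t \<ge> 0" for t using D' that by (simp add: dchain_def)
  have D2: "(D i has_real_derivative D (Suc i) t) (at t within {0..})" if "i < Suc j" "t \<ge> 0" for i t
    using D' that by (simp add: dchain_def)
  have D3: "\<bar>D i t\<bar> \<le> \<nu> * exp (-t)" if "i \<le> Suc j" "t \<ge> 0" for i t
    using D' that by (simp add: dchain_def)
  have \<nu>: "\<nu> \<ge> 0" using D3[of 0 0] by simp
  have "dchain j (u * \<nu>) (\<lambda>s. H s - H (s + u)) (\<lambda>i t. D i t - D i (t + u))"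
    unfolding dchain_def
  proof (intro conjI allI impI)
    fix i t assume "i < j" and t: "(0::real) \<le> t"
    have sub: "(\<lambda>t. t + u) ` {0..} \<subseteq> {0..}" using assms(2) by auto
    have "((\<lambda>t. D i (t + u)) has_real_derivative D (Suc i) (t + u) * 1) (at t within {0..})"
    proof (rule DERIV_image_chain[where f = "D i" and g = "\<lambda>t. t + u", unfolded o_def])
      have "(D i has_real_derivative D (Suc i) (t + u)) (at (t + u) within {0..})"
        using D2[of i "t + u"] \<open>i < j\<close> t assms(2) by simp
      thus "(D i has_real_derivative D (Suc i) (t + u)) (at (t + u) within (\<lambda>t. t + u) ` {0..})"
        by (rule DERIV_subset[OF _ sub])
    qed (auto intro!: derivative_eq_intros)
    thus "((\<lambda>t. D i t - D i (t + u)) has_real_derivative D (Suc i) t - D (Suc i) (t + u)) (at t within {0..})"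
      using D2[of i t] \<open>i < j\<close> t by (intro DERIV_diff) auto
  next
    fix i t assume i: "i \<le> j" and t: "(0::real) \<le> t"
    have "norm (D i t - D i (t + u)) \<le> (\<nu> * exp (-t)) * norm (t - (t + u))"
    proof (rule field_differentiable_bound[where S = "{t..t+u}"])
      fix z assume z: "z \<in> {t..t+u}"
      have "(D i has_real_derivative D (Suc i) z) (at z within {0..})"
        using D2[of i z] i z t by simp
      thus "(D i has_real_derivative D (Suc i) z) (at z within {t..t+u})"
        by (rule DERIV_subset) (use t in auto)
      have "\<bar>D (Suc i) z\<bar> \<le> \<nu> * exp (-z)" using D3[of "Suc i" z] i z t by simp
      also have "\<dots> \<le> \<nu> * exp (-t)" using z \<nu> by (intro mult_left_mono) auto
      finally show "norm (D (Suc i) z) \<le> \<nu> * exp (-t)" by simp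
    qed (use assms(2) in auto)
    thus "\<bar>D i t - D i (t + u)\<bar> \<le> u * \<nu> * exp (-t)" using assms(2) by (simp add: mult_ac)
  qed (use D1 assms(2) in auto)
  thus ?thesis unfolding dbound_def by blast
qed

text \<open>Removing the least prime \<open>p\<close> of \<open>A\<close> from \<open>lam_set L F A t\<close> replaces \<open>F\<close> by
  \<open>F t - F (t + ln p / L)\<close>, which costs one derivative and gains the factor \<open>ln p / L\<close>.\<close>

primrec gbound :: "real \<Rightarrow> nat \<Rightarrow> nat set \<Rightarrow> real" where
  "gbound L 0 = (\<lambda>A. \<Prod>p\<in>A. 1 + exp (- ln (real p) / L))"
| "gbound L (Suc j) = (\<lambda>A. if A = {} then 1 else if ln (real (Min A)) / L \<le> 1
      then ln (real (Min A)) / L * gbound L j (A - {Min A})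
      else (\<Prod>p\<in>A. 1 + exp (- ln (real p) / L)))"

lemma gbound_insert_min:
  assumes "finite A" "\<And>q. q \<in> A \<Longrightarrow> p < q"
  shows "gbound L (Suc j) (insert p A) = (if ln (real p) / L \<le> 1 then ln (real p) / L * gbound L j A else gbound L 0 (insert p A))"
proof -
  have "Min (insert p A) = p" using assms by (intro Min_eqI) (auto intro: less_imp_le)
  moreover have "p \<notin> A" using assms by auto
  ultimately show ?thesis by simp
qed

lemma lam_set_le_gbound0:
  assumes "finite A" "dbound 0 \<nu> H" "t \<ge> 0" "\<And>p. p \<in> A \<Longrightarrow> ln (real p) / L \<ge> 0"
  shows "\<bar>lam_set L H A t\<bar> \<le> \<nu> * exp (-t) * gbound L 0 A"
  using assms(1,3,4)
proof (induction A arbitrary: t)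
  case empty
  then show ?case using dbound_abs_le[OF assms(2)] by simp
next
  case (insert p A)
  have "\<bar>lam_set L H (insert p A) t\<bar> \<le> \<bar>lam_set L H A t\<bar> + \<bar>lam_set L H A (t + ln (real p) / L)\<bar>"
    using insert by (simp add: lam_set_insert)
  also have "\<dots> \<le> \<nu> * exp (-t) * gbound L 0 A + \<nu> * exp (-(t + ln (real p) / L)) * gbound L 0 A"
    using insert.prems by (intro add_mono insert.IH) auto
  also have "exp (-(t + ln (real p) / L)) = exp (-t) * exp (- ln (real p) / L)"
    by (simp add: exp_add[symmetric])
  also have "\<nu> * exp (-t) * gbound L 0 A + \<nu> * (exp (-t) * exp (- ln (real p) / L)) * gbound L 0 A = \<nu> * exp (-t) * gbound L 0 (insert p A)"
    using insert by (simp add: algebra_simps)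
  finally show ?case .
qed

lemma lam_set_le_gbound:
  assumes "finite A" "dbound j \<nu> H" "t \<ge> 0" "\<And>p. p \<in> A \<Longrightarrow> ln (real p) / L \<ge> 0"
  shows "\<bar>lam_set L H A t\<bar> \<le> \<nu> * exp (-t) * gbound L j A"
  using assms
proof (induction j arbitrary: A \<nu> H)
  case 0
  thus ?case using lam_set_le_gbound0 by blast
next
  case (Suc j)
  show ?case
  proof (cases "A = {}")
    case True
    thus ?thesis using dbound_abs_le[OF Suc.prems(2,3)] by simp
  next
    case False
    define p where "p = Min A"
    have p: "p \<in> A" "ln (real p) / L \<ge> 0" using False Suc.prems by (auto simp: p_def)
    show ?thesis
    proof (cases "ln (real p) / L \<le> 1")
      case True
      have A: "insert p (A - {p}) = A" using p by auto
      have "lam_set L H A t = lam_set L (\<lambda>s. H s - H (s + ln (real p) / L)) (A - {p}) t"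
        using lam_set_insert[of "A - {p}" p L H t] Suc.prems(1) unfolding lam_set_diff_shift A by simp
      also have "\<bar>\<dots>\<bar> \<le> (ln (real p) / L * \<nu>) * exp (-t) * gbound L j (A - {p})"
        using Suc.prems p by (intro Suc.IH dbound_shift) auto
      also have "\<dots> = \<nu> * exp (-t) * gbound L (Suc j) A"
        using True False by (simp add: p_def)
      finally show ?thesis .
    next
      case f: False
      have "\<bar>lam_set L H A t\<bar> \<le> \<nu> * exp (-t) * gbound L 0 A"
        using Suc.prems dbound_mono[OF Suc.prems(2), of 0] by (intro lam_set_le_gbound0) auto
      thus ?thesis using f False by (simp add: p_def)
    qed
  qed
qed

section \<open>Random subsets containing each prime p independently with probability r p\<close>

definition rsub_wt :: "(nat \<Rightarrow> real) \<Rightarrow> nat set \<Rightarrow> nat set \<Rightarrow> real" where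
  "rsub_wt r P A = (\<Prod>p\<in>P. if p \<in> A then r p else 1 - r p)"

definition rsub_ex :: "(nat \<Rightarrow> real) \<Rightarrow> nat set \<Rightarrow> (nat set \<Rightarrow> real) \<Rightarrow> real" where
  "rsub_ex r P f = (\<Sum>A\<in>Pow P. rsub_wt r P A * f A)"

lemma rsub_ex_empty [simp]: "rsub_ex r {} f = f {}"
  by (simp add: rsub_ex_def rsub_wt_def)

lemma rsub_ex_insert:
  assumes "finite P" "p \<notin> P"
  shows "rsub_ex r (insert p P) f = (1 - r p) * rsub_ex r P f + r p * rsub_ex r P (\<lambda>A. f (insert p A))"
proof -
  have 1: "rsub_wt r (insert p P) A = (1 - r p) * rsub_wt r P A" if "A \<subseteq> P" for A
    using assms that by (auto simp: rsub_wt_def)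
  have 2: "rsub_wt r (insert p P) (insert p A) = r p * rsub_wt r P A" for A
  proof -
    have "(\<Prod>q\<in>P. if q \<in> insert p A then r q else 1 - r q) = (\<Prod>q\<in>P. if q \<in> A then r q else 1 - r q)"
      using assms(2) by (intro prod.cong) auto
    thus ?thesis using assms by (simp add: rsub_wt_def)
  qed
  have "(\<Sum>A\<in>Pow P. rsub_wt r (insert p P) A * f A) = (\<Sum>A\<in>Pow P. (1 - r p) * (rsub_wt r P A * f A))"
    by (intro sum.cong) (auto simp: 1)
  thus ?thesis unfolding rsub_ex_def sum_Pow_insert[OF assms]
    by (simp add: 2 sum_distrib_left mult.assoc)
qed

lemma rsub_ex_cong: "(\<And>A. A \<subseteq> P \<Longrightarrow> f A = g A) \<Longrightarrow> rsub_ex r P f = rsub_ex r P g"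
  unfolding rsub_ex_def by (intro sum.cong) auto

lemma rsub_ex_cmult: "rsub_ex r P (\<lambda>A. c * f A) = c * rsub_ex r P f"
  by (simp add: rsub_ex_def sum_distrib_left mult_ac)

lemma rsub_ex_prod:
  assumes "finite P"
  shows "rsub_ex r P (\<lambda>A. \<Prod>p\<in>A. f p) = (\<Prod>p\<in>P. 1 - r p + r p * f p)"
  using assms
proof (induction P)
  case (insert p P)
  have "rsub_ex r P (\<lambda>A. \<Prod>q\<in>insert p A. f q) = rsub_ex r P (\<lambda>A. f p * (\<Prod>q\<in>A. f q))"
    using insert by (intro rsub_ex_cong) (metis finite_subset prod.insert subsetD)
  thus ?case using insert by (simp add: rsub_ex_insert rsub_ex_cmult algebra_simps)
qed simp

text \<open>A second moment, because each shift carries two weights, F and G, evaluated at the same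
  random set of primes.\<close>

definition gmoment :: "real \<Rightarrow> (nat \<Rightarrow> real) \<Rightarrow> nat \<Rightarrow> nat set \<Rightarrow> real" where
  "gmoment L r j P = rsub_ex r P (\<lambda>A. (gbound L j A)\<^sup>2)"

lemma gmoment_empty: "gmoment L r j {} = 1"
  by (cases j) (simp_all add: gmoment_def)

lemma gmoment_0:
  assumes "finite P"
  shows "gmoment L r 0 P = (\<Prod>p\<in>P. 1 - r p + r p * (1 + exp (- ln (real p) / L))\<^sup>2)"
  unfolding gmoment_def using rsub_ex_prod[OF assms] by (simp add: prod_power_distrib)

lemma gmoment_insert_min:
  assumes P: "finite P" "\<And>q. q \<in> P \<Longrightarrow> p < q" and u: "ln (real p) / L \<le> 1"
  shows "gmoment L r (Suc j) (insert p P) = (1 - r p) * gmoment L r (Suc j) P + r p * (ln (real p) / L)\<^sup>2 * gmoment L r j P"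
proof -
  have "p \<notin> P" using P(2) by auto
  moreover have "rsub_ex r P (\<lambda>A. (gbound L (Suc j) (insert p A))\<^sup>2) = rsub_ex r P (\<lambda>A. (ln (real p) / L)\<^sup>2 * (gbound L j A)\<^sup>2)"
  proof (rule rsub_ex_cong)
    fix A assume A: "A \<subseteq> P"
    show "(gbound L (Suc j) (insert p A))\<^sup>2 = (ln (real p) / L)\<^sup>2 * (gbound L j A)\<^sup>2"
      using A P u by (subst gbound_insert_min) (auto simp: finite_subset power_mult_distrib power_divide)
  qed
  ultimately show ?thesis
    unfolding gmoment_def using P(1) by (subst rsub_ex_insert) (auto simp: rsub_ex_cmult)
qed

lemma gmoment_large:
  assumes "finite P" "\<And>p. p \<in> P \<Longrightarrow> ln (real p) / L > 1"
  shows "gmoment L r j P = gmoment L r 0 P"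
  unfolding gmoment_def
proof (rule rsub_ex_cong)
  fix A assume "A \<subseteq> P"
  show "(gbound L j A)\<^sup>2 = (gbound L 0 A)\<^sup>2"
  proof (cases j)
    case (Suc i)
    show ?thesis
    proof (cases "A = {}")
      case False
      have "Min A \<in> P" using \<open>A \<subseteq> P\<close> False assms(1) by (meson Min_in finite_subset subsetD)
      thus ?thesis using assms(2) False Suc by (auto simp: not_le[symmetric])
    qed (simp add: Suc)
  qed simp
qed

lemma ln_div_pos_nonzero: "0 < ln (real p) / L \<Longrightarrow> 0 < p"
  by (cases "p = 0") auto

text \<open>Write u for ln p / L. Conditioning on whether the least prime p belongs to the set gives
  M_{j+1}(p, P) = (1 - r) M_{j+1}(P) + r u^2 M_j(P). The trivial bound u^(-3) for j = 0 improves to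
  u^(-1) for j = 1 and to a constant for j = 2. For j = 3 the new term r u^2 is even small: one
  factor u is bounded by the product of the 1 - r q, which is the true order of magnitude, and the
  remaining r u is summable. This is why three derivatives suffice.\<close>

lemma gmoment_3_le:
  fixes P0 :: "nat set"
  assumes fin: "finite P0" and r: "\<And>p. p \<in> P0 \<Longrightarrow> 0 \<le> r p \<and> r p \<le> 1"
    and u0: "\<And>p. p \<in> P0 \<Longrightarrow> ln (real p) / L > 0" and C: "C \<ge> 1" and c: "c > 0"
    and g0: "\<And>P v. P \<subseteq> P0 \<Longrightarrow> 0 < v \<Longrightarrow> v \<le> 1 \<Longrightarrow> (\<And>p. p \<in> P \<Longrightarrow> v \<le> ln (real p) / L) \<Longrightarrow> gmoment L r 0 P \<le> C / v ^ 3"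
    and M: "\<And>P p. P \<subseteq> P0 \<Longrightarrow> p \<in> P \<Longrightarrow> ln (real p) / L \<le> 1 \<Longrightarrow> (\<And>q. q \<in> P \<Longrightarrow> p \<le> q) \<Longrightarrow>
        c * (ln (real p) / L) \<le> (\<Prod>q | q \<in> P \<and> ln (real q) / L \<le> 1. 1 - r q)"
  shows "gmoment L r 3 P0 \<le> C * (\<Prod>q | q \<in> P0 \<and> ln (real q) / L \<le> 1. 1 - r q) *
     (1 + (\<Sum>q | q \<in> P0 \<and> ln (real q) / L \<le> 1. r q * (ln (real q) / L)) / c)"
proof -
  define u where "u p = ln (real p) / L" for p :: nat
  note u0 = u0[folded u_def] and g0 = g0[folded u_def] and M = M[folded u_def]
  have large: "gmoment L r j P \<le> C" if "P \<subseteq> P0" "\<And>p. p \<in> P \<Longrightarrow> u p > 1" for P j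
    using gmoment_large[of P L r j] that g0[of P 1] fin by (auto simp: u_def finite_subset less_imp_le)
  have ins: "gmoment L r (Suc j) (insert p P) = (1 - r p) * gmoment L r (Suc j) P + r p * (u p)\<^sup>2 * gmoment L r j P"
    if "finite P" "\<forall>q\<in>P. p < q" "u p \<le> 1" for p P j
    using gmoment_insert_min[of P p L r j] that by (auto simp: u_def)
  have larger: "u q > 1" if "\<not> u p \<le> 1" "\<forall>q\<in>P. p < q" "insert p P \<subseteq> P0" "q \<in> insert p P" for p q P
  proof -
    have "p \<in> P0" "q \<in> P0" "p \<le> q" using that by auto
    have "p \<noteq> 0" using u0[OF \<open>p \<in> P0\<close>] by (auto simp: u_def intro: ln_div_pos_nonzero)
    hence "ln (real p) \<le> ln (real q)" using \<open>p \<le> q\<close> by (subst ln_le_cancel_iff) auto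
    moreover have "ln (real p) \<ge> 0" using \<open>p \<noteq> 0\<close> by simp
    hence "L > 0" using u0[OF \<open>p \<in> P0\<close>] by (simp add: u_def zero_less_divide_iff)
    ultimately have "u p \<le> u q" by (simp add: u_def divide_right_mono)
    thus ?thesis using that by auto
  qed
  \<comment> \<open>The gain u^2 against the loss u^(-3) leaves C / u \<le> C / v. This enters with
    probability r p and the induction hypothesis with probability 1 - r p, so the bound C / v is
    preserved as a convex combination.\<close>
  have g1: "gmoment L r 1 P \<le> C / v" if "finite P" "P \<subseteq> P0" "0 < v" "v \<le> 1" "\<And>p. p \<in> P \<Longrightarrow> v \<le> u p" for P v
    using that(1,2,5)
  proof (induction P rule: finite_linorder_min_induct)
    case empty
    thus ?case using C that(3,4) by (simp add: gmoment_empty)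
  next
    case (insert p P)
    show ?case
    proof (cases "u p \<le> 1")
      case True
      have up: "u p > 0" "u p \<ge> v" using insert.prems u0 by auto
      have rp: "0 \<le> r p" "r p \<le> 1" using r insert.prems by auto
      have uq: "u p \<le> u q" if "q \<in> P" for q
      proof -
        have "u p > 0" "p \<noteq> 0" using up by (auto simp: u_def dest: ln_div_pos_nonzero)
        have "ln (real p) \<ge> 0" using \<open>p \<noteq> 0\<close> by simp
        hence "L > 0" using up by (simp add: u_def zero_less_divide_iff)
        moreover have "ln (real p) \<le> ln (real q)" using \<open>p \<noteq> 0\<close> insert.hyps that by (subst ln_le_cancel_iff) auto
        ultimately show ?thesis by (simp add: u_def divide_right_mono)
      qed
      have "gmoment L r (Suc 0) (insert p P) = (1 - r p) * gmoment L r (Suc 0) P + r p * (u p)\<^sup>2 * gmoment L r 0 P"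
        using insert True by (intro ins) auto
      also have "\<dots> \<le> (1 - r p) * (C / v) + r p * (u p)\<^sup>2 * (C / u p ^ 3)"
        using insert rp up True uq by (intro add_mono mult_left_mono g0) auto
      also have "r p * (u p)\<^sup>2 * (C / u p ^ 3) = r p * (C / u p)"
        using up by (simp add: power2_eq_square power3_eq_cube)
      also have "\<dots> \<le> r p * (C / v)" using up rp C that(3) by (intro mult_left_mono divide_left_mono) auto
      finally show ?thesis by (simp add: algebra_simps)
    next
      case False
      have "gmoment L r 1 (insert p P) \<le> C" using insert False by (intro large larger[OF False]) auto
      also have "\<dots> \<le> C / v" using C that(3,4) by (simp add: field_simps)
      finally show ?thesis .
    qed
  qed
  have uq: "u p \<le> u q" if "p \<in> P0" "q \<in> P0" "p \<le> q" for p q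
  proof -
    have "u p > 0" "p \<noteq> 0" using u0[OF that(1)] by (auto simp: u_def dest: ln_div_pos_nonzero)
    have "ln (real p) \<ge> 0" using \<open>p \<noteq> 0\<close> by simp
    hence "L > 0" using \<open>u p > 0\<close> by (simp add: u_def zero_less_divide_iff)
    moreover have "ln (real p) \<le> ln (real q)" using \<open>p \<noteq> 0\<close> that by (subst ln_le_cancel_iff) auto
    ultimately show ?thesis by (simp add: u_def divide_right_mono)
  qed
  \<comment> \<open>Now u^2 C / u = C u \<le> C, so even the constant C is preserved.\<close>
  have g2: "gmoment L r 2 P \<le> C" if "finite P" "P \<subseteq> P0" for P
    using that
  proof (induction P rule: finite_linorder_min_induct)
    case empty
    thus ?case using C by (simp add: gmoment_empty)
  next
    case (insert p P)
    show ?case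
    proof (cases "u p \<le> 1")
      case True
      have up: "u p > 0" using insert.prems u0 by auto
      have rp: "0 \<le> r p" "r p \<le> 1" using r insert.prems by auto
      have "gmoment L r (Suc 1) (insert p P) = (1 - r p) * gmoment L r (Suc 1) P + r p * (u p)\<^sup>2 * gmoment L r 1 P"
        using insert True by (intro ins) auto
      also have "\<dots> \<le> (1 - r p) * C + r p * (u p)\<^sup>2 * (C / u p)"
        using insert rp up True uq[of p] by (intro add_mono mult_left_mono g1) (auto simp: numeral_2_eq_2 intro: less_imp_le)
      also have "r p * (u p)\<^sup>2 * (C / u p) = r p * C * u p"
        using up by (simp add: power2_eq_square)
      also have "\<dots> \<le> r p * C" using True rp C by (intro mult_left_le) auto
      finally show ?thesis by (simp add: algebra_simps numeral_2_eq_2)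
    next
      case False
      thus ?thesis using insert by (intro large larger[OF False]) auto
    qed
  qed
  define Ms where "Ms P = (\<Prod>q | q \<in> P \<and> u q \<le> 1. 1 - r q)" for P
  define Ss where "Ss P = (\<Sum>q | q \<in> P \<and> u q \<le> 1. r q * u q)" for P
  \<comment> \<open>Here the bound itself shrinks by the factor 1 - r p with each new prime. The
    hypothesis M bounds the additional term by r u / c times the same product, and these relative
    errors accumulate in the sum \<open>Ss\<close>.\<close>
  have "gmoment L r 3 P \<le> C * Ms P * (1 + Ss P / c)" if "finite P" "P \<subseteq> P0" for P
    using that
  proof (induction P rule: finite_linorder_min_induct)
    case empty
    thus ?case using C by (simp add: gmoment_empty Ms_def Ss_def)
  next
    case (insert p P)
    show ?case
    proof (cases "u p \<le> 1")
      case True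
      have up: "u p > 0" using insert.prems u0 by auto
      have rp: "0 \<le> r p" "r p \<le> 1" using r insert.prems by auto
      have pP: "p \<notin> P" using insert.hyps by auto
      have set: "{q. q \<in> insert p P \<and> u q \<le> 1} = insert p {q. q \<in> P \<and> u q \<le> 1}" using True by auto
      have Ms: "Ms (insert p P) = (1 - r p) * Ms P" and Ss: "Ss (insert p P) = r p * u p + Ss P"
        unfolding Ms_def Ss_def set using insert.hyps pP by auto
      have "c * u p \<le> Ms (insert p P)"
        unfolding Ms_def using insert True by (intro M) (auto intro: less_imp_le)
      hence *: "u p \<le> Ms (insert p P) / c" using c by (simp add: field_simps)
      have "gmoment L r (Suc 2) (insert p P) = (1 - r p) * gmoment L r (Suc 2) P + r p * (u p)\<^sup>2 * gmoment L r 2 P"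
        using insert True by (intro ins) auto
      also have "\<dots> \<le> (1 - r p) * (C * Ms P * (1 + Ss P / c)) + r p * (u p)\<^sup>2 * C"
        using insert rp up True by (intro add_mono mult_left_mono g2) (auto simp: numeral_3_eq_3 numeral_2_eq_2)
      also have "r p * (u p)\<^sup>2 * C = r p * u p * C * u p" by (simp add: power2_eq_square)
      also have "\<dots> \<le> r p * u p * C * (Ms (insert p P) / c)"
        using rp up C by (intro mult_left_mono *) auto
      also have "(1 - r p) * (C * Ms P * (1 + Ss P / c)) + r p * u p * C * (Ms (insert p P) / c) = C * Ms (insert p P) * (1 + Ss (insert p P) / c)"
        unfolding Ms Ss using c by (simp add: field_simps)
      finally show ?thesis by (simp add: numeral_3_eq_3 numeral_2_eq_2)
    next
      case False
      have "q \<notin> {q. q \<in> insert p P \<and> u q \<le> 1}" for q using larger[OF False insert.hyps(2) insert.prems] by force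
      hence e: "{q. q \<in> insert p P \<and> u q \<le> 1} = {}" by blast
      have "gmoment L r 3 (insert p P) \<le> C" using insert False by (intro large larger[OF False]) auto
      thus ?thesis unfolding Ms_def Ss_def e by simp
    qed
  qed
  from this[OF fin order_refl] show ?thesis by (simp add: Ms_def Ss_def u_def)
qed

section \<open>The random model\<close>

text \<open>\<open>Z p = i\<close> stands for the event that \<open>p\<close> divides \<open>n + h i\<close>, and \<open>Z p = 0\<close> for the event that it
  divides no shift (so \<open>0\<close> must not be an index); \<open>1 / (p - 1)\<close> is the density of the former among the \<open>n\<close> with
  \<open>n + h i\<^sub>0\<close> coprime to \<open>p\<close>.\<close>

definition xwt :: "nat set \<Rightarrow> nat \<Rightarrow> nat \<Rightarrow> real" where
  "xwt I p z = (if z \<in> I then 1 / (real p - 1) else 1 - real (card I) / (real p - 1))"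

definition xex :: "nat set \<Rightarrow> nat set \<Rightarrow> ((nat \<Rightarrow> nat) \<Rightarrow> real) \<Rightarrow> real" where
  "xex I P f = (\<Sum>Z\<in>PiE P (\<lambda>_. insert 0 I). (\<Prod>p\<in>P. xwt I p (Z p)) * f Z)"

definition fibre :: "nat set \<Rightarrow> (nat \<Rightarrow> nat) \<Rightarrow> nat \<Rightarrow> nat set" where
  "fibre P Z i = {p \<in> P. Z p = i}"

lemma fibre_subset: "fibre P Z i \<subseteq> P" by (auto simp: fibre_def)

lemma xex_prod:
  assumes "finite I" "finite P"
  shows "xex I P (\<lambda>Z. \<Prod>p\<in>P. g p (Z p)) = (\<Prod>p\<in>P. \<Sum>z\<in>insert 0 I. xwt I p z * g p z)"
  unfolding xex_def using assms by (subst prod_sum_PiE) (auto simp: prod.distrib)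

lemma xex_add: "xex I P (\<lambda>Z. f Z + g Z) = xex I P f + xex I P g"
  by (simp add: xex_def sum.distrib algebra_simps)

lemma xex_cmult: "xex I P (\<lambda>Z. c * f Z) = c * xex I P f"
  by (simp add: xex_def sum_distrib_left mult_ac)

lemma xex_cong: "(\<And>Z. Z \<in> PiE P (\<lambda>_. insert 0 I) \<Longrightarrow> f Z = g Z) \<Longrightarrow> xex I P f = xex I P g"
  unfolding xex_def by (intro sum.cong) auto

lemma xwt_nonneg:
  assumes "real p \<ge> real (card I) + 1" "p \<ge> 2"
  shows "xwt I p z \<ge> 0"
proof -
  have "real p - 1 > 0" using assms by auto
  thus ?thesis using assms(1) by (auto simp: xwt_def field_simps)
qed

lemma abs_xex_le:
  assumes "\<And>p. p \<in> P \<Longrightarrow> real p \<ge> real (card I) + 1 \<and> p \<ge> 2"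
    and "\<And>Z. Z \<in> PiE P (\<lambda>_. insert 0 I) \<Longrightarrow> \<bar>f Z\<bar> \<le> g Z"
  shows "\<bar>xex I P f\<bar> \<le> xex I P g"
proof -
  have "\<bar>xex I P f\<bar> \<le> (\<Sum>Z\<in>PiE P (\<lambda>_. insert 0 I). \<bar>(\<Prod>p\<in>P. xwt I p (Z p)) * f Z\<bar>)"
    unfolding xex_def by (rule sum_abs)
  also have "\<dots> \<le> xex I P g"
    unfolding xex_def
  proof (rule sum_mono)
    fix Z assume Z: "Z \<in> PiE P (\<lambda>_. insert 0 I)"
    have "(\<Prod>p\<in>P. xwt I p (Z p)) \<ge> 0" using assms(1) by (intro prod_nonneg xwt_nonneg) auto
    thus "\<bar>(\<Prod>p\<in>P. xwt I p (Z p)) * f Z\<bar> \<le> (\<Prod>p\<in>P. xwt I p (Z p)) * g Z"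
      using assms(2)[OF Z] by (simp add: abs_mult mult_left_mono)
  qed
  finally show ?thesis .
qed

text \<open>With the weights \<open>1 / (p - card I)\<close>, conditioning independent random sets on being disjoint
  gives exactly the law \<^const>\<open>xwt\<close>; the conditioning costs only a convergent product.\<close>

lemma xwt_le:
  assumes I: "finite I" "0 \<notin> I" and p: "p \<ge> 4 * card I + 4" and z: "z \<in> insert 0 I"
  shows "xwt I p z \<le> exp (4 * real (card I) ^ 2 / real p ^ 2) * (\<Prod>i\<in>I. if z = i then 1 / (real p - real (card I)) else 1 - 1 / (real p - real (card I)))"
proof -
  define m where "m = real (card I)"
  define q where "q = real p"
  have q: "q \<ge> 4 * m + 4" "m \<ge> 0" using p of_nat_le_iff[of "4 * card I + 4" p, where 'a = real] by (simp_all add: m_def q_def)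
  define r where "r = 1 / (q - m)"
  have r: "0 \<le> r" "r \<le> 1" "r < 1" using q by (auto simp: r_def field_simps)
  have "1 - m * r \<le> (1 - r) ^ card I"
    using Bernoulli_inequality[of "-r" "card I"] r by (simp add: m_def)
  moreover have "1 - m * r = (q - 2 * m) / (q - m)" using q by (simp add: r_def field_simps)
  \<comment> \<open>The quotient of 1 - m/(q-1) and (q-2m)/(q-m) is exactly 1 + m(m-1) /
    ((q-1)(q-2m)); the constant 4 arises since q - 1 and q - 2m are both at least q/2.\<close>
  moreover have key: "1 - m / (q - 1) \<le> exp (4 * m^2 / q^2) * ((q - 2 * m) / (q - m))"
  proof -
    have "1 - m / (q - 1) = (1 + m * (m - 1) / ((q - 1) * (q - 2 * m))) * ((q - 2 * m) / (q - m))"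
    proof -
      have nz: "q - 1 \<noteq> 0" "q - 2 * m \<noteq> 0" "q - m \<noteq> 0" using q by auto
      have gen: "(1 + t / (a * b)) * (b / c) = (a * b + t) / (a * c)" if "a \<noteq> 0" "b \<noteq> 0" "c \<noteq> 0" for a b c t :: real
        using that by (simp add: field_simps)
      have gen2: "(a - t) * c / (a * c) = 1 - t / a" if "a \<noteq> 0" "c \<noteq> 0" for a c t :: real
        using that by (simp add: field_simps)
      have "(1 + m * (m - 1) / ((q - 1) * (q - 2 * m))) * ((q - 2 * m) / (q - m)) = ((q - 1) * (q - 2 * m) + m * (m - 1)) / ((q - 1) * (q - m))"
        by (rule gen[OF nz])
      also have "(q - 1) * (q - 2 * m) + m * (m - 1) = (q - 1 - m) * (q - m)" by (simp add: algebra_simps)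
      also have "(q - 1 - m) * (q - m) / ((q - 1) * (q - m)) = 1 - m / (q - 1)" by (rule gen2[OF nz(1,3)])
      finally show ?thesis by simp
    qed
    also have "\<dots> \<le> exp (4 * m^2 / q^2) * ((q - 2 * m) / (q - m))"
    proof (rule mult_right_mono)
      have "m * (m - 1) / ((q - 1) * (q - 2 * m)) \<le> m^2 / ((q/2) * (q/2))"
      proof (rule frac_le)
        show "m * (m - 1) \<le> m^2" using q by (simp add: power2_eq_square algebra_simps)
        show "q / 2 * (q / 2) \<le> (q - 1) * (q - 2 * m)" using q by (intro mult_mono) auto
        show "0 < q / 2 * (q / 2)" using q by simp
      qed simp
      hence "1 + m * (m - 1) / ((q - 1) * (q - 2 * m)) \<le> 1 + 4 * m^2 / q^2"
        by (simp add: power2_eq_square mult_ac)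
      also have "\<dots> \<le> exp (4 * m^2 / q^2)" by (rule exp_ge_add_one_self)
      finally show "1 + m * (m - 1) / ((q - 1) * (q - 2 * m)) \<le> exp (4 * m^2 / q^2)" .
      show "0 \<le> (q - 2 * m) / (q - m)" using q by simp
    qed
    finally show ?thesis .
  qed
  ultimately have main: "1 - m / (q - 1) \<le> exp (4 * m^2 / q^2) * (1 - r) ^ card I"
    by (smt (verit, best) exp_ge_zero mult_left_mono)
  have rr: "1 / (real p - real (card I)) = r" by (simp add: r_def q_def m_def)
  show ?thesis unfolding rr
  proof (cases "z \<in> I")
    case False
    hence "(\<Prod>i\<in>I. if z = i then r else 1 - r) = (1 - r) ^ card I"
      by (subst prod.cong[of I I _ "\<lambda>_. 1 - r"]) auto
    thus "xwt I p z \<le> exp (4 * (real (card I))\<^sup>2 / (real p)\<^sup>2) * (\<Prod>i\<in>I. if z = i then r else 1 - r)"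
      using main False by (simp add: xwt_def m_def q_def)
  next
    case True
    have "(\<Prod>i\<in>I. if z = i then r else 1 - r) = r * (\<Prod>i\<in>I - {z}. if z = i then r else 1 - r)"
      using I True by (subst prod.remove[of I z]) auto
    also have "(\<Prod>i\<in>I - {z}. if z = i then r else 1 - r) = (1 - r) ^ (card I - 1)"
      using I True by (subst prod.cong[of "I - {z}" "I - {z}" _ "\<lambda>_. 1 - r"]) auto
    also have "r * (1 - r) ^ (card I - 1) = (1 - r) ^ card I / (q - m - 1)"
    proof -
      have "card I \<noteq> 0" using True I by auto
      hence "(1 - r) ^ card I = (1 - r) * (1 - r) ^ (card I - 1)" by (cases "card I") auto
      moreover have "(1 - r) / (q - m - 1) = r"
      proof -
        have "(1 - 1 / c) / (c - 1) = 1 / c" if "c > 1" for c :: real using that by (simp add: field_simps)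
        thus ?thesis using q by (simp add: r_def)
      qed
      ultimately show ?thesis by (metis times_divide_eq_left)
    qed
    finally have pr: "(\<Prod>i\<in>I. if z = i then r else 1 - r) = (1 - r) ^ card I / (q - m - 1)" .
    have gen: "(1 - m / a) / (a - m) = 1 / a" if "a > 0" "a > m" for a :: real
      using that by (simp add: field_simps)
    have "1 / (q - 1) = (1 - m / (q - 1)) / (q - m - 1)" using gen[of "q - 1"] q by (simp add: algebra_simps)
    also have "\<dots> \<le> exp (4 * m^2 / q^2) * (1 - r) ^ card I / (q - m - 1)"
      using main q by (intro divide_right_mono) auto
    finally show "xwt I p z \<le> exp (4 * (real (card I))\<^sup>2 / (real p)\<^sup>2) * (\<Prod>i\<in>I. if z = i then r else 1 - r)"
      unfolding pr using True by (simp add: xwt_def m_def q_def)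
  qed
qed

text \<open>An outcome Z corresponds to the disjoint family of its fibres. By \<open>xwt_le\<close>
  its weight is at most that of independent random sets, up to the exponential factor; extending the
  sum to all families, disjoint or not, only adds non-negative terms, and then it factorises over
  I.\<close>

lemma xex_le_rsub_ex:
  assumes I: "finite I" "0 \<notin> I" and P: "finite P" "\<And>p. p \<in> P \<Longrightarrow> p \<ge> 4 * card I + 4"
    and f: "\<And>A. A \<subseteq> P \<Longrightarrow> f A \<ge> 0"
  defines "r \<equiv> \<lambda>p. 1 / (real p - real (card I))"
  shows "xex I P (\<lambda>Z. \<Prod>i\<in>I. f (fibre P Z i)) \<le> exp (4 * real (card I) ^ 2 * (\<Sum>p\<in>P. 1 / real p ^ 2)) * rsub_ex r P f ^ card I"
proof -
  let ?Om = "PiE P (\<lambda>_. insert 0 I)"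
  let ?\<kappa> = "exp (4 * real (card I) ^ 2 * (\<Sum>p\<in>P. 1 / real p ^ 2))"
  have r01: "0 \<le> r p \<and> r p \<le> 1" if "p \<in> P" for p
    using P(2)[OF that] of_nat_le_iff[of "4 * card I + 4" p, where 'a = real] by (auto simp: r_def field_simps)
  have wt0: "rsub_wt r P A \<ge> 0" for A
    unfolding rsub_wt_def using r01 by (intro prod_nonneg) auto
  have "xex I P (\<lambda>Z. \<Prod>i\<in>I. f (fibre P Z i)) \<le> (\<Sum>Z\<in>?Om. ?\<kappa> * (\<Prod>i\<in>I. rsub_wt r P (fibre P Z i) * f (fibre P Z i)))"
    unfolding xex_def
  proof (rule sum_mono)
    fix Z assume Z: "Z \<in> ?Om"
    have "(\<Prod>p\<in>P. xwt I p (Z p)) \<le> (\<Prod>p\<in>P. exp (4 * real (card I) ^ 2 / real p ^ 2) * (\<Prod>i\<in>I. if Z p = i then r p else 1 - r p))"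
    proof (rule prod_mono)
      fix p assume p: "p \<in> P"
      have "xwt I p (Z p) \<ge> 0" using P(2)[OF p] by (intro xwt_nonneg) auto
      moreover have "Z p \<in> insert 0 I" using Z p by auto
      ultimately show "0 \<le> xwt I p (Z p) \<and> xwt I p (Z p) \<le> exp (4 * real (card I) ^ 2 / real p ^ 2) * (\<Prod>i\<in>I. if Z p = i then r p else 1 - r p)"
        using xwt_le[OF I P(2)[OF p]] unfolding r_def by blast
    qed
    also have "\<dots> = ?\<kappa> * (\<Prod>p\<in>P. \<Prod>i\<in>I. if Z p = i then r p else 1 - r p)"
      using P(1) by (simp add: prod.distrib exp_sum[symmetric] sum_distrib_left)
    also have "(\<Prod>p\<in>P. \<Prod>i\<in>I. if Z p = i then r p else 1 - r p) = (\<Prod>i\<in>I. rsub_wt r P (fibre P Z i))"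
      unfolding rsub_wt_def by (subst prod.swap) (auto simp: fibre_def intro!: prod.cong)
    finally have "(\<Prod>p\<in>P. xwt I p (Z p)) \<le> ?\<kappa> * (\<Prod>i\<in>I. rsub_wt r P (fibre P Z i))" .
    moreover have "(\<Prod>i\<in>I. f (fibre P Z i)) \<ge> 0" using f[OF fibre_subset] by (intro prod_nonneg) auto
    ultimately show "(\<Prod>p\<in>P. xwt I p (Z p)) * (\<Prod>i\<in>I. f (fibre P Z i)) \<le> ?\<kappa> * (\<Prod>i\<in>I. rsub_wt r P (fibre P Z i) * f (fibre P Z i))"
      by (simp add: prod.distrib mult.assoc[symmetric] mult_right_mono)
  qed
  also have "\<dots> = ?\<kappa> * (\<Sum>Z\<in>?Om. \<Prod>i\<in>I. rsub_wt r P (fibre P Z i) * f (fibre P Z i))"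
    by (simp add: sum_distrib_left)
  also have "(\<Sum>Z\<in>?Om. \<Prod>i\<in>I. rsub_wt r P (fibre P Z i) * f (fibre P Z i)) = (\<Sum>D\<in>(\<lambda>Z. \<lambda>i\<in>I. fibre P Z i) ` ?Om. \<Prod>i\<in>I. rsub_wt r P (D i) * f (D i))"
  proof (subst sum.reindex)
    show "inj_on (\<lambda>Z. \<lambda>i\<in>I. fibre P Z i) ?Om"
    proof (rule inj_onI)
      fix Z Z' assume Z: "Z \<in> ?Om" "Z' \<in> ?Om" and eq: "(\<lambda>i\<in>I. fibre P Z i) = (\<lambda>i\<in>I. fibre P Z' i)"
      have fibeq: "fibre P Z i = fibre P Z' i" if "i \<in> I" for i using fun_cong[OF eq, of i] that by simp
      show "Z = Z'"
      proof (rule PiE_ext[OF Z])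
        fix p assume p: "p \<in> P"
        have "Z p \<in> insert 0 I" "Z' p \<in> insert 0 I" using Z p by auto
        moreover have "Z p = i \<longleftrightarrow> Z' p = i" if "i \<in> I" for i
          using fibeq[OF that] p unfolding fibre_def by blast
        ultimately show "Z p = Z' p" by (metis insertE)
      qed
    qed
  qed (auto intro!: sum.cong prod.cong)
  also have "\<dots> \<le> (\<Sum>D\<in>PiE I (\<lambda>_. Pow P). \<Prod>i\<in>I. rsub_wt r P (D i) * f (D i))"
  proof (rule sum_mono2)
    show "finite (PiE I (\<lambda>_. Pow P))" using I P by (intro finite_PiE) auto
    show "(\<lambda>Z. \<lambda>i\<in>I. fibre P Z i) ` ?Om \<subseteq> PiE I (\<lambda>_. Pow P)"
      by (auto simp: fibre_def)
    fix D assume "D \<in> PiE I (\<lambda>_. Pow P) - (\<lambda>Z. \<lambda>i\<in>I. fibre P Z i) ` ?Om"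
    hence "D i \<subseteq> P" if "i \<in> I" for i using that by (auto dest: PiE_mem)
    thus "0 \<le> (\<Prod>i\<in>I. rsub_wt r P (D i) * f (D i))"
      using f wt0 by (intro prod_nonneg mult_nonneg_nonneg ballI) auto
  qed
  also have "\<dots> = (\<Prod>i\<in>I. \<Sum>A\<in>Pow P. rsub_wt r P A * f A)"
    using I P by (subst prod_sum_PiE) auto
  also have "\<dots> = rsub_ex r P f ^ card I" by (simp add: rsub_ex_def)
  finally show ?thesis by simp
qed

section \<open>The expectation of the product of all weights in the random model\<close>

definition sform :: "real \<Rightarrow> nat set \<Rightarrow> nat set \<Rightarrow> (nat \<times> bool \<Rightarrow> real \<Rightarrow> real) \<Rightarrow> real" where
  "sform L I P \<phi> = xex I P (\<lambda>Z. \<Prod>j\<in>I \<times> UNIV. lam_set L (\<phi> j) (fibre P Z (fst j)) 0)"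

lemma prod_bool_slots: "(\<Prod>j\<in>I \<times> (UNIV::bool set). f j) = (\<Prod>i\<in>I. f (i, True) * f (i, False))"
proof -
  have "(\<Prod>j\<in>I \<times> (UNIV::bool set). f j) = (\<Prod>i\<in>I. \<Prod>s\<in>UNIV. f (i, s))"
    by (simp add: prod.cartesian_product)
  thus ?thesis by (simp add: UNIV_bool mult.commute)
qed

lemma sform_bound:
  assumes I: "finite I" "0 \<notin> I" and P: "finite P" "\<And>p. p \<in> P \<Longrightarrow> p \<ge> 4 * card I + 4" and L: "L > 0"
    and \<phi>: "\<And>j. j \<in> I \<times> UNIV \<Longrightarrow> dbound 3 (\<nu> j) (\<phi> j)"
  shows "\<bar>sform L I P \<phi>\<bar> \<le> (\<Prod>j\<in>I \<times> UNIV. \<nu> j) * (exp (4 * real (card I) ^ 2 * (\<Sum>p\<in>P. 1 / real p ^ 2)) *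
      gmoment L (\<lambda>p. 1 / (real p - real (card I))) 3 P ^ card I)"
proof -
  have "\<bar>sform L I P \<phi>\<bar> \<le> xex I P (\<lambda>Z. (\<Prod>j\<in>I \<times> UNIV. \<nu> j) * (\<Prod>i\<in>I. (gbound L 3 (fibre P Z i))\<^sup>2))"
    unfolding sform_def
  proof (rule abs_xex_le)
    show "real (card I) + 1 \<le> real p \<and> 2 \<le> p" if "p \<in> P" for p using P(2)[OF that] by linarith
    fix Z
    have "\<bar>\<Prod>j\<in>I \<times> UNIV. lam_set L (\<phi> j) (fibre P Z (fst j)) 0\<bar> = (\<Prod>j\<in>I \<times> UNIV. \<bar>lam_set L (\<phi> j) (fibre P Z (fst j)) 0\<bar>)"
      by (rule abs_prod)
    also have "\<dots> \<le> (\<Prod>j\<in>I \<times> (UNIV :: bool set). \<nu> j * gbound L 3 (fibre P Z (fst j)))"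
    proof (intro prod_mono conjI)
      fix j :: "nat \<times> bool" assume j: "j \<in> I \<times> UNIV"
      have "\<bar>lam_set L (\<phi> j) (fibre P Z (fst j)) 0\<bar> \<le> \<nu> j * exp (-0) * gbound L 3 (fibre P Z (fst j))"
      proof (rule lam_set_le_gbound[OF _ \<phi>[OF j]])
        show "finite (fibre P Z (fst j))" by (rule finite_subset[OF fibre_subset P(1)])
        fix p assume "p \<in> fibre P Z (fst j)"
        hence "p \<in> P" by (auto simp: fibre_def)
        hence "p \<ge> 1" using P(2)[of p] by linarith
        thus "0 \<le> ln (real p) / L" using L by simp
      qed simp
      thus "\<bar>lam_set L (\<phi> j) (fibre P Z (fst j)) 0\<bar> \<le> \<nu> j * gbound L 3 (fibre P Z (fst j))" by simp
    qed auto
    also have "\<dots> = (\<Prod>j\<in>I \<times> UNIV. \<nu> j) * (\<Prod>i\<in>I. (gbound L 3 (fibre P Z i))\<^sup>2)"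
      by (simp add: prod.distrib prod_bool_slots[of "\<lambda>j. gbound L 3 (fibre P Z (fst j))"] power2_eq_square)
    finally show "\<bar>\<Prod>j\<in>I \<times> UNIV. lam_set L (\<phi> j) (fibre P Z (fst j)) 0\<bar> \<le> (\<Prod>j\<in>I \<times> UNIV. \<nu> j) * (\<Prod>i\<in>I. (gbound L 3 (fibre P Z i))\<^sup>2)" .
  qed
  also have "\<dots> = (\<Prod>j\<in>I \<times> UNIV. \<nu> j) * xex I P (\<lambda>Z. \<Prod>i\<in>I. (gbound L 3 (fibre P Z i))\<^sup>2)"
    by (rule xex_cmult)
  also have "\<dots> \<le> (\<Prod>j\<in>I \<times> UNIV. \<nu> j) * (exp (4 * real (card I) ^ 2 * (\<Sum>p\<in>P. 1 / real p ^ 2)) *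
      gmoment L (\<lambda>p. 1 / (real p - real (card I))) 3 P ^ card I)"
  proof (rule mult_left_mono)
    have "\<nu> j \<ge> 0" if "j \<in> I \<times> UNIV" for j
      using dbound_abs_le[OF \<phi>[OF that], of 0] by simp
    thus "(\<Prod>j\<in>I \<times> UNIV. \<nu> j) \<ge> 0" by (intro prod_nonneg) auto
    show "xex I P (\<lambda>Z. \<Prod>i\<in>I. (gbound L 3 (fibre P Z i))\<^sup>2) \<le> exp (4 * real (card I) ^ 2 * (\<Sum>p\<in>P. 1 / real p ^ 2)) *
      gmoment L (\<lambda>p. 1 / (real p - real (card I))) 3 P ^ card I"
      unfolding gmoment_def by (rule xex_le_rsub_ex[OF I P]) auto
  qed
  finally show ?thesis .
qed

lemma lam_set_exp:
  assumes "finite A"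
  shows "lam_set L (\<lambda>t. exp (-a * t)) A t = exp (-a * t) * (\<Prod>p\<in>A. 1 - exp (-a * (ln (real p) / L)))"
  using assms
proof (induction A arbitrary: t)
  case (insert p A)
  have gen: "x * y - x * z * y = x * ((1 - z) * y)" for x y z :: real by (simp add: algebra_simps)
  have eq: "exp (-a * (t + u)) = exp (-a * t) * exp (-a * u)" for u
    by (simp add: exp_add[symmetric] algebra_simps)
  show ?case unfolding lam_set_insert[OF insert.hyps(1,2)] insert.IH prod.insert[OF insert.hyps(1,2)] eq by (rule gen)
qed simp

lemma sform_exp:
  assumes I: "finite I" "0 \<notin> I" and P: "finite P" "\<And>p. p \<in> P \<Longrightarrow> p \<ge> 2"
  shows "sform L I P (\<lambda>j t. exp (-a j * t)) = (\<Prod>p\<in>P. 1 - (\<Sum>i\<in>I. 1 - (1 - exp (-a (i,True) * (ln (real p) / L))) * (1 - exp (-a (i,False) * (ln (real p) / L)))) / (real p - 1))"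
proof -
  define e where "e i p = (1 - exp (-a (i,True) * (ln (real p) / L))) * (1 - exp (-a (i,False) * (ln (real p) / L)))" for i p
  define g where "g p z = (if z \<in> I then e z p else 1)" for p z
  have "sform L I P (\<lambda>j t. exp (-a j * t)) = xex I P (\<lambda>Z. \<Prod>p\<in>P. g p (Z p))"
    unfolding sform_def
  proof (rule xex_cong)
    fix Z assume Z: "Z \<in> PiE P (\<lambda>_. insert 0 I)"
    have fin: "finite (fibre P Z i)" for i by (rule finite_subset[OF fibre_subset P(1)])
    have "(\<Prod>j\<in>I \<times> UNIV. lam_set L (\<lambda>t. exp (-a j * t)) (fibre P Z (fst j)) 0) = (\<Prod>i\<in>I. \<Prod>p\<in>fibre P Z i. e i p)"
      unfolding prod_bool_slots fst_conv lam_set_exp[OF fin] by (simp add: e_def prod.distrib)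
    also have "\<dots> = (\<Prod>i\<in>I. \<Prod>p\<in>P. if Z p = i then e i p else 1)"
      unfolding fibre_def by (intro prod.cong refl prod.inter_filter P(1))
    also have "\<dots> = (\<Prod>p\<in>P. \<Prod>i\<in>I. if Z p = i then e i p else 1)" by (rule prod.swap)
    also have "\<dots> = (\<Prod>p\<in>P. g p (Z p))"
      using I by (intro prod.cong refl) (simp add: g_def prod.delta')
    finally show "(\<Prod>j\<in>I \<times> UNIV. lam_set L (\<lambda>t. exp (-a j * t)) (fibre P Z (fst j)) 0) = (\<Prod>p\<in>P. g p (Z p))" .
  qed
  also have "\<dots> = (\<Prod>p\<in>P. \<Sum>z\<in>insert 0 I. xwt I p z * g p z)"
    by (rule xex_prod[OF I(1) P(1)])
  also have "\<dots> = (\<Prod>p\<in>P. 1 - (\<Sum>i\<in>I. 1 - e i p) / (real p - 1))"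
  proof (rule prod.cong[OF refl])
    fix p assume p: "p \<in> P"
    have "(\<Sum>z\<in>insert 0 I. xwt I p z * g p z) = xwt I p 0 * g p 0 + (\<Sum>z\<in>I. e z p / (real p - 1))"
      using I by (simp add: xwt_def g_def)
    also have "\<dots> = 1 - (\<Sum>i\<in>I. 1 - e i p) / (real p - 1)"
      using I(2) by (simp add: xwt_def g_def sum_subtractf sum_divide_distrib diff_divide_distrib)
    finally show "(\<Sum>z\<in>insert 0 I. xwt I p z * g p z) = 1 - (\<Sum>i\<in>I. 1 - e i p) / (real p - 1)" .
  qed
  finally show ?thesis by (simp add: e_def)
qed

lemma lam_set_add: "lam_set L (\<lambda>t. H t + K t) A s = lam_set L H A s + lam_set L K A s"
  by (simp add: lam_set_def sum.distrib algebra_simps)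

lemma lam_set_cmult: "lam_set L (\<lambda>t. c * H t) A s = c * lam_set L H A s"
  by (simp add: lam_set_def sum_distrib_left mult_ac)

lemma sform_update:
  assumes "finite I" "j \<in> I \<times> UNIV"
  shows "sform L I P (\<phi>(j := h)) = xex I P (\<lambda>Z. lam_set L h (fibre P Z (fst j)) 0 * (\<Prod>l\<in>I \<times> UNIV - {j}. lam_set L (\<phi> l) (fibre P Z (fst l)) 0))"
  unfolding sform_def
proof (rule xex_cong)
  fix Z
  show "(\<Prod>l\<in>I \<times> UNIV. lam_set L ((\<phi>(j := h)) l) (fibre P Z (fst l)) 0) = lam_set L h (fibre P Z (fst j)) 0 * (\<Prod>l\<in>I \<times> UNIV - {j}. lam_set L (\<phi> l) (fibre P Z (fst l)) 0)"
    using assms by (subst prod.remove[of _ j]) (auto intro!: prod.cong)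
qed

lemma sform_update_add:
  assumes "finite I" "j \<in> I \<times> UNIV"
  shows "sform L I P (\<phi>(j := \<lambda>t. h t + g t)) = sform L I P (\<phi>(j := h)) + sform L I P (\<phi>(j := g))"
  by (simp add: sform_update[OF assms] lam_set_add distrib_right xex_add)

lemma sform_update_cmult:
  assumes "finite I" "j \<in> I \<times> UNIV"
  shows "sform L I P (\<phi>(j := \<lambda>t. c * h t)) = c * sform L I P (\<phi>(j := h))"
  by (simp add: sform_update[OF assms] lam_set_cmult mult.assoc xex_cmult)

lemma sform_update_sum:
  assumes "finite I" "j \<in> I \<times> UNIV" "finite N"
  shows "sform L I P (\<phi>(j := \<lambda>t. \<Sum>n\<in>N. c n * h n t)) = (\<Sum>n\<in>N. c n * sform L I P (\<phi>(j := h n)))"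
  using assms(3)
proof (induction N)
  case empty
  show ?case using sform_update_cmult[OF assms(1,2), of L P \<phi> 0 "\<lambda>_. 0"] by (simp only: sum.empty mult_zero_left)
next
  case (insert n N)
  show ?case unfolding sum.insert[OF insert.hyps(1,2)] sform_update_add[OF assms(1,2)] sform_update_cmult[OF assms(1,2)] insert.IH ..
qed

section \<open>Exponential weights\<close>

definition wlim :: "real \<Rightarrow> real" where "wlim x = ln (ln (ln x))"
text \<open>The bound exp((ln x)^2) exceeds every shift n + h i for large x, so no prime factor is
  lost, and it keeps the set finite. It also exceeds every power of x, which makes the truncation of
  the Euler products with exponent 1 + a / ln x negligible.\<close>

definition sieve_primes :: "real \<Rightarrow> nat set" where
  "sieve_primes x = {p. prime p \<and> wlim x < real p \<and> real p \<le> exp ((ln x)\<^sup>2)}"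
definition small_primes :: "real \<Rightarrow> nat set" where
  "small_primes x = {p. prime p \<and> real p \<le> wlim x}"

lemma finite_small_primes [simp]: "finite (small_primes x)"
  unfolding small_primes_def by simp

lemma finite_sieve_primes [simp]: "finite (sieve_primes x)"
  by (rule finite_subset[of _ "{p. prime p \<and> real p \<le> exp ((ln x)\<^sup>2)}"]) (auto simp: sieve_primes_def)

lemma W_mod_eq: "W_mod x = \<Prod>(small_primes x)"
  by (simp add: W_mod_def small_primes_def wlim_def)

lemma coprime_prime_prod:
  assumes "finite P" "\<And>q. q \<in> P \<Longrightarrow> prime q" "prime (p :: nat)" "p \<notin> P"
  shows "coprime p (\<Prod>P)"
  using assms by (intro prod_coprime_right primes_coprime) auto

lemma totient_prod_primes:
  assumes "finite P" "\<And>p. p \<in> P \<Longrightarrow> prime (p :: nat)"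
  shows "real (totient (\<Prod>P)) = (\<Prod>p\<in>P. real p - 1)"
  using assms
proof (induction P)
  case (insert p P)
  have "coprime p (\<Prod>P)" using insert by (intro coprime_prime_prod) auto
  moreover have "real (totient p) = real p - 1"
    using insert.prems[of p] prime_ge_1_nat[of p] by (simp add: totient_prime of_nat_diff)
  ultimately show ?case using insert by (simp add: totient_mult_coprime)
qed simp

lemma W_mod_pos: "W_mod x > 0"
  unfolding W_mod_eq by (intro prod_pos) (auto simp: small_primes_def prime_gt_0_nat)

lemma B_size_eq: "B_size x = (\<Prod>p\<in>small_primes x. 1 - 1 / real p) * ln x"
proof -
  have "real (totient (W_mod x)) / real (W_mod x) = (\<Prod>p\<in>small_primes x. (real p - 1) / real p)"
    unfolding W_mod_eq by (subst totient_prod_primes) (auto simp: small_primes_def prod_dividef)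
  also have "\<dots> = (\<Prod>p\<in>small_primes x. 1 - 1 / real p)"
    by (intro prod.cong) (auto simp: small_primes_def diff_divide_distrib dest: prime_gt_0_nat)
  finally show ?thesis by (simp add: B_size_def)
qed

lemma prime_recip_factor: "prime p \<Longrightarrow> 1/2 \<le> 1 - 1 / real p \<and> 1 - 1 / real p < 1"
  using prime_ge_2_nat[of p] by (auto simp: field_simps)

lemma prod_one_minus_recip_pos:
  assumes "\<And>p. p \<in> P \<Longrightarrow> prime p"
  shows "(\<Prod>p\<in>P. 1 - 1 / real p) > 0"
proof (intro prod_pos)
  fix p assume "p \<in> P"
  from prime_recip_factor[OF assms[OF this]] show "0 < 1 - 1 / real p" by linarith
qed

lemma B_size_pos: "x > 1 \<Longrightarrow> B_size x > 0"
  unfolding B_size_eq by (intro mult_pos_pos prod_one_minus_recip_pos) (auto simp: small_primes_def)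

lemma filterlim_wlim: "filterlim wlim at_top at_top"
  unfolding wlim_def[abs_def] by real_asymp

lemma sieve_primes_ge: "real N \<le> wlim x \<Longrightarrow> p \<in> sieve_primes x \<Longrightarrow> p \<ge> N"
  by (simp add: sieve_primes_def)

lemma eventually_sieve_primes_ge: "\<forall>\<^sub>F x in at_top. \<forall>p\<in>sieve_primes x. p \<ge> N"
proof -
  have "\<forall>\<^sub>F x in at_top. real N \<le> wlim x"
    using filterlim_wlim by (simp add: filterlim_at_top)
  thus ?thesis by eventually_elim (use sieve_primes_ge in blast)
qed

lemma sum_inv_sq_sieve_primes:
  assumes "wlim x \<ge> 1" "P \<subseteq> sieve_primes x"
  shows "(\<Sum>p\<in>P. 1 / real p ^ 2) \<le> 2 / wlim x"
proof (rule sum_inverse_square_le[OF assms(1)])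
  show "finite P" using finite_subset[OF assms(2)] by simp
qed (use assms(2) in \<open>auto simp: sieve_primes_def\<close>)

text \<open>Without any cancellation, the local factor is 1 - r + r (1 + e)^2 \<le> 1 + 3 r e \<le>
  (1 + r e)^3 with e = p^(-1/L). So the moment is at most the cube of a product over primes p \<ge>
  exp(v L), which \<open>prod_large_primes_le\<close> bounds by a constant times 1 / v. Replacing r
  = 1/(p - m) by 1/p costs the convergent factor exp(4 m).\<close>

lemma gmoment_0_bound:
  assumes P: "finite P" "\<And>p. p \<in> P \<Longrightarrow> prime p \<and> p \<ge> 4 * m + 4" and L: "L \<ge> 1"
    and v: "0 < v" "v \<le> 1" "\<And>p. p \<in> P \<Longrightarrow> v \<le> ln (real p) / L"
    and S: "(\<Sum>p\<in>P. 1 / real p ^ 2) \<le> 2"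
  shows "gmoment L (\<lambda>p. 1 / (real p - real m)) 0 P \<le> (2 * exp (1 + 4 * real m)) ^ 3 / v ^ 3"
proof -
  let ?r = "\<lambda>p. 1 / (real p - real m)"
  define e where "e p = exp (- ln (real p) / L)" for p :: nat
  have big: "real p \<ge> 4 * real m + 4" if "p \<in> P" for p
    using P(2)[OF that] of_nat_le_iff[of "4 * m + 4" p, where 'a = real] by simp
  have "gmoment L ?r 0 P \<le> (\<Prod>p\<in>P. (1 / (1 - real p powr (-(1 + 1/L))) * exp (2 * real m * (1 / real p ^ 2))) ^ 3)"
    unfolding gmoment_0[OF P(1)]
  proof (rule prod_mono)
    fix p assume p: "p \<in> P"
    have e: "0 < e p" "e p \<le> 1" using L big[OF p] by (auto simp: e_def divide_le_0_iff)
    have r: "0 \<le> ?r p" "?r p \<le> 1 / real p + 2 * real m / real p ^ 2" "?r p \<le> 1"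
    proof -
      have "1 / real p + real m / (real p * (real p - real m)) = ?r p"
        using big[OF p] by (simp add: field_simps)
      moreover have "real m / (real p * (real p - real m)) \<le> real m / (real p * (real p / 2))"
        using big[OF p] by (intro divide_left_mono mult_left_mono mult_pos_pos) auto
      moreover have "real m / (real p * (real p / 2)) = 2 * real m / real p ^ 2" by (simp add: power2_eq_square)
      ultimately show "?r p \<le> 1 / real p + 2 * real m / real p ^ 2" by linarith
      show "0 \<le> ?r p" "?r p \<le> 1" using big[OF p] by auto
    qed
    have "1 - ?r p + ?r p * (1 + e p)\<^sup>2 = 1 + ?r p * (2 * e p + (e p)\<^sup>2)" by (simp add: power2_eq_square algebra_simps)
    also have "\<dots> \<le> 1 + ?r p * (3 * e p)"
      using e r by (intro add_left_mono mult_left_mono) (auto simp: power2_eq_square mult_left_le)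
    also have "\<dots> \<le> (1 + ?r p * e p) ^ 3"
    proof -
      have "0 \<le> ?r p * e p" using e r by (intro mult_nonneg_nonneg) auto
      hence "1 + real 3 * (?r p * e p) \<le> (1 + ?r p * e p) ^ 3" by (intro Bernoulli_inequality) linarith
      thus ?thesis by (simp add: mult_ac)
    qed
    also have "\<dots> \<le> (1 / (1 - real p powr (-(1 + 1/L))) * exp (2 * real m * (1 / real p ^ 2))) ^ 3"
    proof (rule power_mono)
      define y where "y = real p powr (-(1 + 1/L))"
      have y: "0 < y" "y \<le> 1/2" using one_minus_prime_powr(1)[of p "1 + 1/L"] P(2)[OF p] L big[OF p] by (auto simp: y_def)
      have pe: "e p / real p = y"
      proof -
        have "y = real p powr (-(1/L)) * real p powr (-1)"
          unfolding y_def by (subst powr_add[symmetric]) (simp add: minus_diff_commute)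
        also have "real p powr (-(1/L)) = e p" using big[OF p] by (simp add: powr_def e_def)
        finally show ?thesis using big[OF p] by (simp add: powr_minus field_simps)
      qed
      have "?r p * e p \<le> (1 / real p + 2 * real m / real p ^ 2) * e p" using r e by (intro mult_right_mono) auto
      also have "\<dots> = y + 2 * real m / real p ^ 2 * e p" using pe by (simp add: algebra_simps)
      also have "\<dots> \<le> y + 2 * real m / real p ^ 2" using e by (intro add_left_mono mult_left_le) auto
      finally have "1 + ?r p * e p \<le> (1 + y) + 2 * real m * (1 / real p ^ 2)" by simp
      also have "\<dots> \<le> (1 + y) * (1 + 2 * real m * (1 / real p ^ 2))"
      proof -
        have "0 \<le> y * (2 * real m * (1 / real p ^ 2))" using y by (intro mult_nonneg_nonneg) auto
        moreover have "(1 + y) * (1 + t) = 1 + y + t + y * t" for t by (simp add: algebra_simps)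
        ultimately show ?thesis by simp
      qed
      also have "\<dots> \<le> (1 / (1 - y)) * exp (2 * real m * (1 / real p ^ 2))"
        using y by (intro mult_mono exp_ge_add_one_self) (auto simp: field_simps)
      finally show "1 + ?r p * e p \<le> 1 / (1 - real p powr (-(1 + 1/L))) * exp (2 * real m * (1 / real p ^ 2))"
        by (simp add: y_def)
      show "0 \<le> 1 + ?r p * e p" using r e by simp
    qed
    finally show "0 \<le> 1 - ?r p + ?r p * (1 + exp (- ln (real p) / L))\<^sup>2 \<and> 1 - ?r p + ?r p * (1 + exp (- ln (real p) / L))\<^sup>2
      \<le> (1 / (1 - real p powr (-(1 + 1/L))) * exp (2 * real m * (1 / real p ^ 2))) ^ 3"
      using r by (simp add: e_def)
  qed
  also have "\<dots> = ((\<Prod>p\<in>P. 1 / (1 - real p powr (-(1 + 1/L)))) * exp (2 * real m * (\<Sum>p\<in>P. 1 / real p ^ 2))) ^ 3"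
    unfolding prod_power_distrib[symmetric] prod.distrib sum_distrib_left exp_sum[OF P(1)] ..
  also have "\<dots> \<le> ((2 * exp 1 * L / ln (exp (v * L))) * exp (2 * real m * 2)) ^ 3"
  proof (intro power_mono mult_mono)
    show "(\<Prod>p\<in>P. 1 / (1 - real p powr (-(1 + 1/L)))) \<le> 2 * exp 1 * L / ln (exp (v * L))"
    proof (rule prod_large_primes_le[OF L])
      show "1 < exp (v * L)" "ln (exp (v * L)) \<le> L" using v L by auto
      fix p assume p: "p \<in> P"
      have "v * L \<le> ln (real p)" using v(3)[OF p] L by (simp add: field_simps)
      hence "exp (v * L) \<le> real p" using big[OF p] by (simp add: ln_ge_iff)
      thus "prime p \<and> exp (v * L) \<le> real p" using P(2)[OF p] by simp
    qed (rule P(1))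
    show "exp (2 * real m * (\<Sum>p\<in>P. 1 / real p ^ 2)) \<le> exp (2 * real m * 2)"
    proof -
      have "2 * real m * (\<Sum>p\<in>P. 1 / real p ^ 2) \<le> 2 * real m * 2" using S by (intro mult_left_mono) auto
      thus ?thesis by simp
    qed
    have "1 / (1 - real p powr (-(1 + 1/L))) \<ge> 0" if "p \<in> P" for p
      using one_minus_prime_powr(1)[of p "1 + 1/L"] P(2)[OF that] L by simp
    thus "0 \<le> (\<Prod>p\<in>P. 1 / (1 - real p powr (-(1 + 1/L)))) * exp (2 * real m * (\<Sum>p\<in>P. 1 / real p ^ 2))"
      by (intro mult_nonneg_nonneg prod_nonneg) auto
  qed (use v L in auto)
  also have "\<dots> = (2 * exp (1 + 4 * real m)) ^ 3 / v ^ 3"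
    using v L by (simp add: power_divide power_mult_distrib exp_add)
  finally show ?thesis .
qed

text \<open>The hypotheses of \<open>gmoment_3_le\<close> are checked for r p = 1/(p - m). The
  product of 1 - 1/p over the primes between \<open>wlim x\<close> and x is at most 1 / B by
  \<open>mertens_upper\<close>, which gives the right order of magnitude.\<close>

lemma gmoment_3_bound:
  fixes m :: nat
  obtains K where "K > 0" "\<forall>\<^sub>F x in at_top. gmoment (ln x) (\<lambda>p. 1 / (real p - real m)) 3 (sieve_primes x) \<le> K / B_size x"
proof -
  define C where "C = (2 * exp (1 + 4 * real m)) ^ 3"
  \<comment> \<open>exp(-10) / 2 is from \<open>mertens_lower\<close> at x, another 1/2 from
    \<open>mertens_upper\<close> at the least prime p, and the last factor pays for replacing 1/(q -
    m) by 1/q over all primes considered.\<close>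
  define c where "c = exp (-10) / 4 * exp (-(8 * real m * 2))"
  have C: "C \<ge> 1"
  proof -
    have "1 \<le> exp (1 + 4 * real m)" by simp
    hence "1 \<le> 2 * exp (1 + 4 * real m)" by linarith
    thus ?thesis unfolding C_def by (rule one_le_power)
  qed
  have c: "c > 0" by (simp add: c_def)
  have ev: "\<forall>\<^sub>F x in at_top. x \<ge> exp 1 \<and> x \<ge> 3 \<and> wlim x \<ge> 1 \<and> wlim x \<le> x \<and> ln x \<le> (ln x)\<^sup>2 \<and> (ln x + 4) / ln x \<le> 5 \<and> (\<forall>p\<in>sieve_primes x. p \<ge> 8 * m + 4)"
  proof (intro eventually_conj eventually_sieve_primes_ge)
    show "\<forall>\<^sub>F x in at_top. wlim x \<ge> 1" using filterlim_wlim by (simp add: filterlim_at_top)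
    show "\<forall>\<^sub>F x in at_top. wlim x \<le> x" unfolding wlim_def by real_asymp
    show "\<forall>\<^sub>F x :: real in at_top. ln x \<le> (ln x)\<^sup>2" by real_asymp
    show "\<forall>\<^sub>F x :: real in at_top. (ln x + 4) / ln x \<le> 5" by real_asymp
  qed (rule eventually_ge_at_top)+
  have "\<forall>\<^sub>F x in at_top. gmoment (ln x) (\<lambda>p. 1 / (real p - real m)) 3 (sieve_primes x) \<le> (C * (1 + 10 / c)) / B_size x"
    using ev
  proof eventually_elim
    case (elim x)
    let ?r = "\<lambda>p. 1 / (real p - real m)"
    define L where "L = ln x"
    have L: "L \<ge> 1" using elim by (simp add: L_def ln_ge_iff)
    have x0: "x > 0" using elim by linarith
    have pr: "prime p \<and> p \<ge> 4 * m + 4 \<and> real p \<ge> 8 * real m + 4" if "p \<in> sieve_primes x" for p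
    proof -
      have "p \<ge> 8 * m + 4" using elim that by blast
      hence "real p \<ge> 8 * real m + 4" using of_nat_le_iff[of "8 * m + 4" p, where 'a = real] by simp
      thus ?thesis using \<open>p \<ge> 8 * m + 4\<close> that by (auto simp: sieve_primes_def)
    qed
    have sq: "(\<Sum>p\<in>P. 1 / real p ^ 2) \<le> 2" if "P \<subseteq> sieve_primes x" for P
    proof -
      have "(\<Sum>p\<in>P. 1 / real p ^ 2) \<le> 2 / wlim x" using elim that by (intro sum_inv_sq_sieve_primes) auto
      also have "\<dots> \<le> 2" using elim by (simp add: field_simps)
      finally show ?thesis .
    qed
    have le1: "ln (real p) / L \<le> 1 \<longleftrightarrow> real p \<le> x" if "prime p" for p
    proof -
      have "ln (real p) / L \<le> 1 \<longleftrightarrow> ln (real p) \<le> ln x" using L by (simp add: L_def)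
      also have "\<dots> \<longleftrightarrow> real p \<le> x" using prime_gt_0_nat[OF that] x0 by (intro ln_le_cancel_iff) auto
      finally show ?thesis .
    qed
    \<comment> \<open>The last of these bounds trades 1/(p - m) for 1/p at the cost of a factor
      exp(-8 m / p^2), whose product over any set of sieve primes stays bounded below.\<close>
    have r_bd: "0 \<le> ?r p" "?r p \<le> 1" "1 / real p \<le> ?r p" "?r p \<le> 2 / real p" "(1 - 1 / real p) * exp (-(8 * real m * (1 / real p ^ 2))) \<le> 1 - ?r p"
      if "p \<in> sieve_primes x" for p
    proof -
      define q where "q = real p"
      define n where "n = real m"
      have q: "q \<ge> 8 * n + 4" "n \<ge> 0" using pr[OF that] by (auto simp: q_def n_def)
      have d: "0 < q - n" using q by simp
      have "0 \<le> 1 / (q - n)" "1 / (q - n) \<le> 1" "1 / q \<le> 1 / (q - n)" using q by (auto intro!: divide_left_mono)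
      thus "0 \<le> ?r p" "?r p \<le> 1" "1 / real p \<le> ?r p" by (auto simp: q_def n_def)
      have "1 / (q - n) \<le> 1 / (q / 2)" using q by (intro divide_left_mono) auto
      thus "?r p \<le> 2 / real p" by (simp add: q_def n_def)
      define t where "t = 4 * n * (1 / q ^ 2)"
      have t: "0 \<le> t" "t \<le> 1/2"
      proof -
        have "8 * n * 1 \<le> q * q" using q by (intro mult_mono) auto
        thus "0 \<le> t" "t \<le> 1/2" using q by (auto simp: t_def field_simps power2_eq_square)
      qed
      have "exp (-(2 * t)) \<le> 1 / (1 + 2 * t)"
        using exp_ge_add_one_self[of "2 * t"] t by (simp add: exp_minus field_simps)
      also have "\<dots> \<le> 1 - t"
      proof -
        have "1 \<le> (1 - t) * (1 + 2 * t)" using t by (simp add: algebra_simps mult_left_le)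
        thus ?thesis using t by (simp add: field_simps)
      qed
      finally have "exp (-(2*t)) \<le> 1 - t" .
      hence "(1 - 1 / q) * exp (-(2 * t)) \<le> (1 - 1 / q) * (1 - t)"
        using q by (intro mult_left_mono) (auto simp: field_simps)
      also have "\<dots> \<le> 1 - 1 / (q - n)"
      proof -
        have "1 / q + n / (q * (q - n)) = 1 / (q - n)" using q by (simp add: field_simps)
        moreover have "n / (q * (q - n)) \<le> n / (q * (q / 2))"
          using q by (intro divide_left_mono mult_left_mono mult_pos_pos) auto
        moreover have "n / (q * (q / 2)) = t / 2" by (simp add: t_def power2_eq_square)
        moreover have "t / 2 \<le> (1 - 1 / q) * t"
        proof -
          have "1/2 \<le> 1 - 1 / q" using q by (simp add: field_simps)
          from mult_right_mono[OF this t(1)] show ?thesis by simp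
        qed
        moreover have "(1 - 1 / q) * (1 - t) = (1 - 1 / q) - (1 - 1 / q) * t" by (simp only: right_diff_distrib mult_1_right)
        ultimately show ?thesis by linarith
      qed
      finally show "(1 - 1 / real p) * exp (-(8 * real m * (1 / real p ^ 2))) \<le> 1 - ?r p"
        by (simp add: q_def n_def t_def mult.assoc)
    qed
    have g3: "gmoment L ?r 3 (sieve_primes x) \<le> C * (\<Prod>q | q \<in> sieve_primes x \<and> ln (real q) / L \<le> 1. 1 - ?r q) *
     (1 + (\<Sum>q | q \<in> sieve_primes x \<and> ln (real q) / L \<le> 1. ?r q * (ln (real q) / L)) / c)"
    proof (rule gmoment_3_le)
      show "0 \<le> ?r p \<and> ?r p \<le> 1" if "p \<in> sieve_primes x" for p using r_bd[OF that] by blast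
      show "0 < ln (real p) / L" if "p \<in> sieve_primes x" for p using pr[OF that] L by simp
      show "gmoment L ?r 0 P \<le> C / v ^ 3" if "P \<subseteq> sieve_primes x" "0 < v" "v \<le> 1" "\<And>p. p \<in> P \<Longrightarrow> v \<le> ln (real p) / L" for P v
        unfolding C_def using that pr L sq[OF that(1)] finite_subset[OF that(1)] by (intro gmoment_0_bound) auto
      fix P p assume P: "P \<subseteq> sieve_primes x" "p \<in> P" "ln (real p) / L \<le> 1" "\<And>q. q \<in> P \<Longrightarrow> p \<le> q"
      let ?Q = "{q \<in> P. ln (real q) / L \<le> 1}"
      have "p \<in> sieve_primes x" using P(1,2) by auto
      from pr[OF this] have pp: "prime p" "p \<ge> 4" by auto
      have px: "real p \<le> x" using le1[OF pp(1)] P(3) by simp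
      have finQ: "finite ?Q" using finite_subset[OF P(1)] by simp
      define All where "All = {q. prime q \<and> real q \<le> x}"
      define Low where "Low = {q. prime q \<and> q < p}"
      have finA: "finite All" "finite Low" by (auto simp: All_def Low_def)
      \<comment> \<open>Mertens' bound holds for the primes up to and including p; dropping the
        factor of p itself, which is at least 1/2, turns 1 into 2.\<close>
      have low: "(\<Prod>q\<in>Low. 1 - 1 / real q) \<le> 2 / ln (real p)"
      proof -
        have "(\<Prod>q | prime q \<and> real q \<le> real p. 1 - 1 / real q) = (1 - 1 / real p) * (\<Prod>q\<in>Low. 1 - 1 / real q)"
        proof -
          have "{q. prime q \<and> real q \<le> real p} = insert p Low" using pp by (auto simp: Low_def)
          thus ?thesis using finA by (simp add: Low_def)
        qed
        moreover have "(\<Prod>q | prime q \<and> real q \<le> real p. 1 - 1 / real q) * ln (real p) \<le> 1"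
          using pp by (intro mertens_upper) simp
        ultimately have "(1 - 1 / real p) * ((\<Prod>q\<in>Low. 1 - 1 / real q) * ln (real p)) \<le> 1" by (simp add: mult_ac)
        moreover have "1/2 * ((\<Prod>q\<in>Low. 1 - 1 / real q) * ln (real p)) \<le> (1 - 1 / real p) * ((\<Prod>q\<in>Low. 1 - 1 / real q) * ln (real p))"
          using pp prime_recip_factor[OF pp(1)] prod_one_minus_recip_pos[of Low]
          by (intro mult_right_mono mult_nonneg_nonneg) (auto simp: Low_def less_imp_le)
        ultimately have "(\<Prod>q\<in>Low. 1 - 1 / real q) * ln (real p) \<le> 2" by linarith
        thus ?thesis using pp by (simp add: field_simps)
      qed
      have split: "(\<Prod>q\<in>All. 1 - 1 / real q) = (\<Prod>q\<in>Low. 1 - 1 / real q) * (\<Prod>q\<in>All - Low. 1 - 1 / real q)"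
      proof -
        have "Low \<subseteq> All" using px by (auto simp: Low_def All_def)
        thus ?thesis using finA prod.subset_diff[of Low All "\<lambda>q. 1 - 1 / real q"] by (simp add: mult.commute)
      qed
      have "exp (-10) / (2 * L) \<le> (\<Prod>q\<in>All. 1 - 1 / real q)"
        unfolding All_def L_def using elim by (intro mertens_lower) auto
      also have "\<dots> \<le> 2 / ln (real p) * (\<Prod>q\<in>All - Low. 1 - 1 / real q)"
        unfolding split using low prod_one_minus_recip_pos[of "All - Low"] by (intro mult_right_mono) (auto simp: All_def less_imp_le)
      finally have b1: "exp (-10) / 4 * (ln (real p) / L) \<le> (\<Prod>q\<in>All - Low. 1 - 1 / real q)"
        using pp L by (simp add: field_simps)
      have "(\<Prod>q\<in>All - Low. 1 - 1 / real q) \<le> (\<Prod>q\<in>?Q. 1 - 1 / real q)"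
      proof -
        have sub: "?Q \<subseteq> All - Low"
        proof
          fix q assume q: "q \<in> ?Q"
          hence "prime q" using P(1) pr by auto
          moreover from this have "real q \<le> x" using q le1 by simp
          ultimately show "q \<in> All - Low" using P(4)[of q] q by (simp add: All_def Low_def)
        qed
        have "(\<Prod>q\<in>All - Low. 1 - 1 / real q) = (\<Prod>q\<in>All - Low - ?Q. 1 - 1 / real q) * (\<Prod>q\<in>?Q. 1 - 1 / real q)"
          using sub finA by (intro prod.subset_diff) auto
        also have "\<dots> \<le> 1 * (\<Prod>q\<in>?Q. 1 - 1 / real q)"
        proof (rule mult_right_mono)
          have "0 \<le> 1 - 1 / real q \<and> 1 - 1 / real q \<le> 1" if "q \<in> All - Low - ?Q" for q
            using prime_recip_factor[of q] that by (auto simp: All_def)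
          thus "(\<Prod>q\<in>All - Low - ?Q. 1 - 1 / real q) \<le> 1" by (intro prod_le_1) auto
          show "0 \<le> (\<Prod>q\<in>?Q. 1 - 1 / real q)" using P(1) pr by (intro less_imp_le prod_one_minus_recip_pos) auto
        qed
        finally show ?thesis by simp
      qed
      with b1 have b2: "exp (-10) / 4 * (ln (real p) / L) \<le> (\<Prod>q\<in>?Q. 1 - 1 / real q)" by linarith
      have "c * (ln (real p) / L) = exp (-10) / 4 * (ln (real p) / L) * exp (-(8 * real m * 2))" by (simp add: c_def)
      also have "\<dots> \<le> (\<Prod>q\<in>?Q. 1 - 1 / real q) * exp (-(8 * real m * (\<Sum>q\<in>?Q. 1 / real q ^ 2)))"
      proof (rule mult_mono[OF b2])
        have "(\<Sum>q\<in>?Q. 1 / real q ^ 2) \<le> 2" using P(1) by (intro sq) auto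
        hence "8 * real m * (\<Sum>q\<in>?Q. 1 / real q ^ 2) \<le> 8 * real m * 2" by (intro mult_left_mono) auto
        thus "exp (-(8 * real m * 2)) \<le> exp (-(8 * real m * (\<Sum>q\<in>?Q. 1 / real q ^ 2)))" by simp
        show "0 \<le> (\<Prod>q\<in>?Q. 1 - 1 / real q)" using P(1) pr by (intro less_imp_le prod_one_minus_recip_pos) auto
      qed auto
      also have "\<dots> = (\<Prod>q\<in>?Q. (1 - 1 / real q) * exp (-(8 * real m * (1 / real q ^ 2))))"
        using finQ by (simp only: prod.distrib exp_sum[symmetric] sum_distrib_left sum_negf)
      also have "\<dots> \<le> (\<Prod>q\<in>?Q. 1 - ?r q)"
      proof (rule prod_mono)
        fix q assume "q \<in> ?Q"
        hence q: "q \<in> sieve_primes x" using P(1) by auto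
        have "0 \<le> 1 - 1 / real q" using prime_recip_factor[of q] pr[OF q] by simp
        thus "0 \<le> (1 - 1 / real q) * exp (-(8 * real m * (1 / real q ^ 2))) \<and> (1 - 1 / real q) * exp (-(8 * real m * (1 / real q ^ 2))) \<le> 1 - ?r q"
          using r_bd(5)[OF q] by (intro conjI mult_nonneg_nonneg) auto
      qed
      finally show "c * (ln (real p) / L) \<le> (\<Prod>q\<in>?Q. 1 - ?r q)" .
    qed (use C c in auto)
    let ?S = "{q \<in> sieve_primes x. ln (real q) / L \<le> 1}"
    have S: "?S = {q. prime q \<and> wlim x < real q \<and> real q \<le> x}"
    proof -
      have "x \<le> exp ((ln x)\<^sup>2)" using elim x0 by (metis exp_le_cancel_iff exp_ln)
      thus ?thesis using le1 by (auto simp: sieve_primes_def)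
    qed
    \<comment> \<open>As r q \<le> 2/q, the sum is at most 2 / ln x times the first Mertens sum,
      hence bounded; 10 is twice the bound 5 for (ln x + 4) / ln x.\<close>
    have "(\<Sum>q\<in>?S. ?r q * (ln (real q) / L)) \<le> (\<Sum>q\<in>?S. 2 / L * (ln (real q) / real q))"
    proof (rule sum_mono)
      fix q assume q: "q \<in> ?S"
      have "?r q * (ln (real q) / L) \<le> 2 / real q * (ln (real q) / L)"
        using r_bd(4)[of q] pr[of q] q L by (intro mult_right_mono) auto
      thus "?r q * (ln (real q) / L) \<le> 2 / L * (ln (real q) / real q)" by (simp add: field_simps)
    qed
    also have "\<dots> = 2 / L * (\<Sum>q\<in>?S. ln (real q) / real q)" by (simp add: sum_distrib_left)
    also have "\<dots> \<le> 2 / L * (\<Sum>q | prime q \<and> real q \<le> x. ln (real q) / real q)"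
    proof -
      have "(\<Sum>q\<in>?S. ln (real q) / real q) \<le> (\<Sum>q | prime q \<and> real q \<le> x. ln (real q) / real q)"
        unfolding S by (intro sum_mono2) (auto dest: prime_ge_1_nat)
      thus ?thesis using L by (intro mult_left_mono) auto
    qed
    also have "\<dots> \<le> 2 / L * (ln x + 4)" using L elim by (intro mult_left_mono sum_ln_prime_le) auto
    also have "\<dots> = 2 * ((ln x + 4) / ln x)" by (simp add: L_def)
    also have "\<dots> \<le> 10" using elim by linarith
    finally have s10: "(\<Sum>q\<in>?S. ?r q * (ln (real q) / L)) \<le> 10" .
    have "(\<Prod>q\<in>?S. 1 - ?r q) \<le> (\<Prod>q\<in>?S. 1 - 1 / real q)"
      using r_bd by (intro prod_mono) auto
    also have "\<dots> \<le> 1 / B_size x"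
    proof -
      have "small_primes x \<union> ?S = {q. prime q \<and> real q \<le> x}" using elim by (auto simp: S small_primes_def)
      hence "(\<Prod>q | prime q \<and> real q \<le> x. 1 - 1 / real q) = (\<Prod>q\<in>small_primes x. 1 - 1 / real q) * (\<Prod>q\<in>?S. 1 - 1 / real q)"
      proof (subst prod.union_disjoint[symmetric])
        show "finite ?S" by (rule finite_subset[of _ "sieve_primes x"]) auto
      qed (auto simp: sieve_primes_def small_primes_def)
      moreover have "(\<Prod>q | prime q \<and> real q \<le> x. 1 - 1 / real q) * ln x \<le> 1" using elim by (intro mertens_upper) auto
      ultimately have "B_size x * (\<Prod>q\<in>?S. 1 - 1 / real q) \<le> 1" unfolding B_size_eq by (simp add: mult_ac)
      moreover have "B_size x > 0" using elim by (intro B_size_pos) auto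
      ultimately show ?thesis by (simp add: field_simps)
    qed
    finally have Mb: "(\<Prod>q\<in>?S. 1 - ?r q) \<le> 1 / B_size x" .
    have "gmoment L ?r 3 (sieve_primes x) \<le> C * (1 / B_size x) * (1 + 10 / c)"
    proof (rule order_trans[OF g3], intro mult_mono mult_left_mono Mb add_left_mono divide_right_mono s10)
      show "0 \<le> C * (1 / B_size x)" using C B_size_pos[of x] elim by simp
      have "0 \<le> (\<Sum>q\<in>?S. ?r q * (ln (real q) / L))"
      proof (intro sum_nonneg mult_nonneg_nonneg)
        fix q assume "q \<in> ?S"
        hence q: "q \<in> sieve_primes x" by simp
        show "0 \<le> ?r q" by (rule r_bd(1)[OF q])
        show "0 \<le> ln (real q) / L" using pr[OF q] L by (intro divide_nonneg_nonneg ln_ge_zero) auto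
      qed
      thus "0 \<le> 1 + (\<Sum>q\<in>?S. ?r q * (ln (real q) / L)) / c" using c by simp
      show "0 \<le> (\<Prod>q\<in>?S. 1 - ?r q)" using r_bd(2) by (intro prod_nonneg) auto
    qed (use C c in auto)
    thus ?case by (simp add: L_def)
  qed
  thus ?thesis using that[of "C * (1 + 10 / c)"] C c by (simp add: add_pos_pos)
qed

text \<open>With y = a / ln x the expression equals a (E1 / E2) E3. E1 is \<zeta>(1 + y) times its
  inverse Euler product up to exp((ln x)^2), E2 = y \<zeta>(1 + y), and E3 compares the exponents 1
  and 1 + y over the primes up to w, where y ln w tends to 0. All three tend to 1.\<close>

lemma prod_sieve_asymp:
  assumes a: "a > 0"
  shows "((\<lambda>x. B_size x * (\<Prod>p\<in>sieve_primes x. 1 - real p powr (-(1 + a / ln x)))) \<longlongrightarrow> a) at_top"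
proof -
  define y where "y x = a / ln x" for x
  define f where "f x p = 1 - real p powr (-(1 + y x))" for x and p :: nat
  define All where "All x = {p. prime p \<and> real p \<le> exp ((ln x)\<^sup>2)}" for x
  define E1 where "E1 x = rzeta (1 + y x) * (\<Prod>p\<in>All x. f x p)" for x
  define E2 where "E2 x = y x * rzeta (1 + y x)" for x
  define E3 where "E3 x = (\<Prod>p\<in>small_primes x. 1 - 1 / real p) / (\<Prod>p\<in>small_primes x. f x p)" for x
  have ev: "\<forall>\<^sub>F x in at_top. x > exp 1 \<and> wlim x \<ge> 1 \<and> wlim x \<le> exp ((ln x)\<^sup>2)"
  proof (intro eventually_conj eventually_gt_at_top)
    show "\<forall>\<^sub>F x in at_top. wlim x \<ge> 1" using filterlim_wlim by (simp add: filterlim_at_top)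
    show "\<forall>\<^sub>F x in at_top. wlim x \<le> exp ((ln x)\<^sup>2)" unfolding wlim_def by real_asymp
  qed
  have ypos: "y x > 0" if "x > exp 1" for x
  proof -
    have "ln x > 0" using that by (smt (verit) exp_gt_one ln_gt_zero)
    thus ?thesis using a by (simp add: y_def)
  qed
  have fpos: "f x p > 0" if "x > exp 1" "prime p" for x p
    using one_minus_prime_powr(1)[OF that(2), of "1 + y x"] ypos[OF that(1)] by (simp add: f_def)
  have finA: "finite (All x)" for x unfolding All_def by simp
  have L1: "(E1 \<longlongrightarrow> 1) at_top"
  proof (rule tendsto_sandwich)
    show "\<forall>\<^sub>F x in at_top. 1 \<le> E1 x"
      using ev
    proof eventually_elim
      case (elim x)
      show ?case unfolding E1_def f_def by (rule euler_bounds(1)) (use ypos elim finA in \<open>auto simp: All_def\<close>)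
    qed
    show "\<forall>\<^sub>F x in at_top. E1 x \<le> 1 + exp (-(a / ln x) * ((ln x)\<^sup>2 - ln 2)) * (ln x / a)"
      using ev
    proof eventually_elim
      case (elim x)
      define N where "N = nat \<lfloor>exp ((ln x)\<^sup>2)\<rfloor>"
      have e1: "exp ((ln x)\<^sup>2) \<ge> 1" by simp
      have N: "N \<ge> 1" "real N \<le> exp ((ln x)\<^sup>2)" "exp ((ln x)\<^sup>2) < real N + 1" using e1 by (auto simp: N_def le_nat_iff)
      have "E1 x \<le> 1 + real N powr (-(y x)) / y x"
        unfolding E1_def f_def
      proof (rule euler_bounds(2))
        show "{p. prime p \<and> p \<le> N} \<subseteq> All x"
        proof
          fix p assume "p \<in> {p. prime p \<and> p \<le> N}"
          moreover from this have "real p \<le> real N" by simp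
          ultimately show "p \<in> All x" using N(2) by (simp add: All_def)
        qed
      qed (use ypos elim N finA in \<open>auto simp: All_def\<close>)
      note * = this
      have "real N powr (-(y x)) \<le> (exp ((ln x)\<^sup>2) / 2) powr (-(y x))"
      proof (rule powr_mono2')
        have "real N \<ge> 1" using N(1) by simp
        thus "exp ((ln x)\<^sup>2) / 2 \<le> real N" using N(3) by linarith
      qed (use ypos[of x] elim in auto)
      also have "\<dots> = exp (-(a / ln x) * ((ln x)\<^sup>2 - ln 2))"
        by (simp add: powr_def y_def ln_div)
      finally have "real N powr (-(y x)) / y x \<le> exp (-(a / ln x) * ((ln x)\<^sup>2 - ln 2)) / y x"
        using ypos[of x] elim by (intro divide_right_mono) auto
      with * have "E1 x \<le> 1 + exp (-(a / ln x) * ((ln x)\<^sup>2 - ln 2)) / y x" by linarith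
      thus ?case by (simp add: y_def)
    qed
    show "((\<lambda>x. 1 + exp (-(a / ln x) * ((ln x)\<^sup>2 - ln 2)) * (ln x / a)) \<longlongrightarrow> 1) at_top"
      using a by real_asymp
  qed auto
  have L2: "(E2 \<longlongrightarrow> 1) at_top"
  proof (rule tendsto_sandwich)
    show "\<forall>\<^sub>F x in at_top. 1 \<le> E2 x" using ev by eventually_elim (use ypos rzeta_bounds in \<open>auto simp: E2_def\<close>)
    show "\<forall>\<^sub>F x in at_top. E2 x \<le> 1 + y x" using ev by eventually_elim (use ypos rzeta_bounds in \<open>auto simp: E2_def\<close>)
    show "((\<lambda>x. 1 + y x) \<longlongrightarrow> 1) at_top" unfolding y_def using a by real_asymp
  qed auto
  have L3: "(E3 \<longlongrightarrow> 1) at_top"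
  proof (rule tendsto_sandwich)
    show "\<forall>\<^sub>F x in at_top. exp (-2 * (a / ln x) * (ln (wlim x) + 4)) \<le> E3 x"
      using ev
    proof eventually_elim
      case (elim x)
      have pos: "(\<Prod>p\<in>small_primes x. f x p) > 0" using fpos elim by (intro prod_pos) (auto simp: small_primes_def)
      have "(\<Prod>p\<in>small_primes x. f x p) * exp (-2 * y x * (ln (wlim x) + 4)) \<le> (\<Prod>p\<in>small_primes x. f x p) * exp (-2 * y x * (\<Sum>p\<in>small_primes x. ln (real p) / real p))"
        using sum_ln_prime_le[of "wlim x"] ypos[of x] elim pos unfolding small_primes_def by (intro mult_left_mono) (auto intro: less_imp_le)
      also have "\<dots> = (\<Prod>p\<in>small_primes x. f x p * exp (-2 * y x * (ln (real p) / real p)))"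
        unfolding prod.distrib sum_distrib_left exp_sum[OF finite_small_primes] ..
      also have "\<dots> \<le> (\<Prod>p\<in>small_primes x. 1 - 1 / real p)"
      proof (rule prod_mono)
        fix p assume "p \<in> small_primes x"
        hence p: "prime p" by (simp add: small_primes_def)
        have "0 \<le> f x p" using fpos[OF _ p, of x] elim by simp
        thus "0 \<le> f x p * exp (-2 * y x * (ln (real p) / real p)) \<and> f x p * exp (-2 * y x * (ln (real p) / real p)) \<le> 1 - 1 / real p"
          using one_minus_prime_powr_shift[OF p ypos[of x]] elim unfolding f_def by (intro conjI mult_nonneg_nonneg) auto
      qed
      finally show ?case using pos by (simp add: E3_def field_simps y_def)
    qed
    show "\<forall>\<^sub>F x in at_top. E3 x \<le> 1"
      using ev
    proof eventually_elim
      case (elim x)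
      have pos: "(\<Prod>p\<in>small_primes x. f x p) > 0" using fpos elim by (intro prod_pos) (auto simp: small_primes_def)
      have "(\<Prod>p\<in>small_primes x. 1 - 1 / real p) \<le> (\<Prod>p\<in>small_primes x. f x p)"
      proof (rule prod_mono)
        fix p assume "p \<in> small_primes x"
        hence p: "prime p" by (simp add: small_primes_def)
        have p2: "real p \<ge> 2" using prime_ge_2_nat[OF p] by simp
        have "real p powr (-(1 + y x)) \<le> real p powr (-1)" using p2 ypos[of x] elim by (intro powr_mono) auto
        thus "0 \<le> 1 - 1 / real p \<and> 1 - 1 / real p \<le> f x p" using p2 by (simp add: f_def powr_minus inverse_eq_divide)
      qed
      thus ?case using pos by (simp add: E3_def)
    qed
    show "((\<lambda>x. exp (-2 * (a / ln x) * (ln (wlim x) + 4))) \<longlongrightarrow> 1) at_top"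
      unfolding wlim_def by real_asymp
  qed auto
  have "((\<lambda>x. a * (E1 x / E2 x) * E3 x) \<longlongrightarrow> a * (1 / 1) * 1) at_top"
    by (intro tendsto_intros L1 L2 L3) auto
  moreover have "\<forall>\<^sub>F x in at_top. a * (E1 x / E2 x) * E3 x = B_size x * (\<Prod>p\<in>sieve_primes x. 1 - real p powr (-(1 + a / ln x)))"
    using ev
  proof eventually_elim
    case (elim x)
    have "small_primes x \<union> sieve_primes x = All x" using elim by (auto simp: small_primes_def sieve_primes_def All_def)
    moreover have "small_primes x \<inter> sieve_primes x = {}" by (auto simp: small_primes_def sieve_primes_def)
    ultimately have A: "(\<Prod>p\<in>All x. f x p) = (\<Prod>p\<in>small_primes x. f x p) * (\<Prod>p\<in>sieve_primes x. f x p)"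
      using prod.union_disjoint[OF finite_small_primes finite_sieve_primes, of x x "f x"] by simp
    have pos: "(\<Prod>p\<in>small_primes x. f x p) > 0" using fpos elim by (intro prod_pos) (auto simp: small_primes_def)
    have rz: "rzeta (1 + y x) > 0" using rzeta_pos ypos elim by blast
    have yx: "y x > 0" using ypos elim by blast
    have "ln x = a / y x" using a by (simp add: y_def)
    have gen: "a * (r * (s * q) / (y * r)) * (V / s) = (V * (a / y)) * q" if "r > 0" "s > 0" "y > 0" for r s q y V :: real
      using that by (simp add: field_simps)
    show ?case
      unfolding E1_def E2_def E3_def A B_size_eq \<open>ln x = a / y x\<close> gen[OF rz pos yx] using a by (simp add: f_def y_def)
  qed
  ultimately have "((\<lambda>x. B_size x * (\<Prod>p\<in>sieve_primes x. 1 - real p powr (-(1 + a / ln x)))) \<longlongrightarrow> a * (1 / 1) * 1) at_top"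
    by (rule Lim_transform_eventually)
  thus ?thesis by simp
qed

lemma ln_one_minus_bound: "0 \<le> (t::real) \<Longrightarrow> t \<le> 1/2 \<Longrightarrow> \<bar>ln (1 - t) + t\<bar> \<le> 2 * t\<^sup>2"
  using abs_ln_one_plus_x_minus_x_bound[of "-t"] by simp

text \<open>To first order in 1/q both sides are governed by 1 - (1 - \<alpha>)(1 - \<beta>) =
  \<alpha> + \<beta> - \<alpha> \<beta>. With \<alpha> = p^(-a / ln x) and \<beta> = p^(-b / ln x)
  the right-hand side is the local factor of \<zeta>(1 + (a+b)/ln x) / (\<zeta>(1 + a/ln x)
  \<zeta>(1 + b/ln x)).\<close>

lemma euler_factor_compare:
  fixes q :: real and \<alpha> \<beta> :: "nat \<Rightarrow> real"
  assumes I: "finite I" and q: "q \<ge> 4 * real (card I) + 4"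
    and ab: "\<And>i. i \<in> I \<Longrightarrow> 0 \<le> \<alpha> i \<and> \<alpha> i \<le> 1" "\<And>i. i \<in> I \<Longrightarrow> 0 \<le> \<beta> i \<and> \<beta> i \<le> 1"
  defines "s \<equiv> (\<Sum>i\<in>I. 1 - (1 - \<alpha> i) * (1 - \<beta> i)) / (q - 1)"
  shows "1 - s > 0"
    and "\<bar>ln (1 - s) - (\<Sum>i\<in>I. ln (1 - \<alpha> i / q) + ln (1 - \<beta> i / q) - ln (1 - \<alpha> i * \<beta> i / q))\<bar>
      \<le> (8 * real (card I) ^ 2 + 8 * real (card I)) * (1 / q ^ 2)"
proof -
  define m where "m = real (card I)"
  have q4: "q \<ge> 4 * m + 4" "m \<ge> 0" using q by (auto simp: m_def)
  define c where "c i = 1 - (1 - \<alpha> i) * (1 - \<beta> i)" for i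
  have c: "0 \<le> c i" "c i \<le> 1" if "i \<in> I" for i
  proof -
    have "0 \<le> (1 - \<alpha> i) * (1 - \<beta> i)" using ab that by (intro mult_nonneg_nonneg) auto
    moreover have "(1 - \<alpha> i) * (1 - \<beta> i) \<le> 1 * 1" using ab that by (intro mult_mono) auto
    ultimately show "0 \<le> c i" "c i \<le> 1" by (auto simp: c_def)
  qed
  have S: "0 \<le> (\<Sum>i\<in>I. c i)" "(\<Sum>i\<in>I. c i) \<le> m"
    using c sum_bounded_above[of I c 1] by (auto intro!: sum_nonneg simp: m_def)
  have s_eq: "s = (\<Sum>i\<in>I. c i) / (q - 1)" by (simp add: s_def c_def)
  have s0: "0 \<le> s" using S q4 by (simp add: s_eq)
  have sm: "s \<le> 2 * m * (1 / q)"
  proof -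
    have "s \<le> m / (q / 2)" unfolding s_eq using S q4 by (intro frac_le) auto
    thus ?thesis by (simp add: mult.commute)
  qed
  have s2: "s \<le> 1/2"
  proof -
    have "2 * m * (1 / q) \<le> 1/2" using q4 by (simp add: field_simps)
    thus ?thesis using sm by linarith
  qed
  thus "1 - s > 0" by simp
  have "\<bar>ln (1 - s) + s\<bar> \<le> 2 * s\<^sup>2" by (rule ln_one_minus_bound[OF s0 s2])
  also have "s\<^sup>2 \<le> (2 * m * (1 / q))\<^sup>2" using sm s0 by (intro power_mono)
  finally have 1: "\<bar>ln (1 - s) + s\<bar> \<le> 8 * m\<^sup>2 * (1 / q ^ 2)" by (simp add: power_mult_distrib power_divide)
  have 2: "\<bar>s - (\<Sum>i\<in>I. c i / q)\<bar> \<le> 2 * m * (1 / q ^ 2)"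
  proof -
    have "s - (\<Sum>i\<in>I. c i / q) = (\<Sum>i\<in>I. c i) * (1 / (q - 1) - 1 / q)"
      by (simp add: s_eq sum_divide_distrib[symmetric] right_diff_distrib)
    also have "1 / (q - 1) - 1 / q = 1 / ((q - 1) * q)" using q4 by (simp add: field_simps)
    finally have eq: "s - (\<Sum>i\<in>I. c i / q) = (\<Sum>i\<in>I. c i) * (1 / ((q - 1) * q))" .
    have "1 / ((q - 1) * q) \<le> 1 / ((q / 2) * q)" using q4 by (intro divide_left_mono mult_right_mono mult_pos_pos) auto
    hence "(\<Sum>i\<in>I. c i) * (1 / ((q - 1) * q)) \<le> m * (1 / ((q / 2) * q))"
      using S q4 by (intro mult_mono) auto
    also have "\<dots> = 2 * m * (1 / q ^ 2)" by (simp add: power2_eq_square)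
    finally show ?thesis unfolding eq using S q4 by (simp add: abs_mult)
  qed
  have lb: "\<bar>ln (1 - t / q) + t / q\<bar> \<le> 2 * (1 / q ^ 2)" if "0 \<le> t" "t \<le> 1" for t
  proof -
    have "t / q \<le> 1 / q" using that q4 by (intro divide_right_mono) auto
    moreover have "1 / q \<le> 1/2" using q4 by (simp add: field_simps)
    ultimately have "\<bar>ln (1 - t / q) + t / q\<bar> \<le> 2 * (t / q)\<^sup>2"
      using that q4 by (intro ln_one_minus_bound) auto
    also have "(t / q)\<^sup>2 \<le> (1 / q)\<^sup>2" using \<open>t / q \<le> 1 / q\<close> that q4 by (intro power_mono) auto
    finally show ?thesis by (simp add: power_divide)
  qed
  define \<Lambda> where "\<Lambda> i = ln (1 - \<alpha> i / q) + ln (1 - \<beta> i / q) - ln (1 - \<alpha> i * \<beta> i / q)" for i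
  have "\<bar>\<Lambda> i + c i / q\<bar> \<le> 6 * (1 / q ^ 2)" if "i \<in> I" for i
  proof -
    have "0 \<le> \<alpha> i * \<beta> i" "\<alpha> i * \<beta> i \<le> 1 * 1" using ab[OF that] by (intro mult_nonneg_nonneg mult_mono; simp)+
    hence "\<bar>ln (1 - \<alpha> i * \<beta> i / q) + \<alpha> i * \<beta> i / q\<bar> \<le> 2 * (1 / q ^ 2)" by (intro lb) auto
    moreover have "c i / q = \<alpha> i / q + \<beta> i / q - \<alpha> i * \<beta> i / q"
    proof -
      have "c i = \<alpha> i + \<beta> i - \<alpha> i * \<beta> i" by (simp add: c_def algebra_simps)
      thus ?thesis by (simp only: add_divide_distrib diff_divide_distrib)
    qed
    moreover have "\<bar>ln (1 - \<alpha> i / q) + \<alpha> i / q\<bar> \<le> 2 * (1 / q ^ 2)" "\<bar>ln (1 - \<beta> i / q) + \<beta> i / q\<bar> \<le> 2 * (1 / q ^ 2)"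
      using lb[of "\<alpha> i"] lb[of "\<beta> i"] ab[OF that] by auto
    ultimately show ?thesis unfolding \<Lambda>_def by linarith
  qed
  hence "\<bar>\<Sum>i\<in>I. \<Lambda> i + c i / q\<bar> \<le> (\<Sum>i\<in>I. 6 * (1 / q ^ 2))"
    by (intro order_trans[OF sum_abs] sum_mono) auto
  hence 3: "\<bar>(\<Sum>i\<in>I. \<Lambda> i) + (\<Sum>i\<in>I. c i / q)\<bar> \<le> m * (6 * (1 / q ^ 2))"
    by (simp add: sum.distrib m_def)
  have "\<bar>ln (1 - s) - (\<Sum>i\<in>I. \<Lambda> i)\<bar> \<le> 8 * m\<^sup>2 * (1 / q ^ 2) + 2 * m * (1 / q ^ 2) + m * (6 * (1 / q ^ 2))"
    using 1 2 3 by linarith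
  also have "\<dots> = (8 * m\<^sup>2 + 8 * m) * (1 / q ^ 2)" by (simp add: algebra_simps)
  finally show "\<bar>ln (1 - s) - (\<Sum>i\<in>I. ln (1 - \<alpha> i / q) + ln (1 - \<beta> i / q) - ln (1 - \<alpha> i * \<beta> i / q))\<bar>
      \<le> (8 * real (card I) ^ 2 + 8 * real (card I)) * (1 / q ^ 2)" by (simp add: \<Lambda>_def m_def)
qed

text \<open>The Euler product of the model is replaced by quotients of the products in
  \<open>prod_sieve_asymp\<close>. The replacement costs exp of O(sum of 1/p^2 over p > w), which
  tends to 1 because w tends to infinity: here the preliminary sieving by W is essential. The limit
  a b / (a + b) is the integral of the product of the derivatives of exp(-a t) and exp(-b
  t).\<close>

lemma sform_exp_limit:
  assumes I: "finite I" "0 \<notin> I" and a: "\<And>j. j \<in> I \<times> UNIV \<Longrightarrow> a j > 0"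
  shows "((\<lambda>x. B_size x ^ card I * sform (ln x) I (sieve_primes x) (\<lambda>j t. exp (-a j * t))) \<longlongrightarrow>
     (\<Prod>i\<in>I. a (i,True) * a (i,False) / (a (i,True) + a (i,False)))) at_top"
proof -
  define m where "m = card I"
  define C where "C = 8 * real m ^ 2 + 8 * real m"
  have C: "C \<ge> 0" by (simp add: C_def)
  define Z where "Z b x = (\<Prod>p\<in>sieve_primes x. 1 - real p powr (-(1 + b / ln x)))" for b x
  \<comment> \<open>The quotient of the model expectation and the zeta-type products; everything
    below shows that it is exp u with u tending to 0.\<close>
  define E where "E x = B_size x ^ m * sform (ln x) I (sieve_primes x) (\<lambda>j t. exp (-a j * t)) /
      (\<Prod>i\<in>I. (B_size x * Z (a (i,True)) x) * (B_size x * Z (a (i,False)) x) / (B_size x * Z (a (i,True) + a (i,False)) x))" for x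
  have ev: "\<forall>\<^sub>F x in at_top. x > exp 1 \<and> wlim x \<ge> 1 \<and> (\<forall>p\<in>sieve_primes x. p \<ge> 4 * m + 4)"
  proof (intro eventually_conj eventually_gt_at_top eventually_sieve_primes_ge)
    show "\<forall>\<^sub>F x in at_top. wlim x \<ge> 1" using filterlim_wlim by (simp add: filterlim_at_top)
  qed
  have bound: "\<forall>\<^sub>F x in at_top. \<exists>u. E x = exp u \<and> \<bar>u\<bar> \<le> C * (2 / wlim x)"
    using ev
  proof eventually_elim
    case (elim x)
    define L where "L = ln x"
    have L: "L > 0" using elim unfolding L_def by (smt (verit) exp_gt_one ln_gt_zero)
    have B: "B_size x > 0" using elim by (intro B_size_pos) (smt (verit) exp_gt_one)
    define e where "e b p = exp (-b * (ln (real p) / L))" for b and p :: nat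
    have pr: "prime p" "real p \<ge> 4 * real m + 4" if "p \<in> sieve_primes x" for p
    proof -
      have "p \<ge> 4 * m + 4" using elim that by blast
      thus "real p \<ge> 4 * real m + 4" using of_nat_le_iff[of "4 * m + 4" p, where 'a = real] by simp
    qed (use that in \<open>simp add: sieve_primes_def\<close>)
    have ep: "real p powr (-(1 + b / ln x)) = e b p / real p" if "p \<in> sieve_primes x" for b p
    proof -
      have "real p > 0" using pr[OF that] by linarith
      have "real p powr (-(1 + b / ln x)) = real p powr (-(b / L)) * real p powr (-1)"
        by (subst powr_add[symmetric]) (simp add: L_def minus_diff_commute)
      also have "real p powr (-(b / L)) = e b p" using \<open>real p > 0\<close> by (simp add: powr_def e_def)
      finally show ?thesis using \<open>real p > 0\<close> by (simp add: powr_minus field_simps)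
    qed
    have e01: "0 < e b p \<and> e b p \<le> 1" if "b > 0" "p \<in> sieve_primes x" for b p
    proof -
      have "real p \<ge> 1" using pr[OF that(2)] by linarith
      hence "0 \<le> b * (ln (real p) / L)" using that L by (intro mult_nonneg_nonneg divide_nonneg_nonneg ln_ge_zero) auto
      thus ?thesis by (simp add: e_def)
    qed
    have eadd: "e (b + b') p = e b p * e b' p" for b b' p
    proof -
      have *: "- (b + b') * u = - b * u + - b' * u" for u :: real by (simp add: algebra_simps)
      show ?thesis unfolding e_def exp_add[symmetric] * ..
    qed
    define s where "s p = (\<Sum>i\<in>I. 1 - (1 - e (a (i,True)) p) * (1 - e (a (i,False)) p)) / (real p - 1)" for p
    define ell where "ell p = ln (1 - s p) - (\<Sum>i\<in>I. ln (1 - e (a (i,True)) p / real p) + ln (1 - e (a (i,False)) p / real p) - ln (1 - e (a (i,True)) p * e (a (i,False)) p / real p))" for p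
    have cmp: "1 - s p > 0" "\<bar>ell p\<bar> \<le> C * (1 / real p ^ 2)" if "p \<in> sieve_primes x" for p
      using euler_factor_compare[OF I(1), of "real p" "\<lambda>i. e (a (i,True)) p" "\<lambda>i. e (a (i,False)) p"] that pr[OF that] e01 a
      unfolding s_def ell_def C_def m_def by (auto simp: less_imp_le)
    have fpos: "1 - t / real p > 0" if "0 \<le> t" "t \<le> 1" "p \<in> sieve_primes x" for t p
      using that pr[of p] by (simp add: field_simps)
    have e2: "0 \<le> e (a (i,True)) p * e (a (i,False)) p \<and> e (a (i,True)) p * e (a (i,False)) p \<le> 1" if "i \<in> I" "p \<in> sieve_primes x" for i p
    proof -
      have "e (a (i,True)) p * e (a (i,False)) p \<le> 1 * 1" using e01 a that by (intro mult_mono) (auto simp: less_imp_le)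
      thus ?thesis using e01 a that by (auto simp: less_imp_le)
    qed
    define F where "F i p = (1 - e (a (i,True)) p / real p) * (1 - e (a (i,False)) p / real p) / (1 - e (a (i,True)) p * e (a (i,False)) p / real p)" for i p
    have Fpos: "F i p > 0" if "i \<in> I" "p \<in> sieve_primes x" for i p
      unfolding F_def using that e01 e2 a by (intro divide_pos_pos mult_pos_pos fpos) (auto simp: less_imp_le)
    have lnF: "ln (F i p) = ln (1 - e (a (i,True)) p / real p) + ln (1 - e (a (i,False)) p / real p) - ln (1 - e (a (i,True)) p * e (a (i,False)) p / real p)"
      if "i \<in> I" "p \<in> sieve_primes x" for i p
    proof -
      have h1: "1 - e (a (i,True)) p / real p > 0" by (rule fpos) (use that e01 a in \<open>auto simp: less_imp_le\<close>)
      have h2: "1 - e (a (i,False)) p / real p > 0" by (rule fpos) (use that e01 a in \<open>auto simp: less_imp_le\<close>)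
      have h3: "1 - e (a (i,True)) p * e (a (i,False)) p / real p > 0" by (rule fpos) (use that e2 in auto)
      show ?thesis unfolding F_def ln_divide_pos[OF mult_pos_pos[OF h1 h2] h3] ln_mult_pos[OF h1 h2] ..
    qed
    have "1 - s p = exp (ell p) * (\<Prod>i\<in>I. F i p)" if "p \<in> sieve_primes x" for p
    proof -
      have "(\<Prod>i\<in>I. F i p) = exp (\<Sum>i\<in>I. ln (F i p))"
        using Fpos that I by (simp add: exp_sum)
      also have "(\<Sum>i\<in>I. ln (F i p)) = ln (1 - s p) - ell p"
        using that by (simp add: ell_def lnF)
      finally show ?thesis using cmp(1)[OF that] by (simp add: exp_add[symmetric])
    qed
    hence "(\<Prod>p\<in>sieve_primes x. 1 - s p) = (\<Prod>p\<in>sieve_primes x. exp (ell p) * (\<Prod>i\<in>I. F i p))" by simp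
    also have "\<dots> = exp (\<Sum>p\<in>sieve_primes x. ell p) * (\<Prod>i\<in>I. \<Prod>p\<in>sieve_primes x. F i p)"
      by (simp add: prod.distrib exp_sum prod.swap[of _ I])
    also have "(\<Prod>i\<in>I. \<Prod>p\<in>sieve_primes x. F i p) = (\<Prod>i\<in>I. Z (a (i,True)) x * Z (a (i,False)) x / Z (a (i,True) + a (i,False)) x)"
    proof -
      have Zeq: "Z b x = (\<Prod>p\<in>sieve_primes x. 1 - e b p / real p)" for b
        unfolding Z_def by (intro prod.cong refl) (simp only: ep)
      show ?thesis unfolding Zeq eadd F_def prod_dividef prod.distrib ..
    qed
    finally have main: "sform (ln x) I (sieve_primes x) (\<lambda>j t. exp (-a j * t)) =
       exp (\<Sum>p\<in>sieve_primes x. ell p) * (\<Prod>i\<in>I. Z (a (i,True)) x * Z (a (i,False)) x / Z (a (i,True) + a (i,False)) x)"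
      using elim by (subst sform_exp[OF I]) (auto simp: s_def e_def L_def)
    have Zpos: "Z b x > 0" if "b > 0" for b
      unfolding Z_def
    proof (rule prod_pos)
      fix p assume p: "p \<in> sieve_primes x"
      show "0 < 1 - real p powr (-(1 + b / ln x))"
        unfolding ep[OF p] using e01[OF that p] p by (intro fpos) auto
    qed
    have "(\<Prod>i\<in>I. (B_size x * Z (a (i,True)) x) * (B_size x * Z (a (i,False)) x) / (B_size x * Z (a (i,True) + a (i,False)) x))
       = (\<Prod>i\<in>I. B_size x * (Z (a (i,True)) x * Z (a (i,False)) x / Z (a (i,True) + a (i,False)) x))"
      using B by (intro prod.cong refl) simp
    also have "\<dots> = B_size x ^ m * (\<Prod>i\<in>I. Z (a (i,True)) x * Z (a (i,False)) x / Z (a (i,True) + a (i,False)) x)"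
      by (simp only: prod.distrib prod_constant m_def)
    finally have den: "(\<Prod>i\<in>I. (B_size x * Z (a (i,True)) x) * (B_size x * Z (a (i,False)) x) / (B_size x * Z (a (i,True) + a (i,False)) x)) = B_size x ^ m * (\<Prod>i\<in>I. Z (a (i,True)) x * Z (a (i,False)) x / Z (a (i,True) + a (i,False)) x)" .
    have "(\<Prod>i\<in>I. Z (a (i,True)) x * Z (a (i,False)) x / Z (a (i,True) + a (i,False)) x) > 0"
      using a by (intro prod_pos) (auto intro!: divide_pos_pos mult_pos_pos Zpos add_pos_pos)
    hence "E x = exp (\<Sum>p\<in>sieve_primes x. ell p)"
      unfolding E_def den main using B by simp
    moreover have "\<bar>\<Sum>p\<in>sieve_primes x. ell p\<bar> \<le> C * (2 / wlim x)"
    proof -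
      have "\<bar>\<Sum>p\<in>sieve_primes x. ell p\<bar> \<le> (\<Sum>p\<in>sieve_primes x. C * (1 / real p ^ 2))"
        using cmp(2) by (intro order_trans[OF sum_abs] sum_mono)
      also have "\<dots> = C * (\<Sum>p\<in>sieve_primes x. 1 / real p ^ 2)" by (simp add: sum_distrib_left)
      also have "\<dots> \<le> C * (2 / wlim x)"
        using elim C by (intro mult_left_mono sum_inv_sq_sieve_primes) auto
      finally show ?thesis .
    qed
    ultimately show ?case by blast
  qed
  have E1: "(E \<longlongrightarrow> 1) at_top"
  proof (rule tendsto_sandwich)
    show "\<forall>\<^sub>F x in at_top. exp (-(C * (2 / wlim x))) \<le> E x"
      using bound by eventually_elim auto
    show "\<forall>\<^sub>F x in at_top. E x \<le> exp (C * (2 / wlim x))"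
      using bound by eventually_elim auto
    have "((\<lambda>x. C * (2 / wlim x)) \<longlongrightarrow> C * 0) at_top"
      by (intro tendsto_mult tendsto_const tendsto_divide_0[OF tendsto_const] filterlim_at_top_imp_at_infinity filterlim_wlim)
    hence *: "((\<lambda>x. C * (2 / wlim x)) \<longlongrightarrow> 0) at_top" by simp
    show "((\<lambda>x. exp (C * (2 / wlim x))) \<longlongrightarrow> 1) at_top" using tendsto_exp[OF *] by simp
    show "((\<lambda>x. exp (-(C * (2 / wlim x)))) \<longlongrightarrow> 1) at_top" using tendsto_exp[OF tendsto_minus[OF *]] by simp
  qed
  let ?D = "\<lambda>x. (\<Prod>i\<in>I. (B_size x * Z (a (i,True)) x) * (B_size x * Z (a (i,False)) x) / (B_size x * Z (a (i,True) + a (i,False)) x))"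
  have lim: "(?D \<longlongrightarrow> (\<Prod>i\<in>I. a (i,True) * a (i,False) / (a (i,True) + a (i,False)))) at_top"
    unfolding Z_def
  proof (intro tendsto_prod tendsto_divide tendsto_mult prod_sieve_asymp)
    fix i assume "i \<in> I"
    hence "a (i,True) > 0" "a (i,False) > 0" using a by auto
    thus "0 < a (i,True)" "0 < a (i,False)" "0 < a (i,True) + a (i,False)" "a (i,True) + a (i,False) \<noteq> 0" by auto
  qed
  have pos: "(\<Prod>i\<in>I. a (i,True) * a (i,False) / (a (i,True) + a (i,False))) > 0"
    using a by (intro prod_pos) (auto intro!: divide_pos_pos mult_pos_pos add_pos_pos)
  have "((\<lambda>x. E x * ?D x) \<longlongrightarrow> 1 * (\<Prod>i\<in>I. a (i,True) * a (i,False) / (a (i,True) + a (i,False)))) at_top"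
    by (intro tendsto_mult E1 lim)
  moreover have "\<forall>\<^sub>F x in at_top. E x * ?D x = B_size x ^ card I * sform (ln x) I (sieve_primes x) (\<lambda>j t. exp (-a j * t))"
    using order_tendstoD(1)[OF lim pos] by eventually_elim (simp add: E_def m_def)
  ultimately show ?thesis using Lim_transform_eventually by fastforce
qed

section \<open>Approximation by exponentials\<close>

lemma at_within_atLeast_neq_bot: "t \<ge> (0::real) \<Longrightarrow> at t within {0..} \<noteq> bot"
proof -
  assume "t \<ge> 0"
  hence "at_right t \<le> at t within {0..}" by (intro at_le) auto
  thus ?thesis using trivial_limit_at_right_real[of t] by (metis bot.extremum_uniqueI trivial_limit_def)
qed

lemma deriv_halfline_eq:
  assumes "t \<ge> 0" "(f has_real_derivative d) (at t within {0..})"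
  shows "deriv_halfline f t = d"
  unfolding deriv_halfline_def
  using vector_derivative_within[OF at_within_atLeast_neq_bot[OF assms(1)]] assms(2)
  by (simp add: has_real_derivative_iff_has_vector_derivative)

lemma dchain_derivs:
  assumes "dchain j \<nu> f D" "j \<ge> 2"
  shows "t \<ge> 0 \<Longrightarrow> (f has_real_derivative deriv_halfline f t) (at t within {0..})"
    and "continuous_on {0..} (deriv_halfline f)"
    and "t \<ge> 0 \<Longrightarrow> \<bar>deriv_halfline f t\<bar> \<le> \<nu> * exp (-t)"
proof -
  have D: "D 0 t = f t" "(D 0 has_real_derivative D 1 t) (at t within {0..})" "(D 1 has_real_derivative D 2 t) (at t within {0..})"
     "\<bar>D 1 t\<bar> \<le> \<nu> * exp (-t)" if "t \<ge> 0" for t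
    using assms that unfolding dchain_def
    by (auto simp: numeral_2_eq_2 One_nat_def)
  have df: "(f has_real_derivative D 1 t) (at t within {0..})" if "t \<ge> 0" for t
    by (rule has_field_derivative_transform_within[OF D(2)[OF that], of 1]) (use that D(1) in auto)
  have eq: "deriv_halfline f t = D 1 t" if "t \<ge> 0" for t using deriv_halfline_eq[OF that df[OF that]] .
  show "t \<ge> 0 \<Longrightarrow> (f has_real_derivative deriv_halfline f t) (at t within {0..})" using df eq by simp
  have "continuous_on {0..} (D 1)"
    using D(3) by (intro DERIV_continuous_on) auto
  thus "continuous_on {0..} (deriv_halfline f)"
    by (subst continuous_on_cong[of "{0..}" "{0..}" _ "D 1"]) (auto simp: eq)
  show "t \<ge> 0 \<Longrightarrow> \<bar>deriv_halfline f t\<bar> \<le> \<nu> * exp (-t)" using D(4) eq by simp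
qed

lemma dbound_derivs:
  assumes "dbound 3 \<nu> f"
  shows "t \<ge> 0 \<Longrightarrow> (f has_real_derivative deriv_halfline f t) (at t within {0..})"
    and "continuous_on {0..} (deriv_halfline f)"
    and "t \<ge> 0 \<Longrightarrow> \<bar>deriv_halfline f t\<bar> \<le> \<nu> * exp (-t)"
  using assms dchain_derivs[of 3 \<nu> f] unfolding dbound_def by auto

lemma dbound_nonneg: "dbound j \<nu> f \<Longrightarrow> \<nu> \<ge> 0"
  using dbound_abs_le[of j \<nu> f 0] by simp

lemma dbound_add:
  assumes "dbound j \<nu> f" "dbound j \<mu> g"
  shows "dbound j (\<nu> + \<mu>) (\<lambda>t. f t + g t)"
proof -
  obtain D E where D: "dchain j \<nu> f D" and E: "dchain j \<mu> g E" using assms by (auto simp: dbound_def)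
  have "dchain j (\<nu> + \<mu>) (\<lambda>t. f t + g t) (\<lambda>i t. D i t + E i t)"
    unfolding dchain_def
  proof (intro conjI allI impI)
    fix i t assume "i \<le> j" "(0::real) \<le> t"
    hence "\<bar>D i t\<bar> \<le> \<nu> * exp (-t)" "\<bar>E i t\<bar> \<le> \<mu> * exp (-t)" using D E by (auto simp: dchain_def)
    thus "\<bar>D i t + E i t\<bar> \<le> (\<nu> + \<mu>) * exp (-t)" by (simp add: distrib_right)
  qed (use D E in \<open>auto simp: dchain_def intro!: DERIV_add\<close>)
  thus ?thesis unfolding dbound_def by blast
qed

lemma dbound_cmult:
  assumes "dbound j \<nu> f"
  shows "dbound j (\<bar>c\<bar> * \<nu>) (\<lambda>t. c * f t)"
proof -
  obtain D where D: "dchain j \<nu> f D" using assms by (auto simp: dbound_def)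
  have "dchain j (\<bar>c\<bar> * \<nu>) (\<lambda>t. c * f t) (\<lambda>i t. c * D i t)"
    unfolding dchain_def
  proof (intro conjI allI impI)
    fix i t assume "i \<le> j" "(0::real) \<le> t"
    hence "\<bar>D i t\<bar> \<le> \<nu> * exp (-t)" using D by (auto simp: dchain_def)
    thus "\<bar>c * D i t\<bar> \<le> \<bar>c\<bar> * \<nu> * exp (-t)" by (simp add: abs_mult mult.assoc mult_left_mono)
  qed (use D in \<open>auto simp: dchain_def intro!: DERIV_cmult\<close>)
  thus ?thesis unfolding dbound_def by blast
qed

lemma dbound_zero: "dbound j 0 (\<lambda>_. 0)"
  unfolding dbound_def dchain_def by (rule exI[of _ "\<lambda>_ _. 0"]) auto

lemma dbound_sum:
  assumes "finite N" "\<And>n. n \<in> N \<Longrightarrow> \<exists>\<nu>. dbound j \<nu> (h n)"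
  shows "\<exists>\<nu>. dbound j \<nu> (\<lambda>t. \<Sum>n\<in>N. c n * h n t)"
  using assms
proof (induction N)
  case empty
  show ?case using dbound_zero by auto
next
  case (insert n N)
  then obtain \<nu> \<mu> where "dbound j \<nu> (h n)" "dbound j \<mu> (\<lambda>t. \<Sum>n\<in>N. c n * h n t)" by fastforce
  from dbound_add[OF dbound_cmult[OF this(1)] this(2)] insert.hyps show ?case by auto
qed

lemma dbound_exp:
  assumes "a \<ge> 1"
  shows "dbound j (a ^ j) (\<lambda>t. exp (-a * t))"
proof -
  have "dchain j (a ^ j) (\<lambda>t. exp (-a * t)) (\<lambda>i t. (-a) ^ i * exp (-a * t))"
    unfolding dchain_def
  proof (intro conjI allI impI)
    fix i t assume "i < j" "(0::real) \<le> t"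
    show "((\<lambda>t. (-a) ^ i * exp (-a * t)) has_real_derivative (-a) ^ Suc i * exp (-a * t)) (at t within {0..})"
      by (auto intro!: derivative_eq_intros)
  next
    fix i t assume it: "i \<le> j" "(0::real) \<le> t"
    have "a ^ i \<le> a ^ j" using assms it by (intro power_increasing) auto
    moreover have "exp (-a * t) \<le> exp (-t)" using assms it by (simp add: mult_le_cancel_right1)
    ultimately show "\<bar>(-a) ^ i * exp (-a * t)\<bar> \<le> a ^ j * exp (-t)"
      using assms by (simp add: abs_mult power_abs) (intro mult_mono, auto)
  qed auto
  thus ?thesis unfolding dbound_def by blast
qed

text \<open>The integral extends over the whole half-line so that it also makes sense for
  exponentials; for F with support inside [0, 1) it is the integral over [0, 1], by
  \<open>cpair_eq_integral_01\<close>.\<close>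

definition cpair :: "(real \<Rightarrow> real) \<Rightarrow> (real \<Rightarrow> real) \<Rightarrow> real" where
  "cpair f g = integral {0..} (\<lambda>t. deriv_halfline f t * deriv_halfline g t)"

lemma cpair_integrable:
  assumes f: "dbound 3 \<nu> f" and g: "dbound 3 \<mu> g"
  shows "(\<lambda>t. deriv_halfline f t * deriv_halfline g t) integrable_on {0..}"
    and "\<bar>cpair f g\<bar> \<le> \<nu> * \<mu>"
proof -
  have exp2: "((\<lambda>t::real. exp (-2 * t)) has_integral (exp (-2 * 0) / 2)) {0..}"
    by (rule has_integral_exp_minus_to_infinity) simp
  hence dom: "((\<lambda>t::real. \<nu> * \<mu> * exp (-2 * t)) has_integral (\<nu> * \<mu> * (1/2))) {0..}"
    using has_integral_mult_right[OF exp2, of "\<nu> * \<mu>"] by simp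
  have le: "norm (deriv_halfline f t * deriv_halfline g t) \<le> \<nu> * \<mu> * exp (-2 * t)" if "t \<in> {0..}" for t
  proof -
    have "\<bar>deriv_halfline f t\<bar> * \<bar>deriv_halfline g t\<bar> \<le> (\<nu> * exp (-t)) * (\<mu> * exp (-t))"
      using that dbound_nonneg[OF f] by (intro mult_mono dbound_derivs(3)[OF f] dbound_derivs(3)[OF g]) auto
    also have "\<dots> = \<nu> * \<mu> * (exp (-t) * exp (-t))" by (simp add: mult_ac)
    also have "exp (-t) * exp (-t) = exp (-2 * t)" by (simp add: exp_add[symmetric])
    finally show ?thesis by (simp add: abs_mult)
  qed
  have "(\<lambda>t. deriv_halfline f t * deriv_halfline g t) \<in> borel_measurable (lebesgue_on {0..})"
    by (intro continuous_imp_measurable_on_sets_lebesgue continuous_on_mult dbound_derivs(2)[OF f] dbound_derivs(2)[OF g]) auto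
  thus int: "(\<lambda>t. deriv_halfline f t * deriv_halfline g t) integrable_on {0..}"
    by (rule measurable_bounded_by_integrable_imp_integrable[OF _ has_integral_integrable[OF dom] le]) auto
  have "norm (cpair f g) \<le> integral {0..} (\<lambda>t. \<nu> * \<mu> * exp (-2 * t))"
    unfolding cpair_def by (rule integral_norm_bound_integral[OF int has_integral_integrable[OF dom] le])
  also have "\<dots> = \<nu> * \<mu> * (1/2)" using dom by (rule integral_unique)
  also have "\<dots> \<le> \<nu> * \<mu>" using dbound_nonneg[OF f] dbound_nonneg[OF g] by simp
  finally show "\<bar>cpair f g\<bar> \<le> \<nu> * \<mu>" by simp
qed

lemma cpair_commute: "cpair f g = cpair g f"
  by (simp add: cpair_def mult.commute)

lemma cpair_add:
  assumes f: "dbound 3 \<nu> f" and f': "dbound 3 \<nu>' f'" and g: "dbound 3 \<mu> g"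
  shows "cpair (\<lambda>t. f t + f' t) g = cpair f g + cpair f' g"
proof -
  have "deriv_halfline (\<lambda>t. f t + f' t) t = deriv_halfline f t + deriv_halfline f' t" if "t \<ge> 0" for t
    using that by (intro deriv_halfline_eq DERIV_add dbound_derivs(1)[OF f] dbound_derivs(1)[OF f']) auto
  hence "cpair (\<lambda>t. f t + f' t) g = integral {0..} (\<lambda>t. deriv_halfline f t * deriv_halfline g t + deriv_halfline f' t * deriv_halfline g t)"
    unfolding cpair_def by (intro integral_cong) (auto simp: distrib_right)
  thus ?thesis unfolding cpair_def
    by (simp add: integral_add cpair_integrable(1)[OF f g] cpair_integrable(1)[OF f' g])
qed

lemma cpair_cmult:
  assumes f: "dbound 3 \<nu> f"
  shows "cpair (\<lambda>t. c * f t) g = c * cpair f g"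
proof -
  have "deriv_halfline (\<lambda>t. c * f t) t = c * deriv_halfline f t" if "t \<ge> 0" for t
    using that by (intro deriv_halfline_eq DERIV_cmult dbound_derivs(1)[OF f]) auto
  hence "cpair (\<lambda>t. c * f t) g = integral {0..} (\<lambda>t. c * (deriv_halfline f t * deriv_halfline g t))"
    unfolding cpair_def by (intro integral_cong) (auto simp: mult.assoc)
  thus ?thesis by (simp add: cpair_def)
qed

lemma cpair_sum:
  assumes "finite N" "\<And>n. n \<in> N \<Longrightarrow> \<exists>\<nu>. dbound 3 \<nu> (h n)" "dbound 3 \<mu> g"
  shows "cpair (\<lambda>t. \<Sum>n\<in>N. c n * h n t) g = (\<Sum>n\<in>N. c n * cpair (h n) g)"
  using assms(1,2)
proof (induction N)
  case empty
  show ?case using cpair_cmult[OF dbound_zero, of 0 g] by simp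
next
  case (insert n N)
  obtain \<nu> where 1: "dbound 3 \<nu> (h n)" using insert.prems by blast
  obtain \<nu>' where 2: "dbound 3 \<nu>' (\<lambda>t. \<Sum>n\<in>N. c n * h n t)" using dbound_sum[of N 3 h] insert by blast
  show ?case unfolding sum.insert[OF insert.hyps]
    using cpair_add[OF dbound_cmult[OF 1] 2 assms(3)] cpair_cmult[OF 1] insert by simp
qed

lemma cpair_exp:
  assumes "a \<ge> 1" "b \<ge> 1"
  shows "cpair (\<lambda>t. exp (-a * t)) (\<lambda>t. exp (-b * t)) = a * b / (a + b)"
proof -
  have d: "deriv_halfline (\<lambda>t. exp (-c * t)) t = -c * exp (-c * t)" if "t \<ge> 0" for c t
    by (rule deriv_halfline_eq[OF that]) (auto intro!: derivative_eq_intros)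
  have "((\<lambda>t::real. exp (-(a + b) * t)) has_integral (exp (-(a + b) * 0) / (a + b))) {0..}"
    by (rule has_integral_exp_minus_to_infinity) (use assms in auto)
  from has_integral_mult_right[OF this, of "a * b"]
  have "((\<lambda>t::real. a * b * exp (-(a + b) * t)) has_integral (a * b / (a + b))) {0..}" by simp
  moreover have "a * b * exp (-(a + b) * t) = (-a * exp (-a * t)) * (-b * exp (-b * t))" for t
  proof -
    have "exp (-(a + b) * t) = exp (-a * t) * exp (-b * t)"
      unfolding exp_add[symmetric] by (simp add: algebra_simps)
    thus ?thesis by simp
  qed
  ultimately have "((\<lambda>t::real. (-a * exp (-a * t)) * (-b * exp (-b * t))) has_integral (a * b / (a + b))) {0..}" by (simp only:)
  moreover have "cpair (\<lambda>t. exp (-a * t)) (\<lambda>t. exp (-b * t)) = integral {0..} (\<lambda>t. (-a * exp (-a * t)) * (-b * exp (-b * t)))"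
    unfolding cpair_def
  proof (rule integral_cong)
    fix t :: real assume "t \<in> {0..}"
    hence "t \<ge> 0" by simp
    show "deriv_halfline (\<lambda>t. exp (-a * t)) t * deriv_halfline (\<lambda>t. exp (-b * t)) t = (-a * exp (-a * t)) * (-b * exp (-b * t))"
      unfolding d[OF \<open>t \<ge> 0\<close>] ..
  qed
  ultimately show ?thesis by (simp add: integral_unique)
qed

text \<open>The function f + e exp(-t) is non-increasing and tends to 0, hence non-negative; the
  same holds for -f. Integrating back from infinity thus loses nothing in the weighted norm.\<close>

lemma abs_le_exp_from_deriv:
  fixes f f' :: "real \<Rightarrow> real"
  assumes d: "\<And>t. t \<ge> 0 \<Longrightarrow> (f has_real_derivative f' t) (at t within {0..})"
    and b: "\<And>t. t \<ge> 0 \<Longrightarrow> \<bar>f' t\<bar> \<le> e * exp (-t)" and lim: "(f \<longlongrightarrow> 0) at_top" and t: "t \<ge> 0"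
  shows "\<bar>f t\<bar> \<le> e * exp (-t)"
proof -
  have main: "g t + e * exp (-t) \<ge> 0"
    if d: "\<And>t. t \<ge> 0 \<Longrightarrow> (g has_real_derivative g' t) (at t within {0..})"
      and b: "\<And>t. t \<ge> 0 \<Longrightarrow> \<bar>g' t\<bar> \<le> e * exp (-t)" and lim: "(g \<longlongrightarrow> 0) at_top" for g g'
  proof -
    let ?h = "\<lambda>t. g t + e * exp (-t)"
    have "?h s \<le> ?h t" if "s \<ge> t" for s
    proof (cases "s = t")
      case False
      show ?thesis
      proof (rule DERIV_nonpos_imp_decreasing_open[of t s ?h])
        show "t \<le> s" by (rule that)
        show "\<exists>y. (?h has_real_derivative y) (at x) \<and> y \<le> 0" if "t < x" "x < s" for x
        proof -
          have "x \<in> interior {0..}" using that t by (simp add: interior_real_atLeast)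
          hence "at x within {0..} = at x" by (rule at_within_interior)
          with d[of x] that t have "(g has_real_derivative g' x) (at x)" by simp
          hence "(?h has_real_derivative (g' x + e * (- exp (-x)))) (at x)"
            by (auto intro!: derivative_eq_intros)
          moreover have "g' x + e * (- exp (-x)) \<le> 0" using b[of x] that t by (auto simp: abs_le_iff)
          ultimately show ?thesis by blast
        qed
        have "continuous_on {0..} g" using d by (intro DERIV_continuous_on) auto
        hence "continuous_on {t..s} g" by (rule continuous_on_subset) (use t in auto)
        thus "continuous_on {t..s} ?h" by (intro continuous_intros)
      qed
    qed simp
    hence ev: "\<forall>\<^sub>F s in at_top. ?h s \<le> ?h t" by (rule eventually_mono[OF eventually_ge_at_top[of t]])
    have "((\<lambda>s::real. exp (-s)) \<longlongrightarrow> 0) at_top" by real_asymp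
    from tendsto_add[OF lim tendsto_mult[OF tendsto_const[of e] this]]
    have "(?h \<longlongrightarrow> 0) at_top" by simp
    from tendsto_upperbound[OF this ev] show ?thesis by simp
  qed
  have "- f t + e * exp (-t) \<ge> 0"
    by (rule main[of "\<lambda>t. - f t" "\<lambda>t. - f' t"]) (use d b lim in \<open>auto intro!: DERIV_minus tendsto_eq_intros\<close>)
  moreover have "f t + e * exp (-t) \<ge> 0" by (rule main[of f f']) (use d b lim in auto)
  ultimately show ?thesis by linarith
qed

lemma smooth_compact_derivs:
  assumes "smooth_halfline F" "compact_support_halfline F"
  obtains R D where "R \<ge> 0" "\<And>t. t \<ge> 0 \<Longrightarrow> D 0 t = F t"
    "\<And>n t. t \<ge> 0 \<Longrightarrow> (D n has_real_derivative D (Suc n) t) (at t within {0..})"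
    "\<And>n t. t > R \<Longrightarrow> D n t = 0"
proof -
  obtain D where D: "\<forall>t\<ge>0. D 0 t = F t" "\<forall>n. \<forall>t\<ge>0. (D n has_real_derivative D (Suc n) t) (at t within {0..})"
    using assms(1) unfolding smooth_halfline_def by blast
  obtain R0 where R0: "\<forall>t\<ge>0. t > R0 \<longrightarrow> F t = 0" using assms(2) unfolding compact_support_halfline_def by blast
  define R where "R = max R0 0"
  have "D n t = 0" if "t > R" for n t
    using that
  proof (induction n arbitrary: t)
    case 0
    thus ?case using D(1) R0 by (auto simp: R_def)
  next
    case (Suc n)
    have "t \<in> interior {0..}" using Suc.prems by (simp add: interior_real_atLeast R_def)
    hence "at t within {0..} = at t" by (rule at_within_interior)
    moreover have "t \<ge> 0" using Suc.prems by (simp add: R_def)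
    ultimately have 1: "(D n has_real_derivative D (Suc n) t) (at t)" using D(2) by metis
    have "((\<lambda>_. 0) has_real_derivative 0) (at t)" by simp
    hence "(D n has_real_derivative 0) (at t)"
      by (rule has_field_derivative_transform_within_open[of _ _ _ "{R<..}"]) (use Suc in auto)
    with 1 show ?case using DERIV_unique by blast
  qed
  thus ?thesis using that[of R D] D by (auto simp: R_def)
qed

lemma smooth_compact_dbound:
  assumes "smooth_halfline F" "compact_support_halfline F"
  shows "\<exists>\<nu>. dbound 3 \<nu> F"
proof -
  obtain D R where D: "R \<ge> 0" "\<And>t. t \<ge> 0 \<Longrightarrow> D 0 t = F t"
    "\<And>n t. t \<ge> 0 \<Longrightarrow> (D n has_real_derivative D (Suc n) t) (at t within {0..})"
    "\<And>n t. t > R \<Longrightarrow> D n t = 0" using smooth_compact_derivs[OF assms] by metis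
  have "\<exists>B. \<forall>t\<ge>0. \<bar>D i t\<bar> \<le> B * exp (-t)" for i
  proof -
    have "continuous_on {0..} (D i)" using D(3) by (intro DERIV_continuous_on) auto
    hence "continuous_on {0..R} (D i)" by (rule continuous_on_subset) auto
    hence "continuous_on {0..R} (\<lambda>t. D i t * exp t)" by (intro continuous_on_mult continuous_on_exp continuous_on_id)
    hence "compact ((\<lambda>t. D i t * exp t) ` {0..R})" by (intro compact_continuous_image) auto
    hence "bounded ((\<lambda>t. D i t * exp t) ` {0..R})" by (rule compact_imp_bounded)
    then obtain B where "\<forall>y\<in>(\<lambda>t. D i t * exp t) ` {0..R}. norm y \<le> B" by (auto simp: bounded_iff)
    hence B: "\<bar>D i t * exp t\<bar> \<le> B" if "t \<in> {0..R}" for t using that by simp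
    have "\<bar>D i 0 * exp 0\<bar> \<le> B" using D(1) by (intro B) simp
    hence B0: "B \<ge> 0" by simp
    have "\<bar>D i t\<bar> \<le> B * exp (-t)" if "t \<ge> 0" for t
    proof (cases "t \<le> R")
      case True
      hence "\<bar>D i t\<bar> * exp t \<le> B" using B[of t] that by (simp add: abs_mult)
      thus ?thesis by (simp add: exp_minus field_simps)
    next
      case False
      thus ?thesis using D(4) B0 by simp
    qed
    thus ?thesis by blast
  qed
  hence "\<forall>i. \<exists>B. \<forall>t\<ge>0. \<bar>D i t\<bar> \<le> B * exp (-t)" by blast
  then obtain B where "\<forall>i. \<forall>t\<ge>0. \<bar>D i t\<bar> \<le> B i * exp (-t)" using choice[of "\<lambda>i B. \<forall>t\<ge>0. \<bar>D i t\<bar> \<le> B * exp (-t)"] by blast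
  hence B: "\<bar>D i t\<bar> \<le> B i * exp (-t)" if "t \<ge> 0" for i t using that by blast
  define \<nu> where "\<nu> = (\<Sum>i\<le>3. \<bar>B i\<bar>)"
  have "dchain 3 \<nu> F D"
    unfolding dchain_def
  proof (intro conjI allI impI)
    fix i t assume it: "i \<le> (3::nat)" "(0::real) \<le> t"
    have "\<bar>B i\<bar> \<le> \<nu>" unfolding \<nu>_def using it by (intro member_le_sum) auto
    hence "B i \<le> \<nu>" by linarith
    hence "B i * exp (-t) \<le> \<nu> * exp (-t)" by simp
    thus "\<bar>D i t\<bar> \<le> \<nu> * exp (-t)" using B[OF it(2), of i] by linarith
  next
    fix t :: real assume "0 \<le> t" thus "D 0 t = F t" by (rule D(2))
  next
    fix i :: nat and t :: real assume "0 \<le> t" thus "(D i has_real_derivative D (Suc i) t) (at t within {0..})" by (rule D(3))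
  qed
  thus ?thesis unfolding dbound_def by blast
qed

text \<open>Weierstrass approximation of the third derivative in the variable \<open>exp (-t)\<close>, integrated back
  from infinity.\<close>

lemma smooth_compact_approx:
  assumes "smooth_halfline F" "compact_support_halfline F" and e: "e > 0"
  obtains c n where "dbound 3 e (\<lambda>t. F t - (\<Sum>i\<le>n. c i * exp (- real (Suc i) * t)))"
proof -
  obtain D R where D: "R \<ge> 0" "\<And>t. t \<ge> 0 \<Longrightarrow> D 0 t = F t"
    "\<And>n t. t \<ge> 0 \<Longrightarrow> (D n has_real_derivative D (Suc n) t) (at t within {0..})"
    "\<And>n t. t > R \<Longrightarrow> D n t = 0" using smooth_compact_derivs[OF assms(1,2)] by metis
  \<comment> \<open>The third derivative in the variable u = exp(-t), divided by u: an approximation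
    of h within e then approximates the derivative within e exp(-t), and the exponentials obtained
    start with exp(-t). The support condition makes h vanish near 0, so the division does not spoil
    continuity.\<close>
  define h where "h u = (if u \<le> 0 then 0 else D 3 (- ln u) / u)" for u :: real
  define \<eta> where "\<eta> = exp (-(R+1))"
  have \<eta>: "0 < \<eta>" "\<eta> \<le> 1" using D(1) by (auto simp: \<eta>_def)
  have h0: "h u = 0" if "u \<in> {0..\<eta>}" for u
  proof (cases "u > 0")
    case True
    hence "ln u \<le> ln \<eta>" using that by (subst ln_le_cancel_iff) (auto simp: \<eta>_def)
    hence "D 3 (- ln u) = 0" by (intro D(4)) (simp add: \<eta>_def)
    thus ?thesis by (simp add: h_def)
  qed (simp add: h_def)
  have "continuous_on {0..\<eta>} h"
    by (subst continuous_on_cong[of "{0..\<eta>}" "{0..\<eta>}" h "\<lambda>_. 0"]) (auto simp: h0)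
  moreover have "continuous_on {\<eta>..1} h"
  proof -
    have c3: "continuous_on {0..} (D 3)" using D(3) by (intro DERIV_continuous_on) auto
    have ne: "u > 0" if "u \<in> {\<eta>..1}" for u :: real using that \<eta> by auto
    have "continuous_on {\<eta>..1} (\<lambda>u. D 3 (- ln u))"
    proof (rule continuous_on_compose2[OF c3])
      show "continuous_on {\<eta>..1} (\<lambda>u. - ln u)" using ne by (intro continuous_intros) force
      show "(\<lambda>u. - ln u) ` {\<eta>..1} \<subseteq> {0..}" using ne by auto
    qed
    hence "continuous_on {\<eta>..1} (\<lambda>u. D 3 (- ln u) / u)" using ne by (intro continuous_on_divide continuous_intros) force+
    thus ?thesis by (subst continuous_on_cong[of "{\<eta>..1}" "{\<eta>..1}" h "\<lambda>u. D 3 (- ln u) / u"]) (use \<eta> in \<open>auto simp: h_def\<close>)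
  qed
  ultimately have "continuous_on ({0..\<eta>} \<union> {\<eta>..1}) h" by (intro continuous_on_closed_Un) auto
  moreover have "{0..\<eta>} \<union> {\<eta>..1} = {0..1}" using \<eta> by auto
  ultimately have "continuous_on {0..1} h" by simp
  then obtain g where g: "real_polynomial_function g" "\<And>u. u \<in> {0..1} \<Longrightarrow> \<bar>h u - g u\<bar> < e"
    using Stone_Weierstrass_real_polynomial_function[OF compact_Icc _ e] by blast
  then obtain a n where a: "g = (\<lambda>u. \<Sum>i\<le>n. a i * u ^ i)" using real_polynomial_function_iff_sum[of g] by blast
  \<comment> \<open>Three differentiations multiply exp(-(i+1) t) by -(i+1)^3; the coefficients undo
    this.\<close>
  define c where "c i = - a i / real (Suc i) ^ 3" for i
  define E where "E k t = (\<Sum>i\<le>n. c i * (- real (Suc i)) ^ k * exp (- real (Suc i) * t))" for k :: nat and t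
  define H where "H k t = D k t - E k t" for k t
  have dE: "(E k has_real_derivative E (Suc k) t) (at t within {0..})" for k t
    unfolding E_def by (rule DERIV_sum) (auto intro!: derivative_eq_intros)
  have dH: "(H k has_real_derivative H (Suc k) t) (at t within {0..})" if "t \<ge> 0" for k t
    unfolding H_def using that by (intro DERIV_diff D(3) dE)
  have lim: "(H k \<longlongrightarrow> 0) at_top" for k
  proof -
    have "((\<lambda>t. exp (- real (Suc i) * t)) \<longlongrightarrow> 0) at_top" for i
      by real_asymp
    hence "(E k \<longlongrightarrow> (\<Sum>i\<le>n. c i * (- real (Suc i)) ^ k * 0)) at_top"
      unfolding E_def by (intro tendsto_intros)
    hence "((\<lambda>t. - E k t) \<longlongrightarrow> 0) at_top" by (auto intro!: tendsto_eq_intros)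
    moreover have "\<forall>\<^sub>F t in at_top. - E k t = H k t"
      using eventually_gt_at_top[of R] by eventually_elim (simp add: H_def D(4))
    ultimately show ?thesis by (rule Lim_transform_eventually)
  qed
  have b3: "\<bar>H 3 t\<bar> \<le> e * exp (-t)" if t: "t \<ge> 0" for t
  proof -
    define u where "u = exp (-t)"
    have u: "u > 0" "u \<le> 1" "- ln u = t" using t by (auto simp: u_def)
    have "E 3 t = (\<Sum>i\<le>n. a i * u ^ i * u)"
      unfolding E_def
    proof (rule sum.cong[OF refl])
      fix i
      have "exp (- real (Suc i) * t) = u ^ i * u"
        unfolding u_def by (simp add: exp_of_nat_mult[symmetric] exp_add[symmetric] algebra_simps)
      moreover have "c i * (- real (Suc i)) ^ 3 = a i" by (simp add: c_def del: of_nat_Suc)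
      ultimately show "c i * (- real (Suc i)) ^ 3 * exp (- real (Suc i) * t) = a i * u ^ i * u" by simp
    qed
    hence "E 3 t = g u * u" by (simp add: a sum_distrib_right)
    moreover have "D 3 t = h u * u" using u by (simp add: h_def)
    ultimately have "H 3 t = (h u - g u) * u" by (simp add: H_def algebra_simps)
    moreover have "\<bar>h u - g u\<bar> \<le> e" using g(2)[of u] u by auto
    ultimately show ?thesis using u by (simp add: abs_mult mult_right_mono flip: u_def)
  qed
  have b2: "\<bar>H 2 t\<bar> \<le> e * exp (-t)" if "t \<ge> 0" for t
    by (rule abs_le_exp_from_deriv[OF _ b3 lim that]) (use dH[of _ 2] in \<open>simp_all add: numeral_3_eq_3 numeral_2_eq_2\<close>)
  have b1: "\<bar>H 1 t\<bar> \<le> e * exp (-t)" if "t \<ge> 0" for t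
    by (rule abs_le_exp_from_deriv[OF _ b2 lim that]) (use dH[of _ 1] in \<open>simp_all add: numeral_2_eq_2\<close>)
  have b0: "\<bar>H 0 t\<bar> \<le> e * exp (-t)" if "t \<ge> 0" for t
    by (rule abs_le_exp_from_deriv[OF _ b1 lim that]) (use dH[of _ 0] in simp_all)
  have "dchain 3 e (\<lambda>t. F t - (\<Sum>i\<le>n. c i * exp (- real (Suc i) * t))) H"
    unfolding dchain_def
  proof (intro conjI allI impI)
    fix i t assume "i \<le> (3::nat)" "(0::real) \<le> t"
    moreover from this have "i = 0 \<or> i = 1 \<or> i = 2 \<or> i = 3" by linarith
    ultimately show "\<bar>H i t\<bar> \<le> e * exp (-t)" using b0 b1 b2 b3 by auto
  next
    fix i :: nat and t :: real assume "0 \<le> t" thus "(H i has_real_derivative H (Suc i) t) (at t within {0..})" by (rule dH)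
  next
    fix t :: real assume "0 \<le> t" thus "H 0 t = F t - (\<Sum>i\<le>n. c i * exp (- real (Suc i) * t))" unfolding H_def E_def by (simp only: D(2) power_0 mult_1_right)
  qed
  thus ?thesis using that unfolding dbound_def by blast
qed

section \<open>The limiting form and the passage to general weights\<close>

definition cform :: "nat set \<Rightarrow> (nat \<times> bool \<Rightarrow> real \<Rightarrow> real) \<Rightarrow> real" where
  "cform I \<phi> = (\<Prod>i\<in>I. cpair (\<phi> (i,True)) (\<phi> (i,False)))"

lemma cform_update:
  assumes "finite I" "i \<in> I"
  shows "cform I (\<phi>((i,s) := h)) = cpair h (\<phi> (i, \<not> s)) * (\<Prod>l\<in>I - {i}. cpair (\<phi> (l,True)) (\<phi> (l,False)))"
proof -
  have "cform I (\<phi>((i,s) := h)) = cpair ((\<phi>((i,s) := h)) (i,True)) ((\<phi>((i,s) := h)) (i,False)) *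
      (\<Prod>l\<in>I - {i}. cpair ((\<phi>((i,s) := h)) (l,True)) ((\<phi>((i,s) := h)) (l,False)))"
    unfolding cform_def using assms by (rule prod.remove)
  also have "(\<Prod>l\<in>I - {i}. cpair ((\<phi>((i,s) := h)) (l,True)) ((\<phi>((i,s) := h)) (l,False))) = (\<Prod>l\<in>I - {i}. cpair (\<phi> (l,True)) (\<phi> (l,False)))"
    by (intro prod.cong) auto
  also have "cpair ((\<phi>((i,s) := h)) (i,True)) ((\<phi>((i,s) := h)) (i,False)) = cpair h (\<phi> (i, \<not> s))"
    by (cases s) (simp_all add: cpair_commute)
  finally show ?thesis .
qed

lemma cform_bound:
  assumes "finite I" "\<And>j. j \<in> I \<times> UNIV \<Longrightarrow> dbound 3 (\<nu> j) (\<phi> j)"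
  shows "\<bar>cform I \<phi>\<bar> \<le> (\<Prod>j\<in>I \<times> UNIV. \<nu> j)"
proof -
  have "\<bar>cform I \<phi>\<bar> = (\<Prod>i\<in>I. \<bar>cpair (\<phi> (i,True)) (\<phi> (i,False))\<bar>)" unfolding cform_def by (rule abs_prod)
  also have "\<dots> \<le> (\<Prod>i\<in>I. \<nu> (i,True) * \<nu> (i,False))"
    using assms(2) by (intro prod_mono conjI cpair_integrable(2)) auto
  finally show ?thesis by (simp add: prod_bool_slots)
qed

lemma gmoment_nonneg:
  assumes "\<And>p. p \<in> P \<Longrightarrow> 0 \<le> r p \<and> r p \<le> 1"
  shows "gmoment L r j P \<ge> 0"
  unfolding gmoment_def rsub_ex_def rsub_wt_def using assms
  by (intro sum_nonneg mult_nonneg_nonneg prod_nonneg) auto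

text \<open>K is fixed before the weights: a weight that is small in the norm contributes little for
  all large x, which is what an approximation argument requires.\<close>

lemma sform_scaled_bound:
  assumes I: "finite I" "0 \<notin> I"
  obtains K where "K > 0" "\<forall>\<^sub>F x in at_top. \<forall>\<phi> \<nu>. (\<forall>j\<in>I \<times> UNIV. dbound 3 (\<nu> j) (\<phi> j)) \<longrightarrow>
     \<bar>B_size x ^ card I * sform (ln x) I (sieve_primes x) \<phi>\<bar> \<le> K * (\<Prod>j\<in>I \<times> UNIV. \<nu> j)"
proof -
  obtain K0 where K0: "K0 > 0" "\<forall>\<^sub>F x in at_top. gmoment (ln x) (\<lambda>p. 1 / (real p - real (card I))) 3 (sieve_primes x) \<le> K0 / B_size x"
    by (rule gmoment_3_bound)
  define K where "K = exp (4 * real (card I) ^ 2 * 2) * K0 ^ card I"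
  have ev1: "\<forall>\<^sub>F x in at_top. wlim x \<ge> 1" using filterlim_wlim by (simp add: filterlim_at_top)
  have "\<forall>\<^sub>F x in at_top. \<forall>\<phi> \<nu>. (\<forall>j\<in>I \<times> UNIV. dbound 3 (\<nu> j) (\<phi> j)) \<longrightarrow>
     \<bar>B_size x ^ card I * sform (ln x) I (sieve_primes x) \<phi>\<bar> \<le> K * (\<Prod>j\<in>I \<times> UNIV. \<nu> j)"
    using K0(2) ev1 eventually_gt_at_top[of 1] eventually_sieve_primes_ge[of "4 * card I + 4"]
  proof eventually_elim
    case (elim x)
    have B: "B_size x > 0" using elim by (intro B_size_pos) auto
    let ?g = "gmoment (ln x) (\<lambda>p. 1 / (real p - real (card I))) 3 (sieve_primes x)"
    have g0: "0 \<le> ?g"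
    proof (rule gmoment_nonneg)
      fix p assume "p \<in> sieve_primes x"
      hence "p \<ge> 4 * card I + 4" using elim by blast
      hence "real p \<ge> 4 * real (card I) + 4" using of_nat_le_iff[of "4 * card I + 4" p, where 'a = real] by simp
      thus "0 \<le> 1 / (real p - real (card I)) \<and> 1 / (real p - real (card I)) \<le> 1" by simp
    qed
    have sq: "(\<Sum>p\<in>sieve_primes x. 1 / real p ^ 2) \<le> 2"
    proof -
      have "(\<Sum>p\<in>sieve_primes x. 1 / real p ^ 2) \<le> 2 / wlim x" using elim(2) by (intro sum_inv_sq_sieve_primes) auto
      also have "\<dots> \<le> 2" using elim(2) by (simp add: field_simps)
      finally show ?thesis .
    qed
    show ?case
    proof (intro allI impI)
      fix \<phi> :: "nat \<times> bool \<Rightarrow> real \<Rightarrow> real" and \<nu>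
      assume \<phi>: "\<forall>j\<in>I \<times> UNIV. dbound 3 (\<nu> j) (\<phi> j)"
      have N: "(\<Prod>j\<in>I \<times> UNIV. \<nu> j) \<ge> 0" using \<phi> dbound_nonneg by (intro prod_nonneg) blast
      have "\<bar>B_size x ^ card I * sform (ln x) I (sieve_primes x) \<phi>\<bar> = B_size x ^ card I * \<bar>sform (ln x) I (sieve_primes x) \<phi>\<bar>"
        using B by (simp add: abs_mult)
      also have "\<dots> \<le> B_size x ^ card I * ((\<Prod>j\<in>I \<times> UNIV. \<nu> j) * (exp (4 * real (card I) ^ 2 * (\<Sum>p\<in>sieve_primes x. 1 / real p ^ 2)) * ?g ^ card I))"
        using B elim \<phi> by (intro mult_left_mono sform_bound I) auto
      also have "\<dots> \<le> B_size x ^ card I * ((\<Prod>j\<in>I \<times> UNIV. \<nu> j) * (exp (4 * real (card I) ^ 2 * 2) * (K0 / B_size x) ^ card I))"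
      proof -
        have "4 * real (card I) ^ 2 * (\<Sum>p\<in>sieve_primes x. 1 / real p ^ 2) \<le> 4 * real (card I) ^ 2 * 2"
          using sq by (intro mult_left_mono) auto
        thus ?thesis using B N g0 elim(1) by (intro mult_left_mono mult_mono power_mono) auto
      qed
      also have "\<dots> = K * (\<Prod>j\<in>I \<times> UNIV. \<nu> j)"
        using B by (simp add: K_def power_divide)
      finally show "\<bar>B_size x ^ card I * sform (ln x) I (sieve_primes x) \<phi>\<bar> \<le> K * (\<Prod>j\<in>I \<times> UNIV. \<nu> j)" .
    qed
  qed
  thus ?thesis using that[of K] K0(1) by (simp add: K_def)
qed

lemma sform_cong:
  assumes "\<And>j. j \<in> I \<times> UNIV \<Longrightarrow> \<phi> j = \<psi> j"
  shows "sform L I P \<phi> = sform L I P \<psi>"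
  unfolding sform_def using assms by (intro xex_cong prod.cong) auto

text \<open>The slots are replaced one at a time by finite combinations of exponentials; the error is
  controlled by the uniform bound for multilinear form.\<close>

theorem sform_limit:
  assumes I: "finite I" "0 \<notin> I"
    and \<phi>: "\<And>j. j \<in> I \<times> UNIV \<Longrightarrow> smooth_halfline (\<phi> j) \<and> compact_support_halfline (\<phi> j)"
  shows "((\<lambda>x. B_size x ^ card I * sform (ln x) I (sieve_primes x) \<phi>) \<longlongrightarrow> cform I \<phi>) at_top"
proof -
  let ?Sl = "I \<times> (UNIV :: bool set)"
  define V where "V x \<phi> = B_size x ^ card I * sform (ln x) I (sieve_primes x) \<phi>" for x \<phi>
  define sc where "sc f \<longleftrightarrow> smooth_halfline f \<and> compact_support_halfline f" for f
  define ex where "ex f \<longleftrightarrow> (\<exists>a\<ge>1. f = (\<lambda>t. exp (-a * t)))" for f :: "real \<Rightarrow> real"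
  have finSl: "finite ?Sl" using I by simp
  have db: "\<exists>\<nu>. dbound 3 \<nu> f" if "sc f \<or> ex f" for f
    using that smooth_compact_dbound dbound_exp unfolding sc_def ex_def by blast
  obtain K where K: "K > 0" "\<forall>\<^sub>F x in at_top. \<forall>\<phi> \<nu>. (\<forall>j\<in>?Sl. dbound 3 (\<nu> j) (\<phi> j)) \<longrightarrow> \<bar>V x \<phi>\<bar> \<le> K * (\<Prod>j\<in>?Sl. \<nu> j)"
    unfolding V_def by (rule sform_scaled_bound[OF I])
  have "((\<lambda>x. V x \<phi>) \<longlongrightarrow> cform I \<phi>) at_top"
    if "finite J" "J \<subseteq> ?Sl" "\<forall>j\<in>J. sc (\<phi> j)" "\<forall>j\<in>?Sl - J. ex (\<phi> j)" for J \<phi>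
    using that
  \<comment> \<open>J is the set of slots that still carry the given weights. Once it is empty, all
    slots are exponentials and \<open>sform_exp_limit\<close> applies.\<close>
  proof (induction J arbitrary: \<phi>)
    case empty
    hence "\<forall>j\<in>?Sl. \<exists>a. a \<ge> 1 \<and> \<phi> j = (\<lambda>t. exp (-a * t))" by (simp add: ex_def)
    then obtain a where a: "\<And>j. j \<in> ?Sl \<Longrightarrow> a j \<ge> 1 \<and> \<phi> j = (\<lambda>t. exp (- a j * t))" by metis
    have "((\<lambda>x. B_size x ^ card I * sform (ln x) I (sieve_primes x) (\<lambda>j t. exp (-a j * t))) \<longlongrightarrow>
      (\<Prod>i\<in>I. a (i,True) * a (i,False) / (a (i,True) + a (i,False)))) at_top"
      using a by (intro sform_exp_limit I) fastforce
    moreover have "sform L I P (\<lambda>j t. exp (-a j * t)) = sform L I P \<phi>" for L P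
      using a by (intro sform_cong) auto
    moreover have "(\<Prod>i\<in>I. a (i,True) * a (i,False) / (a (i,True) + a (i,False))) = cform I \<phi>"
      unfolding cform_def
    proof (rule prod.cong[OF refl])
      fix i assume "i \<in> I"
      hence "a (i,True) \<ge> 1" "a (i,False) \<ge> 1" "\<phi> (i,True) = (\<lambda>t. exp (- a (i,True) * t))" "\<phi> (i,False) = (\<lambda>t. exp (- a (i,False) * t))"
        using a by auto
      thus "a (i,True) * a (i,False) / (a (i,True) + a (i,False)) = cpair (\<phi> (i,True)) (\<phi> (i,False))"
        by (simp only: cpair_exp)
    qed
    ultimately show ?case by (simp add: V_def)
  next
    case (insert j J)
    obtain i s where j: "j = (i, s)" "i \<in> I" using insert.prems(1) by auto
    have jS: "j \<in> ?Sl" using j by simp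
    have "\<exists>\<nu>. dbound 3 \<nu> (\<phi> l)" if "l \<in> ?Sl" for l
    proof (cases "l \<in> insert j J")
      case True
      thus ?thesis using insert.prems(2) db by blast
    next
      case False
      thus ?thesis using insert.prems(3) that db by blast
    qed
    then obtain \<nu> where \<nu>: "\<And>l. l \<in> ?Sl \<Longrightarrow> dbound 3 (\<nu> l) (\<phi> l)" by metis
    define M where "M = (\<Prod>l\<in>?Sl - {j}. \<nu> l)"
    have M: "M \<ge> 0" unfolding M_def using \<nu> dbound_nonneg by (intro prod_nonneg) blast
    obtain \<mu> where \<mu>: "dbound 3 \<mu> (\<phi> (i, \<not> s))" using \<nu>[of "(i, \<not> s)"] j by auto
    show ?case
    proof (rule tendstoI)
      fix d :: real assume d: "d > 0"
      \<comment> \<open>The remainder costs K e M in the form and e M in its limit, together at most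
        d/2; the added 1 keeps the denominator positive when M = 0.\<close>
      define e where "e = d / (2 * ((K + 1) * M + 1))"
      have den: "(K + 1) * M + 1 > 0" using K M by (simp add: add_nonneg_pos)
      have e: "e > 0" using d den by (simp add: e_def)
      have scj: "smooth_halfline (\<phi> j)" "compact_support_halfline (\<phi> j)" using insert.prems(2) by (auto simp: sc_def)
      obtain c n where c: "dbound 3 e (\<lambda>t. \<phi> j t - (\<Sum>i\<le>n. c i * exp (- real (Suc i) * t)))"
        by (rule smooth_compact_approx[OF scj e])
      define h where "h i = (\<lambda>t. exp (- real (Suc i) * t))" for i
      define H where "H = (\<lambda>t. \<phi> j t - (\<Sum>i\<le>n. c i * h i t))"
      have H: "dbound 3 e H" using c by (simp only: H_def h_def)
      have h: "dbound 3 (real (Suc i) ^ 3) (h i)" "ex (h i)" for i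
      proof -
        show "dbound 3 (real (Suc i) ^ 3) (h i)" unfolding h_def by (rule dbound_exp) simp
        show "ex (h i)" unfolding h_def ex_def by (rule exI[of _ "real (Suc i)"]) simp
      qed
      have dec: "\<phi> = \<phi>(j := \<lambda>t. (\<Sum>i\<le>n. c i * h i t) + H t)" by (auto simp: H_def fun_eq_iff)
      have Vdec: "V x \<phi> = (\<Sum>i\<le>n. c i * V x (\<phi>(j := h i))) + V x (\<phi>(j := H))" for x
      proof -
        have "V x \<phi> = V x (\<phi>(j := \<lambda>t. (\<Sum>i\<le>n. c i * h i t) + H t))" using dec by simp
        also have "\<dots> = (\<Sum>i\<le>n. c i * V x (\<phi>(j := h i))) + V x (\<phi>(j := H))"
          unfolding V_def sform_update_add[OF I(1) jS] sform_update_sum[OF I(1) jS finite_atMost]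
          by (simp only: distrib_left sum_distrib_left mult.left_commute)
        finally show ?thesis .
      qed
      have Cdec: "cform I \<phi> = (\<Sum>i\<le>n. c i * cform I (\<phi>(j := h i))) + cform I (\<phi>(j := H))"
      proof -
        have "\<exists>\<nu>. dbound 3 \<nu> (h i)" for i using h by blast
        then obtain \<nu>' where E: "dbound 3 \<nu>' (\<lambda>t. \<Sum>i\<le>n. c i * h i t)" using dbound_sum[of "{..n}" 3 h c] by blast
        have "cform I \<phi> = cform I (\<phi>(j := \<lambda>t. (\<Sum>i\<le>n. c i * h i t) + H t))" using dec by simp
        also have "\<dots> = (\<Sum>i\<le>n. c i * cform I (\<phi>(j := h i))) + cform I (\<phi>(j := H))"
          unfolding j(1) cform_update[OF I(1) j(2)] cpair_add[OF E H \<mu>]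
          using h \<mu> by (subst cpair_sum) (auto simp: distrib_right sum_distrib_right mult.assoc)
        finally show ?thesis .
      qed
      have lim: "((\<lambda>x. \<Sum>i\<le>n. c i * V x (\<phi>(j := h i))) \<longlongrightarrow> (\<Sum>i\<le>n. c i * cform I (\<phi>(j := h i)))) at_top"
      proof (intro tendsto_sum tendsto_mult tendsto_const insert.IH)
        fix i
        show "J \<subseteq> ?Sl" using insert.prems by blast
        show "\<forall>l\<in>J. sc ((\<phi>(j := h i)) l)" using insert.prems insert.hyps by auto
        show "\<forall>l\<in>?Sl - J. ex ((\<phi>(j := h i)) l)" using insert.prems h by auto
      qed
      have nuH: "\<forall>l\<in>?Sl. dbound 3 ((\<nu>(j := e)) l) ((\<phi>(j := H)) l)" using \<nu> H by auto
      have prodH: "(\<Prod>l\<in>?Sl. (\<nu>(j := e)) l) = e * M"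
        unfolding M_def using jS finSl by (subst prod.remove[of _ j]) (auto intro!: prod.cong)
      have CH: "\<bar>cform I (\<phi>(j := H))\<bar> \<le> e * M"
        using cform_bound[OF I(1), of "\<nu>(j := e)" "\<phi>(j := H)"] nuH unfolding prodH by blast
      have "\<forall>\<^sub>F x in at_top. dist (\<Sum>i\<le>n. c i * V x (\<phi>(j := h i))) (\<Sum>i\<le>n. c i * cform I (\<phi>(j := h i))) < d / 2"
        using tendstoD[OF lim, of "d / 2"] d by simp
      thus "\<forall>\<^sub>F x in at_top. dist (V x \<phi>) (cform I \<phi>) < d"
        using K(2)
      proof eventually_elim
        case (elim x)
        have "\<bar>V x (\<phi>(j := H))\<bar> \<le> K * (\<Prod>l\<in>?Sl. (\<nu>(j := e)) l)" using elim(2) nuH by blast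
        hence VH: "\<bar>V x (\<phi>(j := H))\<bar> \<le> K * (e * M)" unfolding prodH .
        have "dist (V x \<phi>) (cform I \<phi>) \<le> dist (\<Sum>i\<le>n. c i * V x (\<phi>(j := h i))) (\<Sum>i\<le>n. c i * cform I (\<phi>(j := h i))) + \<bar>V x (\<phi>(j := H))\<bar> + \<bar>cform I (\<phi>(j := H))\<bar>"
          unfolding Vdec Cdec dist_real_def by linarith
        also have "\<dots> < d / 2 + K * (e * M) + e * M" using elim(1) VH CH by linarith
        also have "\<dots> = d / 2 + e * ((K + 1) * M)" by (simp add: algebra_simps)
        also have "\<dots> \<le> d / 2 + e * ((K + 1) * M + 1)" using e by simp
        also have "\<dots> = d"
        proof -
          have "d / (2 * X) * X = d / 2" if "X > 0" for X :: real using that by simp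
          from this[OF den] show ?thesis unfolding e_def by (simp only:)
        qed
        finally show ?case .
      qed
    qed
  qed
  from this[OF finSl order_refl, of \<phi>] \<phi> show ?thesis by (simp add: sc_def V_def)
qed

lemma supp_sup_props:
  assumes "compact_support_halfline F"
  shows "supp_sup F \<ge> 0" and "t \<ge> 0 \<Longrightarrow> F t \<noteq> 0 \<Longrightarrow> t \<le> supp_sup F"
proof -
  obtain R where R: "\<forall>t\<ge>0. t > R \<longrightarrow> F t = 0" using assms unfolding compact_support_halfline_def by blast
  have bdd: "bdd_above {t. t \<ge> 0 \<and> F t \<noteq> 0}" using R by (intro bdd_aboveI[of _ R]) force
  show le: "t \<le> supp_sup F" if "t \<ge> 0" "F t \<noteq> 0" for t
    using that bdd by (auto simp: supp_sup_def intro!: cSup_upper)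
  show "supp_sup F \<ge> 0"
  proof (cases "\<forall>t\<ge>0. F t = 0")
    case False
    then obtain t where "t \<ge> 0" "F t \<noteq> 0" by blast
    thus ?thesis using le[of t] by linarith
  qed (simp add: supp_sup_def)
qed

lemma cpair_eq_integral_01:
  assumes F: "smooth_halfline F" "compact_support_halfline F" and s: "supp_sup F < 1"
  shows "cpair F G = integral {0..1} (\<lambda>t. deriv_halfline F t * deriv_halfline G t)"
proof -
  have "deriv_halfline F t = 0" if "t > 1" for t
  proof -
    have "((\<lambda>_. 0) has_real_derivative 0) (at t within {0..})" by simp
    hence "(F has_real_derivative 0) (at t within {0..})"
    proof (rule has_field_derivative_transform_within[of _ _ _ _ "t - 1"])
      fix y assume "y \<in> {0..}" "dist y t < t - 1"
      hence "y > 1" "y \<ge> 0" by (auto simp: dist_real_def)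
      thus "0 = F y" using supp_sup_props(2)[OF F(2), of y] s by force
    qed (use that in auto)
    thus ?thesis using that by (intro deriv_halfline_eq) auto
  qed
  hence "cpair F G = integral {0..} (\<lambda>t. if t \<in> {0..1} then deriv_halfline F t * deriv_halfline G t else 0)"
    unfolding cpair_def by (intro integral_cong) auto
  also have "\<dots> = integral ({0..1} \<inter> {0..}) (\<lambda>t. deriv_halfline F t * deriv_halfline G t)"
    by (rule integral_restrict_Int)
  also have "{0..1} \<inter> {0..} = {0..1::real}" by auto
  finally show ?thesis .
qed

section \<open>Truncated divisor sums and the discrepancy\<close>

lemma prime_factors_prod_primes:
  assumes "finite S" "\<And>p. p \<in> S \<Longrightarrow> prime (p :: nat)"
  shows "prime_factors (\<Prod>S) = S"
proof -
  have "prime_factors (\<Prod>S) = \<Union>((prime_factors \<circ> (\<lambda>p. p)) ` S)"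
    using assms prime_gt_0_nat by (intro prime_factors_prod) force+
  also have "\<dots> = (\<Union>p\<in>S. {p})" using assms(2) by (auto simp: prime_prime_factors)
  finally show ?thesis by simp
qed

lemma prod_primes_dvd_iff:
  assumes "finite S" "\<And>p. p \<in> S \<Longrightarrow> prime (p :: nat)"
  shows "int (\<Prod>S) dvd n \<longleftrightarrow> (\<forall>p\<in>S. int p dvd n)"
  using assms
proof (induction S)
  case (insert p S)
  have "coprime p (\<Prod>S)" using insert by (intro coprime_prime_prod) auto
  hence "coprime (int p) (int (\<Prod>S))" by (simp only: coprime_int_iff)
  hence "int p * int (\<Prod>S) dvd n \<longleftrightarrow> int p dvd n \<and> int (\<Prod>S) dvd n"
    by (meson divides_mult dvd_mult_left dvd_mult_right)
  thus ?case using insert by simp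
qed simp

lemma prod_primes_dvd_nat_iff:
  assumes "finite S" "\<And>p. p \<in> S \<Longrightarrow> prime (p :: nat)"
  shows "\<Prod>S dvd n \<longleftrightarrow> (\<forall>p\<in>S. p dvd n)"
  using prod_primes_dvd_iff[OF assms, of "int n"] by (simp only: int_dvd_int_iff)

lemma prod_primes_pos: "(\<And>p. p \<in> S \<Longrightarrow> prime (p :: nat)) \<Longrightarrow> \<Prod>S > 0"
  by (intro prod_pos) (auto intro: prime_gt_0_nat)

lemma squarefree_prod_primes:
  assumes "finite S" "\<And>p. p \<in> S \<Longrightarrow> prime (p :: nat)"
  shows "squarefree (\<Prod>S)"
  using assms by (intro squarefree_prod_coprime) (auto intro: primes_coprime squarefree_prime)

lemma squarefree_eq_prod:
  assumes "squarefree (d :: nat)"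
  shows "\<Prod>(prime_factors d) = d"
proof -
  have "d > 0" using assms by (intro Nat.gr0I) auto
  hence "d = (\<Prod>p\<in>prime_factors d. p ^ multiplicity p d)" by (rule prime_factorization_nat)
  also have "\<dots> = (\<Prod>p\<in>prime_factors d. p)"
  proof (rule prod.cong[OF refl])
    fix p assume p: "p \<in> prime_factors d"
    hence "multiplicity p d \<le> 1" "multiplicity p d > 0"
      using assms \<open>d > 0\<close> by (auto simp: squarefree_factorial_semiring'' prime_factors_multiplicity)
    hence "multiplicity p d = 1" by simp
    thus "p ^ multiplicity p d = p" by simp
  qed
  finally show ?thesis by simp
qed

lemma lambda_weight_eq_lam_set:
  assumes "n \<ge> 1" "x > 1"
  shows "lambda_weight x F n = lam_set (ln x) F (prime_factors n) 0"
proof -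
  have fin: "finite {d. d dvd n}" using assms(1) by (intro finite_divisors_nat) auto
  have "lambda_weight x F n = (\<Sum>d | d dvd n \<and> squarefree d. moebius d * F (log x (real d)))"
    unfolding lambda_weight_def by (rule sum.mono_neutral_right) (use fin in \<open>auto simp: moebius_def\<close>)
  also have "\<dots> = (\<Sum>S\<in>Pow (prime_factors n). (-1) ^ card S * F (0 + (\<Sum>p\<in>S. ln (real p) / ln x)))"
  proof (rule sum.reindex_bij_witness[of _ "\<lambda>S. \<Prod>S" prime_factors])
    fix d assume d: "d \<in> {d. d dvd n \<and> squarefree d}"
    show "\<Prod>(prime_factors d) = d" using d squarefree_eq_prod by auto
    show "prime_factors d \<in> Pow (prime_factors n)" using d assms(1) dvd_prime_factors[of n d] by auto
    have "ln (real d) = ln (\<Prod>p\<in>prime_factors d. real p)"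
      using squarefree_eq_prod[of d] d by (metis (no_types, lifting) mem_Collect_eq of_nat_prod prod.cong)
    also have "\<dots> = (\<Sum>p\<in>prime_factors d. ln (real p))"
      by (intro ln_prod) (auto dest: prime_gt_0_nat simp: prime_factors_gt_0_nat)
    finally show "(-1) ^ card (prime_factors d) * F (0 + (\<Sum>p\<in>prime_factors d. ln (real p) / ln x)) = moebius d * F (log x (real d))"
      using d by (simp add: moebius_def log_def sum_divide_distrib)
  next
    fix S assume "S \<in> Pow (prime_factors n)"
    hence S: "finite S" "\<And>p. p \<in> S \<Longrightarrow> prime p" "\<And>p. p \<in> S \<Longrightarrow> p dvd n" by (auto intro: finite_subset)
    show "prime_factors (\<Prod>S) = S" using S by (intro prime_factors_prod_primes) auto
    have "\<Prod>S dvd n" using S by (subst prod_primes_dvd_nat_iff) auto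
    thus "\<Prod>S \<in> {d. d dvd n \<and> squarefree d}" using S by (auto intro: squarefree_prod_primes)
  qed
  finally show ?thesis by (simp add: lam_set_def)
qed

lemma lam_set_indicator:
  assumes "finite P" "A \<subseteq> P"
  shows "lam_set L F A 0 = (\<Sum>S\<in>Pow P. ((-1) ^ card S * F (\<Sum>p\<in>S. ln (real p) / L)) * (if S \<subseteq> A then 1 else 0))"
proof -
  have "lam_set L F A 0 = (\<Sum>S\<in>Pow A. ((-1) ^ card S * F (\<Sum>p\<in>S. ln (real p) / L)) * (if S \<subseteq> A then 1 else 0))"
    unfolding lam_set_def by (intro sum.cong) auto
  also have "\<dots> = (\<Sum>S\<in>Pow P. ((-1) ^ card S * F (\<Sum>p\<in>S. ln (real p) / L)) * (if S \<subseteq> A then 1 else 0))"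
    using assms by (intro sum.mono_neutral_left) auto
  finally show ?thesis .
qed

text \<open>The exponent j satisfies 2^j \<le> y, so there are at most ln y / ln 2 \<le> 2 ln y of
  them for each prime.\<close>

lemma card_prime_powers_le:
  assumes Q: "finite Q" "\<And>p. p \<in> Q \<Longrightarrow> prime p" and y: "y \<ge> 1"
    and A: "\<And>m. m \<in> A \<Longrightarrow> real m \<le> y \<and> (\<exists>p\<in>Q. \<exists>j\<ge>1. m = p ^ j)"
  shows "finite A" "real (card A) \<le> real (card Q) * (2 * ln y)"
proof -
  define J where "J = nat \<lfloor>2 * ln y\<rfloor>"
  have "A \<subseteq> (\<lambda>(p,j). p ^ j) ` (Q \<times> {1..J})"
  proof
    fix m assume m: "m \<in> A"
    then obtain p j where p: "p \<in> Q" "j \<ge> 1" "m = p ^ j" "real m \<le> y" using A by blast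
    have "2 ^ j \<le> p ^ j" using prime_ge_2_nat[OF Q(2)[OF p(1)]] by (intro power_mono) auto
    hence "(2::real) ^ j \<le> y" using p(3,4) by (metis of_nat_le_iff of_nat_numeral of_nat_power order_trans)
    hence "ln ((2::real) ^ j) \<le> ln y" using y by (subst ln_le_cancel_iff) auto
    hence "real j * ln 2 \<le> ln y" by (simp add: ln_realpow)
    moreover have "real j * (1/2) \<le> real j * ln 2" using ln2_ge_two_thirds by (intro mult_left_mono) auto
    ultimately have "real j \<le> 2 * ln y" by simp
    hence "j \<le> J" by (simp add: J_def le_nat_floor)
    thus "m \<in> (\<lambda>(p,j). p ^ j) ` (Q \<times> {1..J})" using p by auto
  qed
  moreover have fin: "finite ((\<lambda>(p,j). p ^ j) ` (Q \<times> {1..J}))" using Q by auto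
  ultimately show "finite A" using finite_subset by blast
  have "card A \<le> card (Q \<times> {1..J})"
    using card_mono[OF fin \<open>A \<subseteq> _\<close>] card_image_le[of "Q \<times> {1..J}" "\<lambda>(p,j). p ^ j"] Q by (meson finite_SigmaI finite_atLeastAtMost order_trans)
  also have "\<dots> = card Q * J" by (simp add: card_cartesian_product)
  finally have "real (card A) \<le> real (card Q) * real J" by (metis of_nat_le_iff of_nat_mult)
  also have "real J \<le> 2 * ln y" using y by (simp add: J_def)
  finally show "real (card A) \<le> real (card Q) * (2 * ln y)" by (simp add: mult_left_mono)
qed

section \<open>Von Mangoldt sums over the interval from x to 2x\<close>

definition dyadic :: "real \<Rightarrow> nat set" where "dyadic x = {m. x \<le> real m \<and> real m \<le> 2 * x}"

lemma finite_dyadic [simp]: "finite (dyadic x)"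
  by (rule finite_subset[of _ "{..nat \<lfloor>2 * x\<rfloor>}"]) (auto simp: dyadic_def le_nat_floor)

lemma infsum_mangoldt_dyadic: "(\<Sum>\<^sub>\<infinity>n\<in>A. mangoldt_dyadic x n) = (\<Sum>n\<in>A \<inter> dyadic x. mangoldt n)"
proof -
  have "(\<Sum>\<^sub>\<infinity>n\<in>A. mangoldt_dyadic x n) = (\<Sum>\<^sub>\<infinity>n\<in>A \<inter> dyadic x. mangoldt n)"
    by (rule infsum_cong_neutral) (auto simp: mangoldt_dyadic_def dyadic_def)
  thus ?thesis by simp
qed

lemma discrepancy_eq:
  "discrepancy (mangoldt_dyadic x) a q = (\<Sum>m | m \<in> dyadic x \<and> [m = a] (mod q). mangoldt m)
     - 1 / real (totient q) * (\<Sum>m | m \<in> dyadic x \<and> coprime m q. mangoldt m)"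
proof -
  have "{n. [n = a] (mod q)} \<inter> dyadic x = {m. m \<in> dyadic x \<and> [m = a] (mod q)}"
    "{n. coprime n q} \<inter> dyadic x = {m. m \<in> dyadic x \<and> coprime m q}" by auto
  thus ?thesis unfolding discrepancy_def infsum_mangoldt_dyadic by simp
qed

definition psi_dyadic :: "real \<Rightarrow> real" where "psi_dyadic x = (\<Sum>m\<in>dyadic x. mangoldt m)"

lemma mangoldt_dyadic_le:
  assumes "x \<ge> 1" "m \<in> dyadic x"
  shows "mangoldt m \<le> ln (2 * x)" "0 \<le> (mangoldt m :: real)"
proof -
  have m: "real m \<ge> 1" "real m \<le> 2 * x" using assms by (auto simp: dyadic_def)
  hence "mangoldt m \<le> ln (real m)" by (intro mangoldt_le) auto
  also have "\<dots> \<le> ln (2 * x)" using m by simp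
  finally show "mangoldt m \<le> ln (2 * x)" .
qed (rule mangoldt_nonneg)

text \<open>Only powers of primes dividing q are lost. There are at most 2 ln q such primes, each
  with at most 2 ln (2x) powers, and each power contributes at most ln (2x).\<close>

lemma coprime_sum_close:
  assumes x: "x \<ge> 1" and q: "q \<ge> 1"
  shows "\<bar>(\<Sum>m | m \<in> dyadic x \<and> coprime m q. mangoldt m) - psi_dyadic x\<bar> \<le> 4 * ln (real q) * ln (2 * x) ^ 2"
proof -
  define Bad where "Bad = {m \<in> dyadic x. \<not> coprime m q \<and> mangoldt m \<noteq> (0 :: real)}"
  have "psi_dyadic x = (\<Sum>m | m \<in> dyadic x \<and> coprime m q. mangoldt m) + (\<Sum>m | m \<in> dyadic x \<and> \<not> coprime m q. mangoldt m)"
    unfolding psi_dyadic_def by (subst sum.union_disjoint[symmetric]) (auto intro!: sum.cong)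
  moreover have "(\<Sum>m | m \<in> dyadic x \<and> \<not> coprime m q. mangoldt m) = (\<Sum>m\<in>Bad. mangoldt m :: real)"
    unfolding Bad_def by (rule sum.mono_neutral_right) auto
  moreover have "0 \<le> (\<Sum>m\<in>Bad. mangoldt m :: real)" by (intro sum_nonneg mangoldt_nonneg)
  moreover have "(\<Sum>m\<in>Bad. mangoldt m :: real) \<le> real (card Bad) * ln (2 * x)"
    using mangoldt_dyadic_le[OF x] by (intro sum_bounded_above) (auto simp: Bad_def)
  moreover have "real (card Bad) * ln (2 * x) \<le> 4 * ln (real q) * ln (2 * x) ^ 2"
  proof -
    have "real (card Bad) \<le> real (card (prime_factors q)) * (2 * ln (2 * x))"
    proof (rule card_prime_powers_le(2))
      fix m assume m: "m \<in> Bad"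
      hence "primepow m" by (auto simp: Bad_def mangoldt_def split: if_splits)
      then obtain p j where pj: "prime p" "j > 0" "m = p ^ j" by (auto simp: primepow_def)
      have "\<not> coprime m q" using m by (simp add: Bad_def)
      hence "p dvd q" using pj by (metis coprime_power_left_iff prime_imp_coprime_nat)
      thus "real m \<le> 2 * x \<and> (\<exists>p\<in>prime_factors q. \<exists>j\<ge>1. m = p ^ j)"
        using m pj q by (auto simp: Bad_def dyadic_def prime_factors_dvd Suc_le_eq)
    qed (use x in auto)
    moreover have "real (card (prime_factors q)) \<le> 2 * ln (real q)"
    proof -
      have "(2::nat) ^ card (prime_factors q) = (\<Prod>p\<in>prime_factors q. 2)" by simp
      also have "\<dots> \<le> \<Prod>(prime_factors q)" by (intro prod_mono) (auto intro!: prime_ge_2_nat in_prime_factors_imp_prime)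
      also have "\<dots> \<le> q"
      proof -
        have "\<Prod>(prime_factors q) dvd q" by (subst prod_primes_dvd_nat_iff) auto
        thus ?thesis using q by (intro dvd_imp_le) auto
      qed
      finally have "(2::real) ^ card (prime_factors q) \<le> real q" by (metis of_nat_le_iff of_nat_numeral of_nat_power)
      hence "ln ((2::real) ^ card (prime_factors q)) \<le> ln (real q)" using q by (subst ln_le_cancel_iff) auto
      hence "real (card (prime_factors q)) * ln 2 \<le> ln (real q)" by (simp add: ln_realpow)
      moreover have "real (card (prime_factors q)) * (1/2) \<le> real (card (prime_factors q)) * ln 2"
        using ln2_ge_two_thirds by (intro mult_left_mono) auto
      ultimately show ?thesis by simp
    qed
    ultimately have "real (card Bad) \<le> 2 * ln (real q) * (2 * ln (2 * x))"
      using x by (smt (verit) ln_ge_zero mult_right_mono)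
    hence "real (card Bad) * ln (2 * x) \<le> 2 * ln (real q) * (2 * ln (2 * x)) * ln (2 * x)"
      using x by (intro mult_right_mono) auto
    thus ?thesis by (simp add: power2_eq_square mult_ac)
  qed
  ultimately show ?thesis by linarith
qed

lemma card_cong_dyadic:
  assumes "q \<ge> 1" "x \<ge> 1"
  shows "real (card {m \<in> dyadic x. [m = a] (mod q)}) \<le> 2 * x / real q + 1"
proof -
  define N where "N = nat \<lfloor>2 * x\<rfloor>"
  have "inj_on (\<lambda>m. m div q) {m \<in> dyadic x. [m = a] (mod q)}"
  proof (rule inj_onI)
    fix m m' assume m: "m \<in> {m \<in> dyadic x. [m = a] (mod q)}" "m' \<in> {m \<in> dyadic x. [m = a] (mod q)}" "m div q = m' div q"
    hence "m mod q = m' mod q" by (simp add: cong_def)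
    thus "m = m'" using m(3) by (metis div_mult_mod_eq)
  qed
  moreover have "(\<lambda>m. m div q) ` {m \<in> dyadic x. [m = a] (mod q)} \<subseteq> {..N div q}"
    by (auto simp: dyadic_def N_def le_nat_floor intro!: div_le_mono)
  ultimately have "card {m \<in> dyadic x. [m = a] (mod q)} \<le> card {..N div q}"
    by (metis card_image card_mono finite_atMost)
  hence "real (card {m \<in> dyadic x. [m = a] (mod q)}) \<le> real (N div q) + 1" by simp
  also have "real (N div q) \<le> real N / real q" by (rule of_nat_div_le_of_nat)
  also have "\<dots> \<le> 2 * x / real q" using assms by (intro divide_right_mono) (auto simp: N_def)
  finally show ?thesis by simp
qed

text \<open>The trivial bound, from counting the integers of one class. It is the input by which the
  divisor-type weights are removed in \<open>weighted_discrepancy_le\<close>.\<close>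

lemma abs_discrepancy_le:
  assumes x: "x \<ge> 1" and q: "q \<ge> 1" "real q \<le> x"
  shows "\<bar>discrepancy (mangoldt_dyadic x) a q\<bar> \<le> 6 * x * ln (2 * x) / real (totient q)"
proof -
  have tq: "real (totient q) > 0" "real (totient q) \<le> real q" using q totient_le[of q] by auto
  have l: "ln (2 * x) \<ge> 0" using x by simp
  have card: "real (card {m \<in> dyadic x. [m = a] (mod r)}) \<le> 3 * x / real r" if "r \<ge> 1" "real r \<le> x" for a r
  proof -
    have "1 \<le> x / real r" using that by simp
    moreover have "3 * x / real r = 2 * x / real r + x / real r" by (simp add: field_simps)
    ultimately show ?thesis using card_cong_dyadic[OF that(1) x, of a] by linarith
  qed
  have "(\<Sum>m | m \<in> dyadic x \<and> [m = a] (mod q). mangoldt m) \<le> real (card {m \<in> dyadic x. [m = a] (mod q)}) * ln (2 * x)"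
    using mangoldt_dyadic_le[OF x] by (intro sum_bounded_above) auto
  also have "\<dots> \<le> 3 * x / real q * ln (2 * x)" using card[OF q] l by (intro mult_right_mono)
  also have "\<dots> \<le> 3 * x / real (totient q) * ln (2 * x)" using tq l x by (intro mult_right_mono divide_left_mono) auto
  finally have 1: "(\<Sum>m | m \<in> dyadic x \<and> [m = a] (mod q). mangoldt m) \<le> 3 * x / real (totient q) * ln (2 * x)" .
  have "(\<Sum>m | m \<in> dyadic x \<and> coprime m q. mangoldt m :: real) \<le> (\<Sum>m | m \<in> dyadic x \<and> [m = 1] (mod 1). mangoldt m)"
    by (intro sum_mono2) (auto simp: mangoldt_nonneg)
  also have "\<dots> \<le> real (card {m \<in> dyadic x. [m = 1] (mod 1)}) * ln (2 * x)"
    using mangoldt_dyadic_le[OF x] by (intro sum_bounded_above) auto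
  also have "\<dots> \<le> 3 * x / real 1 * ln (2 * x)" using l x by (intro mult_right_mono card) auto
  finally have "1 / real (totient q) * (\<Sum>m | m \<in> dyadic x \<and> coprime m q. mangoldt m) \<le> 1 / real (totient q) * (3 * x * ln (2 * x))"
    using tq by (intro mult_left_mono) auto
  hence 2: "1 / real (totient q) * (\<Sum>m | m \<in> dyadic x \<and> coprime m q. mangoldt m) \<le> 3 * x / real (totient q) * ln (2 * x)" by simp
  have 3: "0 \<le> (\<Sum>m | m \<in> dyadic x \<and> [m = a] (mod q). mangoldt m :: real)"
    "0 \<le> 1 / real (totient q) * (\<Sum>m | m \<in> dyadic x \<and> coprime m q. mangoldt m :: real)"
    by (auto intro!: sum_nonneg mangoldt_nonneg divide_nonneg_nonneg)
  have gen: "\<bar>u - v\<bar> \<le> c + c" if "u \<le> c" "v \<le> c" "0 \<le> u" "0 \<le> v" for u v c :: real using that by linarith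
  have "\<bar>discrepancy (mangoldt_dyadic x) a q\<bar> \<le> 3 * x / real (totient q) * ln (2 * x) + 3 * x / real (totient q) * ln (2 * x)"
    unfolding discrepancy_eq by (rule gen[OF 1 2 3])
  thus ?thesis by (simp add: field_simps)
qed

text \<open>A prime p > 2^(1/e) has p^e \<ge> 2 and pays for its own factor 2; the boundedly many
  smaller primes go into the constant.\<close>

lemma two_pow_card_prime_factors_le:
  assumes e: "e > 0"
  obtains C where "C > 0" "\<And>n. n \<ge> 1 \<Longrightarrow> 2 ^ card (prime_factors n) \<le> C * real n powr e"
proof -
  define T where "T = nat \<lfloor>2 powr (1 / e)\<rfloor>"
  have "2 ^ card (prime_factors n) \<le> 2 ^ Suc T * real n powr e" if n: "n \<ge> 1" for n
  proof -
    define A where "A = {p \<in> prime_factors n. p \<le> T}"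
    define B where "B = {p \<in> prime_factors n. p > T}"
    have AB: "prime_factors n = A \<union> B" "A \<inter> B = {}" "finite A" "finite B" by (auto simp: A_def B_def)
    have "card A \<le> card {..T}" by (intro card_mono) (auto simp: A_def)
    hence "(2::real) ^ card A \<le> 2 ^ Suc T" by (intro power_increasing) auto
    moreover have "(2::real) ^ card B \<le> real n powr e"
    proof -
      have "(2::real) ^ card B = (\<Prod>p\<in>B. 2)" by simp
      also have "\<dots> \<le> (\<Prod>p\<in>B. real p powr e)"
      proof (rule prod_mono)
        fix p assume p: "p \<in> B"
        have "2 powr (1 / e) \<le> real p" using p unfolding B_def T_def by (simp add: nat_less_iff floor_less_iff)
        hence "(2 powr (1 / e)) powr e \<le> real p powr e" using e by (intro powr_mono2) auto
        thus "0 \<le> (2::real) \<and> 2 \<le> real p powr e" using e by (simp add: powr_powr)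
      qed
      also have "\<dots> = (\<Prod>p\<in>B. real p) powr e" by (subst prod_powr_distrib) auto
      also have "\<dots> \<le> real n powr e"
      proof (rule powr_mono2)
        have "\<Prod>B dvd n" by (subst prod_primes_dvd_nat_iff) (auto simp: B_def)
        hence "\<Prod>B \<le> n" using n by (intro dvd_imp_le) auto
        hence "real (\<Prod>B) \<le> real n" by (simp only: of_nat_le_iff)
        thus "(\<Prod>p\<in>B. real p) \<le> real n" by (simp only: of_nat_prod)
      qed (use e in \<open>auto intro: prod_nonneg\<close>)
      finally show ?thesis .
    qed
    ultimately have "(2::real) ^ card A * 2 ^ card B \<le> 2 ^ Suc T * real n powr e" by (intro mult_mono) auto
    moreover have "card (prime_factors n) = card A + card B" using AB card_Un_disjoint by metis
    ultimately show ?thesis by (simp add: power_add)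
  qed
  thus ?thesis using that[of "2 ^ Suc T"] by simp
qed

lemma psi_dyadic_asymp: "((\<lambda>x. psi_dyadic x / x) \<longlongrightarrow> 1) at_top"
proof -
  have fl: "((\<lambda>x. cheb_psi (nat \<lfloor>c * x\<rfloor>) / x) \<longlongrightarrow> c) at_top" if c: "c > 0" for c :: real
  proof -
    have f: "filterlim (\<lambda>x. nat \<lfloor>c * x\<rfloor>) sequentially at_top"
      using c by (intro filterlim_compose[OF filterlim_nat_sequentially] filterlim_compose[OF filterlim_floor_sequentially]
         filterlim_tendsto_pos_mult_at_top[OF tendsto_const c filterlim_ident])
    have "((\<lambda>x. cheb_psi (nat \<lfloor>c * x\<rfloor>) / real (nat \<lfloor>c * x\<rfloor>)) \<longlongrightarrow> 1) at_top"
      by (rule filterlim_compose[OF cheb_psi_asymp f])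
    moreover have "((\<lambda>x. real_of_int \<lfloor>c * x\<rfloor> / x) \<longlongrightarrow> c) at_top" using c by real_asymp
    ultimately have "((\<lambda>x. cheb_psi (nat \<lfloor>c * x\<rfloor>) / real (nat \<lfloor>c * x\<rfloor>) * (real_of_int \<lfloor>c * x\<rfloor> / x)) \<longlongrightarrow> 1 * c) at_top"
      by (rule tendsto_mult)
    hence "((\<lambda>x. cheb_psi (nat \<lfloor>c * x\<rfloor>) / x) \<longlongrightarrow> 1 * c) at_top"
    proof (rule Lim_transform_eventually)
      show "\<forall>\<^sub>F x in at_top. cheb_psi (nat \<lfloor>c * x\<rfloor>) / real (nat \<lfloor>c * x\<rfloor>) * (real_of_int \<lfloor>c * x\<rfloor> / x) = cheb_psi (nat \<lfloor>c * x\<rfloor>) / x"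
        using eventually_ge_at_top[of "1 / c"]
      proof eventually_elim
        case (elim x)
        hence "c * x \<ge> 1" using c by (simp add: field_simps)
        hence f: "1 \<le> \<lfloor>c * x\<rfloor>" unfolding le_floor_iff by simp
        have r: "real (nat \<lfloor>c * x\<rfloor>) = real_of_int \<lfloor>c * x\<rfloor>" "real_of_int \<lfloor>c * x\<rfloor> \<noteq> 0" using f by (simp, linarith)
        have "u / r * (r / x) = u / x" if "r \<noteq> 0" for u r :: real using that by simp
        from this[OF r(2)] show ?case unfolding r(1) .
      qed
    qed
    thus ?thesis by simp
  qed
  have "((\<lambda>x. cheb_psi (nat \<lfloor>2 * x\<rfloor>) / x - cheb_psi (nat \<lfloor>1 * x\<rfloor>) / x) \<longlongrightarrow> 2 - 1) at_top"
    by (intro tendsto_diff fl) auto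
  hence A: "((\<lambda>x. (cheb_psi (nat \<lfloor>2 * x\<rfloor>) - cheb_psi (nat \<lfloor>x\<rfloor>)) / x) \<longlongrightarrow> 1) at_top" by (simp add: diff_divide_distrib)
  have "((\<lambda>x. (psi_dyadic x - (cheb_psi (nat \<lfloor>2 * x\<rfloor>) - cheb_psi (nat \<lfloor>x\<rfloor>))) / x) \<longlongrightarrow> 0) at_top"
  proof (rule Lim_null_comparison)
    show "\<forall>\<^sub>F x in at_top. norm ((psi_dyadic x - (cheb_psi (nat \<lfloor>2 * x\<rfloor>) - cheb_psi (nat \<lfloor>x\<rfloor>))) / x) \<le> ln (2 * x) / x"
      using eventually_ge_at_top[of 1]
    proof eventually_elim
      case (elim x)
      define D where "D = {nat \<lfloor>x\<rfloor><..nat \<lfloor>2 * x\<rfloor>}"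
      have c: "cheb_psi (nat \<lfloor>2 * x\<rfloor>) - cheb_psi (nat \<lfloor>x\<rfloor>) = (\<Sum>m\<in>D. mangoldt m)"
      proof -
        have "nat \<lfloor>x\<rfloor> \<le> nat \<lfloor>2 * x\<rfloor>" using elim by (intro nat_mono floor_mono) auto
        hence "{1..nat \<lfloor>2 * x\<rfloor>} = {1..nat \<lfloor>x\<rfloor>} \<union> D" by (auto simp: D_def)
        thus ?thesis unfolding cheb_psi_def by (simp only:, subst sum.union_disjoint) (auto simp: D_def)
      qed
      have sub: "D \<subseteq> dyadic x"
        using elim by (auto simp: D_def dyadic_def nat_less_iff floor_less_iff le_nat_iff le_floor_iff)
      \<comment> \<open>The interval is closed at x, while the difference of values of \<psi> omits
        x when x is an integer; this single term is the whole discrepancy.\<close>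
      have "dyadic x - D \<subseteq> {nat \<lfloor>x\<rfloor>}"
      proof
        fix m assume m: "m \<in> dyadic x - D"
        have "m \<le> nat \<lfloor>2 * x\<rfloor>" using m elim by (auto simp: dyadic_def le_nat_floor)
        hence "m \<le> nat \<lfloor>x\<rfloor>" using m by (auto simp: D_def)
        hence "real m \<le> x" using elim by (simp add: le_nat_iff le_floor_iff)
        hence "real m = x" using m by (simp add: dyadic_def)
        thus "m \<in> {nat \<lfloor>x\<rfloor>}" by auto
      qed
      hence "(\<Sum>m\<in>dyadic x - D. mangoldt m) \<le> ln (2 * x) \<and> 0 \<le> (\<Sum>m\<in>dyadic x - D. mangoldt m :: real)"
      proof -
        assume s: "dyadic x - D \<subseteq> {nat \<lfloor>x\<rfloor>}"
        have "(\<Sum>m\<in>dyadic x - D. mangoldt m) \<le> real (card (dyadic x - D)) * ln (2 * x)"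
          using mangoldt_dyadic_le[OF elim] by (intro sum_bounded_above) auto
        also have "card (dyadic x - D) \<le> 1" using card_mono[OF _ s] by simp
        hence "real (card (dyadic x - D)) * ln (2 * x) \<le> 1 * ln (2 * x)" using elim by (intro mult_right_mono) auto
        finally show ?thesis by (auto intro!: sum_nonneg mangoldt_nonneg)
      qed
      moreover have "psi_dyadic x = (\<Sum>m\<in>dyadic x - D. mangoldt m) + (\<Sum>m\<in>D. mangoldt m)"
        unfolding psi_dyadic_def using sub by (intro sum.subset_diff) auto
      ultimately have "\<bar>psi_dyadic x - (cheb_psi (nat \<lfloor>2 * x\<rfloor>) - cheb_psi (nat \<lfloor>x\<rfloor>))\<bar> \<le> ln (2 * x)"
        unfolding c by linarith
      thus ?case using elim by (simp add: divide_right_mono)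
    qed
    show "((\<lambda>x::real. ln (2 * x) / x) \<longlongrightarrow> 0) at_top" by real_asymp
  qed
  from tendsto_add[OF this A] show ?thesis by (simp add: diff_divide_distrib)
qed

section \<open>Expansion into residue classes\<close>

text \<open>A slot \<open>(i, True)\<close> carries the weight \<open>F i\<close>, a slot \<open>(i, False)\<close> the weight \<open>G i\<close>.\<close>

definition slot_coeff :: "real \<Rightarrow> (nat \<times> bool \<Rightarrow> real \<Rightarrow> real) \<Rightarrow> (nat \<times> bool) set \<Rightarrow> (nat \<times> bool \<Rightarrow> nat set) \<Rightarrow> real" where
  "slot_coeff L \<phi> J S = (\<Prod>j\<in>J. (-1) ^ card (S j) * \<phi> j (\<Sum>p\<in>S j. ln (real p) / L))"

text \<open>S lists for each slot the primes required to divide the corresponding shift; Z assigns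
  to each prime the one shift that it divides. A Z compatible with S exists exactly if no prime is
  demanded by slots of two different shifts.\<close>

definition slot_cons :: "(nat \<times> bool) set \<Rightarrow> (nat \<times> bool \<Rightarrow> nat set) \<Rightarrow> (nat \<Rightarrow> nat) \<Rightarrow> bool" where
  "slot_cons J S Z \<longleftrightarrow> (\<forall>j\<in>J. \<forall>p\<in>S j. Z p = fst j)"

definition slot_union :: "(nat \<times> bool) set \<Rightarrow> (nat \<times> bool \<Rightarrow> nat set) \<Rightarrow> nat set" where
  "slot_union J S = (\<Union>j\<in>J. S j)"

lemma slot_union_subset: "S \<in> PiE J (\<lambda>_. Pow P) \<Longrightarrow> slot_union J S \<subseteq> P"
  by (auto simp: slot_union_def PiE_iff)

lemma prod_indicator_all:
  "finite J \<Longrightarrow> (\<Prod>j\<in>J. if Q j then 1 else 0) = (if \<forall>j\<in>J. Q j then 1 else (0::real))"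
  by (induction J rule: finite_induct) auto

lemma prod_lam_set_expand:
  assumes "finite J" "finite P" "\<And>j. j \<in> J \<Longrightarrow> A j \<subseteq> P"
  shows "(\<Prod>j\<in>J. lam_set L (\<phi> j) (A j) 0) =
    (\<Sum>S\<in>PiE J (\<lambda>_. Pow P). slot_coeff L \<phi> J S * (if \<forall>j\<in>J. S j \<subseteq> A j then 1 else 0))"
proof -
  have "(\<Prod>j\<in>J. lam_set L (\<phi> j) (A j) 0) =
    (\<Prod>j\<in>J. \<Sum>S\<in>Pow P. ((-1) ^ card S * \<phi> j (\<Sum>p\<in>S. ln (real p) / L)) * (if S \<subseteq> A j then 1 else 0))"
    using assms by (intro prod.cong refl lam_set_indicator) auto
  also have "\<dots> = (\<Sum>S\<in>PiE J (\<lambda>_. Pow P). \<Prod>j\<in>J. ((-1) ^ card (S j) * \<phi> j (\<Sum>p\<in>S j. ln (real p) / L)) * (if S j \<subseteq> A j then 1 else 0))"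
    using assms by (intro prod_sum_PiE) auto
  finally show ?thesis by (simp only: prod.distrib prod_indicator_all[OF assms(1)] slot_coeff_def)
qed

lemma sum_PiE_slot_cons:
  assumes fin: "finite P" "finite D" "finite J" and S: "S \<in> PiE J (\<lambda>_. Pow P)"
  shows "(\<Sum>Z\<in>PiE P (\<lambda>_. D). (\<Prod>p\<in>P. w p (Z p)) * (if slot_cons J S Z then 1 else 0)) =
    (\<Prod>p\<in>P. \<Sum>z\<in>D. w p z * (if \<forall>j\<in>J. p \<in> S j \<longrightarrow> z = fst j then 1 else (0::real)))"
proof -
  have "slot_cons J S Z \<longleftrightarrow> (\<forall>p\<in>P. \<forall>j\<in>J. p \<in> S j \<longrightarrow> Z p = fst j)" for Z
    using S by (fastforce simp: slot_cons_def PiE_iff)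
  hence "(\<Sum>Z\<in>PiE P (\<lambda>_. D). (\<Prod>p\<in>P. w p (Z p)) * (if slot_cons J S Z then 1 else 0)) =
    (\<Sum>Z\<in>PiE P (\<lambda>_. D). \<Prod>p\<in>P. w p (Z p) * (if \<forall>j\<in>J. p \<in> S j \<longrightarrow> Z p = fst j then 1 else 0))"
    using fin by (simp only: prod.distrib prod_indicator_all)
  also have "\<dots> = (\<Prod>p\<in>P. \<Sum>z\<in>D. w p z * (if \<forall>j\<in>J. p \<in> S j \<longrightarrow> z = fst j then 1 else 0))"
    using fin by (intro prod_sum_PiE[symmetric]) auto
  finally show ?thesis .
qed

lemma sum_PiE_slot_cons_eq:
  assumes fin: "finite P" "finite D" "finite J" and S: "S \<in> PiE J (\<lambda>_. Pow P)"
    and X: "slot_cons J S X" and fst: "\<And>j. j \<in> J \<Longrightarrow> fst j \<in> D" and w: "\<And>p. p \<in> P \<Longrightarrow> (\<Sum>z\<in>D. w p z) = (1::real)"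
  shows "(\<Sum>Z\<in>PiE P (\<lambda>_. D). (\<Prod>p\<in>P. w p (Z p)) * (if slot_cons J S Z then 1 else 0)) = (\<Prod>p\<in>slot_union J S. w p (X p))"
proof -
  have "(\<Prod>p\<in>P. \<Sum>z\<in>D. w p z * (if \<forall>j\<in>J. p \<in> S j \<longrightarrow> z = fst j then 1 else (0::real))) = (\<Prod>p\<in>P. if p \<in> slot_union J S then w p (X p) else 1)"
  proof (rule prod.cong[OF refl])
    fix p assume p: "p \<in> P"
    show "(\<Sum>z\<in>D. w p z * (if \<forall>j\<in>J. p \<in> S j \<longrightarrow> z = fst j then 1 else (0::real))) = (if p \<in> slot_union J S then w p (X p) else 1)"
    proof (cases "p \<in> slot_union J S")
      case True
      then obtain j where j: "j \<in> J" "p \<in> S j" by (auto simp: slot_union_def)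
      have Xj: "X p = fst j" using X j by (auto simp: slot_cons_def)
      have "(\<forall>j\<in>J. p \<in> S j \<longrightarrow> z = fst j) \<longleftrightarrow> z = X p" for z
        using X j Xj unfolding slot_cons_def by metis
      hence "(\<Sum>z\<in>D. w p z * (if \<forall>j\<in>J. p \<in> S j \<longrightarrow> z = fst j then 1 else (0::real))) = (\<Sum>z\<in>D. if z = X p then w p z else 0)"
        by (intro sum.cong) auto
      also have "\<dots> = w p (X p)" using fin(2) fst[OF j(1)] Xj by (simp add: sum.delta)
      finally show ?thesis using True by simp
    next
      case False
      hence "(\<Sum>z\<in>D. w p z * (if \<forall>j\<in>J. p \<in> S j \<longrightarrow> z = fst j then 1 else (0::real))) = (\<Sum>z\<in>D. w p z)"
        by (intro sum.cong) (auto simp: slot_union_def)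
      thus ?thesis using False w[OF p] by simp
    qed
  qed
  also have "\<dots> = (\<Prod>p\<in>P \<inter> slot_union J S. w p (X p))" using fin(1) by (simp add: prod.inter_restrict)
  also have "P \<inter> slot_union J S = slot_union J S" using slot_union_subset[OF S] by auto
  finally show ?thesis unfolding sum_PiE_slot_cons[OF fin S] .
qed

lemma xex_slot_cons:
  assumes I: "finite I" "0 \<notin> I" and P: "finite P" "\<And>p. p \<in> P \<Longrightarrow> p \<ge> 2"
    and S: "S \<in> PiE (I \<times> UNIV) (\<lambda>_. Pow P)"
  shows "xex I P (\<lambda>Z. if slot_cons (I \<times> UNIV) S Z then 1 else 0) =
    (if \<exists>X. slot_cons (I \<times> UNIV) S X then (\<Prod>p\<in>slot_union (I \<times> UNIV) S. 1 / (real p - 1)) else 0)"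
proof (cases "\<exists>X. slot_cons (I \<times> UNIV) S X")
  case True
  then obtain X where X: "slot_cons (I \<times> UNIV) S X" by blast
  have "xex I P (\<lambda>Z. if slot_cons (I \<times> UNIV) S Z then 1 else 0) = (\<Prod>p\<in>slot_union (I \<times> UNIV) S. xwt I p (X p))"
    unfolding xex_def
  proof (rule sum_PiE_slot_cons_eq[OF P(1) _ _ S X])
    fix p assume "p \<in> P"
    have "(\<Sum>z\<in>insert 0 I. xwt I p z) = xwt I p 0 + (\<Sum>z\<in>I. xwt I p z)" using I by simp
    also have "(\<Sum>z\<in>I. xwt I p z) = (\<Sum>z\<in>I. 1 / (real p - 1))" by (intro sum.cong) (auto simp: xwt_def)
    finally show "(\<Sum>z\<in>insert 0 I. xwt I p z) = 1" using I by (simp add: xwt_def)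
  qed (use I in auto)
  also have "\<dots> = (\<Prod>p\<in>slot_union (I \<times> UNIV) S. 1 / (real p - 1))"
    using X by (intro prod.cong refl) (auto simp: slot_union_def slot_cons_def xwt_def)
  finally show ?thesis using True by simp
qed (simp add: xex_def)

lemma sform_expand:
  assumes I: "finite I" "0 \<notin> I" and P: "finite P" "\<And>p. p \<in> P \<Longrightarrow> p \<ge> 2"
  shows "sform L I P \<phi> = (\<Sum>S\<in>PiE (I \<times> UNIV) (\<lambda>_. Pow P). slot_coeff L \<phi> (I \<times> UNIV) S *
    (if \<exists>X. slot_cons (I \<times> UNIV) S X then (\<Prod>p\<in>slot_union (I \<times> UNIV) S. 1 / (real p - 1)) else 0))"
proof -
  let ?J = "I \<times> (UNIV :: bool set)"
  have "sform L I P \<phi> = xex I P (\<lambda>Z. \<Sum>S\<in>PiE ?J (\<lambda>_. Pow P). slot_coeff L \<phi> ?J S * (if slot_cons ?J S Z then 1 else 0))"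
    unfolding sform_def
  proof (rule xex_cong)
    fix Z
    have "(\<Prod>j\<in>?J. lam_set L (\<phi> j) (fibre P Z (fst j)) 0) =
      (\<Sum>S\<in>PiE ?J (\<lambda>_. Pow P). slot_coeff L \<phi> ?J S * (if \<forall>j\<in>?J. S j \<subseteq> fibre P Z (fst j) then 1 else 0))"
      using I P by (intro prod_lam_set_expand) (auto simp: fibre_def)
    also have "\<dots> = (\<Sum>S\<in>PiE ?J (\<lambda>_. Pow P). slot_coeff L \<phi> ?J S * (if slot_cons ?J S Z then 1 else 0))"
    proof (rule sum.cong[OF refl])
      fix S assume "S \<in> PiE ?J (\<lambda>_. Pow P)"
      hence "(\<forall>j\<in>?J. S j \<subseteq> fibre P Z (fst j)) \<longleftrightarrow> slot_cons ?J S Z"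
        unfolding fibre_def slot_cons_def PiE_iff by blast
      thus "slot_coeff L \<phi> ?J S * (if \<forall>j\<in>?J. S j \<subseteq> fibre P Z (fst j) then 1 else 0) = slot_coeff L \<phi> ?J S * (if slot_cons ?J S Z then 1 else 0)"
        by simp
    qed
    finally show "(\<Prod>j\<in>?J. lam_set L (\<phi> j) (fibre P Z (fst j)) 0) = (\<Sum>S\<in>PiE ?J (\<lambda>_. Pow P). slot_coeff L \<phi> ?J S * (if slot_cons ?J S Z then 1 else 0))" .
  qed
  also have "\<dots> = (\<Sum>S\<in>PiE ?J (\<lambda>_. Pow P). slot_coeff L \<phi> ?J S * xex I P (\<lambda>Z. if slot_cons ?J S Z then 1 else 0))"
    unfolding xex_def sum_distrib_left by (subst sum.swap) (simp only: mult.left_commute)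
  finally show ?thesis using I P by (simp add: xex_slot_cons cong: sum.cong)
qed

text \<open>Given X, the family S is recovered from the union of its F-slots and the union of its
  G-slots: the part in slot (i, t) consists of those primes of the union for t that X sends to i.
  Two subsets of V leave 4^|V| possibilities.\<close>

lemma card_slot_cons_le:
  assumes "finite V" "V \<subseteq> P"
  shows "card {S \<in> PiE (I \<times> UNIV) (\<lambda>_. Pow P). slot_cons (I \<times> UNIV) S X \<and> slot_union (I \<times> UNIV) S = V} \<le> 4 ^ card V"
    (is "card ?A \<le> _")
proof -
  define u where "u S t = (\<Union>i\<in>I. S (i, t))" for S :: "nat \<times> bool \<Rightarrow> nat set" and t
  have rec: "S j = {p \<in> u S (snd j). X p = fst j}" if "S \<in> ?A" "j \<in> I \<times> UNIV" for S j
    using that by (cases j) (fastforce simp: u_def slot_cons_def)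
  have "inj_on (\<lambda>S. (u S True, u S False)) ?A"
  proof (rule inj_onI)
    fix S S' assume S: "S \<in> ?A" "S' \<in> ?A" and eq: "(u S True, u S False) = (u S' True, u S' False)"
    have "u S t = u S' t" for t using eq by (cases t) auto
    hence "S j = S' j" if "j \<in> I \<times> UNIV" for j using rec[OF S(1) that] rec[OF S(2) that] by simp
    moreover have "S \<in> PiE (I \<times> UNIV) (\<lambda>_. Pow P)" "S' \<in> PiE (I \<times> UNIV) (\<lambda>_. Pow P)" using S by auto
    ultimately show "S = S'" by (meson PiE_ext)
  qed
  moreover have "(\<lambda>S. (u S True, u S False)) ` ?A \<subseteq> Pow V \<times> Pow V"
    by (auto simp: u_def slot_union_def)
  ultimately have "card ?A \<le> card (Pow V \<times> Pow V)" using assms by (intro card_inj_on_le) auto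
  also have "\<dots> = 4 ^ card V" using assms by (simp add: card_cartesian_product card_Pow power_mult_distrib[symmetric])
  finally show ?thesis .
qed

lemma sum_slots_cons_le:
  fixes e :: "nat set \<Rightarrow> real"
  assumes I: "finite I" and P: "finite P" and m: "m \<ge> 0"
    and T: "T \<subseteq> PiE (I \<times> UNIV) (\<lambda>_. Pow P)" "\<And>S. S \<in> T \<Longrightarrow> slot_cons (I \<times> UNIV) S X"
      "\<And>S. S \<in> T \<Longrightarrow> good (slot_union (I \<times> UNIV) S)"
    and e: "\<And>V. V \<subseteq> P \<Longrightarrow> e V \<ge> 0"
  shows "(\<Sum>S\<in>T. m ^ card (slot_union (I \<times> UNIV) S) * e (slot_union (I \<times> UNIV) S)) \<le>
    (\<Sum>V | V \<in> Pow P \<and> good V. (4 * m) ^ card V * e V)"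
proof -
  let ?J = "I \<times> (UNIV :: bool set)"
  define U where "U = slot_union ?J"
  define G where "G = {V. V \<in> Pow P \<and> good V}"
  have finS: "finite (PiE ?J (\<lambda>_. Pow P))" using I P by (intro finite_PiE) auto
  have finT: "finite T" by (rule finite_subset[OF T(1) finS])
  have finG: "finite G" unfolding G_def using P by simp
  have "U ` T \<subseteq> G"
  proof
    fix V assume "V \<in> U ` T"
    then obtain S where S: "S \<in> T" "V = U S" by blast
    thus "V \<in> G" using T(1) T(3)[OF S(1)] slot_union_subset[of S ?J P] by (auto simp: G_def U_def)
  qed
  hence "(\<Sum>S\<in>T. m ^ card (U S) * e (U S)) = (\<Sum>V\<in>G. \<Sum>S | S \<in> T \<and> U S = V. m ^ card (U S) * e (U S))"
    using sum.group[of T G U "\<lambda>S. m ^ card (U S) * e (U S)"] finT finG by simp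
  also have "\<dots> \<le> (\<Sum>V\<in>G. (4 * m) ^ card V * e V)"
  proof (rule sum_mono)
    fix V assume V: "V \<in> G"
    have Vf: "finite V" "V \<subseteq> P" using V P by (auto simp: G_def intro: finite_subset)
    have "card {S. S \<in> T \<and> U S = V} \<le> card {S \<in> PiE ?J (\<lambda>_. Pow P). slot_cons ?J S X \<and> slot_union ?J S = V}"
      using finS T(1,2) by (intro card_mono) (auto simp: U_def)
    also have "\<dots> \<le> 4 ^ card V" by (rule card_slot_cons_le[OF Vf])
    finally have "real (card {S. S \<in> T \<and> U S = V}) \<le> real (4 ^ card V)" by (simp only: of_nat_le_iff)
    hence c: "real (card {S. S \<in> T \<and> U S = V}) \<le> 4 ^ card V" by simp
    have "(\<Sum>S | S \<in> T \<and> U S = V. m ^ card (U S) * e (U S)) = (\<Sum>S | S \<in> T \<and> U S = V. m ^ card V * e V)"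
      by (intro sum.cong) auto
    also have "\<dots> = real (card {S. S \<in> T \<and> U S = V}) * (m ^ card V * e V)" by simp
    also have "\<dots> \<le> 4 ^ card V * (m ^ card V * e V)"
      using m Vf(2) by (intro mult_right_mono c mult_nonneg_nonneg e) auto
    finally show "(\<Sum>S | S \<in> T \<and> U S = V. m ^ card (U S) * e (U S)) \<le> (4 * m) ^ card V * e V"
      by (simp add: power_mult_distrib)
  qed
  finally show ?thesis by (simp only: U_def G_def)
qed

text \<open>
  A modulus may carry several residue classes, one for every compatible \<open>S\<close>. Averaging over all
  assignments \<open>X\<close> of slots to primes reduces to a single class for each modulus, at the cost of
  the divisor-bounded factor \<open>(4 card I) ^ card V\<close>.
\<close>
lemma sum_slots_le_average:
  assumes I: "finite I" "I \<noteq> {}" and P: "finite P"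
    and T: "T \<subseteq> PiE (I \<times> UNIV) (\<lambda>_. Pow P)" "\<And>S. S \<in> T \<Longrightarrow> \<exists>X. slot_cons (I \<times> UNIV) S X"
      "\<And>S. S \<in> T \<Longrightarrow> good (slot_union (I \<times> UNIV) S)"
    and E: "\<And>S X. S \<in> T \<Longrightarrow> X \<in> PiE P (\<lambda>_. I) \<Longrightarrow> slot_cons (I \<times> UNIV) S X \<Longrightarrow> E S \<le> e X (slot_union (I \<times> UNIV) S)"
    and e: "\<And>X V. X \<in> PiE P (\<lambda>_. I) \<Longrightarrow> V \<subseteq> P \<Longrightarrow> e X V \<ge> (0::real)"
    and R: "\<And>X. X \<in> PiE P (\<lambda>_. I) \<Longrightarrow> (\<Sum>V | V \<in> Pow P \<and> good V. (4 * real (card I)) ^ card V * e X V) \<le> R"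
  shows "(\<Sum>S\<in>T. E S) \<le> R"
proof -
  let ?J = "I \<times> (UNIV :: bool set)"
  define m where "m = real (card I)"
  have m: "m > 0" using I by (simp add: m_def card_gt_0_iff)
  define X0 where "X0 = PiE P (\<lambda>_. I)"
  define U where "U = slot_union ?J"
  have finX: "finite X0" unfolding X0_def using I P by (intro finite_PiE) auto
  have finS: "finite (PiE ?J (\<lambda>_. Pow P))" using I P by (intro finite_PiE) auto
  have finT: "finite T" by (rule finite_subset[OF T(1) finS])
  have cardX: "real (card X0) = m ^ card P" unfolding X0_def m_def using P by (simp add: card_PiE)
  \<comment> \<open>A uniformly random X agrees with S at each prime of its union with probability
    1/m, independently, so a fraction m^(-|U S|) of all X is compatible with S.\<close>
  have avg: "(\<Sum>X\<in>X0. (if slot_cons ?J S X then 1 else 0)) * m ^ card (U S) = m ^ card P" if S: "S \<in> T" for S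
  proof -
    obtain X where X: "slot_cons ?J S X" using T(2)[OF S] by blast
    have S': "S \<in> PiE ?J (\<lambda>_. Pow P)" using S T(1) by blast
    have "(\<Sum>Z\<in>PiE P (\<lambda>_. I). (\<Prod>p\<in>P. 1 / m) * (if slot_cons ?J S Z then 1 else 0)) = (\<Prod>p\<in>slot_union ?J S. 1 / m)"
      using sum_PiE_slot_cons_eq[OF P I(1) _ S' X, of "\<lambda>_ _. 1 / m"] I m by (auto simp: m_def)
    hence "(1 / m) ^ card P * (\<Sum>X\<in>X0. (if slot_cons ?J S X then 1 else 0)) = (1 / m) ^ card (U S)"
      by (simp only: sum_distrib_left[symmetric] prod_constant X0_def U_def)
    thus ?thesis using m by (simp add: field_simps power_one_over)
  qed
  have "m ^ card P * (\<Sum>S\<in>T. E S) = (\<Sum>S\<in>T. \<Sum>X\<in>X0. (if slot_cons ?J S X then m ^ card (U S) * E S else 0))"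
    unfolding sum_distrib_left
  proof (rule sum.cong[OF refl])
    fix S assume S: "S \<in> T"
    have "m ^ card P * E S = (\<Sum>X\<in>X0. (if slot_cons ?J S X then 1 else 0)) * (m ^ card (U S) * E S)"
      using avg[OF S] by (simp add: mult.assoc[symmetric])
    thus "m ^ card P * E S = (\<Sum>X\<in>X0. (if slot_cons ?J S X then m ^ card (U S) * E S else 0))"
      unfolding sum_distrib_right by (simp add: if_distrib[of "\<lambda>u. u * _"] cong: if_cong)
  qed
  also have "\<dots> = (\<Sum>X\<in>X0. \<Sum>S\<in>T. (if slot_cons ?J S X then m ^ card (U S) * E S else 0))" by (rule sum.swap)
  also have "\<dots> \<le> (\<Sum>X\<in>X0. R)"
  proof (rule sum_mono)
    fix X assume X: "X \<in> X0"
    define TX where "TX = {S \<in> T. slot_cons ?J S X}"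
    have "(\<Sum>S\<in>T. (if slot_cons ?J S X then m ^ card (U S) * E S else 0)) = (\<Sum>S\<in>TX. m ^ card (U S) * E S)"
      unfolding TX_def by (rule sum.inter_filter[OF finT, symmetric])
    also have "\<dots> \<le> (\<Sum>S\<in>TX. m ^ card (U S) * e X (U S))"
      using X m by (intro sum_mono mult_left_mono) (simp_all add: TX_def X0_def U_def E)
    also have "\<dots> \<le> (\<Sum>V | V \<in> Pow P \<and> good V. (4 * m) ^ card V * e X V)"
      unfolding U_def
    proof (rule sum_slots_cons_le[OF I(1) P])
      show "TX \<subseteq> PiE (I \<times> UNIV) (\<lambda>_. Pow P)" using T(1) by (auto simp: TX_def)
      show "slot_cons ?J S X" "good (slot_union ?J S)" if "S \<in> TX" for S using that T(3) by (auto simp: TX_def)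
      show "e X V \<ge> 0" if "V \<subseteq> P" for V using e X that by (simp add: X0_def)
    qed (use m in simp)
    also have "\<dots> \<le> R" using R[of X] X by (simp add: m_def X0_def)
    finally show "(\<Sum>S\<in>T. (if slot_cons ?J S X then m ^ card (U S) * E S else 0)) \<le> R" .
  qed
  also have "\<dots> = m ^ card P * R" using cardX by simp
  finally show ?thesis using m by simp
qed

lemma slot_incompatible:
  assumes "S \<in> PiE J (\<lambda>_. Pow P)" "\<nexists>X. slot_cons J S X"
  obtains j j' p where "j \<in> J" "j' \<in> J" "p \<in> S j" "p \<in> S j'" "fst j \<noteq> fst j'"
proof (rule ccontr)
  assume n: "\<not> thesis"
  note wit = that
  have eq: "fst j = fst j'" if "j \<in> J" "j' \<in> J" "p \<in> S j" "p \<in> S j'" for j j' p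
    using wit[of j j' p] n that by blast
  define X where "X p = fst (SOME j. j \<in> J \<and> p \<in> S j)" for p
  have "slot_cons J S X"
    unfolding slot_cons_def
  proof (intro ballI)
    fix j p assume j: "j \<in> J" "p \<in> S j"
    define j' where "j' = (SOME j. j \<in> J \<and> p \<in> S j)"
    have "j' \<in> J \<and> p \<in> S j'" unfolding j'_def by (rule someI[of _ j]) (use j in simp)
    thus "X p = fst j" using eq[of j' j p] j by (simp add: X_def j'_def)
  qed
  thus False using assms(2) by blast
qed

text \<open>The Chinese remainder theorem yields a class a that depends on X only and serves every
  modulus built from Q and P; \<open>level\<close> allows just one class for all moduli. In terms of
  m = n + h0 the condition p | n + h i reads m = h0 - h i modulo p, and a is invertible because p
  does not divide h0 - h i.\<close>

lemma slot_residue_class_exists: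
  fixes c :: int and h :: "nat \<Rightarrow> int"
  assumes Q: "finite Q" "\<And>p. p \<in> Q \<Longrightarrow> prime p" and P: "finite P" "\<And>p. p \<in> P \<Longrightarrow> prime p"
    and QP: "Q \<inter> P = {}" and c: "coprime c (int (\<Prod>Q))"
    and h: "\<And>p. p \<in> P \<Longrightarrow> \<not> int p dvd h0 - h (X p)"
  obtains a :: nat where "[int a = c] (mod int (\<Prod>Q))" "\<And>p. p \<in> P \<Longrightarrow> int p dvd int a - h0 + h (X p)"
    "coprime a (\<Prod>(Q \<union> P))"
proof -
  define r where "r p = (if p \<in> Q then c else h0 - h (X p))" for p
  have pr: "prime p" if "p \<in> Q \<union> P" for p using that Q P by auto
  have "\<forall>i\<in>Q \<union> P. \<forall>j\<in>Q \<union> P. i \<noteq> j \<longrightarrow> coprime i j" using pr primes_coprime by blast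
  from chinese_remainder_nat[OF _ this, of "\<lambda>p. nat (r p mod int p)"] Q(1) P(1)
  obtain a where a: "\<forall>p\<in>Q \<union> P. [a = nat (r p mod int p)] (mod p)" by auto
  have a': "int p dvd int a - r p" if p: "p \<in> Q \<union> P" for p
  proof -
    have "[int a = int (nat (r p mod int p))] (mod int p)" using a p by (simp only: cong_int_iff)
    also have "int (nat (r p mod int p)) = r p mod int p" using prime_gt_0_nat[OF pr[OF p]] by simp
    also have "[r p mod int p = r p] (mod int p)" by simp
    finally show ?thesis by (simp add: cong_iff_dvd_diff)
  qed
  show thesis
  proof (rule that[of a])
    have "int p dvd int a - c" if "p \<in> Q" for p using a'[of p] that by (simp add: r_def)
    hence "int (\<Prod>Q) dvd int a - c" using Q by (subst prod_primes_dvd_iff) auto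
    thus ac: "[int a = c] (mod int (\<Prod>Q))" by (simp only: cong_iff_dvd_diff)
    show "int p dvd int a - h0 + h (X p)" if p: "p \<in> P" for p
    proof -
      have "r p = h0 - h (X p)" using p QP by (auto simp: r_def)
      moreover have "int a - (h0 - h (X p)) = int a - h0 + h (X p)" by simp
      ultimately show ?thesis using a'[of p] p by (metis UnI2)
    qed
    show "coprime a (\<Prod>(Q \<union> P))"
    proof (rule prod_coprime_right)
      fix p assume p: "p \<in> Q \<union> P"
      have "\<not> int p dvd r p"
      proof (cases "p \<in> Q")
        case True
        hence "int p dvd int (\<Prod>Q)" using Q(1) by (simp only: int_dvd_int_iff) (rule dvd_prodI, auto)
        moreover have "\<not> is_unit (int p)" using pr[OF p] by auto
        ultimately show ?thesis using c True by (auto simp: r_def dest: coprime_common_divisor)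
      next
        case False
        thus ?thesis using h p by (auto simp: r_def)
      qed
      hence "\<not> int p dvd int a" using a'[OF p] by (metis dvd_diff_right_iff dvd_diff diff_diff_eq2 add_diff_cancel_left')
      hence "\<not> p dvd a" by simp
      thus "coprime a p" using prime_imp_coprime_nat[OF pr[OF p]] by (simp add: coprime_commute)
    qed
  qed
qed

text \<open>A prime of the union lies in at least one slot, so its logarithm is counted at least
  once in the sum over slots. This is where the sum of all supports becomes the size of the
  modulus.\<close>

lemma prod_slot_union_le:
  assumes J: "finite J" and P: "\<And>p. p \<in> P \<Longrightarrow> p \<ge> 1" "finite P" and S: "S \<in> PiE J (\<lambda>_. Pow P)" and x: "x > 1"
    and s: "\<And>j. j \<in> J \<Longrightarrow> (\<Sum>p\<in>S j. ln (real p) / ln x) \<le> s j"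
  shows "real (\<Prod>(slot_union J S)) \<le> x powr (\<Sum>j\<in>J. s j)"
proof -
  define U where "U = slot_union J S"
  have U: "U \<subseteq> P" "finite U" unfolding U_def using slot_union_subset[OF S] P finite_subset by auto
  have l: "0 \<le> ln (real p) / ln x" if "p \<in> P" for p using P(1)[OF that] x by simp
  have "(\<Sum>p\<in>U. ln (real p) / ln x) \<le> (\<Sum>p\<in>U. \<Sum>j\<in>J. if p \<in> S j then ln (real p) / ln x else 0)"
  proof (rule sum_mono)
    fix p assume p: "p \<in> U"
    then obtain j where j: "j \<in> J" "p \<in> S j" by (auto simp: U_def slot_union_def)
    have "(if p \<in> S j then ln (real p) / ln x else 0) \<le> (\<Sum>j\<in>J. if p \<in> S j then ln (real p) / ln x else 0)"
      using J j(1) l[of p] p U by (intro member_le_sum) auto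
    thus "ln (real p) / ln x \<le> (\<Sum>j\<in>J. if p \<in> S j then ln (real p) / ln x else 0)" using j by simp
  qed
  also have "\<dots> = (\<Sum>j\<in>J. \<Sum>p\<in>U. if p \<in> S j then ln (real p) / ln x else 0)" by (rule sum.swap)
  also have "\<dots> = (\<Sum>j\<in>J. \<Sum>p\<in>S j. ln (real p) / ln x)"
  proof (rule sum.cong[OF refl])
    fix j assume "j \<in> J"
    hence "U \<inter> S j = S j" by (auto simp: U_def slot_union_def)
    thus "(\<Sum>p\<in>U. if p \<in> S j then ln (real p) / ln x else 0) = (\<Sum>p\<in>S j. ln (real p) / ln x)"
      using sum.inter_restrict[OF U(2), of "\<lambda>p. ln (real p) / ln x" "S j"] by simp
  qed
  also have "\<dots> \<le> (\<Sum>j\<in>J. s j)" by (intro sum_mono s)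
  finally have "(\<Sum>p\<in>U. ln (real p)) \<le> (\<Sum>j\<in>J. s j) * ln x" using x by (simp add: sum_divide_distrib[symmetric] field_simps)
  moreover have pos: "real p > 0" if "p \<in> U" for p using U P(1)[of p] that by auto
  ultimately have "ln (\<Prod>p\<in>U. real p) \<le> (\<Sum>j\<in>J. s j) * ln x" using U(2) by (subst ln_prod) (auto simp: less_imp_neq[symmetric])
  hence "exp (ln (\<Prod>p\<in>U. real p)) \<le> exp ((\<Sum>j\<in>J. s j) * ln x)" by simp
  moreover have "exp (ln (\<Prod>p\<in>U. real p)) = (\<Prod>p\<in>U. real p)" using pos by (intro exp_ln prod_pos)
  ultimately have "(\<Prod>p\<in>U. real p) \<le> exp ((\<Sum>j\<in>J. s j) * ln x)" by (simp only:)
  thus ?thesis using x by (simp add: powr_def U_def)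
qed

lemma slot_coeff_abs_le:
  assumes "finite J" "\<And>j t. j \<in> J \<Longrightarrow> t \<ge> 0 \<Longrightarrow> \<bar>\<phi> j t\<bar> \<le> K" "L > 0" "S \<in> PiE J (\<lambda>_. Pow P)" "\<And>p. p \<in> P \<Longrightarrow> p \<ge> 1"
  shows "\<bar>slot_coeff L \<phi> J S\<bar> \<le> K ^ card J"
proof -
  have "\<bar>slot_coeff L \<phi> J S\<bar> = (\<Prod>j\<in>J. \<bar>\<phi> j (\<Sum>p\<in>S j. ln (real p) / L)\<bar>)"
    by (simp add: slot_coeff_def abs_prod abs_mult power_abs)
  also have "\<dots> \<le> (\<Prod>j\<in>J. K)"
  proof (intro prod_mono conjI abs_ge_zero)
    fix j assume j: "j \<in> J"
    have "S j \<subseteq> P" using assms(4) j by (auto simp: PiE_iff)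
    hence "0 \<le> ln (real p) / L" if "p \<in> S j" for p using assms(3) assms(5)[of p] that by auto
    thus "\<bar>\<phi> j (\<Sum>p\<in>S j. ln (real p) / L)\<bar> \<le> K" using j by (intro assms(2) sum_nonneg)
  qed
  finally show ?thesis by simp
qed

text \<open>Both sides are expanded over the families S of prime sets, in the variable m = n +
  \<open>h i0\<close>. Incompatible S contribute 0 to each side. For a compatible S the two
  contributions differ by a discrepancy modulo W times the product of the union of S, and the
  support conditions bound the primes and the modulus.\<close>

lemma sieve_sum_main_error:
  fixes I P P' Q :: "nat set" and h :: "nat \<Rightarrow> int" and i0 :: nat and b :: int and s :: "nat \<times> bool \<Rightarrow> real"
  defines "J \<equiv> I \<times> (UNIV :: bool set)" and "W \<equiv> \<Prod>Q"
  assumes I: "finite I" "I \<noteq> {}" "0 \<notin> I" "i0 \<notin> I"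
    and P: "finite P" "\<And>p. p \<in> P \<Longrightarrow> prime p" and Q: "finite Q" "\<And>p. p \<in> Q \<Longrightarrow> prime p" and QP: "Q \<inter> P = {}"
    and h: "\<And>p i i'. p \<in> P \<Longrightarrow> i \<in> insert i0 I \<Longrightarrow> i' \<in> insert i0 I \<Longrightarrow> i \<noteq> i' \<Longrightarrow> \<not> int p dvd h i - h i'"
    and b: "coprime (b + h i0) (int W)" and x: "x > 1"
    and s: "\<And>j t. j \<in> J \<Longrightarrow> t \<ge> 0 \<Longrightarrow> \<phi> j t \<noteq> 0 \<Longrightarrow> t \<le> s j" and K: "\<And>j t. j \<in> J \<Longrightarrow> t \<ge> 0 \<Longrightarrow> \<bar>\<phi> j t\<bar> \<le> K"
    and P': "P' \<subseteq> P" "\<And>p j. j \<in> J \<Longrightarrow> p \<in> P \<Longrightarrow> ln (real p) / ln x \<le> s j \<Longrightarrow> p \<in> P'"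
    and y: "real W * x powr (\<Sum>j\<in>J. s j) \<le> y" "y \<ge> 1"
    and R: "\<And>a. coprime a (\<Prod>(Q \<union> P')) \<Longrightarrow> (\<Sum>V | V \<in> Pow P' \<and> real (\<Prod>(Q \<union> V)) \<le> y.
      (4 * real (card I)) ^ card V * (\<bar>discrepancy (mangoldt_dyadic x) a (\<Prod>(Q \<union> V))\<bar> + 4 * ln y * ln (2 * x) ^ 2)) \<le> R"
  shows "\<bar>(\<Sum>m | m \<in> dyadic x \<and> [int m = b + h i0] (mod int W).
      mangoldt m * (\<Prod>j\<in>J. lam_set (ln x) (\<phi> j) {p \<in> P. int p dvd int m - h i0 + h (fst j)} 0))
     - psi_dyadic x / real (totient W) * sform (ln x) I P \<phi>\<bar> \<le> K ^ card J * R"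
proof -
  define D where "D = {m. m \<in> dyadic x \<and> [int m = b + h i0] (mod int W)}"
  define A where "A m i = {p \<in> P. int p dvd int m - h i0 + h i}" for m i
  define cf where "cf = slot_coeff (ln x) \<phi> J"
  define U where "U = slot_union J"
  define PS where "PS = PiE J (\<lambda>_. Pow P)"
  define M where "M S = (\<Sum>m\<in>D. mangoldt m * (if \<forall>j\<in>J. S j \<subseteq> A m (fst j) then 1 else 0) :: real)" for S
  define mn where "mn S = psi_dyadic x / real (totient W) * (if \<exists>X. slot_cons J S X then (\<Prod>p\<in>U S. 1 / (real p - 1)) else 0)" for S
  \<comment> \<open>The families that survive: compatible, and with non-zero coefficient, which
    confines their primes to P' and their modulus to y.\<close>
  define T where "T = {S \<in> PiE J (\<lambda>_. Pow P'). cf S \<noteq> 0 \<and> (\<exists>X. slot_cons J S X)}"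
  have fin: "finite J" "finite PS" "finite D" "finite P'" using I P P'(1) finite_subset
    by (auto simp: J_def PS_def D_def intro!: finite_PiE)
  have lx: "ln x > 0" using x by simp
  have p1: "p \<ge> 1" "p \<ge> 2" if "p \<in> P" for p using prime_ge_2_nat[OF P(2)[OF that]] by auto
  have Wpos: "W \<ge> 1" unfolding W_def using prod_primes_pos[of Q] Q by (simp add: Suc_le_eq)
  have "(\<Sum>m\<in>D. mangoldt m * (\<Prod>j\<in>J. lam_set (ln x) (\<phi> j) (A m (fst j)) 0))
    = (\<Sum>m\<in>D. \<Sum>S\<in>PS. cf S * (mangoldt m * (if \<forall>j\<in>J. S j \<subseteq> A m (fst j) then 1 else 0)))"
  proof (rule sum.cong[OF refl])
    fix m
    have "(\<Prod>j\<in>J. lam_set (ln x) (\<phi> j) (A m (fst j)) 0) = (\<Sum>S\<in>PS. cf S * (if \<forall>j\<in>J. S j \<subseteq> A m (fst j) then 1 else 0))"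
      unfolding PS_def cf_def using fin P by (intro prod_lam_set_expand) (auto simp: A_def)
    thus "mangoldt m * (\<Prod>j\<in>J. lam_set (ln x) (\<phi> j) (A m (fst j)) 0) = (\<Sum>S\<in>PS. cf S * (mangoldt m * (if \<forall>j\<in>J. S j \<subseteq> A m (fst j) then 1 else 0)))"
      by (simp only: sum_distrib_left mult.left_commute)
  qed
  also have "\<dots> = (\<Sum>S\<in>PS. cf S * M S)"
    unfolding M_def sum_distrib_left by (rule sum.swap)
  finally have e1: "(\<Sum>m\<in>D. mangoldt m * (\<Prod>j\<in>J. lam_set (ln x) (\<phi> j) (A m (fst j)) 0)) = (\<Sum>S\<in>PS. cf S * M S)" .
  have "sform (ln x) I P \<phi> = (\<Sum>S\<in>PS. cf S * (if \<exists>X. slot_cons J S X then (\<Prod>p\<in>U S. 1 / (real p - 1)) else 0))"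
    unfolding PS_def cf_def U_def J_def by (rule sform_expand[OF I(1) I(3) P(1) p1(2)])
  hence e2: "psi_dyadic x / real (totient W) * sform (ln x) I P \<phi> = (\<Sum>S\<in>PS. cf S * mn S)"
    by (simp only: mn_def sum_distrib_left mult.left_commute)
  have S_T: "S \<in> T" if S: "S \<in> PS" and c: "cf S \<noteq> 0" and X: "\<exists>X. slot_cons J S X" for S
  proof -
    have "S j \<subseteq> P'" if j: "j \<in> J" for j
    proof
      fix p assume p: "p \<in> S j"
      have sub: "S j \<subseteq> P" using S j by (auto simp: PS_def PiE_iff)
      have nn: "0 \<le> ln (real q) / ln x" if "q \<in> S j" for q using p1[of q] sub that lx by auto
      have "\<phi> j (\<Sum>p\<in>S j. ln (real p) / ln x) \<noteq> 0" using c j fin(1) by (auto simp: cf_def slot_coeff_def)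
      hence "(\<Sum>p\<in>S j. ln (real p) / ln x) \<le> s j" using nn j by (intro s sum_nonneg) auto
      moreover have "ln (real p) / ln x \<le> (\<Sum>p\<in>S j. ln (real p) / ln x)"
        using p nn finite_subset[OF sub P(1)] by (intro member_le_sum) auto
      ultimately show "p \<in> P'" using P'(2)[OF j] p sub by auto
    qed
    thus ?thesis using S c X by (auto simp: T_def PS_def PiE_iff)
  qed
  \<comment> \<open>A prime demanded by two different shifts would divide the difference of the two,
    which h excludes; so no m satisfies the conditions.\<close>
  have M0: "M S = mn S" if S: "S \<in> PS" and X: "\<nexists>X. slot_cons J S X" for S
  proof -
    obtain j j' p where j: "j \<in> J" "j' \<in> J" "p \<in> S j" "p \<in> S j'" "fst j \<noteq> fst j'"
      using slot_incompatible[of S J P] S X unfolding PS_def by blast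
    have "\<not> (\<forall>j\<in>J. S j \<subseteq> A m (fst j))" for m
    proof
      assume "\<forall>j\<in>J. S j \<subseteq> A m (fst j)"
      hence "p \<in> A m (fst j)" "p \<in> A m (fst j')" using j by auto
      hence p: "p \<in> P" "int p dvd int m - h i0 + h (fst j)" "int p dvd int m - h i0 + h (fst j')"
        by (simp_all add: A_def)
      have "int p dvd (int m - h i0 + h (fst j)) - (int m - h i0 + h (fst j'))" by (rule dvd_diff[OF p(2,3)])
      hence "int p dvd h (fst j) - h (fst j')" by simp
      moreover have "fst j \<in> insert i0 I" "fst j' \<in> insert i0 I" using j by (auto simp: J_def)
      ultimately show False using h[of p "fst j" "fst j'"] j(5) p(1) by simp
    qed
    hence "M S = 0" unfolding M_def by (intro sum.neutral) auto
    thus ?thesis using X by (simp add: mn_def)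
  qed
  have "PiE J (\<lambda>_. Pow P') \<subseteq> PS" unfolding PS_def using P'(1) by (intro PiE_mono) auto
  hence T_sub: "T \<subseteq> PS" by (auto simp: T_def)
  have "(\<Sum>S\<in>PS. cf S * M S) - (\<Sum>S\<in>PS. cf S * mn S) = (\<Sum>S\<in>PS. cf S * (M S - mn S))"
    by (simp add: sum_subtractf right_diff_distrib)
  also have "\<dots> = (\<Sum>S\<in>T. cf S * (M S - mn S))"
  proof (rule sum.mono_neutral_right[OF fin(2) T_sub])
    show "\<forall>S\<in>PS - T. cf S * (M S - mn S) = 0" using S_T M0 by (metis DiffD1 DiffD2 diff_self mult_zero_left mult_zero_right)
  qed
  finally have e3: "(\<Sum>S\<in>PS. cf S * M S) - (\<Sum>S\<in>PS. cf S * mn S) = (\<Sum>S\<in>T. cf S * (M S - mn S))" .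
  have "\<bar>\<Sum>S\<in>T. cf S * (M S - mn S)\<bar> \<le> (\<Sum>S\<in>T. K ^ card J * \<bar>M S - mn S\<bar>)"
  proof (rule order_trans[OF sum_abs sum_mono])
    fix S assume "S \<in> T"
    hence "\<bar>cf S\<bar> \<le> K ^ card J" unfolding cf_def using T_sub K lx p1 fin(1) by (intro slot_coeff_abs_le[of _ _ _ _ _ P]) (auto simp: PS_def)
    thus "\<bar>cf S * (M S - mn S)\<bar> \<le> K ^ card J * \<bar>M S - mn S\<bar>" unfolding abs_mult by (rule mult_right_mono) simp
  qed
  also have "\<dots> = K ^ card J * (\<Sum>S\<in>T. \<bar>M S - mn S\<bar>)" by (simp only: sum_distrib_left)
  also have "\<dots> \<le> K ^ card J * R"
  proof (rule mult_left_mono)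
    have "\<exists>a. [int a = b + h i0] (mod int W) \<and> (\<forall>p\<in>P'. int p dvd int a - h i0 + h (X p)) \<and> coprime a (\<Prod>(Q \<union> P'))"
      if X: "X \<in> PiE P' (\<lambda>_. I)" for X
    proof (rule slot_residue_class_exists[of Q P' "b + h i0" "h i0" h X])
      show "\<not> int p dvd h i0 - h (X p)" if "p \<in> P'" for p
        using that X P'(1) I(4) by (intro h) (auto simp: PiE_iff)
    qed (use Q P P'(1) QP b fin in \<open>auto simp: W_def\<close>)
    then obtain a where a: "\<And>X. X \<in> PiE P' (\<lambda>_. I) \<Longrightarrow> [int (a X) = b + h i0] (mod int W)"
      "\<And>X p. X \<in> PiE P' (\<lambda>_. I) \<Longrightarrow> p \<in> P' \<Longrightarrow> int p dvd int (a X) - h i0 + h (X p)"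
      "\<And>X. X \<in> PiE P' (\<lambda>_. I) \<Longrightarrow> coprime (a X) (\<Prod>(Q \<union> P'))" by metis
    define q where "q V = \<Prod>(Q \<union> V)" for V
    have qV: "q V = W * \<Prod>V" "q V \<ge> 1" "real (totient (q V)) = real (totient W) * (\<Prod>p\<in>V. real p - 1)" if V: "V \<subseteq> P'" for V
    proof -
      have fV: "finite V" "Q \<inter> V = {}" "\<And>p. p \<in> V \<Longrightarrow> prime p" using V fin(4) P'(1) QP P(2) finite_subset by blast+
      show "q V = W * \<Prod>V" unfolding q_def W_def using Q(1) fV by (intro prod.union_disjoint) auto
      show "q V \<ge> 1" unfolding q_def using prod_primes_pos[of "Q \<union> V"] fV(3) Q(2) by (fastforce simp: Suc_le_eq)
      have "real (totient (q V)) = (\<Prod>p\<in>Q \<union> V. real p - 1)" unfolding q_def using Q fV by (intro totient_prod_primes) auto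
      also have "\<dots> = (\<Prod>p\<in>Q. real p - 1) * (\<Prod>p\<in>V. real p - 1)" using Q(1) fV by (intro prod.union_disjoint) auto
      finally show "real (totient (q V)) = real (totient W) * (\<Prod>p\<in>V. real p - 1)" unfolding W_def using Q by (simp add: totient_prod_primes)
    qed
    have TP: "S \<in> PiE J (\<lambda>_. Pow P')" "U S \<subseteq> P'" if "S \<in> T" for S
      using that slot_union_subset[of S J P'] by (auto simp: T_def U_def)
    have qy: "real (q (U S)) \<le> y" if S: "S \<in> T" for S
    proof -
      have "(\<Sum>p\<in>S j. ln (real p) / ln x) \<le> s j" if j: "j \<in> J" for j
      proof (rule s[OF j])
        have "S j \<subseteq> P'" using TP(1)[OF S] j by (auto simp: PiE_iff)
        hence "p \<ge> 1" if "p \<in> S j" for p using p1 P'(1) that by auto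
        thus "(\<Sum>p\<in>S j. ln (real p) / ln x) \<ge> 0" using lx by (intro sum_nonneg) auto
        show "\<phi> j (\<Sum>p\<in>S j. ln (real p) / ln x) \<noteq> 0" using S j fin(1) by (auto simp: T_def cf_def slot_coeff_def)
      qed
      hence "real (\<Prod>(U S)) \<le> x powr (\<Sum>j\<in>J. s j)" unfolding U_def
        using p1 P'(1) by (intro prod_slot_union_le[OF fin(1) _ fin(4) TP(1)[OF S] x]) auto
      hence "real W * real (\<Prod>(U S)) \<le> real W * x powr (\<Sum>j\<in>J. s j)" by (intro mult_left_mono) auto
      thus ?thesis unfolding qV(1)[OF TP(2)[OF S]] of_nat_mult using y(1) by linarith
    qed
    show "(\<Sum>S\<in>T. \<bar>M S - mn S\<bar>) \<le> R"
    proof (rule sum_slots_le_average[OF I(1,2) fin(4), where good = "\<lambda>V. real (q V) \<le> y" and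
          e = "\<lambda>X V. \<bar>discrepancy (mangoldt_dyadic x) (a X) (q V)\<bar> + \<bar>4 * ln y * ln (2 * x) ^ 2\<bar>"])
      show "T \<subseteq> PiE (I \<times> UNIV) (\<lambda>_. Pow P')" by (auto simp: T_def J_def)
      show "\<exists>X. slot_cons (I \<times> UNIV) S X" if "S \<in> T" for S using that by (auto simp: T_def J_def)
      show "real (q (slot_union (I \<times> UNIV) S)) \<le> y" if "S \<in> T" for S using qy[OF that] by (simp add: U_def J_def)
      show "(\<Sum>V | V \<in> Pow P' \<and> real (q V) \<le> y. (4 * real (card I)) ^ card V *
          (\<bar>discrepancy (mangoldt_dyadic x) (a X) (q V)\<bar> + \<bar>4 * ln y * ln (2 * x) ^ 2\<bar>)) \<le> R" if X: "X \<in> PiE P' (\<lambda>_. I)" for X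
      proof -
        have "ln y \<ge> 0" using y(2) by simp
        hence "\<bar>4 * ln y * ln (2 * x) ^ 2\<bar> = 4 * ln y * ln (2 * x) ^ 2" by simp
        thus ?thesis using R[OF a(3)[OF X]] by (simp only: q_def)
      qed
      fix S X assume S: "S \<in> T" and X: "X \<in> PiE P' (\<lambda>_. I)" and SX: "slot_cons (I \<times> UNIV) S X"
      have V: "U S \<subseteq> P'" by (rule TP(2)[OF S])
      define r where "r = q (U S)"
      have r: "r \<ge> 1" "real r \<le> y" unfolding r_def using qV(2)[OF V] qy[OF S] by auto
      \<comment> \<open>Because X is compatible with S, all divisibility conditions of S together
        with the class modulo W collapse to the single congruence m = a X modulo r.\<close>
      have iff: "m \<in> D \<and> (\<forall>j\<in>J. S j \<subseteq> A m (fst j)) \<longleftrightarrow> m \<in> dyadic x \<and> [m = a X] (mod r)" for m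
      proof -
        have "[m = a X] (mod r) \<longleftrightarrow> int (\<Prod>(Q \<union> U S)) dvd int m - int (a X)"
          unfolding r_def q_def cong_int_iff[symmetric] cong_iff_dvd_diff ..
        also have "\<dots> \<longleftrightarrow> (\<forall>p\<in>Q. int p dvd int m - int (a X)) \<and> (\<forall>p\<in>U S. int p dvd int m - int (a X))"
          using Q P P'(1) V fin(4) finite_subset[OF V] by (subst prod_primes_dvd_iff) auto
        also have "(\<forall>p\<in>Q. int p dvd int m - int (a X)) \<longleftrightarrow> int W dvd int m - int (a X)"
          unfolding W_def using Q by (subst prod_primes_dvd_iff) auto
        also have "\<dots> \<longleftrightarrow> [int m = b + h i0] (mod int W)"
          unfolding cong_iff_dvd_diff[symmetric] using a(1)[OF X] by (metis cong_sym cong_trans)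
        also have "(\<forall>p\<in>U S. int p dvd int m - int (a X)) \<longleftrightarrow> (\<forall>j\<in>J. \<forall>p\<in>S j. int p dvd int m - int (a X))"
          by (auto simp: U_def slot_union_def)
        also have "\<dots> \<longleftrightarrow> (\<forall>j\<in>J. S j \<subseteq> A m (fst j))"
        proof (intro ball_cong refl)
          fix j assume j: "j \<in> J"
          have sub: "S j \<subseteq> P'" using TP(1)[OF S] j by (auto simp: PiE_iff)
          have "int p dvd int m - int (a X) \<longleftrightarrow> p \<in> A m (fst j)" if p: "p \<in> S j" for p
          proof -
            have pP: "p \<in> P'" "p \<in> P" using p sub P'(1) by auto
            have "X p = fst j" using SX j p by (auto simp: slot_cons_def J_def)
            hence "int p dvd int (a X) - h i0 + h (fst j)" using a(2)[OF X pP(1)] by simp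
            moreover have "int m - h i0 + h (fst j) = (int m - int (a X)) + (int (a X) - h i0 + h (fst j))" by simp
            ultimately have "int p dvd int m - h i0 + h (fst j) \<longleftrightarrow> int p dvd int m - int (a X)"
              by (simp only: dvd_add_left_iff)
            thus ?thesis using pP by (simp add: A_def)
          qed
          thus "(\<forall>p\<in>S j. int p dvd int m - int (a X)) \<longleftrightarrow> S j \<subseteq> A m (fst j)" by auto
        qed
        finally show ?thesis by (auto simp: D_def)
      qed
      have "M S = (\<Sum>m | m \<in> D \<and> (\<forall>j\<in>J. S j \<subseteq> A m (fst j)). mangoldt m)"
        unfolding M_def using fin(3) by (simp add: sum.inter_filter if_distrib[of "\<lambda>u. _ * u"] cong: if_cong)
      hence Meq: "M S = (\<Sum>m | m \<in> dyadic x \<and> [m = a X] (mod r). mangoldt m)" by (simp only: iff)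
      define cp where "cp = (\<Sum>m | m \<in> dyadic x \<and> coprime m r. mangoldt m :: real)"
      have "totient r > 0" using r by simp
      hence "real (totient r) \<ge> 1" by linarith
      hence tr: "1 / real (totient r) \<le> 1" "1 / real (totient r) \<ge> 0" by (auto simp: divide_simps)
      have "mn S = psi_dyadic x / real (totient W) * (1 / (\<Prod>p\<in>U S. real p - 1))"
        using SX by (auto simp: mn_def J_def prod_dividef)
      hence mneq: "mn S = 1 / real (totient r) * psi_dyadic x" unfolding r_def qV(3)[OF V] by simp
      \<comment> \<open>The main term uses the full sum \<open>psi_dyadic x\<close>, the discrepancy
        only the m coprime to r; the second summand corrects for this and is harmless by
        \<open>coprime_sum_close\<close>.\<close>
      have "M S - mn S = discrepancy (mangoldt_dyadic x) (a X) r + 1 / real (totient r) * (cp - psi_dyadic x)"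
        unfolding Meq mneq discrepancy_eq cp_def by (simp add: right_diff_distrib)
      moreover have "\<bar>1 / real (totient r) * (cp - psi_dyadic x)\<bar> \<le> 4 * ln y * ln (2 * x) ^ 2"
      proof -
        have "\<bar>1 / real (totient r) * (cp - psi_dyadic x)\<bar> = 1 / real (totient r) * \<bar>cp - psi_dyadic x\<bar>" using tr(2) by (simp add: abs_mult)
        also have "\<dots> \<le> 1 * \<bar>cp - psi_dyadic x\<bar>" by (rule mult_right_mono[OF tr(1)]) simp
        also have "\<dots> \<le> 4 * ln (real r) * ln (2 * x) ^ 2" using coprime_sum_close[of x r] x r unfolding cp_def by simp
        also have "\<dots> \<le> 4 * ln y * ln (2 * x) ^ 2" using r by (intro mult_right_mono mult_left_mono) auto
        finally show ?thesis .
      qed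
      ultimately show "\<bar>M S - mn S\<bar> \<le> \<bar>discrepancy (mangoldt_dyadic x) (a X) (q (slot_union (I \<times> UNIV) S))\<bar> + \<bar>4 * ln y * ln (2 * x) ^ 2\<bar>"
        unfolding r_def U_def J_def by linarith
    qed simp
    obtain j where "j \<in> J" using I(2) by (auto simp: J_def)
    hence "K \<ge> 0" using K[of j 0] by (smt (verit) abs_ge_zero)
    thus "K ^ card J \<ge> 0" by simp
  qed
  finally show ?thesis using e1 e2 e3 by (simp only: D_def A_def)
qed

section \<open>Level of distribution\<close>

lemma sum_Pow_prod:
  fixes f :: "'a \<Rightarrow> real"
  assumes "finite P"
  shows "(\<Sum>V\<in>Pow P. \<Prod>p\<in>V. f p) = (\<Prod>p\<in>P. 1 + f p)"
  using prod_add[OF assms, of f "\<lambda>_. 1"] by (simp add: add.commute)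

text \<open>Bernoulli's inequality bounds each factor by (p / (p - 1))^\<kappa>, and
  \<open>mertens_lower\<close> bounds the resulting product; hence exp 10.\<close>

lemma prod_one_plus_le:
  assumes P: "\<And>p. p \<in> P \<Longrightarrow> prime p \<and> real p \<le> x" and x: "x \<ge> 3"
  shows "(\<Prod>p\<in>P. 1 + real \<kappa> / (real p - 1)) \<le> (2 * exp 10 * ln x) ^ \<kappa>"
proof -
  define A where "A = {p. prime p \<and> real p \<le> x}"
  have A: "finite A" "P \<subseteq> A" using P by (auto simp: A_def)
  have pr: "1 - 1 / real p > 0" "1 + 1 / (real p - 1) = inverse (1 - 1 / real p)" "1 / (real p - 1) \<ge> 0" if "p \<in> A" for p
    using prime_ge_2_nat[of p] that by (auto simp: A_def field_simps)
  have lx: "ln x > 0" using x by simp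
  have "(\<Prod>p\<in>P. 1 + real \<kappa> / (real p - 1)) \<le> (\<Prod>p\<in>P. (1 + 1 / (real p - 1)) ^ \<kappa>)"
  proof (rule prod_mono)
    fix p assume "p \<in> P"
    hence nn: "1 / (real p - 1) \<ge> 0" using pr(3) A(2) by auto
    hence "1 + real \<kappa> * (1 / (real p - 1)) \<le> (1 + 1 / (real p - 1)) ^ \<kappa>"
      by (intro Bernoulli_inequality) linarith
    moreover have "0 \<le> real \<kappa> * (1 / (real p - 1))" using nn by (intro mult_nonneg_nonneg) auto
    ultimately show "0 \<le> 1 + real \<kappa> / (real p - 1) \<and> 1 + real \<kappa> / (real p - 1) \<le> (1 + 1 / (real p - 1)) ^ \<kappa>"
      by simp
  qed
  also have "\<dots> = (\<Prod>p\<in>P. 1 + 1 / (real p - 1)) ^ \<kappa>" by (rule prod_power_distrib[symmetric])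
  also have "\<dots> \<le> (2 * exp 10 * ln x) ^ \<kappa>"
  proof (rule power_mono)
    have "(\<Prod>p\<in>P. 1 + 1 / (real p - 1)) \<le> (\<Prod>p\<in>A. 1 + 1 / (real p - 1))"
    proof (rule prod_mono2[OF A])
      show "1 \<le> 1 + 1 / (real p - 1)" if "p \<in> A - P" for p using pr(3)[of p] that by simp
      show "0 \<le> 1 + 1 / (real p - 1)" if "p \<in> P" for p using pr(3)[of p] that A(2) by force
    qed
    also have "\<dots> = inverse (\<Prod>p\<in>A. 1 - 1 / real p)" unfolding prod_inversef[symmetric] using pr by (intro prod.cong) auto
    also have "\<dots> \<le> inverse (exp (-10) / (2 * ln x))"
      using mertens_lower[OF x] lx by (intro le_imp_inverse_le) (auto simp: A_def)
    also have "\<dots> = 2 * exp 10 * ln x" by (simp add: exp_minus field_simps)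
    finally show "(\<Prod>p\<in>P. 1 + 1 / (real p - 1)) \<le> 2 * exp 10 * ln x" .
    show "0 \<le> (\<Prod>p\<in>P. 1 + 1 / (real p - 1))" using pr A(2) by (intro prod_nonneg) (auto intro!: add_nonneg_nonneg)
  qed
  finally show ?thesis .
qed

text \<open>Cauchy-Schwarz removes the weights \<kappa>^|V|: one factor receives the squared weights
  and the trivial discrepancy bound, which gives x times a power of ln x, and the other factor is D
  without weights. D may save any power of ln x, so half of its saving suffices.\<close>

lemma weighted_discrepancy_le:
  assumes x: "x \<ge> 3" and P: "\<And>p. p \<in> P \<Longrightarrow> prime p \<and> real p \<le> x" and Q: "finite Q" "\<And>p. p \<in> Q \<Longrightarrow> prime p" and QP: "Q \<inter> P = {}"
    and y: "1 \<le> y" "y \<le> x" and E: "E \<ge> 0"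
    and D: "(\<Sum>V | V \<in> Pow P \<and> real (\<Prod>(Q \<union> V)) \<le> y. \<bar>discrepancy (mangoldt_dyadic x) a (\<Prod>(Q \<union> V))\<bar>) \<le> D"
  shows "(\<Sum>V | V \<in> Pow P \<and> real (\<Prod>(Q \<union> V)) \<le> y. real \<kappa> ^ card V * (\<bar>discrepancy (mangoldt_dyadic x) a (\<Prod>(Q \<union> V))\<bar> + E))
    \<le> sqrt (6 * x * ln (2 * x) * (2 * exp 10 * ln x) ^ (\<kappa>\<^sup>2) * D) + E * y * (2 * exp 10 * ln x) ^ \<kappa>"
proof -
  define G where "G = {V. V \<in> Pow P \<and> real (\<Prod>(Q \<union> V)) \<le> y}"
  define d where "d V = \<bar>discrepancy (mangoldt_dyadic x) a (\<Prod>(Q \<union> V))\<bar>" for V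
  have "P \<subseteq> {p. prime p \<and> real p \<le> x}" using P by auto
  hence finP: "finite P" using finite_primes_le finite_subset by blast
  have finG: "finite G" unfolding G_def using finP by simp
  have D0: "D \<ge> 0" using D by (rule order_trans[rotated]) (intro sum_nonneg, simp)
  have p1: "real p - 1 > 0" "real p > 0" if "p \<in> P" for p using P[OF that] prime_ge_2_nat[of p] by auto
  have V: "finite V" "V \<inter> Q = {}" "\<And>p. p \<in> V \<Longrightarrow> prime p" "V \<subseteq> P" if "V \<in> G" for V
    using that P QP finP finite_subset by (auto simp: G_def)
  have prodpos: "(\<Prod>p\<in>V. real p - 1) > 0" if "V \<in> G" for V using p1 V(4)[OF that] by (intro prod_pos) auto
  have sumG: "(\<Sum>V\<in>G. \<Prod>p\<in>V. c / (real p - 1)) \<le> (\<Sum>V\<in>Pow P. \<Prod>p\<in>V. c / (real p - 1))" if c: "c \<ge> 0" for c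
  proof (rule sum_mono2)
    fix V assume "V \<in> Pow P - G"
    hence "real p - 1 > 0" if "p \<in> V" for p using p1 that by auto
    thus "0 \<le> (\<Prod>p\<in>V. c / (real p - 1))" using c by (intro prod_nonneg divide_nonneg_nonneg) (auto intro: less_imp_le)
  qed (use finP in \<open>auto simp: G_def\<close>)
  have "(\<Sum>V\<in>G. real \<kappa> ^ card V * d V)\<^sup>2 = (\<Sum>V\<in>G. (real \<kappa> ^ card V * sqrt (d V)) * sqrt (d V))\<^sup>2"
    by (intro arg_cong[of _ _ "\<lambda>u. u\<^sup>2"] sum.cong) (auto simp: d_def mult.assoc)
  also have "\<dots> \<le> (\<Sum>V\<in>G. (real \<kappa> ^ card V * sqrt (d V))\<^sup>2) * (\<Sum>V\<in>G. (sqrt (d V))\<^sup>2)"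
    by (rule Cauchy_Schwarz_ineq_sum)
  also have "\<dots> \<le> (6 * x * ln (2 * x) * (2 * exp 10 * ln x) ^ (\<kappa>\<^sup>2)) * D"
  proof (rule mult_mono)
    show "(\<Sum>V\<in>G. (sqrt (d V))\<^sup>2) \<le> D" using D by (simp add: G_def d_def)
    have "(\<Sum>V\<in>G. (real \<kappa> ^ card V * sqrt (d V))\<^sup>2) \<le> (\<Sum>V\<in>G. 6 * x * ln (2 * x) * (\<Prod>p\<in>V. real (\<kappa>\<^sup>2) / (real p - 1)))"
    proof (rule sum_mono)
      fix W assume W: "W \<in> G"
      define q where "q = \<Prod>(Q \<union> W)"
      have pr: "\<And>p. p \<in> Q \<union> W \<Longrightarrow> prime p" using V(3)[OF W] Q by auto
      have q1: "q \<ge> 1" using prod_primes_pos[of "Q \<union> W"] pr by (simp add: q_def Suc_le_eq)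
      have "real (totient q) = (\<Prod>p\<in>Q \<union> W. real p - 1)" unfolding q_def using Q V[OF W] pr by (intro totient_prod_primes) auto
      also have "\<dots> = (\<Prod>p\<in>Q. real p - 1) * (\<Prod>p\<in>W. real p - 1)" using Q(1) V[OF W] by (intro prod.union_disjoint) auto
      finally have t: "real (totient q) = (\<Prod>p\<in>Q. real p - 1) * (\<Prod>p\<in>W. real p - 1)" .
      have "1 \<le> (\<Prod>p\<in>Q. real p - 1)"
      proof (rule prod_ge_1)
        fix p assume "p \<in> Q"
        from prime_ge_2_nat[OF Q(2)[OF this]] show "1 \<le> real p - 1" by linarith
      qed
      hence "1 * (\<Prod>p\<in>W. real p - 1) \<le> real (totient q)" unfolding t using prodpos[OF W] by (intro mult_right_mono) auto
      hence tq: "(\<Prod>p\<in>W. real p - 1) \<le> real (totient q)" by simp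
      have "d W \<le> 6 * x * ln (2 * x) / real (totient q)"
        unfolding d_def q_def[symmetric] using x q1 y W by (intro abs_discrepancy_le) (auto simp: G_def q_def)
      also have "\<dots> \<le> 6 * x * ln (2 * x) / (\<Prod>p\<in>W. real p - 1)"
        using tq prodpos[OF W] x q1 by (intro divide_left_mono mult_pos_pos) auto
      finally have "real (\<kappa>\<^sup>2) ^ card W * d W \<le> real (\<kappa>\<^sup>2) ^ card W * (6 * x * ln (2 * x) / (\<Prod>p\<in>W. real p - 1))" by (rule mult_left_mono) simp
      also have "\<dots> = 6 * x * ln (2 * x) * (\<Prod>p\<in>W. real (\<kappa>\<^sup>2) / (real p - 1))" by (simp add: prod_dividef)
      also have "real (\<kappa>\<^sup>2) ^ card W * d W = (real \<kappa> ^ card W * sqrt (d W))\<^sup>2"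
        by (simp add: power_mult_distrib d_def power_mult[symmetric] mult.commute)
      finally show "(real \<kappa> ^ card W * sqrt (d W))\<^sup>2 \<le> 6 * x * ln (2 * x) * (\<Prod>p\<in>W. real (\<kappa>\<^sup>2) / (real p - 1))" .
    qed
    also have "\<dots> = 6 * x * ln (2 * x) * (\<Sum>V\<in>G. \<Prod>p\<in>V. real (\<kappa>\<^sup>2) / (real p - 1))" by (simp only: sum_distrib_left)
    also have "\<dots> \<le> 6 * x * ln (2 * x) * (2 * exp 10 * ln x) ^ (\<kappa>\<^sup>2)"
    proof (rule mult_left_mono)
      have "(\<Sum>V\<in>G. \<Prod>p\<in>V. real (\<kappa>\<^sup>2) / (real p - 1)) \<le> (\<Sum>V\<in>Pow P. \<Prod>p\<in>V. real (\<kappa>\<^sup>2) / (real p - 1))"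
        by (rule sumG) simp
      also have "\<dots> = (\<Prod>p\<in>P. 1 + real (\<kappa>\<^sup>2) / (real p - 1))" by (rule sum_Pow_prod[OF finP])
      also have "\<dots> \<le> (2 * exp 10 * ln x) ^ (\<kappa>\<^sup>2)" by (rule prod_one_plus_le[OF P x])
      finally show "(\<Sum>V\<in>G. \<Prod>p\<in>V. real (\<kappa>\<^sup>2) / (real p - 1)) \<le> (2 * exp 10 * ln x) ^ (\<kappa>\<^sup>2)" .
    qed (use x in simp)
    finally show "(\<Sum>V\<in>G. (real \<kappa> ^ card V * sqrt (d V))\<^sup>2) \<le> 6 * x * ln (2 * x) * (2 * exp 10 * ln x) ^ (\<kappa>\<^sup>2)" .
  qed (use x in \<open>auto intro!: sum_nonneg simp: d_def\<close>)
  finally have "(\<Sum>V\<in>G. real \<kappa> ^ card V * d V) \<le> sqrt (6 * x * ln (2 * x) * (2 * exp 10 * ln x) ^ (\<kappa>\<^sup>2) * D)"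
    by (rule real_le_rsqrt)
  moreover have "(\<Sum>V\<in>G. real \<kappa> ^ card V * E) \<le> E * y * (2 * exp 10 * ln x) ^ \<kappa>"
  proof -
    have "(\<Sum>V\<in>G. real \<kappa> ^ card V * E) \<le> (\<Sum>V\<in>G. E * y * (\<Prod>p\<in>V. real \<kappa> / (real p - 1)))"
    proof (rule sum_mono)
      fix W assume W: "W \<in> G"
      have "(\<Prod>p\<in>W. real p - 1) \<le> (\<Prod>p\<in>W. real p)" using p1 V(4)[OF W] by (intro prod_mono) (auto intro: less_imp_le)
      also have "\<dots> \<le> (\<Prod>p\<in>Q \<union> W. real p)"
      proof (rule prod_mono2)
        fix p assume "p \<in> Q \<union> W - W"
        hence "prime p" using Q by auto
        from prime_ge_1_nat[OF this] show "1 \<le> real p" by simp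
      qed (use Q V[OF W] in auto)
      also have "\<dots> \<le> y" using W by (simp add: G_def)
      finally have "1 \<le> y / (\<Prod>p\<in>W. real p - 1)" using prodpos[OF W] by simp
      hence "(real \<kappa> ^ card W * E) * 1 \<le> (real \<kappa> ^ card W * E) * (y / (\<Prod>p\<in>W. real p - 1))" using E by (intro mult_left_mono) auto
      thus "real \<kappa> ^ card W * E \<le> E * y * (\<Prod>p\<in>W. real \<kappa> / (real p - 1))" by (simp add: prod_dividef mult_ac)
    qed
    also have "\<dots> = E * y * (\<Sum>V\<in>G. \<Prod>p\<in>V. real \<kappa> / (real p - 1))" by (simp only: sum_distrib_left)
    also have "\<dots> \<le> E * y * (2 * exp 10 * ln x) ^ \<kappa>"
    proof (rule mult_left_mono)
      have "(\<Sum>V\<in>G. \<Prod>p\<in>V. real \<kappa> / (real p - 1)) \<le> (\<Sum>V\<in>Pow P. \<Prod>p\<in>V. real \<kappa> / (real p - 1))"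
        by (rule sumG) simp
      also have "\<dots> = (\<Prod>p\<in>P. 1 + real \<kappa> / (real p - 1))" by (rule sum_Pow_prod[OF finP])
      also have "\<dots> \<le> (2 * exp 10 * ln x) ^ \<kappa>" by (rule prod_one_plus_le[OF P x])
      finally show "(\<Sum>V\<in>G. \<Prod>p\<in>V. real \<kappa> / (real p - 1)) \<le> (2 * exp 10 * ln x) ^ \<kappa>" .
    qed (use E y in simp)
    finally show ?thesis .
  qed
  ultimately have "(\<Sum>V\<in>G. real \<kappa> ^ card V * d V) + (\<Sum>V\<in>G. real \<kappa> ^ card V * E) \<le>
    sqrt (6 * x * ln (2 * x) * (2 * exp 10 * ln x) ^ (\<kappa>\<^sup>2) * D) + E * y * (2 * exp 10 * ln x) ^ \<kappa>" by (rule add_mono)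
  moreover have "(\<Sum>V\<in>G. real \<kappa> ^ card V * (d V + E)) = (\<Sum>V\<in>G. real \<kappa> ^ card V * d V) + (\<Sum>V\<in>G. real \<kappa> ^ card V * E)"
    by (simp add: distrib_left sum.distrib)
  ultimately show ?thesis by (simp only: G_def d_def)
qed

text \<open>The common consequence of the two hypotheses: a bound uniform in the class a, for
  squarefree moduli whose primes are at most x^\<delta>, with one a for all moduli. Under
  \<open>EH\<close> the smoothness condition is void in effect, and \<delta> = 1 is taken.\<close>

definition level :: "real \<Rightarrow> real \<Rightarrow> bool" where
  "level \<theta> \<delta> \<longleftrightarrow> (\<forall>A\<ge>1. \<exists>C. \<forall>\<^sub>F x in at_top. \<forall>a. coprime a (prime_prod_in {1..x powr \<delta>}) \<longrightarrow>
     (\<Sum>q | real q \<le> x powr \<theta> \<and> q \<in> squarefree_in {1..x powr \<delta>}. \<bar>discrepancy (mangoldt_dyadic x) a q\<bar>)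
       \<le> C * (x * ln x powr (-A)))"

lemma lessapprox_refl_powr: "lessapprox (\<lambda>x. x powr \<theta>) (\<lambda>x. x powr \<theta>)"
  unfolding lessapprox_def
proof (intro exI[of _ "\<lambda>_. 0"] conjI)
  show "\<forall>\<^sub>F x in at_top. \<bar>x powr \<theta>\<bar> \<le> x powr 0 * x powr \<theta>"
    using eventually_gt_at_top[of 0] by eventually_elim simp
qed simp

lemma finite_squarefree_in: "finite {q. real q \<le> y \<and> q \<in> squarefree_in I}"
  by (rule finite_subset[of _ "{..nat \<lfloor>y\<rfloor>}"]) (auto simp: le_nat_floor)

text \<open>In \<open>MPZ\<close> the class may be any function of x. Choosing at each x a violating
  class, if there is one, and inserting this function shows that for large x there is none, so the
  bound is uniform in the class.\<close>

lemma MPZ_imp_level: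
  assumes "MPZ \<omega> \<delta>" "\<delta>' \<le> \<delta>"
  shows "level (1/2 + 2 * \<omega>) \<delta>'"
  unfolding level_def
proof (intro allI impI)
  fix A :: real assume A: "A \<ge> 1"
  let ?\<theta> = "1/2 + 2 * \<omega>"
  obtain C where C: "\<And>Q I a. lessapprox Q (\<lambda>x. x powr ?\<theta>) \<Longrightarrow>
     (\<forall>\<^sub>F x in at_top. I x \<subseteq> {1..x powr \<delta>} \<and> coprime (a x) (prime_prod_in (I x))) \<Longrightarrow>
     (\<forall>\<^sub>F x in at_top. (\<Sum>q | real q \<le> Q x \<and> q \<in> squarefree_in (I x). \<bar>discrepancy (mangoldt_dyadic x) (a x) q\<bar>) \<le> C * (x * ln x powr (-A)))"
    using assms(1) A unfolding MPZ_def by blast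
  let ?I = "\<lambda>x::real. {1..x powr \<delta>'}"
  let ?f = "\<lambda>x a. \<Sum>q | real q \<le> x powr ?\<theta> \<and> q \<in> squarefree_in (?I x). \<bar>discrepancy (mangoldt_dyadic x) a q\<bar>"
  define bad where "bad x a \<longleftrightarrow> coprime a (prime_prod_in (?I x)) \<and> \<not> ?f x a \<le> C * (x * ln x powr (-A))" for x a
  define a where "a x = (if \<exists>a. bad x a then SOME a. bad x a else 1)" for x
  have bad_a: "bad x (a x)" if "bad x c" for x c
  proof -
    have "\<exists>a. bad x a" using that by blast
    thus ?thesis using someI_ex[of "bad x"] by (simp add: a_def)
  qed
  have cop: "coprime (a x) (prime_prod_in (?I x))" for x
  proof (cases "\<exists>a. bad x a")
    case True
    thus ?thesis using bad_a by (auto simp: bad_def)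
  qed (simp add: a_def)
  have "\<forall>\<^sub>F x in at_top. ?f x (a x) \<le> C * (x * ln x powr (-A))"
  proof (rule C[OF lessapprox_refl_powr])
    show "\<forall>\<^sub>F x in at_top. ?I x \<subseteq> {1..x powr \<delta>} \<and> coprime (a x) (prime_prod_in (?I x))"
      using eventually_ge_at_top[of 1]
    proof eventually_elim
      case (elim x)
      hence "x powr \<delta>' \<le> x powr \<delta>" using assms(2) by (intro powr_mono) auto
      thus ?case using cop by auto
    qed
  qed
  hence "\<forall>\<^sub>F x in at_top. \<forall>a. coprime a (prime_prod_in (?I x)) \<longrightarrow> ?f x a \<le> C * (x * ln x powr (-A))"
  proof eventually_elim
    case (elim x)
    hence "\<not> bad x (a x)" by (simp add: bad_def)
    hence "\<not> bad x c" for c using bad_a by blast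
    thus ?case by (simp add: bad_def)
  qed
  thus "\<exists>C. \<forall>\<^sub>F x in at_top. \<forall>a. coprime a (prime_prod_in (?I x)) \<longrightarrow> ?f x a \<le> C * (x * ln x powr (-A))" by blast
qed

lemma discrepancy_cong: "[a = a'] (mod q) \<Longrightarrow> discrepancy \<alpha> a q = discrepancy \<alpha> a' q"
proof -
  assume a: "[a = a'] (mod q)"
  hence "[n = a] (mod q) \<longleftrightarrow> [n = a'] (mod q)" for n by (metis cong_sym cong_trans)
  thus ?thesis by (simp add: discrepancy_def)
qed

lemma EH_imp_level:
  assumes "EH \<theta>" "\<theta> \<le> 1"
  shows "level \<theta> 1"
  unfolding level_def
proof (intro allI impI)
  fix A :: real assume A: "A \<ge> 1"
  let ?sup = "\<lambda>x q. SUP a\<in>totatives q. \<bar>discrepancy (mangoldt_dyadic x) a q\<bar>"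
  have "(\<lambda>x. \<Sum>q | q \<ge> 1 \<and> real q \<le> x powr \<theta>. ?sup x q) \<in> O[at_top](\<lambda>x. x * ln x powr (-A))"
    using assms(1) A lessapprox_refl_powr unfolding EH_def by blast
  then obtain C where C: "\<forall>\<^sub>F x in at_top. norm (\<Sum>q | q \<ge> 1 \<and> real q \<le> x powr \<theta>. ?sup x q) \<le> C * norm (x * ln x powr (-A))"
    by (elim landau_o.bigE)
  have "\<forall>\<^sub>F x in at_top. \<forall>a. coprime a (prime_prod_in {1..x powr 1}) \<longrightarrow>
     (\<Sum>q | real q \<le> x powr \<theta> \<and> q \<in> squarefree_in {1..x powr 1}. \<bar>discrepancy (mangoldt_dyadic x) a q\<bar>) \<le> C * (x * ln x powr (-A))"
    using C eventually_ge_at_top[of 1]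
  proof eventually_elim
    case (elim x)
    have le_sup: "\<bar>discrepancy (mangoldt_dyadic x) a q\<bar> \<le> ?sup x q" if a: "coprime a q" and q: "q \<ge> 1" for a q
    proof -
      \<comment> \<open>\<open>totatives\<close> lists representatives between 1 and q, so for q = 1
        the residue 0 has to be replaced by 1.\<close>
      define a' where "a' = (if q = 1 then 1 else a mod q)"
      have "a' \<in> totatives q" using a q
        by (auto simp: a'_def totatives_def Suc_le_eq intro!: Nat.gr0I less_imp_le)
      hence "\<bar>discrepancy (mangoldt_dyadic x) a' q\<bar> \<le> ?sup x q" by (intro cSUP_upper) auto
      moreover have "discrepancy (mangoldt_dyadic x) a q = discrepancy (mangoldt_dyadic x) a' q"
        by (rule discrepancy_cong) (auto simp: a'_def cong_def)
      ultimately show ?thesis by simp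
    qed
    have fin: "finite {q. q \<ge> 1 \<and> real q \<le> x powr \<theta>}"
      by (rule finite_subset[of _ "{..nat \<lfloor>x powr \<theta>\<rfloor>}"]) (auto simp: le_nat_floor)
    have sup_nn: "?sup x q \<ge> 0" if "q \<ge> 1" for q using le_sup[of 1 q] that by simp
    show ?case
    proof (intro allI impI)
      fix a assume a: "coprime a (prime_prod_in {1..x powr 1})"
      have "(\<Sum>q | real q \<le> x powr \<theta> \<and> q \<in> squarefree_in {1..x powr 1}. \<bar>discrepancy (mangoldt_dyadic x) a q\<bar>)
        \<le> (\<Sum>q | real q \<le> x powr \<theta> \<and> q \<in> squarefree_in {1..x powr 1}. ?sup x q)"
      proof (rule sum_mono)
        fix q assume q: "q \<in> {q. real q \<le> x powr \<theta> \<and> q \<in> squarefree_in {1..x powr 1}}"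
        hence sq: "squarefree q" "\<forall>p\<in>prime_factors q. real p \<in> {1..x powr 1}" by (auto simp: squarefree_in_def)
        have q1: "q \<ge> 1" using sq(1) by (cases "q = 0") auto
        have "\<Prod>(prime_factors q) dvd prime_prod_in {1..x powr 1}"
          unfolding prime_prod_in_def using sq(2) finite_primes_le[of "x powr 1"]
          by (intro prod_dvd_prod_subset finite_subset[OF _ finite_primes_le[of "x powr 1"]]) auto
        hence "q dvd prime_prod_in {1..x powr 1}" by (simp only: squarefree_eq_prod[OF sq(1)])
        hence "coprime a q" using a by (meson coprime_divisors dvd_refl)
        thus "\<bar>discrepancy (mangoldt_dyadic x) a q\<bar> \<le> ?sup x q" by (rule le_sup[OF _ q1])
      qed
      also have "\<dots> \<le> (\<Sum>q | q \<ge> 1 \<and> real q \<le> x powr \<theta>. ?sup x q)"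
      proof (rule sum_mono2[OF fin])
        show "{q. real q \<le> x powr \<theta> \<and> q \<in> squarefree_in {1..x powr 1}} \<subseteq> {q. q \<ge> 1 \<and> real q \<le> x powr \<theta>}"
          by (auto simp: squarefree_in_def Suc_le_eq intro!: Nat.gr0I)
      qed (use sup_nn in auto)
      also have "\<dots> \<le> C * (x * ln x powr (-A))" using elim by simp
      finally show "(\<Sum>q | real q \<le> x powr \<theta> \<and> q \<in> squarefree_in {1..x powr 1}. \<bar>discrepancy (mangoldt_dyadic x) a q\<bar>) \<le> C * (x * ln x powr (-A))" .
    qed
  qed
  thus "\<exists>C. \<forall>\<^sub>F x in at_top. \<forall>a. coprime a (prime_prod_in {1..x powr 1}) \<longrightarrow>
     (\<Sum>q | real q \<le> x powr \<theta> \<and> q \<in> squarefree_in {1..x powr 1}. \<bar>discrepancy (mangoldt_dyadic x) a q\<bar>) \<le> C * (x * ln x powr (-A))" by blast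
qed

text \<open>With w = ln ln ln x, the at most w primes up to w give ln W \<le> w^2 \<le> exp w, and
  exp (exp w) = ln x. So W is absorbed by the gap between the sum of the supports and
  \<theta>.\<close>

lemma W_mod_le_ln: "\<forall>\<^sub>F x in at_top. real (W_mod x) \<le> ln x"
proof -
  have "\<forall>\<^sub>F w::real in at_top. 1 \<le> w \<and> w * w \<le> exp w" by (intro eventually_conj eventually_ge_at_top) real_asymp
  hence "\<forall>\<^sub>F x in at_top. 1 \<le> wlim x \<and> wlim x * wlim x \<le> exp (wlim x)"
    using filterlim_wlim by (rule eventually_compose_filterlim)
  thus ?thesis using eventually_gt_at_top[of "exp (exp 1)"]
  proof eventually_elim
    case (elim x)
    define w where "w = wlim x"
    have x: "ln x > 1" "ln (ln x) > 0"
    proof -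
      have "ln x > exp 1" using elim(2) by (smt (verit) exp_gt_zero ln_exp ln_less_cancel_iff)
      thus "ln x > 1" using exp_gt_one[of 1] by linarith
      thus "ln (ln x) > 0" by simp
    qed
    have pr: "1 \<le> real p" "real p \<le> w" if "p \<in> small_primes x" for p
      using that prime_ge_1_nat[of p] by (auto simp: small_primes_def w_def)
    have "card (small_primes x) \<le> card {1..nat \<lfloor>w\<rfloor>}"
      by (intro card_mono) (use pr in \<open>auto simp: le_nat_floor\<close>)
    hence c: "real (card (small_primes x)) \<le> w" using elim(1) by (simp add: w_def le_nat_iff le_floor_iff)
    have "real (W_mod x) = exp (\<Sum>p\<in>small_primes x. ln (real p))"
    proof -
      have "real (W_mod x) = (\<Prod>p\<in>small_primes x. exp (ln (real p)))"
        unfolding W_mod_eq of_nat_prod using pr(1) by (intro prod.cong refl exp_ln[symmetric]) force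
      thus ?thesis by (simp add: exp_sum)
    qed
    also have "\<dots> \<le> exp (w * w)"
    proof (subst exp_le_cancel_iff)
      have "(\<Sum>p\<in>small_primes x. ln (real p)) \<le> real (card (small_primes x)) * w"
      proof (rule sum_bounded_above)
        fix p assume "p \<in> small_primes x"
        thus "ln (real p) \<le> w" using pr[of p] ln_le_minus_one[of "real p"] by linarith
      qed
      also have "\<dots> \<le> w * w" using c elim(1) by (intro mult_right_mono) (auto simp: w_def)
      finally show "(\<Sum>p\<in>small_primes x. ln (real p)) \<le> w * w" .
    qed
    also have "\<dots> \<le> exp (exp w)" using elim(1) by (simp add: w_def)
    also have "exp (exp w) = ln x" using x by (simp add: w_def wlim_def)
    finally show ?case .
  qed
qed

lemma prime_set_split:
  assumes \<delta>: "0 < \<delta>" "\<delta> \<le> 1"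
  shows "\<forall>\<^sub>F x in at_top. {p. prime p \<and> real p \<in> {1..x powr \<delta>}} = small_primes x \<union> {p \<in> sieve_primes x. real p \<le> x powr \<delta>}"
proof -
  have "\<forall>\<^sub>F x::real in at_top. wlim x \<le> x powr \<delta>" unfolding wlim_def using \<delta>(1) by real_asymp
  moreover have "\<forall>\<^sub>F x::real in at_top. ln x \<ge> 1" by real_asymp
  ultimately show ?thesis using eventually_ge_at_top[of 1]
  proof eventually_elim
    case (elim x)
    have "x powr \<delta> = exp (\<delta> * ln x)" using elim by (simp add: powr_def)
    also have "\<dots> \<le> exp ((ln x)\<^sup>2)"
    proof -
      have "\<delta> * ln x \<le> 1 * ln x" using \<delta> elim by (intro mult_right_mono) auto
      also have "\<dots> \<le> ln x * ln x" using elim by (intro mult_right_mono) auto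
      finally show ?thesis by (simp add: power2_eq_square)
    qed
    finally show ?case using elim(1) prime_ge_1_nat
      by (auto simp: small_primes_def sieve_primes_def not_le)
  qed
qed

lemma level_weighted:
  fixes \<kappa> :: nat
  assumes lev: "level \<theta> \<delta>" and \<theta>: "0 < \<theta>" "\<theta> < 1" and \<delta>: "0 < \<delta>" "\<delta> \<le> 1" and B: "B \<ge> 0"
  shows "\<forall>\<^sub>F x in at_top. \<forall>a. coprime a (\<Prod>(small_primes x \<union> {p \<in> sieve_primes x. real p \<le> x powr \<delta>})) \<longrightarrow>
    (\<Sum>V | V \<in> Pow {p \<in> sieve_primes x. real p \<le> x powr \<delta>} \<and> real (\<Prod>(small_primes x \<union> V)) \<le> x powr \<theta>.
      real \<kappa> ^ card V * (\<bar>discrepancy (mangoldt_dyadic x) a (\<Prod>(small_primes x \<union> V))\<bar> + 4 * ln (x powr \<theta>) * ln (2 * x) ^ 2))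
    \<le> x * ln x powr (-B)"
proof -
  define c :: real where "c = 2 * exp 10"
  have "exp (10::real) \<ge> 1" by simp
  hence c: "c \<ge> 1" unfolding c_def by linarith
  \<comment> \<open>The square root in Cauchy-Schwarz halves the saving, hence 2 B. The weights lose
    (ln x)^(\<kappa>^2), the trivial bound one more logarithm, and a further one beats the
    constants.\<close>
  define A where "A = real (\<kappa>\<^sup>2) + 2 + 2 * B"
  have "A \<ge> 1" using B by (simp add: A_def)
  then obtain C0 where C0: "\<forall>\<^sub>F x in at_top. \<forall>a. coprime a (prime_prod_in {1..x powr \<delta>}) \<longrightarrow>
     (\<Sum>q | real q \<le> x powr \<theta> \<and> q \<in> squarefree_in {1..x powr \<delta>}. \<bar>discrepancy (mangoldt_dyadic x) a q\<bar>)
       \<le> C0 * (x * ln x powr (-A))"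
    using lev unfolding level_def by blast
  define C where "C = max C0 1"
  have C: "C \<ge> 1" "C0 \<le> C" by (auto simp: C_def)
  have ev1: "\<forall>\<^sub>F x::real in at_top. ln x \<ge> 48 * C * c ^ \<kappa>\<^sup>2 + 16 * c ^ \<kappa> + 1" by real_asymp
  have ev2: "\<forall>\<^sub>F x::real in at_top. ln x powr (real \<kappa> + 4) * x powr \<theta> \<le> x * ln x powr (-B) / 2"
    using \<theta>(2) by real_asymp
  show ?thesis using C0 ev1 ev2 prime_set_split[OF \<delta>] eventually_ge_at_top[of 3]
  proof eventually_elim
    case (elim x)
    define Q where "Q = small_primes x"
    define P where "P = {p \<in> sieve_primes x. real p \<le> x powr \<delta>}"
    define l where "l = ln x"
    have x: "x \<ge> 3" by fact
    have split: "{p. prime p \<and> real p \<in> {1..x powr \<delta>}} = Q \<union> P" using elim(4) by (simp only: Q_def P_def)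
    have "finite P" unfolding P_def by (rule finite_subset[of _ "sieve_primes x"]) auto
    hence QP: "Q \<inter> P = {}" "finite Q" "finite P" "\<And>p. p \<in> Q \<Longrightarrow> prime p" "\<And>p. p \<in> P \<Longrightarrow> prime p"
      by (auto simp: Q_def P_def small_primes_def sieve_primes_def)
    have P: "prime p \<and> real p \<le> x" if "p \<in> P" for p
    proof -
      have "x powr \<delta> \<le> x powr 1" using x \<delta> by (intro powr_mono) auto
      thus ?thesis using that x by (auto simp: P_def sieve_primes_def)
    qed
    have l: "l \<ge> 1" "48 * C * c ^ \<kappa>\<^sup>2 \<le> l" "16 * c ^ \<kappa> \<le> l"
    proof -
      have "0 \<le> 48 * C * c ^ \<kappa>\<^sup>2" "0 \<le> 16 * c ^ \<kappa>" using c C by auto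
      thus "l \<ge> 1" "48 * C * c ^ \<kappa>\<^sup>2 \<le> l" "16 * c ^ \<kappa> \<le> l" using elim(2) unfolding l_def by linarith+
    qed
    have l2: "0 \<le> ln (2 * x)" "ln (2 * x) \<le> 2 * l" using x by (auto simp: l_def ln_mult)
    show ?case
    proof (intro allI impI)
      fix a assume a: "coprime a (\<Prod>(small_primes x \<union> {p \<in> sieve_primes x. real p \<le> x powr \<delta>}))"
      define G where "G = {V. V \<in> Pow P \<and> real (\<Prod>(Q \<union> V)) \<le> x powr \<theta>}"
      define H where "H = {q. real q \<le> x powr \<theta> \<and> q \<in> squarefree_in {1..x powr \<delta>}}"
      have pf: "prime_factors (\<Prod>(Q \<union> V)) = Q \<union> V" "squarefree (\<Prod>(Q \<union> V))" if "V \<in> G" for V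
        using that QP by (auto simp: G_def intro!: prime_factors_prod_primes squarefree_prod_primes intro: finite_subset)
      have "(\<Sum>V\<in>G. \<bar>discrepancy (mangoldt_dyadic x) a (\<Prod>(Q \<union> V))\<bar>) = (\<Sum>q\<in>(\<lambda>V. \<Prod>(Q \<union> V)) ` G. \<bar>discrepancy (mangoldt_dyadic x) a q\<bar>)"
      proof (subst sum.reindex)
        show "inj_on (\<lambda>V. \<Prod>(Q \<union> V)) G"
        proof (rule inj_onI)
          fix V V' assume V: "V \<in> G" "V' \<in> G" "\<Prod>(Q \<union> V) = \<Prod>(Q \<union> V')"
          hence "Q \<union> V = Q \<union> V'" using pf(1) by metis
          thus "V = V'" using V QP(1) by (auto simp: G_def)
        qed
      qed (simp add: o_def)
      also have "\<dots> \<le> (\<Sum>q\<in>H. \<bar>discrepancy (mangoldt_dyadic x) a q\<bar>)"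
      proof (rule sum_mono2)
        show "finite H" unfolding H_def by (rule finite_squarefree_in)
        show "(\<lambda>V. \<Prod>(Q \<union> V)) ` G \<subseteq> H"
        proof
          fix q assume "q \<in> (\<lambda>V. \<Prod>(Q \<union> V)) ` G"
          then obtain V where V: "V \<in> G" "q = \<Prod>(Q \<union> V)" by blast
          have "Q \<union> V \<subseteq> {p. prime p \<and> real p \<in> {1..x powr \<delta>}}" unfolding split using V by (auto simp: G_def)
          thus "q \<in> H" using V pf[OF V(1)] by (auto simp: H_def G_def squarefree_in_def)
        qed
      qed simp
      also have "\<dots> \<le> C0 * (x * l powr (-A))"
        using elim(1) a split unfolding H_def l_def prime_prod_in_def Q_def P_def by simp
      also have "\<dots> \<le> C * (x * l powr (-A))" using C x by (intro mult_right_mono) auto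
      finally have D: "(\<Sum>V\<in>G. \<bar>discrepancy (mangoldt_dyadic x) a (\<Prod>(Q \<union> V))\<bar>) \<le> C * (x * l powr (-A))" .
      define E where "E = 4 * ln (x powr \<theta>) * ln (2 * x) ^ 2"
      have E: "0 \<le> E" "E \<le> 16 * l ^ 3"
      proof -
        have "ln (x powr \<theta>) = \<theta> * l" using x by (simp add: l_def ln_powr)
        hence th: "0 \<le> ln (x powr \<theta>)" "ln (x powr \<theta>) \<le> l" using \<theta> l by (auto simp: mult_left_le_one_le)
        show "0 \<le> E" using th by (simp add: E_def)
        have "ln (2 * x) ^ 2 \<le> (2 * l) ^ 2" using l2 by (intro power_mono) auto
        hence "ln (x powr \<theta>) * ln (2 * x) ^ 2 \<le> l * (2 * l) ^ 2" using th l by (intro mult_mono) auto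
        thus "E \<le> 16 * l ^ 3" by (simp add: E_def power2_eq_square power3_eq_cube)
      qed
      have "(\<Sum>V\<in>G. real \<kappa> ^ card V * (\<bar>discrepancy (mangoldt_dyadic x) a (\<Prod>(Q \<union> V))\<bar> + E))
        \<le> sqrt (6 * x * ln (2 * x) * (2 * exp 10 * ln x) ^ (\<kappa>\<^sup>2) * (C * (x * l powr (-A)))) + E * x powr \<theta> * (2 * exp 10 * ln x) ^ \<kappa>"
        unfolding G_def
      proof (rule weighted_discrepancy_le[OF x P QP(2,4,1) _ _ E(1)])
        show "1 \<le> x powr \<theta>" using x \<theta> by (intro ge_one_powr_ge_zero) auto
        have "x powr \<theta> \<le> x powr 1" using x \<theta> by (intro powr_mono) auto
        thus "x powr \<theta> \<le> x" using x by simp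
        show "(\<Sum>V | V \<in> Pow P \<and> real (\<Prod>(Q \<union> V)) \<le> x powr \<theta>. \<bar>discrepancy (mangoldt_dyadic x) a (\<Prod>(Q \<union> V))\<bar>) \<le> C * (x * l powr (-A))"
          using D by (simp only: G_def)
      qed
      also have "\<dots> = sqrt (6 * x * ln (2 * x) * (c * l) ^ (\<kappa>\<^sup>2) * (C * (x * l powr (-A)))) + E * x powr \<theta> * (c * l) ^ \<kappa>"
        by (simp only: c_def l_def)
      also have "\<dots> \<le> x * l powr (-B) / 2 + x * l powr (-B) / 2"
      proof (rule add_mono)
        have "6 * x * ln (2 * x) * (c * l) ^ (\<kappa>\<^sup>2) * (C * (x * l powr (-A))) \<le> 6 * x * (2 * l) * (c * l) ^ (\<kappa>\<^sup>2) * (C * (x * l powr (-A)))"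
          using x l c C l2 by (intro mult_right_mono mult_left_mono) auto
        also have "\<dots> = (48 * C * c ^ (\<kappa>\<^sup>2)) * (x\<^sup>2 * l ^ (\<kappa>\<^sup>2 + 1) * l powr (-A) / 4)"
          by (simp add: power_mult_distrib power2_eq_square)
        also have "\<dots> \<le> l * (x\<^sup>2 * l ^ (\<kappa>\<^sup>2 + 1) * l powr (-A) / 4)" using l by (intro mult_right_mono) auto
        also have "\<dots> = x\<^sup>2 * (l ^ (\<kappa>\<^sup>2 + 2) * l powr (-A)) / 4" by simp
        also have "l ^ (\<kappa>\<^sup>2 + 2) * l powr (-A) = l powr (-2 * B)"
        proof -
          have "l ^ (\<kappa>\<^sup>2 + 2) = l powr (real (\<kappa>\<^sup>2) + 2)" using l powr_realpow[of l "\<kappa>\<^sup>2 + 2"] by (simp add: add.commute)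
          thus ?thesis by (simp add: powr_add[symmetric] A_def)
        qed
        also have "x\<^sup>2 * l powr (-2 * B) / 4 = (x * l powr (-B) / 2)\<^sup>2"
          by (simp add: power2_eq_square powr_add[symmetric])
        finally show "sqrt (6 * x * ln (2 * x) * (c * l) ^ (\<kappa>\<^sup>2) * (C * (x * l powr (-A)))) \<le> x * l powr (-B) / 2"
          using x by (intro real_le_lsqrt) auto
        have "E * x powr \<theta> * (c * l) ^ \<kappa> \<le> 16 * l ^ 3 * x powr \<theta> * (c * l) ^ \<kappa>"
          using E l c by (intro mult_right_mono) auto
        also have "\<dots> = 16 * c ^ \<kappa> * (l ^ (\<kappa> + 3) * x powr \<theta>)" by (simp add: power_mult_distrib power_add)
        also have "\<dots> \<le> l * (l ^ (\<kappa> + 3) * x powr \<theta>)" using l by (intro mult_right_mono) auto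
        also have "\<dots> = l powr (real \<kappa> + 4) * x powr \<theta>"
          using l powr_realpow[of l "\<kappa> + 4"] by (simp add: eval_nat_numeral add.commute)
        also have "\<dots> \<le> x * l powr (-B) / 2" using elim(3) by (simp only: l_def)
        finally show "E * x powr \<theta> * (c * l) ^ \<kappa> \<le> x * l powr (-B) / 2" .
      qed
      finally have "(\<Sum>V\<in>G. real \<kappa> ^ card V * (\<bar>discrepancy (mangoldt_dyadic x) a (\<Prod>(Q \<union> V))\<bar> + E)) \<le> x * l powr (-B)"
        by simp
      thus "(\<Sum>V | V \<in> Pow {p \<in> sieve_primes x. real p \<le> x powr \<delta>} \<and> real (\<Prod>(small_primes x \<union> V)) \<le> x powr \<theta>.
        real \<kappa> ^ card V * (\<bar>discrepancy (mangoldt_dyadic x) a (\<Prod>(small_primes x \<union> V))\<bar> + 4 * ln (x powr \<theta>) * ln (2 * x) ^ 2))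
        \<le> x * ln x powr (-B)"
        by (simp only: G_def Q_def P_def E_def l_def)
    qed
  qed
qed

section \<open>Equidistribution applied to the sieve weights\<close>

lemma smooth_compact_bounded:
  assumes "smooth_halfline F" "compact_support_halfline F"
  obtains K where "\<And>t. t \<ge> 0 \<Longrightarrow> \<bar>F t\<bar> \<le> K"
proof -
  obtain \<nu> D where "dchain 3 \<nu> F D" using smooth_compact_dbound[OF assms] unfolding dbound_def by blast
  hence D: "\<And>t. t \<ge> 0 \<Longrightarrow> D 0 t = F t \<and> \<bar>D 0 t\<bar> \<le> \<nu> * exp (-t)" by (auto simp: dchain_def)
  have "\<bar>D 0 0\<bar> \<le> \<nu>" using conjunct2[OF D[OF order_refl]] by simp
  hence "\<nu> \<ge> 0" by linarith
  have "\<bar>F t\<bar> \<le> \<nu>" if "t \<ge> 0" for t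
  proof -
    have "\<bar>F t\<bar> \<le> \<nu> * exp (-t)" using D[OF that] by metis
    also have "\<dots> \<le> \<nu> * 1" using that \<open>\<nu> \<ge> 0\<close> by (intro mult_left_mono) auto
    finally show ?thesis by simp
  qed
  thus thesis by (rule that)
qed

lemma smooth_compact_bounded_finite:
  assumes "finite J" "\<And>j. j \<in> J \<Longrightarrow> smooth_halfline (\<phi> j) \<and> compact_support_halfline (\<phi> j)"
  obtains K where "K \<ge> 1" "\<And>j t. j \<in> J \<Longrightarrow> t \<ge> 0 \<Longrightarrow> \<bar>\<phi> j t\<bar> \<le> K"
proof -
  have "\<forall>j\<in>J. \<exists>K. \<forall>t\<ge>0. \<bar>\<phi> j t\<bar> \<le> K" using smooth_compact_bounded assms(2) by metis
  then obtain K where K: "\<And>j t. j \<in> J \<Longrightarrow> t \<ge> 0 \<Longrightarrow> \<bar>\<phi> j t\<bar> \<le> K j" by metis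
  show thesis
  proof (rule that[of "1 + (\<Sum>j\<in>J. \<bar>K j\<bar>)"])
    fix j and t :: real assume j: "j \<in> J" "t \<ge> 0"
    have "\<bar>\<phi> j t\<bar> \<le> \<bar>K j\<bar>" using K[OF j] by linarith
    also have "\<dots> \<le> (\<Sum>j\<in>J. \<bar>K j\<bar>)" using assms(1) j by (intro member_le_sum) auto
    finally show "\<bar>\<phi> j t\<bar> \<le> 1 + (\<Sum>j\<in>J. \<bar>K j\<bar>)" by simp
  qed (simp add: sum_nonneg)
qed

text \<open>With s j = S(\<phi> j), the total modulus is at most W x^(sum of supports) \<le>
  x^\<theta> for large x, and each prime that occurs is at most x^\<delta>. So both kinds of support
  condition enter here.\<close>

lemma sieve_sum_main_asymp:
  fixes I :: "nat set" and h :: "nat \<Rightarrow> int" and i0 :: nat and b :: "real \<Rightarrow> int"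
  defines "J \<equiv> I \<times> (UNIV :: bool set)"
  assumes lev: "level \<theta> \<delta>" and \<theta>: "0 < \<theta>" "\<theta> < 1" and \<delta>: "0 < \<delta>" "\<delta> \<le> 1" and B: "B \<ge> 0"
    and I: "finite I" "I \<noteq> {}" "0 \<notin> I" "i0 \<notin> I" and h: "inj_on h (insert i0 I)"
    and b: "\<forall>\<^sub>F x in at_top. coprime (b x + h i0) (int (W_mod x))"
    and \<phi>: "\<And>j. j \<in> J \<Longrightarrow> smooth_halfline (\<phi> j) \<and> compact_support_halfline (\<phi> j)"
    and s: "(\<Sum>j\<in>J. supp_sup (\<phi> j)) < \<theta>" "\<And>j. j \<in> J \<Longrightarrow> supp_sup (\<phi> j) < \<delta>"
  shows "\<forall>\<^sub>F x in at_top. \<bar>(\<Sum>m | m \<in> dyadic x \<and> [int m = b x + h i0] (mod int (W_mod x)).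
      mangoldt m * (\<Prod>j\<in>J. lam_set (ln x) (\<phi> j) {p \<in> sieve_primes x. int p dvd int m - h i0 + h (fst j)} 0))
     - psi_dyadic x / real (totient (W_mod x)) * sform (ln x) I (sieve_primes x) \<phi>\<bar> \<le> x * ln x powr (-B)"
proof -
  have finJ: "finite J" using I by (simp add: J_def)
  obtain K where K: "K \<ge> 1" "\<And>j t. j \<in> J \<Longrightarrow> t \<ge> 0 \<Longrightarrow> \<bar>\<phi> j t\<bar> \<le> K"
    using smooth_compact_bounded_finite[OF finJ, of \<phi>] \<phi> by metis
  \<comment> \<open>All shifts are at most H in absolute value, so for large x a sieve prime p > 2 H
    divides no difference of two distinct shifts.\<close>
  define H where "H = (\<Sum>i\<in>insert i0 I. nat \<bar>h i\<bar>)"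
  have H: "nat \<bar>h i\<bar> \<le> H" if "i \<in> insert i0 I" for i
    unfolding H_def using I that by (intro member_le_sum) auto
  have "\<forall>\<^sub>F x in at_top. \<forall>p\<in>sieve_primes x. p \<ge> 2 * H + 1" by (rule eventually_sieve_primes_ge)
  moreover have "\<forall>\<^sub>F x::real in at_top. ln x * x powr (\<Sum>j\<in>J. supp_sup (\<phi> j)) \<le> x powr \<theta>"
  proof -
    have "\<forall>\<^sub>F x::real in at_top. ln x * x powr \<sigma> \<le> x powr \<theta>" if "\<sigma> < \<theta>" for \<sigma> using that by real_asymp
    thus ?thesis using s(1) .
  qed
  moreover have "\<forall>\<^sub>F x::real in at_top. ln x \<ge> K ^ card J + 1" by real_asymp
  \<comment> \<open>One additional power of ln x is saved in order to absorb the constant K ^ card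
    J.\<close>
  moreover have "B + 1 \<ge> 0" using B by simp
  note level_weighted[OF lev \<theta> \<delta> this, of "4 * card I"]
  ultimately show ?thesis using b W_mod_le_ln eventually_gt_at_top[of 1]
  proof eventually_elim
    case (elim x)
    define R where "R = x * ln x powr (-(B + 1))"
    have lx: "ln x \<ge> 1" "K ^ card J \<le> ln x" using elim(3) K(1) zero_le_power[of K "card J"] by linarith+
    have "\<bar>(\<Sum>m | m \<in> dyadic x \<and> [int m = b x + h i0] (mod int (W_mod x)).
      mangoldt m * (\<Prod>j\<in>J. lam_set (ln x) (\<phi> j) {p \<in> sieve_primes x. int p dvd int m - h i0 + h (fst j)} 0))
     - psi_dyadic x / real (totient (W_mod x)) * sform (ln x) I (sieve_primes x) \<phi>\<bar> \<le> K ^ card J * R"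
      unfolding W_mod_eq J_def
    proof (rule sieve_sum_main_error[where s = "\<lambda>j. supp_sup (\<phi> j)" and y = "x powr \<theta>" and P' = "{p \<in> sieve_primes x. real p \<le> x powr \<delta>}"])
      show "finite I" "I \<noteq> {}" "0 \<notin> I" "i0 \<notin> I" "x > 1" by fact+
      show "finite (sieve_primes x)" by simp
      show "prime p" if "p \<in> sieve_primes x" for p using that by (simp add: sieve_primes_def)
      show "prime p" if "p \<in> small_primes x" for p using that by (simp add: small_primes_def)
      show "small_primes x \<inter> sieve_primes x = {}" by (auto simp: small_primes_def sieve_primes_def)
      show "finite (small_primes x)" by simp
      show "\<not> int p dvd h i - h i'" if "p \<in> sieve_primes x" "i \<in> insert i0 I" "i' \<in> insert i0 I" "i \<noteq> i'" for p i i'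
      proof
        assume d: "int p dvd h i - h i'"
        have "h i - h i' \<noteq> 0" using h that by (auto simp: inj_on_def)
        hence "int p \<le> \<bar>h i - h i'\<bar>" using d by (intro zdvd_imp_le) (auto simp: dvd_abs_iff)
        moreover have "p \<ge> 2 * H + 1" using elim(1) that(1) by blast
        ultimately show False using H[OF that(2)] H[OF that(3)] by linarith
      qed
      show "coprime (b x + h i0) (int (\<Prod>(small_primes x)))" using elim(5) by (simp only: W_mod_eq)
      show "t \<le> supp_sup (\<phi> j)" if "j \<in> I \<times> UNIV" "t \<ge> 0" "\<phi> j t \<noteq> 0" for j t
        using supp_sup_props(2)[of "\<phi> j" t] \<phi>[of j] that by (simp add: J_def)
      show "\<bar>\<phi> j t\<bar> \<le> K" if "j \<in> I \<times> UNIV" "t \<ge> 0" for j t using K(2) that by (simp add: J_def)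
      show "{p \<in> sieve_primes x. real p \<le> x powr \<delta>} \<subseteq> sieve_primes x" by auto
      show "p \<in> {p \<in> sieve_primes x. real p \<le> x powr \<delta>}"
        if j: "j \<in> I \<times> UNIV" "p \<in> sieve_primes x" "ln (real p) / ln x \<le> supp_sup (\<phi> j)" for j p
      proof -
        have p: "real p > 0" using j(2) by (auto simp: sieve_primes_def prime_gt_0_nat)
        have "ln (real p) / ln x \<le> \<delta>" using j s(2)[of j] by (simp add: J_def)
        hence "ln (real p) \<le> \<delta> * ln x" using lx by (simp add: field_simps)
        hence "exp (ln (real p)) \<le> exp (\<delta> * ln x)" by simp
        thus ?thesis using p j(2) elim(7) by (simp add: powr_def)
      qed
      have "real (W_mod x) * x powr (\<Sum>j\<in>J. supp_sup (\<phi> j)) \<le> ln x * x powr (\<Sum>j\<in>J. supp_sup (\<phi> j))"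
        using elim(6) by (intro mult_right_mono) auto
      thus "real (\<Prod>(small_primes x)) * x powr (\<Sum>j\<in>I \<times> UNIV. supp_sup (\<phi> j)) \<le> x powr \<theta>"
        using elim(2) by (simp only: W_mod_eq J_def)
      show "1 \<le> x powr \<theta>" using elim(7) \<theta> by (intro ge_one_powr_ge_zero) auto
      show "(\<Sum>V | V \<in> Pow {p \<in> sieve_primes x. real p \<le> x powr \<delta>} \<and> real (\<Prod>(small_primes x \<union> V)) \<le> x powr \<theta>.
         (4 * real (card I)) ^ card V * (\<bar>discrepancy (mangoldt_dyadic x) a (\<Prod>(small_primes x \<union> V))\<bar> + 4 * ln (x powr \<theta>) * ln (2 * x) ^ 2)) \<le> R"
        if "coprime a (\<Prod>(small_primes x \<union> {p \<in> sieve_primes x. real p \<le> x powr \<delta>}))" for a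
        using elim(4) that by (simp add: R_def)
    qed
    also have "\<dots> \<le> ln x * R" using lx elim(7) by (intro mult_right_mono) (auto simp: R_def)
    also have "ln x * R = x * ln x powr (-B)"
    proof -
      have "ln x * ln x powr (-(B + 1)) = ln x powr (1 + -(B + 1))" using lx by (subst powr_add) auto
      thus ?thesis by (simp add: R_def)
    qed
    finally show ?case .
  qed
qed

section \<open>The sieve sum\<close>

text \<open>Since n is coprime to W, none of its prime factors is at most w, and the upper cut-off
  exceeds n; hence the sieve primes dividing n are all its prime factors.\<close>

lemma lambda_weight_eq_lam_set_sieve:
  assumes n: "n \<ge> 1" "real n \<le> exp ((ln x)\<^sup>2)" and x: "x > 1" and cop: "coprime n (W_mod x)"
  shows "lambda_weight x F n = lam_set (ln x) F {p \<in> sieve_primes x. p dvd n} 0"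
proof -
  have "p \<in> sieve_primes x" if p: "prime p" "p dvd n" for p
  proof -
    have "p \<notin> small_primes x"
    proof
      assume "p \<in> small_primes x"
      hence "p dvd W_mod x" unfolding W_mod_eq by (intro dvd_prodI) auto
      hence "is_unit p" using cop p(2) by (auto dest: coprime_common_divisor)
      thus False using p(1) by auto
    qed
    moreover have "p \<le> n" using p n by (intro dvd_imp_le) auto
    hence "real p \<le> exp ((ln x)\<^sup>2)" using n(2) by linarith
    ultimately show ?thesis using p by (auto simp: small_primes_def sieve_primes_def)
  qed
  hence "prime_factors n = {p \<in> sieve_primes x. p dvd n}"
    using n(1) by (auto simp: prime_factors_dvd sieve_primes_def)
  thus ?thesis using lambda_weight_eq_lam_set[OF n(1) x] by simp
qed

lemma abs_lambda_weight_le: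
  assumes n: "n \<ge> 1" and x: "x > 1" and F: "\<And>t. t \<ge> 0 \<Longrightarrow> \<bar>F t\<bar> \<le> K"
  shows "\<bar>lambda_weight x F n\<bar> \<le> K * 2 ^ card (prime_factors n)"
proof -
  have "\<bar>lambda_weight x F n\<bar> \<le> (\<Sum>S\<in>Pow (prime_factors n). K)"
    unfolding lambda_weight_eq_lam_set[OF n x] lam_set_def
  proof (rule order_trans[OF sum_abs sum_mono])
    fix S assume S: "S \<in> Pow (prime_factors n)"
    have "0 \<le> ln (real p) / ln x" if "p \<in> S" for p
    proof -
      have "prime p" using S that by auto
      from prime_ge_1_nat[OF this] show ?thesis using x by simp
    qed
    hence "0 \<le> 0 + (\<Sum>p\<in>S. ln (real p) / ln x)" by (simp add: sum_nonneg)
    from F[OF this] show "\<bar>(-1) ^ card S * F (0 + (\<Sum>p\<in>S. ln (real p) / ln x))\<bar> \<le> K" by (simp add: abs_mult power_abs)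
  qed
  thus ?thesis by (simp add: card_Pow mult.commute)
qed

lemma card_near_le:
  assumes "H \<ge> 0"
  shows "finite {m::nat. \<bar>real m - x\<bar> \<le> H}" "real (card {m::nat. \<bar>real m - x\<bar> \<le> H}) \<le> 2 * H + 1"
proof -
  have sub: "int ` {m::nat. \<bar>real m - x\<bar> \<le> H} \<subseteq> {\<lceil>x - H\<rceil>..\<lfloor>x + H\<rfloor>}"
    by (auto simp: le_floor_iff ceiling_le_iff)
  hence "finite (int ` {m::nat. \<bar>real m - x\<bar> \<le> H})" by (rule finite_subset) simp
  thus "finite {m::nat. \<bar>real m - x\<bar> \<le> H}" by (rule finite_imageD) (simp add: inj_on_def)
  have "card {m::nat. \<bar>real m - x\<bar> \<le> H} = card (int ` {m::nat. \<bar>real m - x\<bar> \<le> H})" by (rule card_image[symmetric]) (simp add: inj_on_def)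
  also have "\<dots> \<le> card {\<lceil>x - H\<rceil>..\<lfloor>x + H\<rfloor>}" by (intro card_mono sub) simp
  finally have "real (card {m::nat. \<bar>real m - x\<bar> \<le> H}) \<le> real (nat (\<lfloor>x + H\<rfloor> - \<lceil>x - H\<rceil> + 1))" by simp
  also have "\<dots> \<le> 2 * H + 1" using assms by linarith
  finally show "real (card {m::nat. \<bar>real m - x\<bar> \<le> H}) \<le> 2 * H + 1" .
qed

text \<open>D is the interval from x to 2x moved by h0. The two sums differ only at integers within
  |h0| of x or 2x and at proper prime powers, whose primes are at most sqrt (3x); the weights are
  bounded pointwise by M.\<close>

lemma theta_mangoldt_close:
  fixes f :: "nat \<Rightarrow> real" and h0 :: int and x M :: real
  defines "D \<equiv> {m::nat. x \<le> real_of_int (int m - h0) \<and> real_of_int (int m - h0) \<le> 2 * x}"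
  assumes x: "x \<ge> 1" "x \<ge> \<bar>real_of_int h0\<bar>"
    and f: "\<And>m. m \<in> D \<union> dyadic x \<Longrightarrow> Q m \<Longrightarrow> \<bar>f m\<bar> \<le> M" and M: "M \<ge> 0"
  shows "\<bar>(\<Sum>m | m \<in> D \<and> Q m. theta m * f m) - (\<Sum>m | m \<in> dyadic x \<and> Q m. mangoldt m * f m)\<bar>
    \<le> (4 * \<bar>real_of_int h0\<bar> + 2 + 2 * sqrt (3 * x) * ln (3 * x)) * (ln (3 * x) * M)"
proof -
  define H where "H = \<bar>real_of_int h0\<bar>"
  define E where "E = {m. m \<in> D \<union> dyadic x \<and> Q m}"
  define g where "g m = (if m \<in> D then theta m else 0) - (if m \<in> dyadic x then mangoldt m else 0)" for m
  have H: "H \<ge> 0" "x \<ge> H" using x by (auto simp: H_def)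
  have le3: "real m \<le> 3 * x" if "m \<in> D \<union> dyadic x" for m
    using that x by (auto simp: D_def dyadic_def)
  have "D \<union> dyadic x \<subseteq> {..nat \<lfloor>3 * x\<rfloor>}" using le3 by (auto simp: le_nat_floor)
  hence fin: "finite (D \<union> dyadic x)" using finite_subset by blast
  hence finE: "finite E" by (simp add: E_def)
  define Ps where "Ps = {p. prime p \<and> real p \<le> sqrt (3 * x)}"
  define PP where "PP = {m. real m \<le> 3 * x \<and> (\<exists>p\<in>Ps. \<exists>j\<ge>1. m = p ^ j)}"
  have finPs: "finite Ps" unfolding Ps_def by (rule finite_primes_le)
  have PP: "finite PP" "real (card PP) \<le> real (card Ps) * (2 * ln (3 * x))"
    using card_prime_powers_le[OF finPs, of "3 * x" PP] x by (auto simp: PP_def Ps_def)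
  have "card Ps \<le> card {1..nat \<lfloor>sqrt (3 * x)\<rfloor>}"
    by (intro card_mono) (auto simp: Ps_def le_nat_floor Suc_le_eq prime_gt_0_nat)
  hence "real (card Ps) \<le> sqrt (3 * x)" using x by (simp add: le_nat_iff le_floor_iff)
  hence "real (card Ps) * (2 * ln (3 * x)) \<le> sqrt (3 * x) * (2 * ln (3 * x))" using x by (intro mult_right_mono) auto
  hence cPP: "real (card PP) \<le> 2 * sqrt (3 * x) * ln (3 * x)" using PP(2) by linarith
  define Near where "Near = {m::nat. \<bar>real m - x\<bar> \<le> H} \<union> {m::nat. \<bar>real m - 2 * x\<bar> \<le> H}"
  have finNear: "finite Near" unfolding Near_def using card_near_le(1)[OF H(1)] by auto
  have "real (card Near) \<le> real (card {m::nat. \<bar>real m - x\<bar> \<le> H}) + real (card {m::nat. \<bar>real m - 2 * x\<bar> \<le> H})"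
    unfolding Near_def of_nat_add[symmetric] of_nat_le_iff by (rule card_Un_le)
  hence cNear: "real (card Near) \<le> 4 * H + 2" using card_near_le(2)[OF H(1), of x] card_near_le(2)[OF H(1), of "2 * x"] by linarith
  define Bad where "Bad = {m \<in> E. g m \<noteq> 0}"
  have "Bad \<subseteq> Near \<union> PP"
  proof
    fix m assume m: "m \<in> Bad"
    have mE: "m \<in> D \<union> dyadic x" and gm: "g m \<noteq> 0" using m by (auto simp: Bad_def E_def)
    show "m \<in> Near \<union> PP"
    proof (cases "m \<in> D \<and> m \<in> dyadic x")
      case False
      hence "m \<in> Near" using mE unfolding D_def dyadic_def Near_def H_def by auto
      thus ?thesis by simp
    next
      case True
      hence ne: "theta m \<noteq> mangoldt m" using gm by (simp add: g_def)
      have np: "\<not> prime m" using ne by (auto simp: theta_def mangoldt_prime)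
      hence "mangoldt m \<noteq> (0 :: real)" using ne by (simp add: theta_def)
      hence "primepow m" by (auto simp: mangoldt_def split: if_splits)
      then obtain p j where pj: "prime p" "j > 0" "m = p ^ j" by (auto simp: primepow_def)
      have "j \<noteq> 1" using np pj by auto
      hence "p ^ 2 \<le> m" using pj prime_ge_1_nat[of p] by (auto intro: power_increasing)
      hence "real p ^ 2 \<le> 3 * x" using le3[OF mE] by (metis of_nat_le_iff of_nat_power order_trans)
      hence "p \<in> Ps" using pj by (auto simp: Ps_def intro: real_le_rsqrt)
      thus ?thesis using pj le3[OF mE] by (auto simp: PP_def Suc_le_eq)
    qed
  qed
  hence "card Bad \<le> card (Near \<union> PP)" using finNear PP(1) by (intro card_mono) auto
  also have "\<dots> \<le> card Near + card PP" by (rule card_Un_le)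
  finally have "real (card Bad) \<le> real (card Near) + real (card PP)" by (simp only: of_nat_add[symmetric] of_nat_le_iff)
  hence cBad: "real (card Bad) \<le> 4 * H + 2 + 2 * sqrt (3 * x) * ln (3 * x)" using cNear cPP by linarith
  have "(\<Sum>m | m \<in> D \<and> Q m. theta m * f m) = (\<Sum>m\<in>E. (if m \<in> D then theta m else 0) * f m)"
    using finE by (intro sum.mono_neutral_cong_left) (auto simp: E_def)
  moreover have "(\<Sum>m | m \<in> dyadic x \<and> Q m. mangoldt m * f m) = (\<Sum>m\<in>E. (if m \<in> dyadic x then mangoldt m else 0) * f m)"
    using finE by (intro sum.mono_neutral_cong_left) (auto simp: E_def)
  ultimately have "(\<Sum>m | m \<in> D \<and> Q m. theta m * f m) - (\<Sum>m | m \<in> dyadic x \<and> Q m. mangoldt m * f m) = (\<Sum>m\<in>E. g m * f m)"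
    by (simp add: g_def sum_subtractf left_diff_distrib)
  also have "\<dots> = (\<Sum>m\<in>Bad. g m * f m)"
    using finE by (intro sum.mono_neutral_right) (auto simp: Bad_def)
  finally have "\<bar>(\<Sum>m | m \<in> D \<and> Q m. theta m * f m) - (\<Sum>m | m \<in> dyadic x \<and> Q m. mangoldt m * f m)\<bar> \<le> (\<Sum>m\<in>Bad. \<bar>g m * f m\<bar>)"
    by (simp only: sum_abs)
  also have "\<dots> \<le> (\<Sum>m\<in>Bad. ln (3 * x) * M)"
  proof (rule sum_mono)
    fix m assume "m \<in> Bad"
    hence mE: "m \<in> D \<union> dyadic x" "Q m" by (auto simp: Bad_def E_def)
    have l3: "ln (3 * x) \<ge> 0" using x by simp
    have th: "0 \<le> theta m" "theta m \<le> ln (3 * x)" using le3[OF mE(1)] l3 prime_ge_1_nat[of m] by (auto simp: theta_def)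
    have mg: "0 \<le> (mangoldt m :: real)" "mangoldt m \<le> ln (3 * x)" if "m \<in> dyadic x"
    proof -
      have "ln (2 * x) \<le> ln (3 * x)" using x by simp
      thus "0 \<le> (mangoldt m :: real)" "mangoldt m \<le> ln (3 * x)" using mangoldt_dyadic_le[OF x(1) that] by linarith+
    qed
    have "\<bar>g m\<bar> \<le> ln (3 * x)" using th mg l3 unfolding g_def by (auto simp: abs_if)
    thus "\<bar>g m * f m\<bar> \<le> ln (3 * x) * M" unfolding abs_mult using f[OF mE] by (intro mult_mono) auto
  qed
  also have "\<dots> = real (card Bad) * (ln (3 * x) * M)" by simp
  also have "\<dots> \<le> (4 * H + 2 + 2 * sqrt (3 * x) * ln (3 * x)) * (ln (3 * x) * M)"
    using cBad x M by (intro mult_right_mono) auto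
  finally show ?thesis by (simp only: H_def)
qed

lemma B_size_le_ln: "x > 1 \<Longrightarrow> B_size x \<le> ln x"
proof -
  assume "x > 1"
  moreover have "real (totient (W_mod x)) / real (W_mod x) \<le> 1"
    using totient_le[of "W_mod x"] W_mod_pos[of x] by simp
  ultimately show ?thesis unfolding B_size_def by (intro mult_left_le_one_le) auto
qed

text \<open>N0 is the sum in question, N1 the same sum with \<Lambda> in place of
  \<open>theta\<close> and m = n + \<open>h i0\<close> running over the interval from x to 2x. The
  distances from N0 to N1 and from N1 to the main term both save a power of ln x that outweighs the
  normalising factor; the prime number theorem enters only through
  \<open>psi_dyadic_asymp\<close>.\<close>

theorem sieve_sum_limit:
  fixes I :: "nat set" and h :: "nat \<Rightarrow> int" and i0 :: nat and b :: "real \<Rightarrow> int" and F G :: "nat \<Rightarrow> real \<Rightarrow> real"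
  assumes lev: "level \<theta> \<delta>" and \<theta>: "0 < \<theta>" "\<theta> < 1" and \<delta>: "0 < \<delta>" "\<delta> \<le> 1"
    and I: "finite I" "I \<noteq> {}" "0 \<notin> I" "i0 \<notin> I" and h: "inj_on h (insert i0 I)"
    and b: "\<forall>\<^sub>F x in at_top. \<forall>i\<in>insert i0 I. coprime (b x + h i) (int (W_mod x))"
    and F: "\<And>i. i \<in> I \<Longrightarrow> smooth_halfline (F i) \<and> compact_support_halfline (F i)"
    and G: "\<And>i. i \<in> I \<Longrightarrow> smooth_halfline (G i) \<and> compact_support_halfline (G i)"
    and s: "(\<Sum>i\<in>I. supp_sup (F i) + supp_sup (G i)) < \<theta>" "\<And>i. i \<in> I \<Longrightarrow> supp_sup (F i) < \<delta> \<and> supp_sup (G i) < \<delta>"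
  shows "((\<lambda>x. (\<Sum>n | x \<le> real_of_int n \<and> real_of_int n \<le> 2 * x \<and> [n = b x] (mod int (W_mod x)).
      theta (nat (n + h i0)) * (\<Prod>i\<in>I. lambda_weight x (F i) (nat (n + h i)) * lambda_weight x (G i) (nat (n + h i))))
      * (B_size x ^ card I * real (totient (W_mod x)) / x)) \<longlongrightarrow> (\<Prod>i\<in>I. cpair (F i) (G i))) at_top"
proof -
  let ?J = "I \<times> (UNIV :: bool set)"
  define m where "m = card I"
  have m: "m > 0" using I by (simp add: m_def card_gt_0_iff)
  define \<phi> where "\<phi> j = (if snd j then F (fst j) else G (fst j))" for j :: "nat \<times> bool"
  have \<phi>: "smooth_halfline (\<phi> j) \<and> compact_support_halfline (\<phi> j)" if "j \<in> ?J" for j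
    using that F G by (auto simp: \<phi>_def)
  define f where "f x n = (\<Prod>i\<in>I. lambda_weight x (F i) (nat (n + h i)) * lambda_weight x (G i) (nat (n + h i)))" for x n
  define N0 where "N0 x = (\<Sum>n | x \<le> real_of_int n \<and> real_of_int n \<le> 2 * x \<and> [n = b x] (mod int (W_mod x)). theta (nat (n + h i0)) * f x n)" for x
  define N1 where "N1 x = (\<Sum>m | m \<in> dyadic x \<and> [int m = b x + h i0] (mod int (W_mod x)). mangoldt m * f x (int m - h i0))" for x
  define S where "S x = sform (ln x) I (sieve_primes x) \<phi>" for x
  define H where "H = (\<Sum>i\<in>insert i0 I. \<bar>real_of_int (h i)\<bar>)"
  have H: "\<bar>real_of_int (h i)\<bar> \<le> H" if "i \<in> insert i0 I" for i
    unfolding H_def using I that by (intro member_le_sum) auto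
  \<comment> \<open>The normalising factor T is at most (ln x)^(m+1) / x, so this saving leaves an
    error of 2 / ln x.\<close>
  define B where "B = real m + 2"
  have range: "1 \<le> n + h i" "real_of_int (n + h i) \<le> 4 * x" if "x \<ge> 2 * H + 1" "i \<in> I" "x - H \<le> real_of_int n" "real_of_int n \<le> 2 * x + H" for x n i
  proof -
    have "\<bar>real_of_int (h i)\<bar> \<le> H" using H that(2) by auto
    hence "1 \<le> real_of_int (n + h i)" "real_of_int (n + h i) \<le> 4 * x" using that by auto
    thus "1 \<le> n + h i" "real_of_int (n + h i) \<le> 4 * x" by simp_all
  qed
  have finJ: "finite ?J" using I(1) by simp
  obtain K where K: "K \<ge> 1" "\<And>j t. j \<in> ?J \<Longrightarrow> t \<ge> 0 \<Longrightarrow> \<bar>\<phi> j t\<bar> \<le> K"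
    using smooth_compact_bounded_finite[OF finJ, of \<phi>] \<phi> by metis
  \<comment> \<open>There are 2 m weights, each of size (4x)^e up to a constant, together
    (4x)^(1/4). Against about sqrt x exceptional integers this gives x^(3/4) up to
    logarithms.\<close>
  define e where "e = 1 / (8 * real m)"
  have e: "e > 0" using m by (simp add: e_def)
  obtain C where C: "C > 0" "\<And>n. n \<ge> 1 \<Longrightarrow> 2 ^ card (prime_factors n) \<le> C * real n powr e"
    using two_pow_card_prime_factors_le[OF e] by metis
  define M where "M = (K * C) ^ (2 * m)"
  have f_le: "\<bar>f x n\<bar> \<le> M * (4 * x) powr (1/4)"
    if x: "x > 1" "x \<ge> 2 * H + 1" and n: "x - H \<le> real_of_int n" "real_of_int n \<le> 2 * x + H" for x n
  proof -
    have lw: "\<bar>lambda_weight x (\<phi> j) (nat (n + h (fst j)))\<bar> \<le> K * (C * (4 * x) powr e)" if j: "j \<in> ?J" for j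
    proof -
      define r where "r = nat (n + h (fst j))"
      have r: "r \<ge> 1" "real r \<le> 4 * x" using range[OF x(2) _ n, of "fst j"] j by (auto simp: r_def)
      have "\<bar>lambda_weight x (\<phi> j) r\<bar> \<le> K * 2 ^ card (prime_factors r)"
        using r x K(2)[OF j] by (intro abs_lambda_weight_le) auto
      also have "\<dots> \<le> K * (C * real r powr e)" using C(2)[OF r(1)] K(1) by (intro mult_left_mono) auto
      also have "\<dots> \<le> K * (C * (4 * x) powr e)" using r e K C by (intro mult_left_mono powr_mono2) auto
      finally show ?thesis by (simp only: r_def)
    qed
    have "\<bar>f x n\<bar> = (\<Prod>i\<in>I. \<bar>lambda_weight x (F i) (nat (n + h i))\<bar> * \<bar>lambda_weight x (G i) (nat (n + h i))\<bar>)"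
      unfolding f_def abs_prod abs_mult ..
    also have "\<dots> \<le> (\<Prod>i\<in>I. (K * (C * (4 * x) powr e)) * (K * (C * (4 * x) powr e)))"
    proof (intro prod_mono conjI mult_nonneg_nonneg abs_ge_zero mult_mono)
      fix i assume i: "i \<in> I"
      show "\<bar>lambda_weight x (F i) (nat (n + h i))\<bar> \<le> K * (C * (4 * x) powr e)" using lw[of "(i, True)"] i by (simp add: \<phi>_def)
      show "\<bar>lambda_weight x (G i) (nat (n + h i))\<bar> \<le> K * (C * (4 * x) powr e)" using lw[of "(i, False)"] i by (simp add: \<phi>_def)
    qed (use K C in auto)
    also have "\<dots> = (K * (C * (4 * x) powr e)) ^ (2 * m)"
      by (simp only: prod_constant m_def power2_eq_square[symmetric] power_mult)
    also have "\<dots> = M * ((4 * x) powr e) ^ (2 * m)" by (simp add: M_def power_mult_distrib mult.assoc)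
    also have "((4 * x) powr e) ^ (2 * m) = (4 * x) powr (e * real (2 * m))"
      using x by (simp add: powr_powr powr_realpow[symmetric])
    also have "e * real (2 * m) = 1/4" using m by (simp add: e_def field_simps)
    finally show ?thesis .
  qed
  have N1_eq: "\<forall>\<^sub>F x in at_top. N1 x = (\<Sum>m | m \<in> dyadic x \<and> [int m = b x + h i0] (mod int (W_mod x)).
      mangoldt m * (\<Prod>j\<in>?J. lam_set (ln x) (\<phi> j) {p \<in> sieve_primes x. int p dvd int m - h i0 + h (fst j)} 0))"
  proof -
    have "\<forall>\<^sub>F x::real in at_top. 4 * x \<le> exp ((ln x)\<^sup>2)" by real_asymp
    thus ?thesis using b eventually_ge_at_top[of "2 * H + 1"] eventually_gt_at_top[of 1]
    proof eventually_elim
      case (elim x)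
      show ?case unfolding N1_def
      proof (intro sum.cong refl arg_cong2[of _ _ _ _ "(*)"])
        fix m assume m: "m \<in> {m. m \<in> dyadic x \<and> [int m = b x + h i0] (mod int (W_mod x))}"
        define n where "n = int m - h i0"
        have h0: "\<bar>real_of_int (h i0)\<bar> \<le> H" using H by auto
        have n: "x - H \<le> real_of_int n" "real_of_int n \<le> 2 * x + H" using m h0 by (auto simp: n_def dyadic_def)
        have lw: "lambda_weight x \<psi> (nat (n + h i)) = lam_set (ln x) \<psi> {p \<in> sieve_primes x. int p dvd n + h i} 0" if i: "i \<in> I" for i \<psi>
        proof -
          define r where "r = nat (n + h i)"
          have ir: "int r = n + h i" using range(1)[OF elim(3) i n] by (simp add: r_def)
          have r: "r \<ge> 1" "real r \<le> 4 * x" using range[OF elim(3) i n] by (auto simp: r_def)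
          have "[n = b x] (mod int (W_mod x))" using m by (simp add: n_def cong_iff_dvd_diff algebra_simps)
          hence "[n + h i = b x + h i] (mod int (W_mod x))" by (simp add: cong_add)
          \<comment> \<open>Coprimality to W depends only on the class of n modulo W, where b is
            chosen suitably for every shift.\<close>
          hence "coprime (n + h i) (int (W_mod x))" using elim(2) i by (metis cong_imp_coprime cong_sym insertI2)
          hence "coprime r (W_mod x)" unfolding ir[symmetric] by simp
          hence "lambda_weight x \<psi> r = lam_set (ln x) \<psi> {p \<in> sieve_primes x. p dvd r} 0"
            using r elim by (intro lambda_weight_eq_lam_set_sieve) auto
          moreover have "p dvd r \<longleftrightarrow> int p dvd n + h i" for p unfolding ir[symmetric] by simp
          ultimately show ?thesis by (simp add: r_def)
        qed
        show "f x (int m - h i0) = (\<Prod>j\<in>?J. lam_set (ln x) (\<phi> j) {p \<in> sieve_primes x. int p dvd int m - h i0 + h (fst j)} 0)"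
          unfolding prod_bool_slots f_def n_def[symmetric] using lw by (intro prod.cong) (simp_all add: \<phi>_def)
      qed
    qed
  qed
  have "\<forall>\<^sub>F x in at_top. \<bar>N0 x - N1 x\<bar> \<le> (4 * \<bar>real_of_int (h i0)\<bar> + 2 + 2 * sqrt (3 * x) * ln (3 * x)) * (ln (3 * x) * (M * (4 * x) powr (1/4)))"
    using eventually_ge_at_top[of "2 * H + 1"] eventually_gt_at_top[of 1]
  proof eventually_elim
    case (elim x)
    have h0: "\<bar>real_of_int (h i0)\<bar> \<le> H" using H by auto
    define D where "D = {m::nat. x \<le> real_of_int (int m - h i0) \<and> real_of_int (int m - h i0) \<le> 2 * x}"
    have "N0 x = (\<Sum>m | m \<in> D \<and> [int m = b x + h i0] (mod int (W_mod x)). theta m * f x (int m - h i0))"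
      unfolding N0_def
    proof (rule sum.reindex_bij_witness[of _ "\<lambda>m. int m - h i0" "\<lambda>n. nat (n + h i0)"])
      fix n assume n: "n \<in> {n. x \<le> real_of_int n \<and> real_of_int n \<le> 2 * x \<and> [n = b x] (mod int (W_mod x))}"
      have "real_of_int (n + h i0) \<ge> 0" using n h0 elim by auto
      hence nn: "n + h i0 \<ge> 0" by (simp only: of_int_0_le_iff)
      show "int (nat (n + h i0)) - h i0 = n" using nn by simp
      show "nat (n + h i0) \<in> {m \<in> D. [int m = b x + h i0] (mod int (W_mod x))}"
        using n nn by (simp add: D_def cong_add_rcancel)
      show "theta (nat (n + h i0)) * f x (int (nat (n + h i0)) - h i0) = theta (nat (n + h i0)) * f x n" using nn by simp
    next
      fix m assume m: "m \<in> {m \<in> D. [int m = b x + h i0] (mod int (W_mod x))}"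
      show "nat (int m - h i0 + h i0) = m" by simp
      have "[int m - h i0 = b x] (mod int (W_mod x))" using m by (simp add: cong_iff_dvd_diff algebra_simps)
      thus "int m - h i0 \<in> {n. x \<le> real_of_int n \<and> real_of_int n \<le> 2 * x \<and> [n = b x] (mod int (W_mod x))}"
        using m by (simp add: D_def)
    qed
    moreover have "\<bar>f x (int m - h i0)\<bar> \<le> M * (4 * x) powr (1/4)" if "m \<in> D \<union> dyadic x" for m
      using that h0 elim by (intro f_le) (auto simp: D_def dyadic_def)
    moreover have "M \<ge> 0" using K C by (simp add: M_def)
    ultimately show ?case unfolding N1_def D_def using elim h0
      by (simp only:) (intro theta_mangoldt_close, auto)
  qed
  moreover have "\<forall>\<^sub>F x::real in at_top. (4 * \<bar>real_of_int (h i0)\<bar> + 2 + 2 * sqrt (3 * x) * ln (3 * x)) * (ln (3 * x) * (M * (4 * x) powr (1/4))) \<le> x * ln x powr (-B)"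
    by real_asymp
  ultimately have d1: "\<forall>\<^sub>F x in at_top. \<bar>N0 x - N1 x\<bar> \<le> x * ln x powr (-B)" by eventually_elim linarith
  have sumJ: "(\<Sum>j\<in>?J. supp_sup (\<phi> j)) = (\<Sum>i\<in>I. supp_sup (F i) + supp_sup (G i))"
  proof -
    have "(\<Sum>j\<in>?J. supp_sup (\<phi> j)) = (\<Sum>i\<in>I. \<Sum>t\<in>UNIV. supp_sup (\<phi> (i, t)))" by (simp add: sum.cartesian_product)
    thus ?thesis by (simp add: UNIV_bool \<phi>_def add.commute)
  qed
  have b0: "\<forall>\<^sub>F x in at_top. coprime (b x + h i0) (int (W_mod x))" using b by eventually_elim auto
  have s\<delta>: "supp_sup (\<phi> j) < \<delta>" if "j \<in> ?J" for j using s(2) that by (auto simp: \<phi>_def)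
  have "B \<ge> 0" by (simp add: B_def)
  hence main: "\<forall>\<^sub>F x in at_top. \<bar>(\<Sum>m | m \<in> dyadic x \<and> [int m = b x + h i0] (mod int (W_mod x)).
      mangoldt m * (\<Prod>j\<in>?J. lam_set (ln x) (\<phi> j) {p \<in> sieve_primes x. int p dvd int m - h i0 + h (fst j)} 0))
     - psi_dyadic x / real (totient (W_mod x)) * S x\<bar> \<le> x * ln x powr (-B)"
    unfolding S_def using s(1) by (intro sieve_sum_main_asymp[OF lev \<theta> \<delta> _ I h b0]) (simp_all only: sumJ \<phi> s\<delta>)
  have d2: "\<forall>\<^sub>F x in at_top. \<bar>N1 x - psi_dyadic x / real (totient (W_mod x)) * S x\<bar> \<le> x * ln x powr (-B)"
    using main N1_eq by eventually_elim (simp only:)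
  define T where "T x = B_size x ^ m * real (totient (W_mod x)) / x" for x
  have "((\<lambda>x. (N0 x - psi_dyadic x / real (totient (W_mod x)) * S x) * T x) \<longlongrightarrow> 0) at_top"
  proof (rule Lim_null_comparison)
    show "((\<lambda>x::real. 2 / ln x) \<longlongrightarrow> 0) at_top" by real_asymp
    show "\<forall>\<^sub>F x in at_top. norm ((N0 x - psi_dyadic x / real (totient (W_mod x)) * S x) * T x) \<le> 2 / ln x"
      using d1 d2 W_mod_le_ln eventually_gt_at_top[of 1]
    proof eventually_elim
      case (elim x)
      have l: "ln x > 0" using elim(4) by simp
      have "real (totient (W_mod x)) \<le> ln x" using totient_le[of "W_mod x"] elim(3) by linarith
      moreover have "B_size x ^ m \<le> ln x ^ m" using B_size_le_ln[OF elim(4)] B_size_pos[OF elim(4)] by (intro power_mono) auto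
      ultimately have "B_size x ^ m * real (totient (W_mod x)) \<le> ln x ^ m * ln x" using l by (intro mult_mono) auto
      hence T: "T x \<le> ln x ^ m * ln x / x" "T x \<ge> 0" using elim(4) B_size_pos[OF elim(4)] by (auto simp: T_def divide_right_mono)
      have "\<bar>N0 x - psi_dyadic x / real (totient (W_mod x)) * S x\<bar> \<le> 2 * (x * ln x powr (-B))" using elim(1,2) by linarith
      hence "\<bar>N0 x - psi_dyadic x / real (totient (W_mod x)) * S x\<bar> * T x \<le> 2 * (x * ln x powr (-B)) * (ln x ^ m * ln x / x)"
        using T elim(4) by (intro mult_mono) auto
      also have "\<dots> = 2 * (ln x ^ m * ln x * ln x powr (-B))" using elim(4) by simp
      also have "ln x ^ m * ln x * ln x powr (-B) = 1 / ln x"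
      proof -
        have "ln x powr B = ln x ^ (m + 2)" using l powr_realpow[of "ln x" "m + 2"] by (simp add: B_def add.commute)
        thus ?thesis using l by (simp add: powr_minus field_simps power2_eq_square)
      qed
      finally show ?case using T(2) by (simp add: abs_mult)
    qed
  qed
  moreover have "((\<lambda>x. psi_dyadic x / x * (B_size x ^ card I * S x)) \<longlongrightarrow> 1 * cform I \<phi>) at_top"
    unfolding S_def by (intro tendsto_mult psi_dyadic_asymp sform_limit I \<phi>)
  ultimately have "((\<lambda>x. (N0 x - psi_dyadic x / real (totient (W_mod x)) * S x) * T x + psi_dyadic x / x * (B_size x ^ card I * S x)) \<longlongrightarrow> 0 + 1 * cform I \<phi>) at_top"
    by (rule tendsto_add)
  moreover have "(N0 x - psi_dyadic x / real (totient (W_mod x)) * S x) * T x + psi_dyadic x / x * (B_size x ^ card I * S x) = N0 x * T x" for x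
  proof -
    have "real (totient (W_mod x)) \<noteq> 0" using W_mod_pos[of x] by simp
    hence "psi_dyadic x / real (totient (W_mod x)) * S x * T x = psi_dyadic x / x * (B_size x ^ card I * S x)"
      by (simp add: T_def m_def)
    thus ?thesis by (simp add: left_diff_distrib)
  qed
  ultimately have "((\<lambda>x. N0 x * T x) \<longlongrightarrow> cform I \<phi>) at_top" by simp
  thus ?thesis by (simp add: N0_def f_def T_def m_def cform_def \<phi>_def)
qed

theorem theorem3p5:
  fixes k i\<^sub>0 :: nat
    and h :: "nat \<Rightarrow> int"
    and b :: "real \<Rightarrow> int"
    and F G :: "nat \<Rightarrow> real \<Rightarrow> real"
  assumes "k \<ge> 2"
    and "admissible_tuple k h"
    and "\<forall>\<^sub>F x in at_top. \<forall>i\<in>{1..k}. coprime (b x + h i) (int (W_mod x))"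
    and "i\<^sub>0 \<in> {1..k}"
    and "\<And>i. i \<in> {1..k} - {i\<^sub>0} \<Longrightarrow> smooth_halfline (F i) \<and> compact_support_halfline (F i)"
    and "\<And>i. i \<in> {1..k} - {i\<^sub>0} \<Longrightarrow> smooth_halfline (G i) \<and> compact_support_halfline (G i)"
    and "(\<exists>\<theta>. 0 < \<theta> \<and> \<theta> < 1 \<and> EH \<theta> \<and>
             (\<Sum>i\<in>{1..k} - {i\<^sub>0}. supp_sup (F i) + supp_sup (G i)) < \<theta>)
         \<or> (\<exists>\<omega> \<delta>. 0 \<le> \<omega> \<and> \<omega> < 1/4 \<and> \<delta> > 0 \<and> MPZ \<omega> \<delta> \<and>
             (\<Sum>i\<in>{1..k} - {i\<^sub>0}. supp_sup (F i) + supp_sup (G i)) < 1/2 + 2 * \<omega> \<and>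
             (MAX i\<in>{1..k} - {i\<^sub>0}. max (supp_sup (F i)) (supp_sup (G i))) < \<delta>)"
  shows "\<exists>\<epsilon> :: real \<Rightarrow> real. (\<epsilon> \<longlongrightarrow> 0) at_top \<and>
    (\<forall>\<^sub>F x in at_top.
      (\<Sum>n | x \<le> real_of_int n \<and> real_of_int n \<le> 2 * x \<and> [n = b x] (mod int (W_mod x)).
         theta (nat (n + h i\<^sub>0)) *
         (\<Prod>i\<in>{1..k} - {i\<^sub>0}.
            lambda_weight x (F i) (nat (n + h i)) * lambda_weight x (G i) (nat (n + h i))))
      = ((\<Prod>i\<in>{1..k} - {i\<^sub>0}.
            integral {0..1} (\<lambda>t. deriv_halfline (F i) t * deriv_halfline (G i) t)) + \<epsilon> x)
        * B_size x powi (1 - int k) * (x / real (totient (W_mod x))))"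
proof -
  define I where "I = {1..k} - {i\<^sub>0}"
  have card: "card I = k - 1" using assms(4) by (simp add: I_def)
  have I: "finite I" "I \<noteq> {}" "0 \<notin> I" "i\<^sub>0 \<notin> I"
  proof -
    show "I \<noteq> {}" using card assms(1) by auto
  qed (auto simp: I_def)
  have ins: "insert i\<^sub>0 I = {1..k}" using assms(4) by (auto simp: I_def)
  have h: "inj_on h (insert i\<^sub>0 I)"
    using assms(2) unfolding ins admissible_tuple_def by (blast intro: strict_mono_on_imp_inj_on)
  have nn: "supp_sup (F i) \<ge> 0" "supp_sup (G i) \<ge> 0" if "i \<in> I" for i
    using that assms(5,6) supp_sup_props(1) by (auto simp: I_def)
  have le: "supp_sup (F i) \<le> (\<Sum>i\<in>I. supp_sup (F i) + supp_sup (G i))" "supp_sup (G i) \<le> (\<Sum>i\<in>I. supp_sup (F i) + supp_sup (G i))"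
    if i: "i \<in> I" for i
  proof -
    have "supp_sup (F i) + supp_sup (G i) \<le> (\<Sum>i\<in>I. supp_sup (F i) + supp_sup (G i))"
      using I nn i by (intro member_le_sum) auto
    thus "supp_sup (F i) \<le> (\<Sum>i\<in>I. supp_sup (F i) + supp_sup (G i))" "supp_sup (G i) \<le> (\<Sum>i\<in>I. supp_sup (F i) + supp_sup (G i))"
      using nn[OF i] by linarith+
  qed
  obtain \<theta> \<delta> where lev: "level \<theta> \<delta>" and \<theta>: "0 < \<theta>" "\<theta> < 1" and \<delta>: "0 < \<delta>" "\<delta> \<le> 1"
    and s: "(\<Sum>i\<in>I. supp_sup (F i) + supp_sup (G i)) < \<theta>" "\<And>i. i \<in> I \<Longrightarrow> supp_sup (F i) < \<delta> \<and> supp_sup (G i) < \<delta>"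
    using assms(7) unfolding I_def[symmetric]
  proof (elim disjE exE conjE)
    fix \<theta> assume *: "0 < \<theta>" "\<theta> < 1" "EH \<theta>" "(\<Sum>i\<in>I. supp_sup (F i) + supp_sup (G i)) < \<theta>"
    show thesis
    proof (rule that[of \<theta> 1])
      show "supp_sup (F i) < 1 \<and> supp_sup (G i) < 1" if "i \<in> I" for i using le[OF that] * by linarith
    qed (use * EH_imp_level in auto)
  next
    fix \<omega> \<delta> assume *: "0 \<le> \<omega>" "\<omega> < 1/4" "\<delta> > 0" "MPZ \<omega> \<delta>"
      "(\<Sum>i\<in>I. supp_sup (F i) + supp_sup (G i)) < 1/2 + 2 * \<omega>" "(MAX i\<in>I. max (supp_sup (F i)) (supp_sup (G i))) < \<delta>"
    show thesis
    \<comment> \<open>\<open>sieve_sum_limit\<close> needs \<delta> \<le> 1. Capping it is harmless: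
      the supports are non-negative and sum to less than 1/2 + 2 \<omega> < 1, so each is below 1 as
      well.\<close>
    proof (rule that[of "1/2 + 2 * \<omega>" "min \<delta> 1"])
      show "supp_sup (F i) < min \<delta> 1 \<and> supp_sup (G i) < min \<delta> 1" if i: "i \<in> I" for i
      proof -
        have "max (supp_sup (F i)) (supp_sup (G i)) < \<delta>" using *(6) I i by (simp add: Max_less_iff)
        thus ?thesis using le[OF i] * by simp
      qed
    qed (use * MPZ_imp_level[of \<omega> \<delta> "min \<delta> 1"] in auto)
  qed
  define N where "N x = (\<Sum>n | x \<le> real_of_int n \<and> real_of_int n \<le> 2 * x \<and> [n = b x] (mod int (W_mod x)).
      theta (nat (n + h i\<^sub>0)) * (\<Prod>i\<in>I. lambda_weight x (F i) (nat (n + h i)) * lambda_weight x (G i) (nat (n + h i))))" for x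
  define c where "c = (\<Prod>i\<in>I. integral {0..1} (\<lambda>t. deriv_halfline (F i) t * deriv_halfline (G i) t))"
  define T where "T x = B_size x ^ card I * real (totient (W_mod x)) / x" for x
  have "(\<Prod>i\<in>I. cpair (F i) (G i)) = c"
    unfolding c_def
  proof (rule prod.cong[OF refl])
    fix i assume i: "i \<in> I"
    have "supp_sup (F i) < 1" using s(2)[OF i] \<delta> by linarith
    thus "cpair (F i) (G i) = integral {0..1} (\<lambda>t. deriv_halfline (F i) t * deriv_halfline (G i) t)"
      using assms(5)[of i] i by (intro cpair_eq_integral_01) (auto simp: I_def)
  qed
  moreover have "((\<lambda>x. N x * T x) \<longlongrightarrow> (\<Prod>i\<in>I. cpair (F i) (G i))) at_top"
    unfolding N_def T_def
  proof (rule sieve_sum_limit[OF lev \<theta> \<delta> I h _ _ _ s])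
    show "\<forall>\<^sub>F x in at_top. \<forall>i\<in>insert i\<^sub>0 I. coprime (b x + h i) (int (W_mod x))" unfolding ins by fact
  qed (use assms(5,6) in \<open>auto simp: I_def\<close>)
  ultimately have lim: "((\<lambda>x. N x * T x) \<longlongrightarrow> c) at_top" by simp
  show ?thesis unfolding I_def[symmetric] N_def[symmetric] c_def[symmetric]
  \<comment> \<open>The error function is read off from the sum itself, after which the claimed
    equation is an identity wherever B is positive; only its convergence to 0 carries
    content.\<close>
  proof (intro exI[of _ "\<lambda>x. N x * T x - c"] conjI)
    show "((\<lambda>x. N x * T x - c) \<longlongrightarrow> 0) at_top" using tendsto_diff[OF lim tendsto_const[of c]] by simp
    show "\<forall>\<^sub>F x in at_top. N x = (c + (N x * T x - c)) * B_size x powi (1 - int k) * (x / real (totient (W_mod x)))"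
      using eventually_gt_at_top[of 1]
    proof eventually_elim
      case (elim x)
      have Bp: "B_size x > 0" by (rule B_size_pos[OF elim])
      have "1 - int k = - int (card I)" using card assms(1) by simp
      hence "B_size x powi (1 - int k) = inverse (B_size x ^ card I)" by (simp add: power_int_minus)
      moreover have "real (totient (W_mod x)) > 0" using W_mod_pos[of x] by simp
      ultimately show ?case using Bp elim by (simp add: T_def)
    qed
  qed
qed

end
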